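(* Let $G$ be a planar graph with $\mathrm{dist}^{\Delta}(G) \geq 2$ that contains no cycles of length $5$, $6$ or $7$. Then $G$ is weakly $2$-degenerate.
   Context: Graphs are finite and simple. A triangle is a $3$-cycle. For a graph $G$, $\mathrm{dist}^{\Delta}(G) = \min\{d_G(v_1,v_2) : v_1 \in V(T_1),\ v_2 \in V(T_2),\ T_1, T_2 \text{ distinct triangles of } G\}$, where $d_G$ is the graph distance; if $G$ has at most one triangle, $\mathrm{dist}^{\Delta}(G) = +\infty$. "No cycles of length $k$" means no subgraph (not necessarily induced) isomorphic to a $k$-cycle. Let $f: V(G) \to \mathbb{Z}$. Writing $f \ge 0$ means that all values of $f$ are nonnegative. Operation $\mathsf{Delete}_u$: for a vertex $u \in V(G)$, $\mathsf{Delete}_u(G,f)$ outputs the graph $G-u$ and the function $f_{-u}: V(G)\setminus\{u\} \to \mathbb{Z}$ given by $f_{-u}(x) = f(x) - |N_G(x) \cap \{u\}|$ (that is, $f(x)-1$ if $x$ is a neighbor of $u$, and $f(x)$ otherwise). It is legal if $f(u) \ge 0$ and $f_{-u} \ge 0$. Operation $\mathsf{DeleteSave}_{(a,b)}$: for two adjacent vertices $a,b$ of $G$, $\mathsf{DeleteSave}_{(a,b)}(G,f)$ outputs the graph $G-a$ and the function $f'$ on $V(G)\setminus\{a\}$ with $f'(v) = f(v)-1$ if $v$ is a neighbor of $a$ and $v \ne b$, and $f'(v) = f(v)$ otherwise. It is legal if $f(a) > f(b)$ and $f' \ge 0$. A graph $G$ is weakly $f$-degenerate if, starting from $(G,f)$,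 it can be reduced to the null graph (the graph with no vertices) by a sequence of legal operations $\mathsf{Delete}$ and $\mathsf{DeleteSave}$. For a positive integer $k$, $G$ is weakly $k$-degenerate if it is weakly $f$-degenerate for the constant function $f \equiv k$. *)

theory Defs
  imports "HOL-Analysis.Analysis" "Graph_Theory.Graph_Theory"
begin

text \<open>
  A finite simple graph is the locale \<^const>\<open>graph\<close> of the \<^verbatim>\<open>Graph_Theory\<close> entry: a finite
  symmetric loop-free digraph without parallel arcs, so that an undirected edge is a pair of
  opposite arcs.
\<close>

subsection \<open>Planarity\<close>

definition edges :: "('a, 'b) pre_digraph \<Rightarrow> 'a set set" where
  "edges G = {{u, v} | u v. u \<rightarrow>\<^bsub>G\<^esub> v}"

text \<open>
  Vertices are drawn as distinct points of the plane \<^typ>\<open>complex\<close> and each undirected edge as an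
  arc (an injective path) between the points of its ends. The interior of an edge contains no
  vertex and no point of any other edge.
\<close>

definition plane_drawing ::
  "('a, 'b) pre_digraph \<Rightarrow> ('a \<Rightarrow> complex) \<Rightarrow> ('a set \<Rightarrow> real \<Rightarrow> complex) \<Rightarrow> bool" where
  "plane_drawing G p \<gamma> \<longleftrightarrow>
     inj_on p (verts G) \<and>
     (\<forall>e\<in>edges G. arc (\<gamma> e) \<and> {pathstart (\<gamma> e), pathfinish (\<gamma> e)} = p ` e) \<and>
     (\<forall>e\<in>edges G. (path_image (\<gamma> e) - p ` e) \<inter> p ` verts G = {}) \<and>
     (\<forall>e\<in>edges G. \<forall>e'\<in>edges G. e \<noteq> e' \<longrightarrow>
        (path_image (\<gamma> e) - p ` e) \<inter> path_image (\<gamma> e') = {})"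

definition planar :: "('a, 'b) pre_digraph \<Rightarrow> bool" where
  "planar G \<longleftrightarrow> (\<exists>p \<gamma>. plane_drawing G p \<gamma>)"

subsection \<open>Cycles and the distance between triangles\<close>

text \<open>
  In a symmetric digraph \<^const>\<open>pre_digraph.cycle\<close> also accepts closed walks \<open>a, b, a\<close> of length 2.
  From length 3 on, the cycles of a graph are exactly the usual ones.
\<close>

definition has_cycle_of_length :: "('a, 'b) pre_digraph \<Rightarrow> nat \<Rightarrow> bool" where
  "has_cycle_of_length G k \<longleftrightarrow> (\<exists>c. pre_digraph.cycle G c \<and> length c = k)"

text \<open>
  A triangle is identified with its vertex set: in a simple graph, two 3-cycles on the same
  vertices are the same subgraph, whereas \<^const>\<open>pre_digraph.cycle\<close> distinguishes starting points
  and orientations.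
\<close>

definition triangles :: "('a, 'b) pre_digraph \<Rightarrow> 'a set set" where
  "triangles G = {tail G ` set c | c. pre_digraph.cycle G c \<and> length c = 3}"

text \<open>The value is \<open>\<infinity>\<close> for vertices in different components.\<close>

definition graph_dist :: "('a, 'b) pre_digraph \<Rightarrow> 'a \<Rightarrow> 'a \<Rightarrow> ereal" where
  "graph_dist G u v = wf_digraph.\<mu> G (\<lambda>_. 1) u v"

text \<open>The infimum is \<open>\<infinity>\<close> if there is at most one triangle.\<close>

definition triangle_dist :: "('a, 'b) pre_digraph \<Rightarrow> ereal" where
  "triangle_dist G = Inf {graph_dist G v1 v2 | v1 v2 T1 T2.
     T1 \<in> triangles G \<and> T2 \<in> triangles G \<and> T1 \<noteq> T2 \<and> v1 \<in> T1 \<and> v2 \<in> T2}"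

subsection \<open>Weak degeneracy\<close>

text \<open>
  A function on the vertex set is represented by a total function, of which only the values on
  \<^term>\<open>verts G\<close> matter.
\<close>

type_synonym ('a, 'b) weighted = "('a, 'b) pre_digraph \<times> ('a \<Rightarrow> int)"

definition nonneg :: "('a, 'b) weighted \<Rightarrow> bool" where
  "nonneg = (\<lambda>(G, f). \<forall>x\<in>verts G. 0 \<le> f x)"

definition Delete :: "'a \<Rightarrow> ('a, 'b) weighted \<Rightarrow> ('a, 'b) weighted" where
  "Delete u = (\<lambda>(G, f).
     (pre_digraph.del_vert G u, \<lambda>x. if x \<rightarrow>\<^bsub>G\<^esub> u then f x - 1 else f x))"

definition DeleteSave :: "'a \<Rightarrow> 'a \<Rightarrow> ('a, 'b) weighted \<Rightarrow> ('a, 'b) weighted" where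
  "DeleteSave a b = (\<lambda>(G, f).
     (pre_digraph.del_vert G a, \<lambda>x. if x \<rightarrow>\<^bsub>G\<^esub> a \<and> x \<noteq> b then f x - 1 else f x))"

inductive legal_step :: "('a, 'b) weighted \<Rightarrow> ('a, 'b) weighted \<Rightarrow> bool" where
  delete: "legal_step (G, f) (Delete u (G, f))"
    if "u \<in> verts G" "0 \<le> f u" "nonneg (Delete u (G, f))"
| delete_save: "legal_step (G, f) (DeleteSave a b (G, f))"
    if "a \<rightarrow>\<^bsub>G\<^esub> b" "f b < f a" "nonneg (DeleteSave a b (G, f))"

definition weakly_f_degenerate :: "('a, 'b) pre_digraph \<Rightarrow> ('a \<Rightarrow> int) \<Rightarrow> bool" where
  "weakly_f_degenerate G f \<longleftrightarrow>
     (\<exists>H h. legal_step\<^sup>*\<^sup>* (G, f) (H, h) \<and> verts H = {})"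

definition weakly_degenerate :: "nat \<Rightarrow> ('a, 'b) pre_digraph \<Rightarrow> bool" where
  "weakly_degenerate k G \<longleftrightarrow> weakly_f_degenerate G (\<lambda>_. int k)"

end

theory Submission
  imports Defs
begin

text \<open>
  Take a vertex set \<open>U\<close>, minimal such that for some \<open>x \<in> U\<close> the graph induced on \<open>U - {x}\<close> is
  not weakly degenerate for the function that is 1 at the neighbours of \<open>x\<close> and 2 elsewhere. The
  graph induced on \<open>U\<close> is then 2-connected, and all its vertices other than \<open>x\<close> have degree at
  least 3. A set \<open>S\<close> that avoids \<open>x\<close> cannot be removed last, i.e. it is not weakly degenerate for
  2 minus the number of neighbours outside \<open>S\<close>. This excludes a 2-connected set of 3-vertices that
  is not a cycle, and also, by one operation \<open>DeleteSave\<close>, certain sets with a single 4-vertex.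

  A drawing of a 2-connected graph has faces bounded by cycles, built up by an ear decomposition,
  so every face has length 3, 4 or at least 8. Give each vertex the charge \<open>6 (deg - 4)\<close> and each
  face the charge \<open>6 (length - 4)\<close>; the total is \<open>-48\<close>. Charge is moved from the faces of length at
  least 8 to the 3-vertices and to the triangles; the faces of length 8 that cannot afford this are
  helped by faces nearby, unless they belong to one of the excluded configurations. In the
  end only \<open>x\<close>, and its neighbours if \<open>x\<close> has degree 2, have negative charge, more than
  \<open>-48\<close> in total.
\<close>

section \<open>Paths and cycles as lists\<close>

text \<open>The deleted vertex \<open>x\<close> is a root, and cut vertices are the reason for it:
  the piece on the side of a cut vertex \<open>c\<close> away from \<open>x\<close> loses nothing
  but \<open>c\<close>, so the same claim with root \<open>c\<close> empties it. In return nothing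
  is known about the degree of \<open>x\<close>. This is affordable because Euler's formula leaves
  -48, while \<open>x\<close> ends with at least -24 and each of at most two exceptional neighbours
  with at least -10.

  In a set of 3-vertices that is removed last, every vertex has one unit less than its degree in the
  set, so greedy deletion just fails. One \<open>DeleteSave\<close> gains a unit, and
  2-connectedness keeps the rest connected, so that this unit suffices.

  The obstacle is an 8-face whose vertices all have degree 3: its charge 24 may be no more than what
  they ask for, and then a triangle beside it lacks 2. Reducibility shows that the third vertex of
  the triangle is not a 3-vertex, but a 4-vertex has no charge to give. The missing units come from
  faces further away, and most of the work is to find these donors and to show that no face is
  charged twice at the same vertex.\<close>

fun pedges :: "'a list \<Rightarrow> 'a set set" where
  "pedges [] = {}"
| "pedges [x] = {}"
| "pedges (x # y # zs) = insert {x, y} (pedges (y # zs))"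

text \<open>The edge set forgets the starting point and the direction, so a face can be stored as
  \<open>cedges c\<close> and every rotation or reversal of \<open>c\<close> serves as well. Only
  from length 3 on does it have as many edges as \<open>c\<close> has entries.\<close>

definition cedges :: "'a list \<Rightarrow> 'a set set" where
  "cedges c = pedges (c @ [hd c])"

lemma pedges_append: "pedges (xs @ y # zs) = pedges (xs @ [y]) \<union> pedges (y # zs)"
  by (induction xs rule: pedges.induct) (auto; cases zs; auto)+

lemma pedges_Cons: "ys \<noteq> [] \<Longrightarrow> pedges (x # ys) = insert {x, hd ys} (pedges ys)"
  by (cases ys) auto

lemma pedges_snoc: "xs \<noteq> [] \<Longrightarrow> pedges (xs @ [y]) = insert {last xs, y} (pedges xs)"
  by (induction xs rule: pedges.induct) auto

lemma pedges_rev: "pedges (rev xs) = pedges xs"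
proof (induction xs rule: pedges.induct)
  case (3 x y zs)
  then show ?case using pedges_append[of "rev zs" y "[x]"] by (auto simp: insert_commute)
qed auto

lemma pedges_subset: "e \<in> pedges xs \<Longrightarrow> e \<subseteq> set xs"
  by (induction xs rule: pedges.induct) auto

lemma finite_pedges [simp]: "finite (pedges xs)"
  by (induction xs rule: pedges.induct) auto

lemma finite_cedges [simp]: "finite (cedges c)"
  by (simp add: cedges_def)

lemma pedges_doubleton: "e \<in> pedges xs \<Longrightarrow> \<exists>a b. e = {a, b}"
  by (induction xs rule: pedges.induct) auto

lemma pedges_singleton: "distinct xs \<Longrightarrow> {c} \<notin> pedges xs"
  by (induction xs rule: pedges.induct) auto

lemma Union_pedges: "2 \<le> length xs \<Longrightarrow> \<Union>(pedges xs) = set xs"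
proof (induction xs rule: pedges.induct)
  case (3 x y zs)
  then show ?case by (cases zs) auto
qed auto

lemma card_pedges: "distinct xs \<Longrightarrow> card (pedges xs) = length xs - 1"
proof (induction xs rule: pedges.induct)
  case (3 x y zs)
  have "{x, y} \<notin> pedges (y # zs)"
    using pedges_subset[of "{x,y}" "y # zs"] 3(2) by auto
  then show ?case using 3 by simp
qed auto

lemma Union_cedges: "c \<noteq> [] \<Longrightarrow> \<Union>(cedges c) = set c"
  unfolding cedges_def by (subst Union_pedges) (cases c; auto)+

lemma cedges_subset: "e \<in> cedges c \<Longrightarrow> c \<noteq> [] \<Longrightarrow> e \<subseteq> set c"
  using Union_cedges by blast

lemma cedges_eq: "c \<noteq> [] \<Longrightarrow> cedges c = insert {last c, hd c} (pedges c)"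
  by (simp add: cedges_def pedges_snoc)

lemma last_hd_notin_pedges:
  assumes "distinct c" "3 \<le> length c"
  shows "{last c, hd c} \<notin> pedges c"
proof -
  obtain a b cs where c: "c = a # b # cs" "cs \<noteq> []"
    using assms(2) by (cases c rule: pedges.cases) (auto simp: Suc_le_eq)
  have "last c \<noteq> b" using c assms(1) by auto
  moreover have "last c \<noteq> a" using c assms(1) by auto
  moreover have "{last c, a} \<notin> pedges (b # cs)"
    using pedges_subset[of _ "b # cs"] assms(1) c by auto
  ultimately show ?thesis using c by (auto simp: doubleton_eq_iff)
qed

lemma card_cedges:
  assumes "distinct c" "3 \<le> length c"
  shows "card (cedges c) = length c"
  using assms last_hd_notin_pedges[OF assms] by (subst cedges_eq) (auto simp: card_pedges)

lemma cedges_rotate: "cedges (xs @ ys) = cedges (ys @ xs)"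
proof (cases "xs = [] \<or> ys = []")
  case False
  then obtain x xs' y ys' where *: "xs = x # xs'" "ys = y # ys'" by (meson neq_Nil_conv)
  show ?thesis
    using pedges_append[of "x # xs'" y "ys' @ [x]"] pedges_append[of "y # ys'" x "xs' @ [y]"]
    by (simp add: cedges_def * Un_commute)
qed auto

lemma cedges_rev: "cedges (rev c) = cedges c"
proof (cases c)
  case (Cons a cs)
  have "cedges (rev c) = cedges (a # rev cs)"
    using cedges_rotate[of "rev cs" "[a]"] Cons by simp
  also have "\<dots> = pedges (rev (a # cs @ [a]))" by (simp add: cedges_def)
  finally show ?thesis by (simp only: pedges_rev) (simp add: cedges_def Cons)
qed auto

lemma cedges_split:
  "cedges (a # xs @ b # ys) = pedges (a # xs @ [b]) \<union> pedges (b # ys @ [a])"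
  using pedges_append[of "a # xs" b "ys @ [a]"] by (simp add: cedges_def)

lemma rotate_to_hd:
  assumes "v \<in> set c"
  obtains ys where "cedges (v # ys) = cedges c" "set (v # ys) = set c" "distinct c \<longleftrightarrow> distinct (v # ys)"
    "length (v # ys) = length c"
proof -
  obtain as bs where c: "c = as @ v # bs" using assms by (meson split_list)
  show ?thesis
    by (rule that[of "bs @ as"]) (use cedges_rotate[of as "v # bs"] in \<open>auto simp: c\<close>)
qed

lemma rotate_to_two:
  assumes "distinct c" "a \<in> set c" "b \<in> set c" "a \<noteq> b"
  obtains xs ys where "cedges (a # xs @ b # ys) = cedges c" "distinct (a # xs @ b # ys)"
    "set (a # xs @ b # ys) = set c" "length (a # xs @ b # ys) = length c"
proof -
  obtain zs where zs: "cedges (a # zs) = cedges c" "set (a # zs) = set c" "distinct (a # zs)"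
    "length (a # zs) = length c"
    using rotate_to_hd[OF assms(2)] assms(1) by metis
  then have "b \<in> set zs" using assms(3,4) by auto
  then obtain xs ys where "zs = xs @ b # ys" by (meson split_list)
  then show ?thesis using zs that by auto
qed

text \<open>A common edge can only join the two ends, and a path contains that edge only if it has
  no inner vertex.\<close>

lemma path_edges_disjoint:
  assumes "distinct (a # xs @ [b])" "distinct (a # ys @ [b])" "set xs \<inter> set ys = {}" "\<not> (xs = [] \<and> ys = [])"
  shows "pedges (a # xs @ [b]) \<inter> pedges (a # ys @ [b]) = {}"
proof -
  have key: "{a, b} \<notin> pedges (a # zs @ [b])" if "zs \<noteq> []" "distinct (a # zs @ [b])" for zs
    using that last_hd_notin_pedges[of "a # zs @ [b]"] by (cases zs) (auto simp: insert_commute)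
  have "e = {a, b}" if e: "e \<in> pedges (a # xs @ [b])" "e \<in> pedges (a # ys @ [b])" for e
  proof -
    have "e \<subseteq> {a, b}" using pedges_subset[OF e(1)] pedges_subset[OF e(2)] assms(3) by auto
    moreover obtain u v where uv: "e = {u, v}" using pedges_doubleton[OF e(1)] by auto
    moreover have "u \<noteq> v" using pedges_singleton[OF assms(1)] e(1) uv by auto
    ultimately show ?thesis by auto
  qed
  moreover have "{a, b} \<notin> pedges (a # xs @ [b]) \<or> {a, b} \<notin> pedges (a # ys @ [b])"
    using key[of xs] key[of ys] assms by auto
  ultimately show ?thesis by auto
qed

section \<open>Weak degeneracy of vertex sets\<close>

locale sgraph =
  fixes A :: "'a \<Rightarrow> 'a \<Rightarrow> bool"
  assumes sym: "A a b \<Longrightarrow> A b a" and irr: "\<not> A a a"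
begin

definition d :: "'a \<Rightarrow> 'a set \<Rightarrow> nat" where
  "d v S = card {y \<in> S. A v y}"

text \<open>Cuts instead of paths: the degeneracy arguments use exactly an edge that leaves a given
  proper part. The empty set and singletons count as connected.\<close>

definition conn :: "'a set \<Rightarrow> bool" where
  "conn S \<longleftrightarrow> (\<forall>X. X \<subseteq> S \<and> X \<noteq> {} \<and> X \<noteq> S \<longrightarrow> (\<exists>a\<in>X. \<exists>b\<in>S - X. A a b))"

text \<open>Single vertices and single edges qualify too. Where more is needed, a vertex of degree 3
  inside the set is demanded separately.\<close>

definition biconn :: "'a set \<Rightarrow> bool" where
  "biconn B \<longleftrightarrow> conn B \<and> (\<forall>v\<in>B. conn (B - {v}))"

definition EA :: "'a set set" where
  "EA = {{a, b} |a b. A a b}"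

text \<open>
  Weak degeneracy of the subgraph induced on \<open>S\<close>; the two steps are \<open>Delete u\<close> and
  \<open>DeleteSave a b\<close>.
\<close>

inductive wd :: "'a set \<Rightarrow> ('a \<Rightarrow> int) \<Rightarrow> bool" where
  wd_empty: "wd {} f"
| wd_del: "wd S f" if "u \<in> S" "0 \<le> f u" "\<forall>y\<in>S - {u}. 0 \<le> f y - of_bool (A y u)"
    "wd (S - {u}) (\<lambda>y. f y - of_bool (A y u))"
| wd_save: "wd S f" if "a \<in> S" "b \<in> S" "A a b" "f b < f a" "\<forall>y\<in>S - {a}. 0 \<le> f y - of_bool (A y a \<and> y \<noteq> b)"
    "wd (S - {a}) (\<lambda>y. f y - of_bool (A y a \<and> y \<noteq> b))"

lemma EA_iff: "{a, b} \<in> EA \<longleftrightarrow> A a b"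
  using sym by (auto simp: EA_def doubleton_eq_iff)

lemma d_Un: "finite R \<Longrightarrow> finite S \<Longrightarrow> R \<inter> S = {} \<Longrightarrow> d v (R \<union> S) = d v R + d v S"
proof -
  assume a: "finite R" "finite S" "R \<inter> S = {}"
  have "{y \<in> R \<union> S. A v y} = {y \<in> R. A v y} \<union> {y \<in> S. A v y}" by auto
  then show ?thesis unfolding d_def using a by (simp add: card_Un_disjoint disjoint_iff)
qed

lemma d_remove: "finite S \<Longrightarrow> u \<in> S \<Longrightarrow> d v S = d v (S - {u}) + of_bool (A v u)"
proof -
  assume a: "finite S" "u \<in> S"
  then have "d v S = d v ((S - {u}) \<union> {u})" by (simp add: insert_absorb)
  also have "\<dots> = d v (S - {u}) + d v {u}" by (rule d_Un) (use a in auto)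
  also have "d v {u} = of_bool (A v u)"
    unfolding d_def by (cases "A v u") (auto simp: card_1_singleton_iff intro!: exI[of _ u])
  finally show ?thesis .
qed

lemma d_self: "d v (S - {v}) = d v S"
  unfolding d_def by (rule arg_cong[of _ _ card]) (use irr in auto)

lemma d_mono: "finite S \<Longrightarrow> R \<subseteq> S \<Longrightarrow> d v R \<le> d v S"
  unfolding d_def by (rule card_mono) auto

lemma d_less: "finite S \<Longrightarrow> R \<subseteq> S \<Longrightarrow> y \<in> S - R \<Longrightarrow> A v y \<Longrightarrow> d v R < d v S"
  unfolding d_def by (rule psubset_card_mono) auto

lemma d_pos: "finite S \<Longrightarrow> y \<in> S \<Longrightarrow> A v y \<Longrightarrow> 0 < d v S"
  unfolding d_def by (auto simp: card_gt_0_iff)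

lemma wd_finite: "wd S f \<Longrightarrow> finite S"
  by (induction rule: wd.induct) auto

lemma wd_cong: "wd S f \<Longrightarrow> (\<And>y. y \<in> S \<Longrightarrow> f y = g y) \<Longrightarrow> wd S g"
proof (induction arbitrary: g rule: wd.induct)
  case (wd_del u S f)
  show ?case by (rule wd.wd_del[of u]) (use wd_del in auto)
next
  case (wd_save a S b f)
  show ?case by (rule wd.wd_save[of a _ b]) (use wd_save in auto)
qed (rule wd_empty)

text \<open>
  The set \<open>B\<close> is processed after \<open>R\<close>, when its vertices have lost their neighbours in \<open>R\<close>.
\<close>

lemma wd_compose:
  assumes "wd R f" "finite B" "R \<inter> B = {}" "\<And>y. y \<in> B \<Longrightarrow> 0 \<le> f y - int (d y R)"
    "wd B (\<lambda>y. f y - int (d y R))"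
  shows "wd (R \<union> B) f"
  using assms
proof (induction rule: wd.induct)
  case (wd_empty f)
  then show ?case by (simp add: d_def)
next
  case (wd_del u S f)
  have fin: "finite S" using wd_finite[OF wd_del(4)] by simp
  have dd: "int (d y S) = int (d y (S - {u})) + of_bool (A y u)" for y
    using d_remove[OF fin wd_del(1)] by simp
  have eq: "S \<union> B - {u} = (S - {u}) \<union> B" using wd_del by auto
  have "wd ((S - {u}) \<union> B) (\<lambda>y. f y - of_bool (A y u))"
  proof (rule wd_del.IH)
    show "wd B (\<lambda>y. f y - of_bool (A y u) - int (d y (S - {u})))"
      by (rule wd_cong[OF wd_del(9)]) (simp add: dd)
  qed (use wd_del dd in \<open>auto simp: algebra_simps\<close>)
  moreover have "0 \<le> f y - of_bool (A y u)" if "y \<in> B" for y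
    using wd_del(8)[OF that] dd[of y] by simp
  ultimately have "\<forall>y\<in>S \<union> B - {u}. 0 \<le> f y - of_bool (A y u)"
      "wd (S \<union> B - {u}) (\<lambda>y. f y - of_bool (A y u))"
    using wd_del(3) unfolding eq by blast+
  then show ?case using wd.wd_del[of u "S \<union> B" f] wd_del(1,2) by blast
next
  case (wd_save a S b f)
  have fin: "finite S" using wd_finite[OF wd_save(6)] by simp
  have dd: "int (d y S) = int (d y (S - {a})) + of_bool (A y a)" for y
    using d_remove[OF fin wd_save(1)] by simp
  have eq: "S \<union> B - {a} = (S - {a}) \<union> B" using wd_save by auto
  have nb: "y \<noteq> b" if "y \<in> B" for y using that wd_save by auto
  have "wd ((S - {a}) \<union> B) (\<lambda>y. f y - of_bool (A y a \<and> y \<noteq> b))"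
  proof (rule wd_save.IH)
    show "wd B (\<lambda>y. f y - of_bool (A y a \<and> y \<noteq> b) - int (d y (S - {a})))"
      by (rule wd_cong[OF wd_save(11)]) (simp add: dd nb)
    show "0 \<le> f y - of_bool (A y a \<and> y \<noteq> b) - int (d y (S - {a}))" if "y \<in> B" for y
      using wd_save(10)[OF that] dd[of y] nb[OF that] by (cases "A y a") auto
  qed (use wd_save in auto)
  moreover have "0 \<le> f y - of_bool (A y a \<and> y \<noteq> b)" if "y \<in> B" for y
    using wd_save(10)[OF that] dd[of y] by (cases "A y a") auto
  ultimately have "\<forall>y\<in>S \<union> B - {a}. 0 \<le> f y - of_bool (A y a \<and> y \<noteq> b)"
      "wd (S \<union> B - {a}) (\<lambda>y. f y - of_bool (A y a \<and> y \<noteq> b))"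
    using wd_save(5) unfolding eq by blast+
  then show ?case using wd.wd_save[of a "S \<union> B" b f] wd_save(1-4) by blast
qed

section \<open>Greedy deletion and the value of one saved unit\<close>

lemma wd_single: "0 \<le> f y \<Longrightarrow> wd {y} f"
  by (rule wd.wd_del[of y]) (auto intro: wd_empty)

text \<open>Greedy order: a vertex with at most \<open>f\<close> neighbours in the whole set can
  wait until all others are gone.\<close>

lemma wd_degenerate:
  assumes "finite R" "\<And>X. X \<subseteq> R \<Longrightarrow> X \<noteq> {} \<Longrightarrow> \<exists>y\<in>X. int (d y X) \<le> f y"
  shows "wd R f"
  using assms
proof (induction "card R" arbitrary: R)
  case 0
  then show ?case by (simp add: wd_empty)
next
  case (Suc n)
  then have "R \<noteq> {}" by auto
  then obtain y where y: "y \<in> R" "int (d y R) \<le> f y" using Suc(4)[of R] by auto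
  have 1: "wd (R - {y}) f"
  proof (rule Suc(1))
    show "\<exists>z\<in>X. int (d z X) \<le> f z" if "X \<subseteq> R - {y}" "X \<noteq> {}" for X
      using Suc(4)[of X] that by auto
  qed (use Suc y in auto)
  have "wd ((R - {y}) \<union> {y}) f"
    by (rule wd_compose[OF 1]) (use y in \<open>auto simp: d_self intro: wd_single\<close>)
  then show ?case using y by (simp add: insert_absorb)
qed

lemma conn_edge:
  assumes "conn S" "X \<subseteq> S" "X \<noteq> {}" "X \<noteq> S"
  obtains a b where "a \<in> X" "b \<in> S" "b \<notin> X" "A a b"
  using assms unfolding conn_def by (metis Diff_iff)

lemma conn_nbr:
  assumes "conn S" "y \<in> S" "S \<noteq> {y}" obtains z where "z \<in> S" "A y z"
  using conn_edge[of S "{y}"] assms by blast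

text \<open>A proper part of a connected set has an edge leaving it, and the inner end of this edge
  has lost a neighbour, which makes up for the missing unit. Only the whole set needs the surplus of
  \<open>b\<close>.\<close>

lemma wd_surplus:
  assumes "conn S" "finite S" "\<And>y. y \<in> S \<Longrightarrow> int (d y S) - 1 \<le> f y" "b \<in> S" "int (d b S) \<le> f b"
  shows "wd S f"
proof (rule wd_degenerate[OF assms(2)])
  fix X assume X: "X \<subseteq> S" "X \<noteq> {}"
  show "\<exists>y\<in>X. int (d y X) \<le> f y"
  proof (cases "X = S")
    case False
    then obtain a b where ab: "a \<in> X" "b \<in> S" "b \<notin> X" "A a b" using conn_edge[OF assms(1) X] by metis
    then have "d a X < d a S" using d_less[OF assms(2) X(1)] by auto
    moreover have "int (d a S) - 1 \<le> f a" using assms(3) ab X by auto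
    ultimately show ?thesis using ab by (intro bexI[of _ a]) linarith+
  qed (use assms in auto)
qed

text \<open>Every part of \<open>S - B\<close> has an edge leaving it, so \<open>S - B\<close> can
  be emptied greedily first. The positive degrees in \<open>B\<close> guarantee that no value in
  \<open>B\<close> becomes negative meanwhile.\<close>

lemma wd_prune:
  assumes "conn S" "finite S" "\<And>y. y \<in> S \<Longrightarrow> int (d y S) - 1 \<le> f y" "B \<subseteq> S" "B \<noteq> {}"
    "\<And>y. y \<in> B \<Longrightarrow> 0 < d y B" "wd B (\<lambda>y. f y - int (d y (S - B)))"
  shows "wd S f"
proof -
  have fB: "finite B" using assms(2,4) finite_subset by metis
  have 1: "wd (S - B) f"
  proof (rule wd_degenerate)
    fix X assume X: "X \<subseteq> S - B" "X \<noteq> {}"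
    then have "X \<noteq> S" "X \<subseteq> S" using assms(4,5) by auto
    then obtain a b where ab: "a \<in> X" "b \<in> S" "b \<notin> X" "A a b" using conn_edge[OF assms(1)] X by metis
    then have "d a X < d a S" using d_less[OF assms(2) \<open>X \<subseteq> S\<close>] by auto
    moreover have "int (d a S) - 1 \<le> f a" using assms(3) ab \<open>X \<subseteq> S\<close> by auto
    ultimately show "\<exists>y\<in>X. int (d y X) \<le> f y" using ab by (intro bexI[of _ a]) linarith+
  qed (use assms in auto)
  have "wd ((S - B) \<union> B) f"
  proof (rule wd_compose[OF 1 fB _ _ assms(7)])
    fix y assume y: "y \<in> B"
    have "S = (S - B) \<union> B" using assms by auto
    then have "d y S = d y (S - B) + d y B" using d_Un[of "S - B" B y] assms(2) fB by auto
    then show "0 \<le> f y - int (d y (S - B))" using assms(3)[of y] assms(6)[OF y] y assms(4) by auto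
  qed auto
  then show ?thesis using assms(4) by (simp add: Un_absorb2)
qed

text \<open>
  If \<open>f = d - 1\<close> throughout, then \<open>DeleteSave a b\<close>, for adjacent \<open>a\<close> of degree at least 3 and \<open>b\<close>
  of degree at most 2, leaves a connected set in which \<open>b\<close> has a surplus.
\<close>

lemma wd_biconnected:
  assumes "biconn B" "finite B" "\<And>y. y \<in> B \<Longrightarrow> int (d y B) - 1 \<le> f y"
    and a0: "a0 \<in> B" "3 \<le> d a0 B" and b0: "b0 \<in> B" "d b0 B \<le> 2"
  shows "wd B f"
proof (cases "\<exists>b\<in>B. int (d b B) \<le> f b")
  case True
  then show ?thesis using wd_surplus assms unfolding biconn_def by blast
next
  case False
  then have f: "f y = int (d y B) - 1" if "y \<in> B" for y using assms(3)[OF that] that by force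
  \<comment> \<open>An edge between degree at least 3 and degree at most 2 is wanted: since
    \<open>f\<close> is the degree minus 1, it satisfies \<open>f b < f a\<close>, which makes the
    saving legal.\<close>
  define X where "X = {y \<in> B. 3 \<le> d y B}"
  have "b0 \<notin> X" using b0 by (simp add: X_def)
  then have "X \<noteq> B" using b0(1) by blast
  moreover have "X \<subseteq> B" "a0 \<in> X" using a0 by (auto simp: X_def)
  ultimately obtain a b where ab: "a \<in> X" "b \<in> B" "b \<notin> X" "A a b"
    using assms(1) conn_edge[of B X] unfolding biconn_def by blast
  then have aB: "a \<in> B" "3 \<le> d a B" and bX: "d b B < 3" by (auto simp: X_def)
  have ne: "b \<noteq> a" using ab irr by auto
  have cB: "conn (B - {a})" using assms(1) aB unfolding biconn_def by auto
  have nbr: "0 < d y (B - {a})" if y: "y \<in> B - {a}" for y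
  proof -
    have "B - {a} \<noteq> {y}"
    proof
      assume s: "B - {a} = {y}"
      have "d a B = d a {y}" using d_self[of a B] s by simp
      moreover have "d a {y} \<le> card {y}" unfolding d_def by (rule card_mono) auto
      ultimately show False using aB by simp
    qed
    then obtain z where "z \<in> B - {a}" "A y z" using conn_nbr[OF cB y] by metis
    then show ?thesis using d_pos assms(2) by auto
  qed
  have rem: "int (d y B) = int (d y (B - {a})) + of_bool (A y a)" for y
    using d_remove[OF assms(2) aB(1)] by simp
  have Aba: "A b a" using ab sym by auto
  let ?g = "\<lambda>y. f y - of_bool (A y a \<and> y \<noteq> b)"
  have g: "int (d y (B - {a})) - 1 \<le> ?g y" if "y \<in> B - {a}" for y
    using f[of y] rem[of y] that by auto
  have gb: "int (d b (B - {a})) \<le> ?g b" using f[of b] rem[of b] ab Aba by auto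
  show ?thesis
  proof (rule wd_save[of a _ b])
    show "f b < f a" using f[of a] f[of b] aB ab bX by auto
    show "\<forall>y\<in>B - {a}. 0 \<le> f y - of_bool (A y a \<and> y \<noteq> b)"
      using g nbr by (smt (verit) zero_less_iff_neq_zero of_nat_0_less_iff)
    show "wd (B - {a}) (\<lambda>y. f y - of_bool (A y a \<and> y \<noteq> b))"
      by (rule wd_surplus[OF cB _ g _ gb]) (use assms(2) ab ne in auto)
  qed (use ab aB in auto)
qed

lemma biconn_pos_degree:
  assumes "biconn B" "finite B" "a0 \<in> B" "3 \<le> d a0 B" "y \<in> B"
  shows "0 < d y B"
proof -
  have "B \<noteq> {y}"
  proof
    assume s: "B = {y}"
    have "d a0 {y} \<le> card {y}" unfolding d_def by (rule card_mono) auto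
    then show False using assms s by simp
  qed
  then show ?thesis using assms conn_nbr[of B y] d_pos[of B _ y] unfolding biconn_def by metis
qed

text \<open>The bound \<open>d - 1\<close> is inherited by \<open>B\<close>, as a vertex loses one
  unit for each neighbour in \<open>S - B\<close>. So a good 2-connected part makes the whole
  connected set removable.\<close>

lemma wd_normal:
  assumes "conn S" "finite S" "\<And>y. y \<in> S \<Longrightarrow> int (d y S) - 1 \<le> f y" "B \<subseteq> S" "biconn B"
    and a0: "a0 \<in> B" "3 \<le> d a0 B" and b0: "b0 \<in> B" "d b0 B \<le> 2"
  shows "wd S f"
proof -
  have fB: "finite B" using assms(2,4) finite_subset by metis
  show ?thesis
  proof (rule wd_prune[OF assms(1-4)])
    show "0 < d y B" if "y \<in> B" for y using biconn_pos_degree[OF assms(5) fB a0 that] .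
    show "wd B (\<lambda>y. f y - int (d y (S - B)))"
    proof (rule wd_biconnected[OF assms(5) fB _ a0 b0])
      fix y assume y: "y \<in> B"
      have "S = (S - B) \<union> B" using assms by auto
      then have "d y S = d y (S - B) + d y B" using d_Un[of "S - B" B y] assms(2) fB by auto
      then show "int (d y B) - 1 \<le> f y - int (d y (S - B))" using assms(3)[of y] y assms(4) by auto
    qed
  qed (use a0 in auto)
qed

section \<open>Connected and 2-connected vertex sets\<close>

lemma conn_singleton: "conn {y}"
  unfolding conn_def by auto

lemma conn_Un:
  assumes "conn S" "conn T" "S \<inter> T \<noteq> {} \<or> (\<exists>s\<in>S. \<exists>t\<in>T. A s t)"
  shows "conn (S \<union> T)"
  unfolding conn_def
proof (intro allI impI)
  fix X assume X: "X \<subseteq> S \<union> T \<and> X \<noteq> {} \<and> X \<noteq> S \<union> T"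
  show "\<exists>a\<in>X. \<exists>b\<in>S \<union> T - X. A a b"
  proof (cases "X \<inter> S = {} \<or> X \<inter> S = S")
    case False
    then obtain a b where "a \<in> X \<inter> S" "b \<in> S" "b \<notin> X \<inter> S" "A a b" using conn_edge[OF assms(1), of "X \<inter> S"] by auto
    then show ?thesis by auto
  next
    case S: True
    show ?thesis
    proof (cases "X \<inter> T = {} \<or> X \<inter> T = T")
      case False
      then obtain a b where "a \<in> X \<inter> T" "b \<in> T" "b \<notin> X \<inter> T" "A a b" using conn_edge[OF assms(2), of "X \<inter> T"] by auto
      then show ?thesis by auto
    next
      case T: True
      have alt: "(X \<inter> S = {} \<and> X \<inter> T = T) \<or> (X \<inter> S = S \<and> X \<inter> T = {})" using X S T by blast
      have "S \<noteq> {}" "T \<noteq> {}" using X S T by blast+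
      then obtain s t where st: "s \<in> S" "t \<in> T" "A s t"
        using assms(3) alt by blast
      then show ?thesis using alt sym by (metis Diff_iff IntD1 Int_iff UnI1 UnI2 empty_iff)
    qed
  qed
qed

lemma conn_insert: "conn S \<Longrightarrow> s \<in> S \<Longrightarrow> A y s \<Longrightarrow> conn (insert y S)"
  using conn_Un[OF conn_singleton[of y], of S] by auto

lemma conn_path: "pedges xs \<subseteq> EA \<Longrightarrow> conn (set xs)"
proof (induction xs rule: pedges.induct)
  case (3 x y zs)
  then have "conn (set (y # zs))" "A x y" by (auto simp: EA_iff)
  then show ?case using conn_insert[of "set (y # zs)" y x] by auto
qed (auto simp: conn_def)

lemma biconn_cycle:
  assumes "distinct c" "cedges c \<subseteq> EA"
  shows "biconn (set c)"
proof -
  have 1: "conn (set c)"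
    by (rule conn_path) (use assms(2) in \<open>cases "c = []"; auto simp: cedges_eq\<close>)
  have "conn (set c - {v})" if v: "v \<in> set c" for v
  proof -
    obtain ys where ys: "cedges (v # ys) = cedges c" "set (v # ys) = set c" "distinct (v # ys)"
      using rotate_to_hd[OF v] assms(1) by metis
    have "pedges ys \<subseteq> cedges (v # ys)" by (cases ys) (auto simp: cedges_eq)
    then have "conn (set ys)" using assms(2) ys by (intro conn_path) auto
    moreover have "set c - {v} = set ys" using ys by auto
    ultimately show ?thesis by simp
  qed
  then show ?thesis using 1 by (simp add: biconn_def)
qed

lemma biconn_Un:
  assumes "biconn B" "biconn C" "s \<in> B \<inter> C" "t \<in> B \<inter> C" "s \<noteq> t"
  shows "biconn (B \<union> C)"
proof -
  have del: "conn (D - {v})" if "biconn D" for D v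
    using that unfolding biconn_def by (cases "v \<in> D") auto
  have "conn (B \<union> C - {v})" for v
  proof -
    have "s \<noteq> v \<or> t \<noteq> v" using assms by auto
    then have "conn ((B - {v}) \<union> (C - {v}))"
      by (intro conn_Un) (use del assms in blast)+
    then show ?thesis by (simp add: Un_Diff)
  qed
  moreover have "conn (B \<union> C)" by (rule conn_Un) (use assms in \<open>auto simp: biconn_def\<close>)
  ultimately show ?thesis by (simp add: biconn_def)
qed

text \<open>If an inner vertex of the ear is deleted, the two remaining pieces still hang on
  \<open>D\<close>, one at \<open>s\<close> and the other at \<open>t\<close>.\<close>

lemma biconn_ear:
  assumes "biconn D" "distinct ys" "ys \<noteq> []" "pedges ys \<subseteq> EA" "set ys \<inter> D = {}"
    "s \<in> D" "t \<in> D" "s \<noteq> t" "A s (hd ys)" "A t (last ys)"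
  shows "biconn (D \<union> set ys)"
proof -
  have cy: "conn (set ys)" using conn_path assms by blast
  have cD: "conn D" using assms(1) biconn_def by auto
  have "conn (D \<union> set ys - {v})" if v: "v \<in> D \<union> set ys" for v
  proof (cases "v \<in> D")
    case True
    then have "conn (D - {v})" using assms(1) biconn_def by auto
    then have "conn ((D - {v}) \<union> set ys)"
      by (rule conn_Un[OF _ cy]) (use assms True in \<open>metis Diff_iff empty_iff hd_in_set insert_iff last_in_set\<close>)
    moreover have "D \<union> set ys - {v} = (D - {v}) \<union> set ys" using True assms(5) by auto
    ultimately show ?thesis by simp
  next
    case False
    then have "v \<in> set ys" using v by auto
    then obtain as bs where ys: "ys = as @ v # bs" by (meson split_list)
    have pe: "pedges as \<subseteq> EA" "pedges bs \<subseteq> EA"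
    proof -
      have "pedges as \<subseteq> pedges (as @ [v])" by (cases as rule: rev_cases) (use pedges_append in \<open>force+\<close>)
      then show "pedges as \<subseteq> EA" using assms(4) ys pedges_append[of as v bs] by auto
      have "pedges bs \<subseteq> pedges (v # bs)" by (cases bs) auto
      then show "pedges bs \<subseteq> EA" using assms(4) ys pedges_append[of as v bs] by auto
    qed
    have 1: "conn (D \<union> set as)"
    proof (cases "as = []")
      case False
      then have "hd ys \<in> set as" using ys by auto
      then show ?thesis using conn_Un[OF cD conn_path[OF pe(1)]] assms by blast
    qed (use cD in auto)
    have "conn ((D \<union> set as) \<union> set bs)"
    proof (cases "bs = []")
      case False
      then have "last ys \<in> set bs" using ys by auto
      then show ?thesis using conn_Un[OF 1 conn_path[OF pe(2)]] assms by blast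
    qed (use 1 in auto)
    moreover have "D \<union> set ys - {v} = (D \<union> set as) \<union> set bs" using False ys assms(2) by auto
    ultimately show ?thesis by simp
  qed
  moreover have "conn (D \<union> set ys)"
    by (rule conn_Un[OF cD cy]) (use assms in \<open>metis hd_in_set\<close>)
  ultimately show ?thesis by (simp add: biconn_def)
qed

section \<open>Cycles and ears in 2-connected graphs\<close>

lemma conn_path_exists:
  assumes "conn Y" "u \<in> Y" "v \<in> Y"
  obtains ys where "distinct ys" "ys \<noteq> []" "pedges ys \<subseteq> EA" "set ys \<subseteq> Y" "hd ys = u" "last ys = v"
proof -
  let ?P = "\<lambda>z ys. distinct ys \<and> ys \<noteq> [] \<and> pedges ys \<subseteq> EA \<and> set ys \<subseteq> Y \<and> hd ys = u \<and> last ys = z"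
  define X where "X = {z \<in> Y. \<exists>ys. ?P z ys}"
  have "X = Y"
  proof (rule ccontr)
    assume ne: "X \<noteq> Y"
    have "?P u [u]" using assms by auto
    then have "u \<in> X" using assms unfolding X_def by blast
    moreover have "X \<subseteq> Y" by (auto simp: X_def)
    ultimately obtain a b where ab: "a \<in> X" "b \<in> Y" "b \<notin> X" "A a b"
      using conn_edge[OF assms(1), of X] ne by blast
    then obtain ys where ys: "?P a ys" by (auto simp: X_def)
    have "b \<notin> set ys"
    proof
      assume "b \<in> set ys"
      then obtain as bs where s: "ys = as @ b # bs" by (meson split_list)
      have "pedges (as @ [b]) \<subseteq> EA" using ys s pedges_append[of as b bs] by auto
      then have "?P b (as @ [b])" using ys s by (cases as) auto
      then have "b \<in> X" using ab(2) unfolding X_def by blast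
      then show False using ab(3) by simp
    qed
    then have "?P b (ys @ [b])" using ys ab by (auto simp: pedges_snoc EA_iff)
    then have "b \<in> X" using ab(2) unfolding X_def by blast
    then show False using ab(3) by simp
  qed
  then show ?thesis using assms that by (auto simp: X_def)
qed

text \<open>A vertex \<open>a\<close> has two neighbours, and a path between them that avoids
  \<open>a\<close> closes up to a cycle through \<open>a\<close>.\<close>

lemma cycle_exists:
  assumes "finite V" "3 \<le> card V" "conn V" "\<And>v. v \<in> V \<Longrightarrow> conn (V - {v})"
  obtains c where "distinct c" "3 \<le> length c" "set c \<subseteq> V" "cedges c \<subseteq> EA"
proof -
  obtain a where a: "a \<in> V" using assms(2) by (metis all_not_in_conv card.empty not_numeral_le_zero)
  have "V \<noteq> {a}" using assms(2) by auto
  then obtain w where w: "w \<in> V" "A a w" using conn_nbr[OF assms(3) a] by metis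
  have wa: "w \<noteq> a" using w irr by auto
  have "V - {w} \<noteq> {a}"
  proof
    assume "V - {w} = {a}"
    then have "V = {w, a}" using w by auto
    moreover have "card {w, a} \<le> 2" by (simp add: card_insert_if)
    ultimately show False using assms(2) by simp
  qed
  then obtain w' where w': "w' \<in> V - {w}" "A a w'"
    using conn_nbr[OF assms(4)[OF w(1)], of a] a wa by auto
  then have "w' \<noteq> a" using irr by auto
  then obtain ys where ys: "distinct ys" "ys \<noteq> []" "pedges ys \<subseteq> EA" "set ys \<subseteq> V - {a}" "hd ys = w" "last ys = w'"
    using conn_path_exists[OF assms(4)[OF a], of w w'] w wa w' by auto
  have "w \<noteq> w'" using w' by auto
  then have "2 \<le> length ys" using ys(2,5,6) by (cases ys rule: pedges.cases) auto
  have "cedges (a # ys) = insert {w', a} (insert {a, w} (pedges ys))"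
    using ys(2,5,6) by (simp add: cedges_eq pedges_Cons)
  moreover have "A w' a" using w'(2) sym by blast
  ultimately have "cedges (a # ys) \<subseteq> EA" using ys(3) w(2) by (simp add: EA_iff)
  moreover have "distinct (a # ys)" "set (a # ys) \<subseteq> V" "3 \<le> length (a # ys)" using ys a \<open>2 \<le> length ys\<close> by auto
  ultimately show ?thesis using that by blast
qed

text \<open>A missing edge inside \<open>W\<close> is itself an ear. Otherwise leave
  \<open>W\<close> along an edge from \<open>a\<close> and return by a path avoiding
  \<open>a\<close>, cut off at its first vertex in \<open>W\<close>; this vertex \<open>b\<close> is
  then different from \<open>a\<close>.\<close>

lemma ear_exists:
  assumes "finite V" "conn V" "\<And>v. v \<in> V \<Longrightarrow> conn (V - {v})"
    and W: "W \<subseteq> V" "\<Union>D = W" and D: "D \<subseteq> {e \<in> EA. e \<subseteq> V}" "D \<noteq> {e \<in> EA. e \<subseteq> V}"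
    and a1: "a1 \<in> W" "a2 \<in> W" "a1 \<noteq> a2"
  obtains a b ps where "a \<in> W" "b \<in> W" "distinct (a # ps @ [b])" "set ps \<inter> W = {}" "set ps \<subseteq> V"
    "pedges (a # ps @ [b]) \<subseteq> {e \<in> EA. e \<subseteq> V}" "pedges (a # ps @ [b]) \<inter> D = {}"
proof (cases "\<exists>e \<in> {e \<in> EA. e \<subseteq> V} - D. e \<subseteq> W")
  case True
  then obtain e where e: "e \<in> EA" "e \<subseteq> V" "e \<notin> D" "e \<subseteq> W" by auto
  then obtain a b where ab: "e = {a, b}" "A a b" by (auto simp: EA_def)
  then have "a \<noteq> b" using irr by auto
  then show ?thesis by (intro that[of a b "[]"]) (use e ab in auto)
next
  case False
  obtain e where e0: "e \<in> {e \<in> EA. e \<subseteq> V} - D" using D by blast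
  then have "\<not> e \<subseteq> W" using False by simp
  then have e: "e \<in> EA" "e \<subseteq> V" "\<not> e \<subseteq> W" using e0 by simp_all
  then have "W \<noteq> V" "W \<noteq> {}" using a1 by auto
  then obtain a w where aw: "a \<in> W" "w \<in> V" "w \<notin> W" "A a w" using conn_edge[OF assms(2) W(1)] by metis
  have aV: "a \<in> V" using aw W by auto
  obtain b0 where b0: "b0 \<in> W" "b0 \<noteq> a" using a1 by metis
  have "w \<in> V - {a}" "b0 \<in> V - {a}" using aw b0 W by auto
  then obtain ys where ys: "distinct ys" "ys \<noteq> []" "pedges ys \<subseteq> EA" "set ys \<subseteq> V - {a}" "hd ys = w" "last ys = b0"
    using conn_path_exists[OF assms(3)[OF aV], of w b0] by metis
  have "\<exists>y\<in>set ys. y \<in> W" using ys b0 by (metis last_in_set)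
  then obtain as b bs where s: "ys = as @ b # bs" "b \<in> W" "\<forall>y\<in>set as. y \<notin> W"
    using split_list_first_prop[of ys "\<lambda>y. y \<in> W"] by blast
  have as: "as \<noteq> []" using s ys aw by auto
  have pe: "pedges (as @ [b]) \<subseteq> EA" using ys(3) s pedges_append[of as b bs] by auto
  have hd: "hd (as @ [b]) = w" using as s ys by auto
  have P: "pedges (a # as @ [b]) = insert {a, w} (pedges (as @ [b]))"
    using pedges_Cons[of "as @ [b]" a] hd by auto
  have dis: "distinct (a # as @ [b])" using ys s by auto
  show ?thesis
  proof (rule that[OF aw(1) s(2) dis])
    show "pedges (a # as @ [b]) \<subseteq> {e \<in> EA. e \<subseteq> V}"
    proof
      fix e assume e: "e \<in> pedges (a # as @ [b])"
      have "e \<subseteq> set (a # as @ [b])" using pedges_subset[OF e] .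
      moreover have "set (a # as @ [b]) \<subseteq> V" using ys s aV by auto
      ultimately show "e \<in> {e \<in> EA. e \<subseteq> V}" using e pe P aw by (auto simp: EA_iff)
    qed
    \<comment> \<open>An edge of \<open>D\<close> lies within \<open>W\<close>, so on the ear it
      could only be \<open>{a, b}\<close>; but this ear has inner vertices.\<close>
    show "pedges (a # as @ [b]) \<inter> D = {}"
    proof (rule ccontr)
      assume "pedges (a # as @ [b]) \<inter> D \<noteq> {}"
      then obtain e where e: "e \<in> pedges (a # as @ [b])" "e \<in> D" by auto
      obtain u v where uv: "e = {u, v}" using pedges_doubleton[OF e(1)] by auto
      have "u \<noteq> v" using pedges_singleton[OF dis] e(1) uv by auto
      moreover have "e \<subseteq> {a, b}" using pedges_subset[OF e(1)] e(2) W(2) s(3) by auto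
      ultimately have "e = {a, b}" using uv by auto
      moreover have "distinct (a # [] @ [b])" using dis by auto
      ultimately show False using path_edges_disjoint[of a as b "[]"] dis as e(1) by auto
    qed
  qed (use ys s in auto)
qed

end

section \<open>Faces of a plane graph\<close>

lemma two_arcs_Jordan:
  fixes g h :: "real \<Rightarrow> complex"
  assumes "arc g" "arc h" "pathstart g = \<alpha>" "pathfinish g = \<beta>" "pathstart h = \<alpha>" "pathfinish h = \<beta>"
    and int: "path_image g \<inter> path_image h = {\<alpha>, \<beta>}"
  obtains I O' where "components (- (path_image g \<union> path_image h)) = {I, O'}" "I \<noteq> O'" "I \<inter> O' = {}"
    "I \<union> O' = - (path_image g \<union> path_image h)"
    "frontier I = path_image g \<union> path_image h" "frontier O' = path_image g \<union> path_image h"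
    "I \<noteq> {}" "O' \<noteq> {}" "open I" "open O'" "topological_space_class.connected I" "topological_space_class.connected O'"
proof -
  let ?c = "g +++ reversepath h"
  have sp: "simple_path ?c"
    by (rule simple_path_join_loop) (use assms in \<open>auto simp: arc_reversepath\<close>)
  have loop: "pathfinish ?c = pathstart ?c" using assms by simp
  have im: "path_image ?c = path_image g \<union> path_image h"
    using assms by (simp add: path_image_join)
  obtain I O' where J: "I \<noteq> {}" "open I" "topological_space_class.connected I" "O' \<noteq> {}" "open O'" "topological_space_class.connected O'"
    "I \<inter> O' = {}" "I \<union> O' = - path_image ?c"
    "frontier I = path_image ?c" "frontier O' = path_image ?c"
    using Jordan_curve[OF sp loop] by metis
  have "components (- path_image ?c) = {I, O'}"
    by (rule components_open_unique) (use J in \<open>auto simp: pairwise_def disjnt_def\<close>)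
  then show ?thesis using that J im by (metis inf.idem)
qed

text \<open>An arc across one side \<open>D\<close> of a closed curve cuts this side into exactly
  two regions, each bounded by the arc and one half of the curve. Here \<open>demanding\<close> is
  just the name of the first of these regions. The other side \<open>E\<close> of the curve serves
  as the point of reference.\<close>

lemma theta_regions:
  fixes g1 g2 g3 :: "real \<Rightarrow> complex"
  defines "A1 \<equiv> path_image g1" and "A2 \<equiv> path_image g2" and "A3 \<equiv> path_image g3"
  assumes arcs: "arc g1" "arc g2" "arc g3"
    and starts: "pathstart g1 = \<alpha>" "pathstart g2 = \<alpha>" "pathstart g3 = \<alpha>"
    and ends: "pathfinish g1 = \<beta>" "pathfinish g2 = \<beta>" "pathfinish g3 = \<beta>"
    and i12: "A1 \<inter> A2 = {\<alpha>, \<beta>}" and i13: "A1 \<inter> A3 = {\<alpha>, \<beta>}" and i23: "A2 \<inter> A3 = {\<alpha>, \<beta>}"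
    and D: "D \<in> components (- (A1 \<union> A2))" and sub: "A3 - {\<alpha>, \<beta>} \<subseteq> D"
  obtains demanding D2 where "demanding \<in> components (- (A1 \<union> A3))" "D2 \<in> components (- (A2 \<union> A3))"
    "demanding \<inter> D2 = {}" "D - A3 = demanding \<union> D2" "demanding \<noteq> {}" "D2 \<noteq> {}"
proof -
  have ab: "\<alpha> \<in> A1" "\<beta> \<in> A1" "\<alpha> \<in> A2" "\<beta> \<in> A2" "\<alpha> \<in> A3" "\<beta> \<in> A3"
    using i12 i13 by auto
  obtain I O' where IO: "components (- (A1 \<union> A2)) = {I, O'}" "I \<noteq> O'" "I \<inter> O' = {}"
    "I \<union> O' = - (A1 \<union> A2)" "frontier I = A1 \<union> A2" "frontier O' = A1 \<union> A2"
    "I \<noteq> {}" "O' \<noteq> {}" "topological_space_class.connected I" "topological_space_class.connected O'"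
    using two_arcs_Jordan[OF arcs(1,2) starts(1) ends(1) starts(2) ends(2)] i12
    unfolding A1_def A2_def by metis
  obtain E where E: "D \<inter> E = {}" "D \<union> E = - (A1 \<union> A2)" "frontier E = A1 \<union> A2" "E \<noteq> {}" "topological_space_class.connected E"
    "E \<in> components (- (A1 \<union> A2))" "E \<noteq> D"
    using IO D by (metis Un_commute Int_commute insertCI insertE singletonD)
  have EA3: "E \<inter> A3 = {}" using sub E(1,2) ab by blast
  \<comment> \<open>Replace the half \<open>C\<close> of the curve by the new arc. The other side
    \<open>E\<close> together with the inside of \<open>C\<close> is connected, lying between
    \<open>E\<close> and its closure, and misses the new curve; so it is contained in one side
    \<open>K\<close>. The opposite side \<open>D'\<close> therefore stays inside
    \<open>D\<close>.\<close>
  have side: "\<exists>K D'. components (- (B \<union> A3)) = {K, D'} \<and> K \<inter> D' = {} \<and> K \<union> D' = - (B \<union> A3)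
      \<and> E \<union> (C - {\<alpha>,\<beta>}) \<subseteq> K \<and> frontier D' = B \<union> A3 \<and> D' \<noteq> {} \<and> topological_space_class.connected D' \<and> topological_space_class.connected K \<and> D' \<subseteq> D - A3"
    if g: "arc g" "pathstart g = \<alpha>" "pathfinish g = \<beta>" "path_image g = B"
      and BC: "B \<union> C = A1 \<union> A2" "B \<inter> C = {\<alpha>,\<beta>}" and i: "B \<inter> A3 = {\<alpha>,\<beta>}" and iC: "C \<inter> A3 = {\<alpha>,\<beta>}" for g B C
  proof -
    have fac: "path_image g \<inter> path_image g3 = {\<alpha>, \<beta>}" using i g(4) A3_def by simp
    obtain K0 deficient where KD: "components (- (B \<union> A3)) = {K0, deficient}" "K0 \<inter> deficient = {}"
      "K0 \<union> deficient = - (B \<union> A3)" "frontier K0 = B \<union> A3" "frontier deficient = B \<union> A3"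
      "K0 \<noteq> {}" "deficient \<noteq> {}" "topological_space_class.connected K0" "topological_space_class.connected deficient"
      using two_arcs_Jordan[OF g(1) arcs(3) g(2,3) starts(3) ends(3) fac]
      unfolding g(4) A3_def[symmetric] by metis
    define M where "M = E \<union> (C - {\<alpha>,\<beta>})"
    have "C \<subseteq> closure E" using BC E(3) by (auto simp: closure_Un_frontier)
    then have "topological_space_class.connected M" unfolding M_def
      by (intro connected_intermediate_closure[OF E(5)]) (use closure_subset in auto)
    moreover have Msub: "M \<subseteq> - (B \<union> A3)" unfolding M_def using BC iC EA3 E(2) by auto
    moreover have "M \<noteq> {}" using E(4) M_def by auto
    ultimately obtain K where K: "K \<in> {K0, deficient}" "M \<subseteq> K"
      using KD(1,3,6) exists_component_superset[of M "- (B \<union> A3)"] by (metis Un_empty)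
    define D' where "D' = (if K = K0 then deficient else K0)"
    have "D' \<inter> M = {}" using K KD(2) by (auto simp: D'_def split: if_splits)
    have "D' \<subseteq> D - A3"
    proof
      fix z assume z: "z \<in> D'"
      then have "z \<notin> B" "z \<notin> A3" using KD(3) K by (auto simp: D'_def split: if_splits)
      moreover have "z \<notin> E" "z \<notin> C - {\<alpha>,\<beta>}" using \<open>D' \<inter> M = {}\<close> z by (auto simp: M_def)
      moreover have "\<alpha> \<in> A3" "\<beta> \<in> A3" using ab by auto
      ultimately have "z \<notin> A1 \<union> A2" "z \<notin> E" using BC by auto
      then show "z \<in> D - A3" using E(2) \<open>z \<notin> A3\<close> by auto
    qed
    moreover have "K \<inter> D' = {}" "components (- (B \<union> A3)) = {K, D'}" "K \<union> D' = - (B \<union> A3)"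
      using KD K by (auto simp: D'_def split: if_splits)
    moreover have "frontier D' = B \<union> A3" "D' \<noteq> {}" "topological_space_class.connected D'" "topological_space_class.connected K"
      using KD K by (auto simp: D'_def split: if_splits)
    ultimately show ?thesis using K(2) unfolding M_def by (intro exI[of _ K] exI[of _ D'] conjI) assumption+
  qed
  obtain K1 demanding where 1: "components (- (A1 \<union> A3)) = {K1, demanding}" "K1 \<inter> demanding = {}" "K1 \<union> demanding = - (A1 \<union> A3)"
    "E \<union> (A2 - {\<alpha>,\<beta>}) \<subseteq> K1" "frontier demanding = A1 \<union> A3" "demanding \<noteq> {}" "topological_space_class.connected demanding" "topological_space_class.connected K1" "demanding \<subseteq> D - A3"
    using side[OF arcs(1) starts(1) ends(1) A1_def[THEN meta_eq_to_obj_eq, symmetric] refl i12 i13 i23] by (elim exE conjE) (rule that)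
  have c2: "A2 \<union> A1 = A1 \<union> A2" "A2 \<inter> A1 = {\<alpha>,\<beta>}" using i12 by auto
  obtain K2 D2 where 2: "components (- (A2 \<union> A3)) = {K2, D2}" "K2 \<inter> D2 = {}" "K2 \<union> D2 = - (A2 \<union> A3)"
    "E \<union> (A1 - {\<alpha>,\<beta>}) \<subseteq> K2" "frontier D2 = A2 \<union> A3" "D2 \<noteq> {}" "topological_space_class.connected D2" "topological_space_class.connected K2" "D2 \<subseteq> D - A3"
    using side[OF arcs(2) starts(2) ends(2) A2_def[THEN meta_eq_to_obj_eq, symmetric] c2 i23 i13] by (elim exE conjE) (rule that)
  \<comment> \<open>If they met, both would be components containing each other and hence have the
    same frontier. Then the first arc would consist of its two ends only, which is not
    connected.\<close>
  have disj: "demanding \<inter> D2 = {}"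
  proof (rule ccontr)
    assume ne: "demanding \<inter> D2 \<noteq> {}"
    have s1: "demanding \<subseteq> - (A2 \<union> A3)" and s2: "D2 \<subseteq> - (A1 \<union> A3)"
      using 1(9) 2(9) E(2) by blast+
    have "demanding \<subseteq> D2" using components_maximal[of D2 "- (A2 \<union> A3)" demanding] 2(1) 1(7) s1 ne by auto
    moreover have "D2 \<subseteq> demanding" using components_maximal[of demanding "- (A1 \<union> A3)" D2] 1(1) 2(7) s2 ne by auto
    ultimately have "A1 \<union> A3 = A2 \<union> A3" using 1(5) 2(5) by auto
    then have "A1 \<subseteq> {\<alpha>,\<beta>}" using i12 i13 by auto
    then have "finite A1" using finite_subset by blast
    moreover have "topological_space_class.connected A1" unfolding A1_def using arcs(1) by (intro connected_path_image arc_imp_path)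
    ultimately have "A1 = {} \<or> (\<exists>a. A1 = {a})" by (simp add: connected_finite_iff_sing)
    moreover have "\<alpha> \<noteq> \<beta>" using arc_distinct_ends[OF arcs(1)] starts ends by auto
    ultimately show False using ab by auto
  qed
  \<comment> \<open>A point in neither region is on the side of \<open>E\<close> for both new
    curves. These meet in the connected arc \<open>A3\<close>, so by Janiszewski's theorem the point
    is joined to \<open>E\<close> outside their union, contrary to its being in
    \<open>D\<close>.\<close>
  have cover: "D - A3 \<subseteq> demanding \<union> D2"
  proof
    fix z assume z: "z \<in> D - A3"
    show "z \<in> demanding \<union> D2"
    proof (rule ccontr)
      assume nz: "z \<notin> demanding \<union> D2"
      obtain e where e: "e \<in> E" using E(4) by auto
      have "z \<notin> A1" "z \<notin> A2" "z \<notin> A3" using z E(2) by auto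
      then have zK: "z \<in> K1" "z \<in> K2" using 1(3) 2(3) nz by auto
      have eK: "e \<in> K1" "e \<in> K2" using e 1(4) 2(4) by auto
      have cc1: "connected_component (- (A1 \<union> A3)) z e"
        unfolding connected_component_def using 1(3,8) zK eK by (intro exI[of _ K1]) auto
      have cc2: "connected_component (- (A2 \<union> A3)) z e"
        unfolding connected_component_def using 2(3,8) zK eK by (intro exI[of _ K2]) auto
      have comp: "compact (A1 \<union> A3)" "closed (A2 \<union> A3)"
        unfolding A1_def A2_def A3_def using arcs
        by (auto intro!: compact_Un closed_Un compact_path_image closed_path_image arc_imp_path)
      have int: "(A1 \<union> A3) \<inter> (A2 \<union> A3) = A3" using i12 ab by auto
      have conn: "topological_space_class.connected ((A1 \<union> A3) \<inter> (A2 \<union> A3))" unfolding int unfolding A3_def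
        using arcs(3) by (intro connected_path_image arc_imp_path)
      have "connected_component (- ((A1 \<union> A3) \<union> (A2 \<union> A3))) z e"
        using Janiszewski[OF comp conn cc1 cc2] .
      then have "connected_component (- (A1 \<union> A2)) z e"
        by (rule connected_component_of_subset) auto
      then obtain T where T: "topological_space_class.connected T" "T \<subseteq> - (A1 \<union> A2)" "z \<in> T" "e \<in> T"
        unfolding connected_component_def by auto
      have "T \<subseteq> D" using components_maximal[OF D T(1,2)] T(3) z by auto
      then show False using T(4) e E(1) by auto
    qed
  qed
  show ?thesis
    by (rule that[of demanding D2]) (use 1 2 disj cover in auto)
qed

locale plane_graph =
  fixes p :: "'a \<Rightarrow> complex" and \<gamma> :: "'a set \<Rightarrow> real \<Rightarrow> complex" and U :: "'a set" and E :: "'a set set"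
  assumes inj: "inj_on p U"
    and E_sub: "\<And>e. e \<in> E \<Longrightarrow> e \<subseteq> U"
    and E_card: "\<And>e. e \<in> E \<Longrightarrow> card e = 2"
    and arc_\<gamma>: "\<And>e. e \<in> E \<Longrightarrow> arc (\<gamma> e)"
    and ends_\<gamma>: "\<And>e. e \<in> E \<Longrightarrow> {pathstart (\<gamma> e), pathfinish (\<gamma> e)} = p ` e"
    and verts_\<gamma>: "\<And>e. e \<in> E \<Longrightarrow> (path_image (\<gamma> e) - p ` e) \<inter> p ` U = {}"
    and edges_\<gamma>: "\<And>e e'. e \<in> E \<Longrightarrow> e' \<in> E \<Longrightarrow> e \<noteq> e' \<Longrightarrow> (path_image (\<gamma> e) - p ` e) \<inter> path_image (\<gamma> e') = {}"
begin

section \<open>Drawings of paths and cycles\<close>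

definition img :: "'a set set \<Rightarrow> complex set" where
  "img D = (\<Union>e\<in>D. path_image (\<gamma> e))"

lemma img_Un: "img (D \<union> D') = img D \<union> img D'"
  by (auto simp: img_def)

lemma p_in_img: "e \<in> E \<Longrightarrow> p ` e \<subseteq> path_image (\<gamma> e)"
  using ends_\<gamma> by (metis insert_subset empty_subsetI pathfinish_in_path_image pathstart_in_path_image)

lemma img_vertex:
  assumes "D \<subseteq> E" "v \<in> U"
  shows "p v \<in> img D \<longleftrightarrow> v \<in> \<Union>D"
proof
  assume "p v \<in> img D"
  then obtain e where e: "e \<in> D" "p v \<in> path_image (\<gamma> e)" by (auto simp: img_def)
  then have "p v \<in> p ` e" using verts_\<gamma>[of e] assms by auto
  then have "v \<in> e" using inj E_sub[of e] assms e by (auto simp: inj_on_def)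
  then show "v \<in> \<Union>D" using e by auto
next
  assume "v \<in> \<Union>D"
  then obtain e where e: "e \<in> D" "v \<in> e" by auto
  then show "p v \<in> img D" using p_in_img[of e] assms by (auto simp: img_def)
qed

lemma img_Int:
  assumes "D \<subseteq> E" "D' \<subseteq> E" "D \<inter> D' = {}"
  shows "img D \<inter> img D' = p ` (\<Union>D \<inter> \<Union>D')"
proof
  show "img D \<inter> img D' \<subseteq> p ` (\<Union>D \<inter> \<Union>D')"
  proof
    fix z assume "z \<in> img D \<inter> img D'"
    then obtain e e' where e: "e \<in> D" "z \<in> path_image (\<gamma> e)" "e' \<in> D'" "z \<in> path_image (\<gamma> e')"
      by (auto simp: img_def)
    then have ne: "e \<noteq> e'" "e \<in> E" "e' \<in> E" using assms by auto
    have "z \<in> p ` e" "z \<in> p ` e'" using edges_\<gamma>[of e e'] edges_\<gamma>[of e' e] ne e by auto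
    then obtain v v' where v: "z = p v" "v \<in> e" "z = p v'" "v' \<in> e'" by (elim imageE) (rule that)
    then have "v = v'" using inj E_sub ne by (metis inj_on_def subsetD)
    then show "z \<in> p ` (\<Union>D \<inter> \<Union>D')" using v e by blast
  qed
next
  show "p ` (\<Union>D \<inter> \<Union>D') \<subseteq> img D \<inter> img D'"
    using img_vertex assms E_sub by (auto; meson UnionI subsetD)
qed

lemma edge_arc:
  assumes "{a, b} \<in> E"
  obtains g where "arc g" "path_image g = path_image (\<gamma> {a, b})" "pathstart g = p a" "pathfinish g = p b"
proof -
  have ne: "a \<noteq> b" using E_card[OF assms] by auto
  then have "p a \<noteq> p b" using inj E_sub[OF assms] by (auto simp: inj_on_def)
  then consider "pathstart (\<gamma> {a,b}) = p a" "pathfinish (\<gamma> {a,b}) = p b"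
    | "pathstart (\<gamma> {a,b}) = p b" "pathfinish (\<gamma> {a,b}) = p a"
    using ends_\<gamma>[OF assms] by (auto simp: doubleton_eq_iff)
  then show ?thesis
  proof cases
    case 1 then show ?thesis using that arc_\<gamma>[OF assms] by blast
  next
    case 2 then show ?thesis
      using that[of "reversepath (\<gamma> {a,b})"] arc_\<gamma>[OF assms] by (simp add: arc_reversepath)
  qed
qed

lemma path_arc:
  assumes "distinct xs" "2 \<le> length xs" "pedges xs \<subseteq> E"
  shows "\<exists>g. arc g \<and> path_image g = img (pedges xs) \<and> pathstart g = p (hd xs) \<and> pathfinish g = p (last xs)"
  using assms
proof (induction xs rule: pedges.induct)
  case (3 a b zs)
  have ab: "{a, b} \<in> E" using 3(4) by simp
  obtain g where g: "arc g" "path_image g = path_image (\<gamma> {a, b})" "pathstart g = p a" "pathfinish g = p b"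
    using edge_arc[OF ab] by metis
  show ?case
  proof (cases zs)
    case Nil
    then show ?thesis using g by (intro exI[of _ g]) (auto simp: img_def)
  next
    case (Cons c cs)
    then obtain h where h: "arc h" "path_image h = img (pedges (b # zs))" "pathstart h = p b"
      "pathfinish h = p (last (b # zs))"
      using 3 by auto
    have Dn: "{a, b} \<notin> pedges (b # zs)" using pedges_subset[of "{a,b}" "b # zs"] 3(2) by auto
    have "\<Union>(pedges (b # zs)) = set (b # zs)" by (rule Union_pedges) (use Cons in auto)
    then have "path_image g \<inter> path_image h = p ` ({a, b} \<inter> set (b # zs))"
      using img_Int[of "{{a, b}}" "pedges (b # zs)"] Dn 3(4) unfolding g h by (auto simp: img_def)
    also have "{a, b} \<inter> set (b # zs) = {b}" using 3(2) by auto
    finally have i: "path_image g \<inter> path_image h = {p b}" by auto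
    have "arc (g +++ h)" by (rule arc_join) (use g h i in auto)
    moreover have "path_image (g +++ h) = img (pedges (a # b # zs))"
      using g h by (simp add: path_image_join img_def)
    ultimately show ?thesis using g h by (intro exI[of _ "g +++ h"]) auto
  qed
qed auto

lemma path_arc':
  assumes "distinct (a # xs @ [b])" "pedges (a # xs @ [b]) \<subseteq> E"
  obtains g where "arc g" "path_image g = img (pedges (a # xs @ [b]))" "pathstart g = p a" "pathfinish g = p b"
  using path_arc[of "a # xs @ [b]"] assms by auto

lemma img_path_Int:
  assumes "pedges (a # xs @ [b]) \<subseteq> E" "pedges (a # ys @ [b]) \<subseteq> E"
    "distinct (a # xs @ [b])" "distinct (a # ys @ [b])" "set xs \<inter> set ys = {}"
    "pedges (a # xs @ [b]) \<inter> pedges (a # ys @ [b]) = {}"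
  shows "img (pedges (a # xs @ [b])) \<inter> img (pedges (a # ys @ [b])) = {p a, p b}"
proof -
  have "\<Union>(pedges (a # xs @ [b])) = set (a # xs @ [b])" "\<Union>(pedges (a # ys @ [b])) = set (a # ys @ [b])"
    by (rule Union_pedges; simp)+
  then show ?thesis using img_Int[OF assms(1,2,6)] assms(3-5) by auto
qed


end

context plane_graph begin

text \<open>With \<open>rev ys\<close> both halves of the cycle run from \<open>a\<close> to
  \<open>b\<close>, as \<open>theta_regions\<close> requires.\<close>

lemma cycle_arcs:
  assumes "distinct (a # xs @ b # ys)" "3 \<le> length (a # xs @ b # ys)" "cedges (a # xs @ b # ys) \<subseteq> E"
  obtains g1 g2 where "arc g1" "arc g2" "path_image g1 = img (pedges (a # xs @ [b]))"
    "path_image g2 = img (pedges (a # rev ys @ [b]))" "pathstart g1 = p a" "pathstart g2 = p a"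
    "pathfinish g1 = p b" "pathfinish g2 = p b" "path_image g1 \<inter> path_image g2 = {p a, p b}"
    "path_image g1 \<union> path_image g2 = img (cedges (a # xs @ b # ys))"
proof -
  have r: "pedges (a # rev ys @ [b]) = pedges (b # ys @ [a])"
    using pedges_rev[of "b # ys @ [a]"] by simp
  have sp: "cedges (a # xs @ b # ys) = pedges (a # xs @ [b]) \<union> pedges (a # rev ys @ [b])"
    unfolding r by (rule cedges_split)
  have d: "distinct (a # xs @ [b])" "distinct (a # rev ys @ [b])" "set xs \<inter> set (rev ys) = {}"
    using assms(1) by auto
  have E12: "pedges (a # xs @ [b]) \<subseteq> E" "pedges (a # rev ys @ [b]) \<subseteq> E" using assms(3) sp by auto
  have dj: "pedges (a # xs @ [b]) \<inter> pedges (a # rev ys @ [b]) = {}"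
    by (rule path_edges_disjoint[OF d]) (use assms(2) in auto)
  obtain g1 where g1: "arc g1" "path_image g1 = img (pedges (a # xs @ [b]))" "pathstart g1 = p a" "pathfinish g1 = p b"
    using path_arc'[OF d(1) E12(1)] by metis
  obtain g2 where g2: "arc g2" "path_image g2 = img (pedges (a # rev ys @ [b]))" "pathstart g2 = p a" "pathfinish g2 = p b"
    using path_arc'[OF d(2) E12(2)] by metis
  show ?thesis
    by (rule that[OF g1(1) g2(1) g1(2) g2(2) g1(3) g2(3) g1(4) g2(4)])
      (use img_path_Int[OF E12 d dj] sp in \<open>auto simp: g1 g2 img_Un\<close>)
qed

lemma cycle_components:
  assumes "distinct c" "3 \<le> length c" "cedges c \<subseteq> E"
  obtains I O' where "components (- img (cedges c)) = {I, O'}" "I \<noteq> O'" "I \<inter> O' = {}"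
    "I \<union> O' = - img (cedges c)" "frontier I = img (cedges c)" "frontier O' = img (cedges c)"
    "open I" "open O'"
proof -
  obtain a b cs where "c = a # b # cs" using assms(2) by (cases c rule: pedges.cases) auto
  then have c: "c = a # [] @ b # cs" by simp
  obtain g1 g2 where g: "arc g1" "arc g2" "pathstart g1 = p a" "pathstart g2 = p a"
    "pathfinish g1 = p b" "pathfinish g2 = p b" "path_image g1 \<inter> path_image g2 = {p a, p b}"
    "path_image g1 \<union> path_image g2 = img (cedges c)"
    using cycle_arcs[of a "[]" b cs] assms unfolding c by metis
  show ?thesis
    using two_arcs_Jordan[OF g(1,2,3,5,4,6,7)] that unfolding g(8) by metis
qed

text \<open>
  The invariant of the ear decomposition: \<open>F\<close> is the set of regions of the drawing of the
  subgraph with vertices \<open>W\<close> and edges \<open>D\<close>, and \<open>bd\<close> gives the edges on the boundary of a region.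
  The last but one clause says that the regions at \<open>v\<close> connect the edges at \<open>v\<close>.
\<close>

definition plane_regions :: "'a set \<Rightarrow> 'a set set \<Rightarrow> complex set set \<Rightarrow> (complex set \<Rightarrow> 'a set set) \<Rightarrow> bool" where
  "plane_regions W D F bd \<longleftrightarrow>
     W \<subseteq> U \<and> D \<subseteq> E \<and> \<Union>D = W \<and> finite F \<and>
     (\<forall>R\<in>F. R \<in> components (- img (bd R)) \<and> bd R \<subseteq> D \<and> (\<exists>c. distinct c \<and> 3 \<le> length c \<and> cedges c = bd R)) \<and>
     (\<forall>R\<in>F. \<forall>R'\<in>F. R \<noteq> R' \<longrightarrow> R \<inter> R' = {}) \<and>
     \<Union>F = - img D \<and>
     (\<forall>e\<in>D. card {R\<in>F. e \<in> bd R} = 2) \<and>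
     (\<forall>v X. X \<subseteq> {e\<in>D. v \<in> e} \<and> X \<noteq> {} \<and> X \<noteq> {e\<in>D. v \<in> e} \<longrightarrow>
        (\<exists>R\<in>F. \<exists>e\<in>X. \<exists>e'\<in>D - X. v \<in> e' \<and> e \<in> bd R \<and> e' \<in> bd R)) \<and>
     card W + card F = card D + 2"

section \<open>Regions of a cycle and the effect of adding an ear\<close>

lemma plane_regions_cycle:
  assumes "distinct c" "3 \<le> length c" "cedges c \<subseteq> E"
  shows "\<exists>F. plane_regions (set c) (cedges c) F (\<lambda>_. cedges c)"
proof -
  obtain I O' where IO: "components (- img (cedges c)) = {I, O'}" "I \<noteq> O'" "I \<inter> O' = {}"
    "I \<union> O' = - img (cedges c)"
    using cycle_components[OF assms] by metis
  have ne: "c \<noteq> []" using assms(2) by auto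
  have Uc: "\<Union>(cedges c) = set c" using Union_cedges[OF ne] .
  show ?thesis
    unfolding plane_regions_def
  proof (intro exI[of _ "{I, O'}"] conjI ballI allI impI)
    show "set c \<subseteq> U" using Uc E_sub assms(3) by blast
    show "card {R \<in> {I, O'}. e \<in> cedges c} = 2" if "e \<in> cedges c" for e
    proof -
      have "{R \<in> {I, O'}. e \<in> cedges c} = {I, O'}" using that by blast
      then show ?thesis using IO(2) by simp
    qed
    show "card (set c) + card {I, O'} = card (cedges c) + 2"
      using card_cedges[OF assms(1,2)] distinct_card[OF assms(1)] IO(2) by simp
    show "\<exists>R\<in>{I, O'}. \<exists>e\<in>X. \<exists>e'\<in>cedges c - X. v \<in> e' \<and> e \<in> cedges c \<and> e' \<in> cedges c"
      if "X \<subseteq> {e\<in>cedges c. v \<in> e} \<and> X \<noteq> {} \<and> X \<noteq> {e\<in>cedges c. v \<in> e}" for v X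
      using that by blast
  qed (use IO assms Uc in auto)
qed

lemma cycle_pair_arcs:
  assumes "distinct (a # xs @ b # ys)" "v \<notin> {a, b}"
    "e \<in> pedges (a # xs @ [b])" "v \<in> e" "e' \<in> pedges (a # rev ys @ [b])" "v \<in> e'"
  shows False
  using pedges_subset[OF assms(3)] pedges_subset[OF assms(5)] assms by auto

text \<open>The open ear is connected and misses the old drawing, so it lies in one region
  \<open>R\<close>. Its ends are on the cycle around \<open>R\<close>, which they cut into two
  paths, and \<open>theta_regions\<close> replaces \<open>R\<close> by two regions (again called
  \<open>demanding\<close> and \<open>D2\<close>). All other regions and their boundaries are
  kept.\<close>

lemma plane_regions_ear:
  assumes st: "plane_regions W D F bd" and finU: "finite U"
    and ab: "a \<in> W" "b \<in> W" and P: "distinct (a # ps @ [b])" "set ps \<inter> W = {}" "set ps \<subseteq> U"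
      "pedges (a # ps @ [b]) \<subseteq> E" "pedges (a # ps @ [b]) \<inter> D = {}"
  shows "\<exists>F' bd'. plane_regions (W \<union> set ps) (D \<union> pedges (a # ps @ [b])) F' bd'"
proof -
  let ?P = "pedges (a # ps @ [b])"
  note s = st[unfolded plane_regions_def]
  note WU = s[THEN conjunct1] and s = s[THEN conjunct2]
  note DE = s[THEN conjunct1] and s = s[THEN conjunct2]
  note UD = s[THEN conjunct1] and s = s[THEN conjunct2]
  note finF = s[THEN conjunct1] and s = s[THEN conjunct2]
  note F = s[THEN conjunct1, THEN bspec] and s = s[THEN conjunct2]
  note disj = s[THEN conjunct1, THEN bspec, THEN bspec, THEN mp] and s = s[THEN conjunct2]
  note UF = s[THEN conjunct1] and s = s[THEN conjunct2]
  note two = s[THEN conjunct1, THEN bspec] and s = s[THEN conjunct2]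
  note rot0 = s[THEN conjunct1] and euler = s[THEN conjunct2]
  have rot: "\<exists>R\<in>F. \<exists>e\<in>X. \<exists>e'\<in>D - X. v \<in> e' \<and> e \<in> bd R \<and> e' \<in> bd R"
    if "X \<subseteq> {e\<in>D. v \<in> e}" "X \<noteq> {}" "X \<noteq> {e\<in>D. v \<in> e}" for v X
    using rot0[THEN spec, THEN spec, THEN mp, OF conjI, OF that(1) conjI, OF that(2,3)] .
  have finW: "finite W" using WU finU finite_subset by auto
  have finD: "finite D"
  proof -
    have "D \<subseteq> Pow W" using UD by auto
    then show ?thesis using finW finite_subset by blast
  qed
  have neq: "a \<noteq> b" using P(1) by auto
  have UP: "\<Union>?P = set (a # ps @ [b])" by (rule Union_pedges) simp
  obtain g3 where g3: "arc g3" "path_image g3 = img ?P" "pathstart g3 = p a" "pathfinish g3 = p b"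
    using path_arc'[OF P(1,4)] by metis
  define A3 where "A3 = img ?P"
  define T where "T = A3 - {p a, p b}"
  have iD: "img D \<inter> A3 = {p a, p b}"
  proof -
    have "img D \<inter> A3 = p ` (\<Union>D \<inter> \<Union>?P)" unfolding A3_def by (rule img_Int) (use DE P in auto)
    also have "\<Union>D \<inter> \<Union>?P = {a, b}" unfolding UP UD using ab P by auto
    finally show ?thesis by simp
  qed
  have sp3: "simple_path g3" using g3 arc_imp_simple_path by auto
  have Tc: "topological_space_class.connected T" using connected_simple_path_endless[OF sp3] g3 by (simp add: T_def A3_def)
  have Tne: "T \<noteq> {}" using nonempty_simple_path_endless[OF sp3] g3 by (simp add: T_def A3_def)
  have pab: "p a \<noteq> p b" using arc_distinct_ends[OF g3(1)] g3 by auto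
  have A3c: "topological_space_class.connected A3" using connected_path_image[OF arc_imp_path[OF g3(1)]] g3(2) by (simp add: A3_def)
  have pA3: "p a \<in> A3" "p b \<in> A3" using iD by auto
  \<comment> \<open>An end of the arc is a limit of its interior: otherwise that end would be an
    isolated point of the connected arc.\<close>
  have Tcl: "u \<in> closure T" if u: "{u, w} = {p a, p b}" for u w
  proof (rule ccontr)
    assume nu: "u \<notin> closure T"
    have uw: "u \<noteq> w" "u \<in> A3" "w \<in> A3" using u pab pA3 by (auto simp: doubleton_eq_iff)
    have "T = A3 - {u, w}" using u by (simp add: T_def)
    then have "A3 \<subseteq> {u} \<union> (closure T \<union> {w})" using closure_subset[of T] by blast
    moreover have "{u} \<inter> (closure T \<union> {w}) \<inter> A3 = {}" using nu uw by auto
    ultimately show False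
      using A3c uw unfolding connected_closed
      by (metis IntI Un_iff closed_Un closed_closure closed_singleton empty_iff insertI1)
  qed
  have TD: "T \<subseteq> - img D" using iD by (auto simp: T_def)
  then obtain R where R: "R \<in> F" "R \<inter> T \<noteq> {}" using UF Tne by blast
  note FR = F[OF R(1)]
  have imgR: "img (bd R) \<subseteq> img D" using FR by (auto simp: img_def)
  have TR: "T \<subseteq> R"
    using components_maximal[of R "- img (bd R)" T] FR Tc TD imgR R(2) by auto
  obtain c where c: "distinct c" "3 \<le> length c" "cedges c = bd R" using FR by auto
  have cE: "cedges c \<subseteq> E" using c FR DE by auto
  obtain I O' where IO: "components (- img (cedges c)) = {I, O'}" "frontier I = img (cedges c)"
    "frontier O' = img (cedges c)" "open I" "open O'"
    using cycle_components[OF c(1,2) cE] by metis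
  have Rf: "frontier R = img (bd R)" "open R" using FR IO c(3) by auto
  have Rne: "R \<noteq> {}" using FR in_components_nonempty by blast
  \<comment> \<open>The end \<open>z\<close> is a limit of \<open>R\<close> but belongs to the old
    drawing, so it is on the frontier of \<open>R\<close>, which is the drawing of its
    cycle.\<close>
  have inc: "z \<in> set c" if "z \<in> {a, b}" for z
  proof -
    have zU: "z \<in> U" "z \<in> W" using that ab WU by auto
    have "p z \<in> closure T" using that Tcl[of "p a" "p b"] Tcl[of "p b" "p a"] by auto
    then have "p z \<in> closure R" using TR closure_mono by blast
    moreover have "p z \<in> img D" using img_vertex[OF DE zU(1)] UD zU by auto
    then have "p z \<notin> R" using UF R(1) by auto
    ultimately have "p z \<in> frontier R" using Rf(2) by (simp add: frontier_def interior_open)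
    then have "z \<in> \<Union>(bd R)" using img_vertex[of "bd R" z] Rf(1) zU FR DE by auto
    moreover have "c \<noteq> []" using c(2) by auto
    ultimately show ?thesis using Union_cedges[of c] unfolding c(3) by blast
  qed
  obtain xs ys where xy: "cedges (a # xs @ b # ys) = cedges c" "distinct (a # xs @ b # ys)"
    "set (a # xs @ b # ys) = set c" "length (a # xs @ b # ys) = length c"
    using rotate_to_two[OF c(1) inc[of a] inc[of b] neq] by blast
  have xyE: "3 \<le> length (a # xs @ b # ys)" "cedges (a # xs @ b # ys) \<subseteq> E" using xy c cE by auto
  let ?P1 = "pedges (a # xs @ [b])" and ?P2 = "pedges (a # rev ys @ [b])"
  obtain g1 g2 where g: "arc g1" "arc g2" "path_image g1 = img ?P1"
    "path_image g2 = img ?P2" "pathstart g1 = p a" "pathstart g2 = p a"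
    "pathfinish g1 = p b" "pathfinish g2 = p b" "path_image g1 \<inter> path_image g2 = {p a, p b}"
    "path_image g1 \<union> path_image g2 = img (cedges (a # xs @ b # ys))"
    using cycle_arcs[OF xy(2) xyE] by metis
  have bdR: "bd R = ?P1 \<union> ?P2"
    using xy(1) c(3) cedges_split[of a xs b ys] pedges_rev[of "b # ys @ [a]"] by simp
  have P12: "?P1 \<inter> ?P2 = {}"
    by (rule path_edges_disjoint) (use xy(2) xyE(1) in auto)
  have sub12: "?P1 \<subseteq> D" "?P2 \<subseteq> D" using bdR FR by auto
  have cW: "set c \<subseteq> W"
  proof -
    have "c \<noteq> []" using c(2) by auto
    then show ?thesis using UD FR c(3) Union_cedges[of c] by blast
  qed
  have i13: "path_image g1 \<inter> path_image g3 = {p a, p b}"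
    unfolding g(3) g3(2)
  proof (rule img_path_Int)
    show "set xs \<inter> set ps = {}" using cW xy(3) P(2) by auto
    show "?P1 \<inter> ?P = {}" using sub12 P(5) by auto
  qed (use P xy(2) sub12 DE in auto)
  have i23: "path_image g2 \<inter> path_image g3 = {p a, p b}"
    unfolding g(4) g3(2)
  proof (rule img_path_Int)
    show "set (rev ys) \<inter> set ps = {}" using cW xy(3) P(2) by auto
    show "?P2 \<inter> ?P = {}" using sub12 P(5) by auto
  qed (use P xy(2) sub12 DE in auto)
  have Rc: "R \<in> components (- (path_image g1 \<union> path_image g2))" using FR g(10) xy(1) c(3) by simp
  have sub3: "path_image g3 - {p a, p b} \<subseteq> R" using TR g3(2) by (simp add: T_def A3_def)
  obtain demanding D2 where D12: "demanding \<in> components (- (path_image g1 \<union> path_image g3))"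
    "D2 \<in> components (- (path_image g2 \<union> path_image g3))"
    "demanding \<inter> D2 = {}" "R - path_image g3 = demanding \<union> D2" "demanding \<noteq> {}" "D2 \<noteq> {}"
    using theta_regions[OF g(1,2) g3(1) g(5,6) g3(3) g(7,8) g3(4) g(9) i13 i23 Rc sub3] by metis
  define c1 where "c1 = a # xs @ b # rev ps"
  define c2 where "c2 = a # rev ys @ b # rev ps"
  have ce1: "cedges c1 = ?P1 \<union> ?P" and ce2: "cedges c2 = ?P2 \<union> ?P"
    using cedges_split[of a xs b "rev ps"] cedges_split[of a "rev ys" b "rev ps"] pedges_rev[of "b # rev ps @ [a]"]
    by (auto simp: c1_def c2_def)
  \<comment> \<open>Otherwise the ear would be the edge \<open>{a, b}\<close>, which the old graph
    already has. So the new boundary lists have length at least 3.\<close>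
  have notempty: "xs \<noteq> [] \<or> ps \<noteq> []" "ys \<noteq> [] \<or> ps \<noteq> []"
    using sub12 P(5) by auto
  have dc: "distinct c1" "distinct c2" "3 \<le> length c1" "3 \<le> length c2"
    using xy(2) P(1,2) cW xy(3) notempty by (auto simp: c1_def c2_def Suc_le_eq)
  define F' where "F' = (F - {R}) \<union> {demanding, D2}"
  define bd' where "bd' = bd(demanding := cedges c1, D2 := cedges c2)"
  have Dsub: "demanding \<subseteq> R" "D2 \<subseteq> R" using D12(4) by auto
  have notF: "Q \<notin> F - {R}" if "Q \<subseteq> R" "Q \<noteq> {}" for Q
  proof
    assume "Q \<in> F - {R}"
    then have "Q \<inter> R = {}" using disj[OF _ R(1), of Q] by blast
    then show False using that by blast
  qed
  have D12F: "demanding \<notin> F - {R}" "D2 \<notin> F - {R}" "demanding \<noteq> D2"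
    using notF Dsub D12(3,5,6) by blast+
  have bdF: "bd' Q = bd Q" if "Q \<in> F - {R}" for Q using that D12F by (auto simp: bd'_def)
  have bdD: "bd' demanding = ?P1 \<union> ?P" "bd' D2 = ?P2 \<union> ?P" using D12F ce1 ce2 by (auto simp: bd'_def)
  have cardP: "card ?P = length ps + 1" using card_pedges[OF P(1)] by simp
  show ?thesis
  proof (intro exI[of _ F'] exI[of _ bd'])
    show "plane_regions (W \<union> set ps) (D \<union> ?P) F' bd'"
      unfolding plane_regions_def
    proof (intro conjI)
      show "W \<union> set ps \<subseteq> U" using WU P by auto
      show "D \<union> ?P \<subseteq> E" using DE P by auto
      show "\<Union> (D \<union> ?P) = W \<union> set ps" using UD UP ab by auto
      show "finite F'" using finF by (simp add: F'_def)
      show "\<forall>Q\<in>F'. Q \<in> components (- img (bd' Q)) \<and> bd' Q \<subseteq> D \<union> ?P \<and>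
              (\<exists>c. distinct c \<and> 3 \<le> length c \<and> cedges c = bd' Q)"
      proof
        fix Q assume "Q \<in> F'"
        then consider "Q \<in> F - {R}" | "Q = demanding" | "Q = D2" by (auto simp: F'_def)
        then show "Q \<in> components (- img (bd' Q)) \<and> bd' Q \<subseteq> D \<union> ?P \<and>
              (\<exists>c. distinct c \<and> 3 \<le> length c \<and> cedges c = bd' Q)"
        proof cases
          case 1 then show ?thesis using F[of Q] bdF[of Q] by auto
        next
          case 2 then show ?thesis using D12(1) g(3) g3(2) bdD sub12 dc ce1 by (auto simp: img_Un)
        next
          case 3 then show ?thesis using D12(2) g(4) g3(2) bdD sub12 dc ce2 by (auto simp: img_Un)
        qed
      qed
      show "\<forall>Q\<in>F'. \<forall>Q'\<in>F'. Q \<noteq> Q' \<longrightarrow> Q \<inter> Q' = {}"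
      proof (intro ballI impI)
        fix Q Q' assume Q: "Q \<in> F'" "Q' \<in> F'" "Q \<noteq> Q'"
        have RQ: "Q \<inter> R = {}" if "Q \<in> F - {R}" for Q using disj[of Q R] that R by auto
        show "Q \<inter> Q' = {}"
          using Q RQ[of Q] RQ[of Q'] disj[of Q Q'] Dsub D12(3) by (auto simp: F'_def)
      qed
      have "\<Union>F' = (\<Union>F - R) \<union> (R - A3)"
        using D12(4) disj[OF _ R(1)] by (auto simp: F'_def g3(2) A3_def)
      also have "\<dots> = - img D - A3"
        using UF R(1) TR iD by (auto simp: T_def)
      finally show "\<Union>F' = - img (D \<union> ?P)" by (auto simp: img_Un A3_def)
      show "\<forall>e\<in>D \<union> ?P. card {Q \<in> F'. e \<in> bd' Q} = 2"
      proof
        fix e assume e: "e \<in> D \<union> ?P"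
        have split: "{Q \<in> F'. e \<in> bd' Q} = {Q \<in> F - {R}. e \<in> bd Q} \<union> {Q \<in> {demanding, D2}. e \<in> bd' Q}"
          using bdF by (auto simp: F'_def)
        show "card {Q \<in> F'. e \<in> bd' Q} = 2"
        proof (cases "e \<in> ?P")
          case True
          then have "{Q \<in> F - {R}. e \<in> bd Q} = {}" using F P(5) by auto
          moreover have "{Q \<in> {demanding, D2}. e \<in> bd' Q} = {demanding, D2}" using True bdD by auto
          ultimately have "{Q \<in> F'. e \<in> bd' Q} = {demanding, D2}" using split by (simp only: Un_empty_left)
          then show ?thesis using D12F(3) by simp
        next
          case False
          then have eD: "e \<in> D" using e by auto
          have "{Q \<in> F. e \<in> bd Q} = {Q \<in> F - {R}. e \<in> bd Q} \<union> (if e \<in> bd R then {R} else {})"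
            using R(1) by auto
          then have c0: "card {Q \<in> F - {R}. e \<in> bd Q} = (if e \<in> bd R then 1 else 2)"
            using two[OF eD] finF by (auto simp: card_insert_if split: if_splits)
          have "{Q \<in> {demanding, D2}. e \<in> bd' Q} = (if e \<in> ?P1 then {demanding} else if e \<in> ?P2 then {D2} else {})"
            using False bdD P12 by auto
          then have c1: "card {Q \<in> {demanding, D2}. e \<in> bd' Q} = (if e \<in> bd R then 1 else 0)"
            using bdR by auto
          have "card {Q \<in> F'. e \<in> bd' Q} = card {Q \<in> F - {R}. e \<in> bd Q} + card {Q \<in> {demanding, D2}. e \<in> bd' Q}"
            unfolding split by (rule card_Un_disjoint) (use finF D12F in auto)
          then show ?thesis using c0 c1 by simp
        qed
      qed
      \<comment> \<open>At an inner vertex of the ear both edges bound \<open>demanding\<close>.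
        Elsewhere an old witness survives unless it is \<open>R\<close>. Away from \<open>a\<close>
        and \<open>b\<close> its two edges then lie on the same half of the cycle; at
        \<open>a\<close> or \<open>b\<close> they may lie on different halves, and the ear edge
        \<open>eP\<close> mediates, since it bounds both new regions.\<close>
      show "\<forall>v X. X \<subseteq> {e \<in> D \<union> ?P. v \<in> e} \<and> X \<noteq> {} \<and> X \<noteq> {e \<in> D \<union> ?P. v \<in> e} \<longrightarrow>
            (\<exists>Q\<in>F'. \<exists>e\<in>X. \<exists>e'\<in>D \<union> ?P - X. v \<in> e' \<and> e \<in> bd' Q \<and> e' \<in> bd' Q)"
      proof (intro allI impI, elim conjE)
        fix v X assume X: "X \<subseteq> {e \<in> D \<union> ?P. v \<in> e}" "X \<noteq> {}" "X \<noteq> {e \<in> D \<union> ?P. v \<in> e}"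
        define Gl where "Gl \<longleftrightarrow> (\<exists>Q\<in>F'. \<exists>e\<in>X. \<exists>e'\<in>D \<union> ?P - X. v \<in> e' \<and> e \<in> bd' Q \<and> e' \<in> bd' Q)"
        have inF': "demanding \<in> F'" "D2 \<in> F'" by (auto simp: F'_def)
        have keep: "Gl"
          if "Q \<in> F - {R}" "e \<in> X" "e' \<in> D - X" "v \<in> e'" "e \<in> bd Q" "e' \<in> bd Q" for Q e e'
          unfolding Gl_def using that bdF[OF that(1)] by (intro bexI[of _ Q] bexI[of _ e] bexI[of _ e']) (auto simp: F'_def)
        have D1w: "Gl"
          if "e \<in> X" "e' \<in> D \<union> ?P - X" "v \<in> e'" "e \<in> ?P1 \<union> ?P" "e' \<in> ?P1 \<union> ?P" for e e'
          unfolding Gl_def using that bdD inF' by (intro bexI[of _ demanding] bexI[of _ e] bexI[of _ e']) auto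
        have D2w: "Gl"
          if "e \<in> X" "e' \<in> D \<union> ?P - X" "v \<in> e'" "e \<in> ?P2 \<union> ?P" "e' \<in> ?P2 \<union> ?P" for e e'
          unfolding Gl_def using that bdD inF' by (intro bexI[of _ D2] bexI[of _ e] bexI[of _ e']) auto
        obtain e0 e0' where e0: "e0 \<in> X" "e0' \<in> D \<union> ?P" "v \<in> e0'" "e0' \<notin> X" "v \<in> e0" using X by blast
        have "Gl"
        proof (cases "v \<in> W")
          case False
          then have "e0 \<in> ?P" "e0' \<in> ?P" using e0 X(1) UD by auto
          then show ?thesis using D1w[of e0 e0'] e0 by auto
        next
          case vW: True
          show ?thesis
          proof (cases "v \<in> {a, b}")
            case False
            then have nP: "v \<notin> set (a # ps @ [b])" using vW P(2) by auto
            then have nPe: "e \<notin> ?P" if "v \<in> e" for e using that pedges_subset by blast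
            then have "X \<subseteq> {e \<in> D. v \<in> e}" "X \<noteq> {e \<in> D. v \<in> e}" using X by auto
            then obtain Q e e' where Q: "Q \<in> F" "e \<in> X" "e' \<in> D - X" "v \<in> e'" "e \<in> bd Q" "e' \<in> bd Q"
              using rot[OF _ X(2)] by blast
            show ?thesis
            proof (cases "Q = R")
              case True
              have ve: "v \<in> e" using Q(2) X(1) by auto
              have "\<not> (e \<in> ?P1 \<and> e' \<in> ?P2)" "\<not> (e' \<in> ?P1 \<and> e \<in> ?P2)"
                using cycle_pair_arcs[OF xy(2), of v e e'] cycle_pair_arcs[OF xy(2), of v e' e] False ve Q(4) by blast+
              then have "(e \<in> ?P1 \<and> e' \<in> ?P1) \<or> (e \<in> ?P2 \<and> e' \<in> ?P2)" using Q(5,6) bdR True by blast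
              then show ?thesis using D1w[of e e'] D2w[of e e'] Q by blast
            next
              case False
              then show ?thesis using keep Q by blast
            qed
          next
            case True
            obtain eP where eP: "eP \<in> ?P" "v \<in> eP" "\<And>e. e \<in> ?P \<Longrightarrow> v \<in> e \<Longrightarrow> e = eP"
            proof (cases "v = a")
              case True
              have *: "?P = insert {a, hd (ps @ [b])} (pedges (ps @ [b]))" by (simp add: pedges_Cons)
              have "a \<notin> e" if "e \<in> pedges (ps @ [b])" for e using pedges_subset[OF that] P(1) by auto
              then show ?thesis using True unfolding * by (intro that[unfolded *, of "{a, hd (ps @ [b])}"]) blast+
            next
              case False
              then have vb: "v = b" using True by auto
              have *: "?P = insert {last (a # ps), b} (pedges (a # ps))" using pedges_snoc[of "a # ps" b] by simp
              have "b \<notin> e" if "e \<in> pedges (a # ps)" for e using pedges_subset[OF that] P(1) by auto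
              then show ?thesis using vb unfolding * by (intro that[unfolded *, of "{last (a # ps), b}"]) blast+
            qed
            have "v \<in> \<Union>?P1" "v \<in> \<Union>?P2"
              using True Union_pedges[of "a # xs @ [b]"] Union_pedges[of "a # rev ys @ [b]"] by auto
            then obtain e1 e2 where e12: "e1 \<in> ?P1" "v \<in> e1" "e2 \<in> ?P2" "v \<in> e2" by auto
            have in12: "e1 \<in> D" "e2 \<in> D" using e12 sub12 by auto
            show ?thesis
            proof (cases "eP \<in> X \<longleftrightarrow> e1 \<in> X")
              case False
              then show ?thesis using D1w[of eP e1] D1w[of e1 eP] eP(1,2) e12 in12 by blast
            next
              case s1: True
              show ?thesis
              proof (cases "eP \<in> X \<longleftrightarrow> e2 \<in> X")
                case False
                then show ?thesis using D2w[of eP e2] D2w[of e2 eP] eP(1,2) e12 in12 by blast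
              next
                case s2: True
                \<comment> \<open>Now the ear edge and the two cycle edges at \<open>v\<close> are
                  on the same side of \<open>X\<close>, so the old edges in \<open>X\<close> are
                  neither none nor all of those at \<open>v\<close>, and the old invariant applies
                  to them.\<close>
                define Y where "Y = X \<inter> D"
                have Y: "Y \<subseteq> {e \<in> D. v \<in> e}" using X(1) by (auto simp: Y_def)
                have "Y \<noteq> {}"
                proof
                  assume "Y = {}"
                  then have "e1 \<notin> X" "eP \<in> X" using in12 e0 X(1) eP(3)[of e0] unfolding Y_def by blast+
                  then show False using s1 by simp
                qed
                moreover have "Y \<noteq> {e \<in> D. v \<in> e}"
                proof
                  assume Ye: "Y = {e \<in> D. v \<in> e}"
                  then have "e1 \<in> X" using in12 e12 by (auto simp: Y_def)
                  then have "eP \<in> X" using s1 by simp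
                  moreover have "e0' \<notin> D" using Ye e0 by (auto simp: Y_def)
                  then have "e0' = eP" using e0 eP(3)[of e0'] by blast
                  ultimately show False using e0 by simp
                qed
                ultimately obtain Q e e' where Q: "Q \<in> F" "e \<in> Y" "e' \<in> D - Y" "v \<in> e'" "e \<in> bd Q" "e' \<in> bd Q"
                  using rot[OF Y] by blast
                have eX: "e \<in> X" "e' \<in> D - X" "v \<in> e" using Q X(1) by (auto simp: Y_def)
                show ?thesis
                proof (cases "Q = R")
                  case True
                  consider "e \<in> ?P1" "e' \<in> ?P1" | "e \<in> ?P2" "e' \<in> ?P2" | "e \<in> ?P1" "e' \<in> ?P2" | "e \<in> ?P2" "e' \<in> ?P1"
                    using Q(5,6) bdR True by blast
                  then show ?thesis
                  proof cases
                    case 1 then show ?thesis using D1w[of e e'] eX Q by blast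
                  next
                    case 2 then show ?thesis using D2w[of e e'] eX Q by blast
                  next
                    case 3
                    show ?thesis
                    proof (cases "eP \<in> X")
                      case True then show ?thesis using D2w[of eP e'] eP(1,2) eX Q 3 by blast
                    next
                      case False then show ?thesis using D1w[of e eP] eP(1,2) eX Q 3 by blast
                    qed
                  next
                    case 4
                    show ?thesis
                    proof (cases "eP \<in> X")
                      case True then show ?thesis using D1w[of eP e'] eP(1,2) eX Q 4 by blast
                    next
                      case False then show ?thesis using D2w[of e eP] eP(1,2) eX Q 4 by blast
                    qed
                  qed
                next
                  case False
                  then show ?thesis using keep[of Q e e'] Q eX by blast
                qed
              qed
            qed
          qed
        qed
        then show "\<exists>Q\<in>F'. \<exists>e\<in>X. \<exists>e'\<in>D \<union> ?P - X. v \<in> e' \<and> e \<in> bd' Q \<and> e' \<in> bd' Q" unfolding Gl_def .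
      qed
      \<comment> \<open>Euler's formula persists: an ear with \<open>k\<close> inner vertices adds
        \<open>k\<close> vertices, \<open>k + 1\<close> edges and one region.\<close>
      have "card (W \<union> set ps) = card W + length ps"
        using card_Un_disjoint[OF finW, of "set ps"] P(1,2) distinct_card[of ps] by auto
      moreover have "card (D \<union> ?P) = card D + length ps + 1"
        using card_Un_disjoint[OF finD, of ?P] P(5) cardP by auto
      moreover have "card F' = card F + 1"
      proof -
        have "card F' = card (F - {R}) + card {demanding, D2}"
          unfolding F'_def by (rule card_Un_disjoint) (use finF D12F in auto)
        moreover have "card (F - {R}) = card F - 1" "card F > 0" using R(1) finF by (auto simp: card_gt_0_iff)
        ultimately show ?thesis using D12F by simp
      qed
      ultimately show "card (W \<union> set ps) + card F' = card (D \<union> ?P) + 2" using euler by simp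
    qed
  qed
qed

end

theorem (in sgraph) plane_faces:
  fixes p :: "'a \<Rightarrow> complex" and V :: "'a set"
  defines "E \<equiv> {e \<in> EA. e \<subseteq> V}"
  assumes pg: "plane_graph p \<gamma> V E" and V: "finite V" "3 \<le> card V" "conn V" "\<And>v. v \<in> V \<Longrightarrow> conn (V - {v})"
  obtains F :: "complex set set" and bd where "finite F"
    "\<And>R. R \<in> F \<Longrightarrow> \<exists>c. distinct c \<and> 3 \<le> length c \<and> cedges c = bd R"
    "\<And>R. R \<in> F \<Longrightarrow> bd R \<subseteq> E"
    "\<And>e. e \<in> E \<Longrightarrow> card {R\<in>F. e \<in> bd R} = 2"
    "\<And>v X. X \<subseteq> {e\<in>E. v \<in> e} \<Longrightarrow> X \<noteq> {} \<Longrightarrow> X \<noteq> {e\<in>E. v \<in> e} \<Longrightarrow>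
        \<exists>R\<in>F. \<exists>e\<in>X. \<exists>e'\<in>E - X. v \<in> e' \<and> e \<in> bd R \<and> e' \<in> bd R"
    "card V + card F = card E + 2"
proof -
  interpret plane_graph p \<gamma> V E by fact
  have finE: "finite E"
  proof -
    have "E \<subseteq> Pow V" by (auto simp: E_def)
    then show ?thesis using V(1) finite_subset by blast
  qed
  have grow: "\<exists>F bd. plane_regions V E F bd" if "plane_regions W D F bd" "\<exists>a1\<in>W. \<exists>a2\<in>W. a1 \<noteq> a2" for W D F bd
    using that
  proof (induction "card (E - D)" arbitrary: W D F bd rule: less_induct)
    case less
    note st = less(2)[unfolded plane_regions_def]
    note s = st[THEN conjunct1] st[THEN conjunct2, THEN conjunct1] st[THEN conjunct2, THEN conjunct2, THEN conjunct1]
    show ?case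
    proof (cases "D = E")
      case True
      have "V \<subseteq> W"
      proof
        fix v assume v: "v \<in> V"
        have "V \<noteq> {v}" using V(2) by auto
        then obtain z where "z \<in> V" "A v z" using conn_nbr[OF V(3) v] by metis
        then have "{v, z} \<in> E" using v by (auto simp: E_def EA_iff)
        then show "v \<in> W" using s(3) True by auto
      qed
      then show ?thesis using less(2) True s(1) by (metis subset_antisym)
    next
      case False
      obtain a1 a2 where a12: "a1 \<in> W" "a2 \<in> W" "a1 \<noteq> a2" using less(3) by auto
      obtain a b ps where P: "a \<in> W" "b \<in> W" "distinct (a # ps @ [b])" "set ps \<inter> W = {}" "set ps \<subseteq> V"
        "pedges (a # ps @ [b]) \<subseteq> E" "pedges (a # ps @ [b]) \<inter> D = {}"
        using ear_exists[OF V(1,3,4) s(1,3) s(2)[unfolded E_def] False[unfolded E_def] a12]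
        unfolding E_def[symmetric] by metis
      obtain F' bd' where st: "plane_regions (W \<union> set ps) (D \<union> pedges (a # ps @ [b])) F' bd'"
        using plane_regions_ear[OF less(2) V(1) P] by blast
      have "pedges (a # ps @ [b]) \<noteq> {}" by (cases ps) auto
      then have "E - (D \<union> pedges (a # ps @ [b])) \<subset> E - D" using P(6,7) by blast
      then have lt: "card (E - (D \<union> pedges (a # ps @ [b]))) < card (E - D)"
        using finE by (intro psubset_card_mono) auto
      show ?thesis by (rule less(1)[OF lt st]) (use a12 in blast)
    qed
  qed
  obtain c where c: "distinct c" "3 \<le> length c" "set c \<subseteq> V" "cedges c \<subseteq> EA"
    using cycle_exists[OF V] by metis
  have cE: "cedges c \<subseteq> E"
  proof
    fix e assume e: "e \<in> cedges c"
    have "c \<noteq> []" using c(2) by auto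
    then have "e \<subseteq> set c" using cedges_subset[OF e] by simp
    then show "e \<in> E" using e c by (auto simp: E_def)
  qed
  have two: "\<exists>a1\<in>set c. \<exists>a2\<in>set c. a1 \<noteq> a2"
    using c(1,2) by (cases c rule: pedges.cases) auto
  obtain F0 where "plane_regions (set c) (cedges c) F0 (\<lambda>_. cedges c)" using plane_regions_cycle[OF c(1,2) cE] by blast
  then obtain F bd where st: "plane_regions V E F bd" using grow two by blast
  note s = st[unfolded plane_regions_def, THEN conjunct2, THEN conjunct2, THEN conjunct2]
  note finF = s[THEN conjunct1] and s = s[THEN conjunct2]
  note F = s[THEN conjunct1, THEN bspec] and s = s[THEN conjunct2]
  note s = s[THEN conjunct2, THEN conjunct2]
  note two = s[THEN conjunct1, THEN bspec] and s = s[THEN conjunct2]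
  note rot0 = s[THEN conjunct1] and euler = s[THEN conjunct2]
  have rot: "\<exists>R\<in>F. \<exists>e\<in>X. \<exists>e'\<in>E - X. v \<in> e' \<and> e \<in> bd R \<and> e' \<in> bd R"
    if "X \<subseteq> {e\<in>E. v \<in> e}" "X \<noteq> {}" "X \<noteq> {e\<in>E. v \<in> e}" for v X
    using rot0[THEN spec, THEN spec, THEN mp, OF conjI, OF that(1) conjI, OF that(2,3)] .
  show ?thesis
    by (rule that[OF finF _ _ two rot euler]) (use F in blast)+
qed

context sgraph begin

text \<open>Only adjacency inside \<open>S\<close> matters. This allows passing between the whole
  graph and the graph with the edges outside \<open>U\<close> removed.\<close>

lemma wd_agree:
  assumes "sgraph.wd B S f" "\<And>a b. a \<in> S \<Longrightarrow> b \<in> S \<Longrightarrow> B a b = A a b" "sgraph B"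
  shows "wd S f"
proof -
  interpret B: sgraph B by fact
  show ?thesis
    using assms(1,2)
  proof (induction rule: B.wd.induct)
    case (wd_empty f)
    show ?case by (rule wd.wd_empty)
  next
    case (wd_del u S f)
    have "wd (S - {u}) (\<lambda>y. f y - of_bool (A y u))"
      by (rule wd_cong[OF wd_del(5)]) (use wd_del in auto)
    then show ?case using wd_del by (intro wd.wd_del[of u S f]) auto
  next
    case (wd_save a S b f)
    have "wd (S - {a}) (\<lambda>y. f y - of_bool (A y a \<and> y \<noteq> b))"
      by (rule wd_cong[OF wd_save(7)]) (use wd_save in auto)
    then show ?case using wd_save by (intro wd.wd_save[of a S b f]) auto
  qed
qed

end

section \<open>Minimal counterexamples\<close>

text \<open>Minimality is assumed for every root \<open>y\<close>, not only for \<open>x\<close>, so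
  that a cut vertex can take over the role of the root. All edges are inside \<open>U\<close>, so
  degrees in \<open>U\<close> are degrees in the graph.\<close>

locale mincex = sgraph A for A :: "'a \<Rightarrow> 'a \<Rightarrow> bool" +
  fixes U :: "'a set" and x :: 'a
  assumes finU: "finite U" and AU: "A a b \<Longrightarrow> a \<in> U" and xU: "x \<in> U"
    and bad: "\<not> wd (U - {x}) (\<lambda>v. 2 - of_bool (A v x))"
    and minimal: "\<And>V y. V \<subset> U \<Longrightarrow> y \<in> V \<Longrightarrow> wd (V - {y}) (\<lambda>v. 2 - of_bool (A v y))"
begin

abbreviation deg :: "'a \<Rightarrow> nat" where "deg v \<equiv> d v U"

lemma AU2: "A a b \<Longrightarrow> b \<in> U"
  using AU sym by blast

text \<open>The set \<open>U - S\<close> still contains \<open>x\<close> and is smaller, so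
  minimality with the same root empties it first; \<open>S\<close> is then left with 2 minus the
  number of its outside neighbours.\<close>

lemma irreducible:
  assumes "S \<subseteq> U - {x}" "S \<noteq> {}" "\<And>y. y \<in> S \<Longrightarrow> d y (U - S) \<le> 2"
    "wd S (\<lambda>y. 2 - int (d y (U - S)))"
  shows False
proof -
  have fin: "finite S" "finite (U - S)" using assms(1) finU finite_subset by auto
  have "wd (U - S - {x}) (\<lambda>v. 2 - of_bool (A v x))"
    by (rule minimal) (use assms xU in auto)
  moreover have dx: "int (d y (U - S)) = int (d y (U - S - {x})) + of_bool (A y x)" for y
  proof -
    have "x \<in> U - S" using assms(1) xU by auto
    then show ?thesis using d_remove[OF fin(2), of x y] by (cases "A y x") simp_all
  qed
  have "wd S (\<lambda>y. 2 - of_bool (A y x) - int (d y (U - S - {x})))"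
    by (rule wd_cong[OF assms(4)]) (simp add: dx)
  ultimately have "wd ((U - S - {x}) \<union> S) (\<lambda>v. 2 - of_bool (A v x))"
  proof (intro wd_compose)
    show "0 \<le> 2 - of_bool (A y x) - int (d y (U - S - {x}))" if "y \<in> S" for y
      using assms(3)[OF that] dx[of y] by simp
  qed (use fin in auto)
  moreover have "(U - S - {x}) \<union> S = U - {x}" using assms(1) by auto
  ultimately show False using bad by simp
qed

lemma deg_ge_3: "v \<in> U \<Longrightarrow> v \<noteq> x \<Longrightarrow> 3 \<le> deg v"
proof (rule ccontr)
  assume v: "v \<in> U" "v \<noteq> x" "\<not> 3 \<le> deg v"
  then show False
    by (intro irreducible[of "{v}"]) (auto simp: d_self intro!: wd_single)
qed

lemma ex_other: "\<exists>v\<in>U. v \<noteq> x"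
proof (rule ccontr)
  assume "\<not> ?thesis"
  then have "U - {x} = {}" by auto
  have "wd (U - {x}) (\<lambda>v. 2 - of_bool (A v x))" unfolding \<open>U - {x} = {}\<close> by (rule wd_empty)
  then show False using bad by simp
qed

lemma card_U: "4 \<le> card U"
proof -
  obtain v where v: "v \<in> U" "v \<noteq> x" using ex_other by auto
  have "{y \<in> U. A v y} \<subseteq> U - {v}" using irr by auto
  then have "deg v \<le> card (U - {v})" unfolding d_def using finU by (intro card_mono) auto
  then show ?thesis using deg_ge_3[OF v] v finU by auto
qed

text \<open>Let \<open>S\<close> be a side of the cut vertex \<open>c\<close> without
  \<open>x\<close>. The only outside neighbour its vertices may have is \<open>c\<close>, so
  minimality for \<open>S\<close> together with \<open>c\<close>, rooted at \<open>c\<close>, is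
  exactly the removability of \<open>S\<close>.\<close>

lemma conn_minus:
  assumes c: "c \<in> U"
  shows "conn (U - {c})"
  unfolding conn_def
proof (intro allI impI, rule ccontr)
  fix X assume X: "X \<subseteq> U - {c} \<and> X \<noteq> {} \<and> X \<noteq> U - {c}" and no: "\<not> (\<exists>a\<in>X. \<exists>b\<in>U - {c} - X. A a b)"
  define S where "S = (if x \<in> X then U - {c} - X else X)"
  have S: "S \<subseteq> U - {x}" "S \<noteq> {}" "c \<notin> S" "S \<union> {c} \<subset> U" using X c by (auto simp: S_def)
  have noS: "\<not> A y z" if "y \<in> S" "z \<in> U - S - {c}" for y z
    using no that X sym by (auto simp: S_def split: if_splits)
  have dS: "d y (U - S) = of_bool (A y c)" if "y \<in> S" for y
  proof -
    have "{z \<in> U - S. A y z} = (if A y c then {c} else {})" using noS that S c by auto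
    then show ?thesis unfolding d_def by simp
  qed
  have eq: "S \<union> {c} - {c} = S" using S by auto
  have "wd S (\<lambda>v. 2 - of_bool (A v c))"
    using minimal[OF S(4), of c] eq by simp
  then have "wd S (\<lambda>y. 2 - int (d y (U - S)))"
    by (rule wd_cong) (simp add: dS)
  then show False by (intro irreducible[OF S(1,2)]) (auto simp: dS)
qed

lemma conn_U: "conn U"
  unfolding conn_def
proof (intro allI impI, rule ccontr)
  fix X assume X: "X \<subseteq> U \<and> X \<noteq> {} \<and> X \<noteq> U" and no: "\<not> (\<exists>a\<in>X. \<exists>b\<in>U - X. A a b)"
  define S where "S = (if x \<in> X then U - X else X)"
  have S: "S \<subseteq> U - {x}" "S \<noteq> {}" "S \<subset> U" using X xU by (auto simp: S_def)
  have dS: "d y (U - S) = 0" if "y \<in> S" for y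
  proof -
    have "{z \<in> U - S. A y z} = {}" using no that X sym by (auto simp: S_def split: if_splits)
    then show ?thesis unfolding d_def by (metis card.empty)
  qed
  obtain y where y: "y \<in> S" using S by auto
  have "wd S (\<lambda>_. 2)"
    by (rule wd_del[of y]) (use y minimal[OF S(3) y] in auto)
  then have "wd S (\<lambda>y. 2 - int (d y (U - S)))"
    by (rule wd_cong) (simp add: dS)
  then show False by (intro irreducible[OF S(1,2)]) (auto simp: dS)
qed

lemma nbr_outside:
  assumes "B \<subseteq> U - {x}" "B \<noteq> {}"
  obtains b z where "b \<in> B" "z \<in> U" "z \<notin> B" "A b z"
  using conn_edge[OF conn_U, of B] assms xU by blast

lemma d_split: "S \<subseteq> U \<Longrightarrow> deg y = d y S + d y (U - S)"
  using d_Un[of S "U - S" y] finU finite_subset by (metis Diff_disjoint Un_Diff_cancel finite_Diff sup.absorb2)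

text \<open>For 3-vertices the remaining budget is the degree in \<open>B\<close> minus 1. Since the
  graph is connected, some vertex of \<open>B\<close> has a neighbour outside and thus degree at
  most 2 in \<open>B\<close>, and \<open>wd_biconnected\<close> applies.\<close>

lemma reducible_biconn:
  assumes "B \<subseteq> U - {x}" "biconn B" "\<And>y. y \<in> B \<Longrightarrow> deg y = 3" "a \<in> B" "3 \<le> d a B"
  shows False
proof -
  have fB: "finite B" using assms(1) finU finite_subset by auto
  obtain b z where b: "b \<in> B" "z \<in> U" "z \<notin> B" "A b z" using nbr_outside[OF assms(1)] assms(4) by blast
  then have "d b B < deg b" using d_less[OF finU, of B z b] assms(1) by auto
  then have b2: "d b B \<le> 2" using assms(3)[OF b(1)] by simp
  have sp: "deg y = d y B + d y (U - B)" for y by (rule d_split) (use assms(1) in auto)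
  have pos: "0 < d y B" if "y \<in> B" for y using biconn_pos_degree[OF assms(2) fB assms(4,5) that] .
  have f: "2 - int (d y (U - B)) = int (d y B) - 1" if "y \<in> B" for y
    using sp[of y] assms(3)[OF that] by linarith
  show False
  proof (rule irreducible[OF assms(1)])
    show "d y (U - B) \<le> 2" if "y \<in> B" for y using f[OF that] pos[OF that] by linarith
    show "wd B (\<lambda>y. 2 - int (d y (U - B)))"
      by (rule wd_biconnected[OF assms(2) fB _ assms(4,5) b(1) b2]) (simp add: f)
  qed (use assms in auto)
qed

text \<open>A 4-vertex \<open>w\<close> is one unit worse off than the 3-vertices. This is repaired
  by deleting its neighbour \<open>a\<close> and saving \<open>w\<close>: its degree drops and its
  budget does not. Afterwards every vertex has its degree minus 1, and \<open>wd_normal\<close>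
  finishes with \<open>B\<close>.\<close>

lemma reducible_save:
  assumes S: "S \<subseteq> U - {x}" and a: "a \<in> S" "deg a = 3" "\<And>y. A a y \<Longrightarrow> y \<in> S"
    and w: "w \<in> S" "A a w" "deg w = 4" "d w S = 3"
    and three: "\<And>y. y \<in> S \<Longrightarrow> y \<noteq> w \<Longrightarrow> deg y = 3"
    and con: "conn (S - {a})" and B: "B \<subseteq> S - {a}" "biconn B" "a0 \<in> B" "3 \<le> d a0 B"
  shows False
proof -
  have fS: "finite S" and fB: "finite B" using S B finU by (meson finite_subset finite_Diff)+
  have sp: "deg y = d y S + d y (U - S)" for y by (rule d_split) (use S in auto)
  let ?f = "\<lambda>y. 2 - int (d y (U - S))"
  have rem: "int (d y S) = int (d y (S - {a})) + of_bool (A y a)" for y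
    using d_remove[OF fS a(1)] by simp
  have f3: "?f y = int (d y S) - 1" if "y \<in> S" "y \<noteq> w" for y
    using sp[of y] three[OF that] by linarith
  \<comment> \<open>Here the budget is the degree in \<open>S\<close> minus 2. All neighbours of
    \<open>a\<close> are in \<open>S\<close>, so \<open>a\<close> still has 2, and the saving is
    legal.\<close>
  have fw: "?f w = 1" using sp[of w] w by linarith
  have "{y \<in> S. A a y} = {y \<in> U. A a y}" using a(3) S by auto
  then have da: "d a S = 3" using a(2) unfolding d_def by simp
  have aw: "a \<noteq> w" using w irr by auto
  have fa: "?f a = 2" using f3[OF a(1) aw] da by simp
  have neS: "S - {a} \<noteq> {y}" for y
  proof
    assume s: "S - {a} = {y}"
    have "d w (S - {a}) \<le> card {y}" unfolding s d_def by (rule card_mono) auto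
    then show False using rem[of w] w by (cases "A w a") auto
  qed
  have pos: "0 < d y (S - {a})" if y: "y \<in> S - {a}" for y
    using conn_nbr[OF con y neS] d_pos[of "S - {a}"] fS by (metis finite_Diff)
  let ?g = "\<lambda>y. ?f y - of_bool (A y a \<and> y \<noteq> w)"
  have Awa: "A w a" using w sym by auto
  have dw: "d w (S - {a}) = 2" using rem[of w] w Awa by simp
  have g: "?g y = int (d y (S - {a})) - 1" if "y \<in> S - {a}" for y
    using f3[of y] rem[of y] that dw fw by (cases "y = w") auto
  obtain b z where b: "b \<in> B" "z \<in> U" "z \<notin> B" "A b z" using nbr_outside[of B] B S by blast
  have b2: "d b B \<le> 2"
  proof (cases "b = w")
    case True
    then show ?thesis using d_mono[of "S - {a}" B w] B(1) fS dw by simp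
  next
    case False
    have "d b B < deg b" using d_less[OF finU, of B z b] b B(1) S by auto
    then show ?thesis using three[of b] b B(1) False by auto
  qed
  have "wd S ?f"
  proof (rule wd_save[of a S w])
    show "?f w < ?f a" using fw fa by simp
    show "\<forall>y\<in>S - {a}. 0 \<le> ?g y" using g pos by (metis diff_ge_0_iff_ge int_one_le_iff_zero_less of_nat_0_less_iff)
    show "wd (S - {a}) ?g"
      by (rule wd_normal[OF con _ _ B(1,2,3,4) b(1) b2]) (use fS g in auto)
  qed (use a w in auto)
  moreover have "d y (U - S) \<le> 2" if y: "y \<in> S" for y
  proof -
    have "0 \<le> ?f y"
    proof (cases "y = a")
      case False
      have "0 \<le> ?g y" using g[of y] pos[of y] False y by auto
      moreover have "0 \<le> (of_bool (A y a \<and> y \<noteq> w) :: int)" by simp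
      ultimately show ?thesis by linarith
    qed (use fa in auto)
    then show ?thesis by simp
  qed
  ultimately show False using irreducible[OF S] a(1) by blast
qed

end

section \<open>Faces around a vertex\<close>

text \<open>
  From now on the faces are abstract objects, and all that is known of the topology are the
  assumptions \<open>cyc\<close> to \<open>euler\<close>.
\<close>

locale cex = mincex A U x for A :: "'a \<Rightarrow> 'a \<Rightarrow> bool" and U x +
  fixes F :: "'f set" and bd :: "'f \<Rightarrow> 'a set set"
  assumes finF: "finite F"
    and cyc: "f \<in> F \<Longrightarrow> \<exists>c. distinct c \<and> 3 \<le> length c \<and> cedges c = bd f"
    and bdE: "f \<in> F \<Longrightarrow> bd f \<subseteq> EA"
    and two: "e \<in> EA \<Longrightarrow> card {f\<in>F. e \<in> bd f} = 2"
    and rot: "X \<subseteq> {e\<in>EA. v \<in> e} \<Longrightarrow> X \<noteq> {} \<Longrightarrow> X \<noteq> {e\<in>EA. v \<in> e} \<Longrightarrow>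
        \<exists>f\<in>F. \<exists>e\<in>X. \<exists>e'\<in>EA - X. v \<in> e' \<and> e \<in> bd f \<and> e' \<in> bd f"
    and euler: "card U + card F = card EA + 2"
    and no567: "distinct xs \<Longrightarrow> cedges xs \<subseteq> EA \<Longrightarrow> length xs \<notin> {5, 6, 7}"
    and tri_far: "A a b \<Longrightarrow> A b c \<Longrightarrow> A a c \<Longrightarrow> A a' b' \<Longrightarrow> A b' c' \<Longrightarrow> A a' c' \<Longrightarrow>
        {a, b, c} \<noteq> {a', b', c'} \<Longrightarrow> u \<in> {a, b, c} \<Longrightarrow> u' \<in> {a', b', c'} \<Longrightarrow> u \<noteq> u' \<and> \<not> A u u'"
begin

text \<open>
  \<open>facial f c\<close>: the list \<open>c\<close> runs around \<open>f\<close>. \<open>angle f a v b\<close>: the edges of \<open>f\<close> at \<open>v\<close> lead to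
  \<open>a\<close> and \<open>b\<close>. \<open>other f e\<close>: the face on the other side of the edge \<open>e\<close> of \<open>f\<close>, arbitrary if \<open>e\<close>
  is not an edge of \<open>f\<close>.
\<close>

definition facial :: "'f \<Rightarrow> 'a list \<Rightarrow> bool" where
  "facial f c \<longleftrightarrow> f \<in> F \<and> distinct c \<and> 3 \<le> length c \<and> cedges c = bd f"

definition angle :: "'f \<Rightarrow> 'a \<Rightarrow> 'a \<Rightarrow> 'a \<Rightarrow> bool" where
  "angle f a v b \<longleftrightarrow> f \<in> F \<and> a \<noteq> b \<and> {a, v} \<in> bd f \<and> {v, b} \<in> bd f"

definition vs :: "'f \<Rightarrow> 'a set" where "vs f = \<Union>(bd f)"

definition len :: "'f \<Rightarrow> nat" where "len f = card (bd f)"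

definition other :: "'f \<Rightarrow> 'a set \<Rightarrow> 'f" where
  "other f e = (THE g. g \<in> F \<and> g \<noteq> f \<and> e \<in> bd g)"

lemma facial_F: "facial f c \<Longrightarrow> f \<in> F" and facial_distinct: "facial f c \<Longrightarrow> distinct c"
  and facial_bd: "facial f c \<Longrightarrow> bd f = cedges c" and facial_ge3: "facial f c \<Longrightarrow> 3 \<le> length c"
  by (auto simp: facial_def)

lemma facial_ex: "f \<in> F \<Longrightarrow> \<exists>c. facial f c"
  using cyc by (auto simp: facial_def)

lemma facial_len: "facial f c \<Longrightarrow> len f = length c"
  by (metis card_cedges facial_def len_def)

lemma facial_vs: "facial f c \<Longrightarrow> vs f = set c"
proof -
  assume c: "facial f c"
  then have "c \<noteq> []" by (auto simp: facial_def)
  then show ?thesis using Union_cedges[of c] c by (simp add: facial_def vs_def)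
qed

lemma facial_rot: "facial f (a # xs) \<Longrightarrow> facial f (xs @ [a])"
  using cedges_rotate[of "[a]" xs] by (auto simp: facial_def)

lemma facial_rev: "facial f c \<Longrightarrow> facial f (rev c)"
  by (simp add: facial_def cedges_rev)

lemma fin_vs: "f \<in> F \<Longrightarrow> finite (vs f)"
  using facial_ex facial_vs by fastforce

lemma fin_bd: "f \<in> F \<Longrightarrow> finite (bd f)"
  using facial_ex facial_bd by fastforce

lemma card_vs: "f \<in> F \<Longrightarrow> card (vs f) = len f"
  using facial_ex facial_vs facial_len facial_distinct distinct_card by metis

lemma len_ge_3: "f \<in> F \<Longrightarrow> 3 \<le> len f"
  using facial_ex facial_len facial_ge3 by metis

lemma len_small_or_large: "f \<in> F \<Longrightarrow> len f \<le> 4 \<or> 8 \<le> len f"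
proof -
  assume f: "f \<in> F"
  then obtain c where c: "facial f c" using facial_ex by blast
  then have "cedges c \<subseteq> EA" using bdE[OF f] facial_bd by auto
  then have "length c \<notin> {5, 6, 7}" using no567 c facial_distinct by blast
  then show ?thesis using facial_len[OF c] by auto
qed

lemma edge_A: "f \<in> F \<Longrightarrow> {a, b} \<in> bd f \<Longrightarrow> A a b"
  using bdE EA_iff by blast

lemma edge_vs: "{a, b} \<in> bd f \<Longrightarrow> a \<in> vs f" "{a, b} \<in> bd f \<Longrightarrow> b \<in> vs f"
  by (auto simp: vs_def)

lemma vs_U: "f \<in> F \<Longrightarrow> v \<in> vs f \<Longrightarrow> v \<in> U"
  using bdE AU AU2 unfolding vs_def EA_def by blast

lemma angleD:
  assumes "angle f a v b"
  shows "f \<in> F" "a \<noteq> b" "{a, v} \<in> bd f" "{v, b} \<in> bd f" "{v, a} \<in> bd f" "{b, v} \<in> bd f" "A a v" "A v b"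
    "A v a" "A b v" "a \<noteq> v" "v \<noteq> b" "a \<in> U" "v \<in> U" "b \<in> U" "a \<in> vs f" "v \<in> vs f" "b \<in> vs f"
proof -
  show 1: "f \<in> F" "a \<noteq> b" "{a, v} \<in> bd f" "{v, b} \<in> bd f" using assms by (auto simp: angle_def)
  then show 2: "{v, a} \<in> bd f" "{b, v} \<in> bd f" by (simp_all add: insert_commute)
  show 3: "A a v" "A v b" using edge_A 1 by blast+
  then show "A v a" "A b v" using sym by blast+
  show "a \<noteq> v" "v \<noteq> b" using 3 irr by auto
  show "a \<in> U" "v \<in> U" "b \<in> U" using 3 AU AU2 by blast+
  show "a \<in> vs f" "v \<in> vs f" "b \<in> vs f" using 1 edge_vs by auto
qed

lemma angle_sym: "angle f a v b \<Longrightarrow> angle f b v a"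
  by (auto simp: angle_def insert_commute)

lemma hd_edges:
  assumes "distinct (v # ys)" "2 \<le> length ys"
  shows "{v, y} \<in> cedges (v # ys) \<longleftrightarrow> y = hd ys \<or> y = last ys"
proof -
  have ne: "ys \<noteq> []" using assms(2) by auto
  then have *: "cedges (v # ys) = insert {last ys, v} (insert {v, hd ys} (pedges ys))"
    by (simp add: cedges_eq pedges_Cons)
  have "{v, y} \<notin> pedges ys" using pedges_subset[of "{v, y}" ys] assms(1) by auto
  then show ?thesis unfolding * by (auto simp: doubleton_eq_iff)
qed

lemma two_ends:
  assumes "2 \<le> length ys" shows "\<exists>h zs l. ys = h # zs @ [l]"
proof -
  obtain h ys' where h: "ys = h # ys'" using assms by (cases ys) auto
  then have "ys' \<noteq> []" using assms by auto
  then have "ys' = butlast ys' @ [last ys']" by simp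
  then show ?thesis using h by blast
qed

lemma vs_facial_hd:
  assumes "f \<in> F" "v \<in> vs f"
  obtains ys where "facial f (v # ys)"
proof -
  obtain c where c: "facial f c" using facial_ex assms(1) by blast
  then have "v \<in> set c" using assms facial_vs by auto
  then obtain ys where "cedges (v # ys) = cedges c" "set (v # ys) = set c" "distinct c \<longleftrightarrow> distinct (v # ys)"
    "length (v # ys) = length c"
    using rotate_to_hd by metis
  then show ?thesis using that c unfolding facial_def by metis
qed

lemma angle_facial:
  assumes "angle f a v b"
  obtains zs where "facial f (a # v # b # zs)"
proof -
  note a = angleD[OF assms]
  obtain ys where ys: "facial f (v # ys)" using vs_facial_hd[OF a(1) a(17)] by blast
  have d: "distinct (v # ys)" "2 \<le> length ys" "bd f = cedges (v # ys)"
    using facial_distinct[OF ys] facial_ge3[OF ys] facial_bd[OF ys] by auto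
  have ab: "a = hd ys \<or> a = last ys" "b = hd ys \<or> b = last ys"
    using hd_edges[OF d(1,2)] a(4,5) d(3) by auto
  obtain h zs l where zs: "ys = h # zs @ [l]"
  proof -
    show ?thesis using two_ends[OF d(2)] that by metis
  qed
  consider "a = l" "b = h" | "a = h" "b = l" using ab a(2) zs by auto
  then show ?thesis
  proof cases
    case 1
    have "facial f ([l] @ (v # h # zs))" using ys zs cedges_rotate[of "v # h # zs" "[l]"] by (auto simp: facial_def)
    then show ?thesis using that 1 by simp
  next
    case 2
    have "facial f (v # l # rev zs @ [h])" using facial_rev[OF ys] zs facial_rev[OF facial_rot[OF ys]] by simp
    then have "facial f ([h] @ (v # l # rev zs))"
      using cedges_rotate[of "v # l # rev zs" "[h]"] by (auto simp: facial_def)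
    then show ?thesis using that 2 by simp
  qed
qed

lemma angle_unique: "angle f a v b \<Longrightarrow> {v, y} \<in> bd f \<Longrightarrow> y = a \<or> y = b"
proof -
  assume a: "angle f a v b" and y: "{v, y} \<in> bd f"
  obtain zs where zs: "facial f (a # v # b # zs)" using angle_facial[OF a] by blast
  have "facial f ((v # b # zs) @ [a])" using facial_rot[OF zs] by simp
  then have *: "distinct (v # ((b # zs) @ [a]))" "bd f = cedges (v # ((b # zs) @ [a]))"
    by (auto simp: facial_def)
  then show ?thesis using hd_edges[OF *(1)] y by auto
qed

lemma vs_angle:
  assumes "f \<in> F" "v \<in> vs f" obtains a b where "angle f a v b"
proof -
  obtain ys where ys: "facial f (v # ys)" using vs_facial_hd[OF assms] by blast
  have d: "distinct (v # ys)" "2 \<le> length ys" "bd f = cedges (v # ys)"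
    using facial_distinct[OF ys] facial_ge3[OF ys] facial_bd[OF ys] by auto
  have "hd ys \<noteq> last ys" using two_ends[OF d(2)] d(1) by auto
  moreover have "{v, hd ys} \<in> bd f" "{v, last ys} \<in> bd f" using hd_edges[OF d(1,2)] d(3) by auto
  ultimately have "angle f (hd ys) v (last ys)"
    using assms(1) insert_commute[of v "hd ys" "{}"] by (simp add: angle_def)
  then show ?thesis using that by blast
qed

lemma edge_angle:
  assumes "f \<in> F" "{v, a} \<in> bd f" obtains b where "angle f a v b"
proof -
  obtain a' b' where ab: "angle f a' v b'" using vs_angle[OF assms(1)] edge_vs assms(2) by metis
  then have "a = a' \<or> a = b'" using angle_unique assms(2) by blast
  then show ?thesis using that ab angle_sym by blast
qed

lemma other:
  assumes "f \<in> F" "e \<in> bd f"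
  shows "other f e \<in> F" "other f e \<noteq> f" "e \<in> bd (other f e)" "g \<in> F \<Longrightarrow> e \<in> bd g \<Longrightarrow> g = f \<or> g = other f e"
proof -
  have "e \<in> EA" using bdE assms by auto
  then have "card {f\<in>F. e \<in> bd f} = 2" using two by blast
  then obtain f1 f2 where f12: "f1 \<noteq> f2" "{f\<in>F. e \<in> bd f} = {f1, f2}"
    unfolding card_2_iff by blast
  define g0 where "g0 = (if f = f1 then f2 else f1)"
  have "f \<in> {f1, f2}" using f12(2) assms by blast
  then have "{f1, f2} = {f, g0}" "g0 \<noteq> f" using f12(1) by (auto simp: g0_def)
  then have s: "g \<in> F \<and> e \<in> bd g \<longleftrightarrow> g = f \<or> g = g0" for g using f12(2) by (metis (lifting) insert_iff mem_Collect_eq singletonD)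
  have o: "other f e = g0" unfolding other_def
    by (rule the_equality) (use s[of g0] s \<open>g0 \<noteq> f\<close> in metis)+
  show "other f e \<in> F" "other f e \<noteq> f" "e \<in> bd (other f e)" using s[of g0] \<open>g0 \<noteq> f\<close> unfolding o by blast+
  show "g \<in> F \<Longrightarrow> e \<in> bd g \<Longrightarrow> g = f \<or> g = other f e" using s[of g] unfolding o by blast
qed

lemma other_eq: "f \<in> F \<Longrightarrow> e \<in> bd f \<Longrightarrow> g \<in> F \<Longrightarrow> e \<in> bd g \<Longrightarrow> g \<noteq> f \<Longrightarrow> other f e = g"
  using other(4) by metis

lemma other_other: "f \<in> F \<Longrightarrow> e \<in> bd f \<Longrightarrow> other (other f e) e = f"
  using other[of f e] other_eq[of "other f e" e f] by metis

section \<open>The cyclic order of faces at vertices of degree 3 and 4\<close>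

lemma edges_at: "{e\<in>EA. v \<in> e} = (\<lambda>y. {v, y}) ` {y. A v y}"
proof
  show "{e\<in>EA. v \<in> e} \<subseteq> (\<lambda>y. {v, y}) ` {y. A v y}"
    using sym unfolding EA_def by (auto simp: insert_commute)
  show "(\<lambda>y. {v, y}) ` {y. A v y} \<subseteq> {e\<in>EA. v \<in> e}" by (auto simp: EA_iff)
qed

lemma deg_eq: "deg v = card {y. A v y}"
proof -
  have "{y \<in> U. A v y} = {y. A v y}" using AU2 by auto
  then show ?thesis by (simp add: d_def)
qed

lemma fin_nbrs: "finite {y. A v y}"
  using AU2 finU by (metis finite_subset mem_Collect_eq subsetI)

lemma rot_nbrs:
  assumes "N \<subseteq> {y. A v y}" "N \<noteq> {}" "N \<noteq> {y. A v y}"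
  obtains f a b where "angle f a v b" "a \<in> N" "b \<notin> N"
proof -
  let ?X = "(\<lambda>y. {v, y}) ` N"
  have inj: "inj (\<lambda>y. {v, y})" by (rule injI) (auto simp: doubleton_eq_iff)
  have X: "?X \<subseteq> {e\<in>EA. v \<in> e}" "?X \<noteq> {}" "?X \<noteq> {e\<in>EA. v \<in> e}"
    using assms unfolding edges_at inj_image_eq_iff[OF inj] by (simp_all add: image_mono)
  obtain f e e' where f: "f \<in> F" "e \<in> ?X" "e' \<in> EA - ?X" "v \<in> e'" "e \<in> bd f" "e' \<in> bd f"
    using rot[OF X] by blast
  then obtain a where a: "e = {v, a}" "a \<in> N" by auto
  have "e' \<in> {e\<in>EA. v \<in> e}" using f by auto
  then obtain b where b: "e' = {v, b}" "A v b" unfolding edges_at by auto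
  then have "b \<notin> N" using f by auto
  then have "angle f a v b" using f a b by (auto simp: angle_def insert_commute)
  then show ?thesis using that a \<open>b \<notin> N\<close> by blast
qed

text \<open>Two faces with the same angle use up both sides of both edges. No face leads from these
  edges to another one at \<open>v\<close>, so by \<open>rot\<close> there is no other.\<close>

lemma two_edges:
  assumes "angle f a v b" "angle g a v b" "f \<noteq> g"
  shows "deg v = 2"
proof -
  note fa = angleD[OF assms(1)] and ga = angleD[OF assms(2)]
  have sub: "{a, b} \<subseteq> {y. A v y}" using fa by auto
  have "{a, b} = {y. A v y}"
  proof (rule ccontr)
    assume "{a, b} \<noteq> {y. A v y}"
    then obtain h y z where h: "angle h y v z" "y \<in> {a, b}" "z \<notin> {a, b}" using rot_nbrs[OF sub] by blast
    note ha = angleD[OF h(1)]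
    have o: "other f {v, a} = g" "other f {v, b} = g"
      using other_eq[OF fa(1) fa(5) ga(1) ga(5)] other_eq[OF fa(1) fa(4) ga(1) ga(4)] assms(3) by simp_all
    consider "y = a" | "y = b" using h(2) by blast
    then have "h = f \<or> h = g"
    proof cases
      case 1 then show ?thesis using other(4)[OF fa(1) fa(5) ha(1)] ha(5) o by simp
    next
      case 2 then show ?thesis using other(4)[OF fa(1) fa(4) ha(1)] ha(5) o by simp
    qed
    then have "z = a \<or> z = b" using angle_unique[OF assms(1), of z] angle_unique[OF assms(2), of z] ha(4) by blast
    then show False using h(3) by blast
  qed
  then show ?thesis unfolding deg_eq using fa(2) by (metis card_2_iff)
qed

lemma third_nbr:
  assumes "deg v = 3" "A v a" "A v b" "a \<noteq> b"
  obtains c where "{y. A v y} = {a, b, c}" "c \<noteq> a" "c \<noteq> b"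
proof -
  have "card ({y. A v y} - {a, b}) = 1" using assms deg_eq fin_nbrs by (simp add: card_Diff_subset)
  then obtain c where "{y. A v y} - {a, b} = {c}" by (metis card_1_singletonE)
  then show ?thesis using that[of c] assms by auto
qed

lemma other_two_nbrs:
  assumes "deg v = 4" "A v a" "A v b" "a \<noteq> b"
  obtains c e where "{y. A v y} = {a, b, c, e}" "c \<noteq> a" "c \<noteq> b" "e \<noteq> a" "e \<noteq> b" "c \<noteq> e"
proof -
  have "card ({y. A v y} - {a, b}) = 2" using assms deg_eq fin_nbrs by (simp add: card_Diff_subset)
  then obtain c e where "{y. A v y} - {a, b} = {c, e}" "c \<noteq> e" by (metis card_2_iff)
  then show ?thesis using that[of c e] assms by auto
qed

text \<open>The faces beyond the two edges of the angle cannot turn back to the other edge, by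
  \<open>two_edges\<close>; so both continue with the third edge and are the two faces at
  it.\<close>

lemma three_struct:
  assumes "deg v = 3" "angle f a v b"
  obtains c where "{y. A v y} = {a, b, c}" "c \<noteq> a" "c \<noteq> b"
    "angle (other f {v, b}) b v c" "angle (other f {v, a}) a v c" "other f {v, a} \<noteq> other f {v, b}"
    "other (other f {v, b}) {v, c} = other f {v, a}" "other (other f {v, a}) {v, c} = other f {v, b}"
    "\<And>g. g \<in> F \<Longrightarrow> v \<in> vs g \<Longrightarrow> g = f \<or> g = other f {v, a} \<or> g = other f {v, b}"
proof -
  note fa = angleD[OF assms(2)]
  obtain c where c: "{y. A v y} = {a, b, c}" "c \<noteq> a" "c \<noteq> b" using third_nbr[OF assms(1) fa(9,8,2)] by blast
  let ?g = "other f {v, b}" and ?h = "other f {v, a}"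
  note g = other[OF fa(1) fa(4)] and h = other[OF fa(1) fa(5)]
  have ag: "angle ?g b v c"
  proof -
    obtain y where y: "angle ?g b v y" using edge_angle[OF g(1) g(3)] by blast
    then have "y \<in> {a, b, c}" "y \<noteq> b" using angleD[OF y] c by auto
    moreover have "y \<noteq> a" using two_edges[OF angle_sym[OF assms(2)], of ?g] y g(2) assms(1) by auto
    ultimately show ?thesis using y by auto
  qed
  have ah: "angle ?h a v c"
  proof -
    obtain y where y: "angle ?h a v y" using edge_angle[OF h(1) h(3)] by blast
    then have "y \<in> {a, b, c}" "y \<noteq> a" using angleD[OF y] c by auto
    moreover have "y \<noteq> b" using two_edges[OF assms(2), of ?h] y h(2) assms(1) by auto
    ultimately show ?thesis using y by auto
  qed
  have gh: "?h \<noteq> ?g"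
  proof
    assume "?h = ?g"
    then have "a = b \<or> a = c" using angle_unique[OF ag, of a] h(3) by auto
    then show False using c fa by auto
  qed
  have o1: "other ?g {v, c} = ?h" "other ?h {v, c} = ?g"
    using other_eq[OF g(1) angleD(4)[OF ag] h(1) angleD(4)[OF ah] gh]
      other_eq[OF h(1) angleD(4)[OF ah] g(1) angleD(4)[OF ag] gh[symmetric]] by auto
  have all: "k = f \<or> k = ?h \<or> k = ?g" if k: "k \<in> F" "v \<in> vs k" for k
  proof -
    obtain y z where yz: "angle k y v z" using vs_angle[OF k] by blast
    note ka = angleD[OF yz]
    have "y \<in> {a, b, c}" using ka c by auto
    then consider "y = a" | "y = b" | "y = c" by auto
    then show ?thesis
    proof cases
      case 1 then show ?thesis using h(4)[OF k(1)] ka by auto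
    next
      case 2 then show ?thesis using g(4)[OF k(1)] ka by auto
    next
      case 3 then show ?thesis using other(4)[OF g(1) angleD(4)[OF ag] k(1)] ka o1 by auto
    qed
  qed
  show ?thesis by (rule that[OF c ag ah gh o1 all])
qed

lemma four_struct:
  assumes "deg v = 4" "angle f a v b"
  obtains c e k where "{y. A v y} = {a, b, c, e}" "c \<noteq> a" "c \<noteq> b" "e \<noteq> a" "e \<noteq> b" "c \<noteq> e"
    "angle (other f {v, b}) b v c" "angle (other f {v, a}) a v e" "angle k c v e"
    "other f {v, a} \<noteq> other f {v, b}" "k \<noteq> f" "k \<noteq> other f {v, a}" "k \<noteq> other f {v, b}"
    "other (other f {v, b}) {v, c} = k" "other (other f {v, a}) {v, e} = k"
    "\<And>g. g \<in> F \<Longrightarrow> v \<in> vs g \<Longrightarrow> g = f \<or> g = other f {v, a} \<or> g = other f {v, b} \<or> g = k"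
proof -
  note fa = angleD[OF assms(2)]
  let ?g = "other f {v, b}" and ?h = "other f {v, a}"
  note g = other[OF fa(1) fa(4)] and h = other[OF fa(1) fa(5)]
  obtain c where ag: "angle ?g b v c" using edge_angle[OF g(1) g(3)] by blast
  obtain e where ah: "angle ?h a v e" using edge_angle[OF h(1) h(3)] by blast
  note ga = angleD[OF ag] and ha = angleD[OF ah]
  have ca: "c \<noteq> a" using two_edges[OF angle_sym[OF assms(2)], of ?g] ag g(2) assms(1) by auto
  have eb: "e \<noteq> b" using two_edges[OF assms(2), of ?h] ah h(2) assms(1) by auto
  obtain y z where yz: "{y. A v y} = {a, b, y, z}" "y \<noteq> a" "y \<noteq> b" "z \<noteq> a" "z \<noteq> b" "y \<noteq> z"
    using other_two_nbrs[OF assms(1) fa(9,8,2)] by blast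
  have gh: "?h \<noteq> ?g"
  proof
    assume "?h = ?g"
    then have "a = b \<or> a = c" using angle_unique[OF ag, of a] h(3) by auto
    then show False using ca fa by auto
  qed
  \<comment> \<open>If both neighbouring faces ended at the same edge, the edges to
    \<open>a\<close>, \<open>b\<close> and \<open>c\<close> would be closed under common faces,
    which \<open>rot\<close> forbids as there is a fourth edge.\<close>
  have ce: "c \<noteq> e"
  proof
    assume ce: "c = e"
    have "{a, b, c} \<subseteq> {y. A v y}" "{a, b, c} \<noteq> {y. A v y}" "{a, b, c} \<noteq> {}"
      using fa ga ha yz by auto
    then obtain k p q where k: "angle k p v q" "p \<in> {a, b, c}" "q \<notin> {a, b, c}" using rot_nbrs by metis
    note ka = angleD[OF k(1)]
    have "other ?g {v, c} = ?h" using other_eq[OF g(1) ga(4) h(1) _ gh] ha(4) ce by auto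
    moreover consider "p = a" | "p = b" | "p = c" using k(2) by blast
    then have "k = f \<or> k = ?g \<or> k = ?h \<or> k = other ?g {v, c}"
    proof cases
      case 1 then show ?thesis using h(4)[OF ka(1)] ka(5) by blast
    next
      case 2 then show ?thesis using g(4)[OF ka(1)] ka(5) by blast
    next
      case 3 then show ?thesis using other(4)[OF g(1) ga(4) ka(1)] ka(5) by blast
    qed
    ultimately have "k = f \<or> k = ?g \<or> k = ?h" by simp
    then have "q = a \<or> q = b \<or> q = c \<or> q = e"
      using angle_unique[OF ag, of q] angle_unique[OF ah, of q] angle_unique[OF assms(2), of q] ka(4) by blast
    then show False using k(3) ce by blast
  qed
  have N: "{y. A v y} = {a, b, c, e}" 
  proof -
    have "c \<in> {a, b, y, z}" "e \<in> {a, b, y, z}" unfolding yz(1)[symmetric] using ga(8) ha(8) by simp_all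
    then have "(c = y \<and> e = z) \<or> (c = z \<and> e = y)" using ca eb ce ga(2) ha(2) by blast
    then show ?thesis unfolding yz(1) by blast
  qed
  let ?k = "other ?g {v, c}"
  note k = other[OF g(1) ga(4)]
  have kf: "?k \<noteq> f" using angle_unique[OF assms(2), of c] k(3) ca ga(2) by auto
  have kh: "?k \<noteq> ?h" using angle_unique[OF ah, of c] k(3) ca ce by auto
  have ak: "angle ?k c v e"
  proof -
    obtain y where y: "angle ?k c v y" using edge_angle[OF k(1) k(3)] by blast
    note ya = angleD[OF y]
    have "y \<in> {a, b, c, e}" unfolding N[symmetric] using ya(8) by simp
    moreover have "y \<noteq> c" using ya(2) by simp
    moreover have "y \<noteq> b" using two_edges[OF ag, of ?k] angle_sym[OF y] k(2) assms(1) by auto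
    moreover have "y \<noteq> a" using h(4)[OF k(1)] ya(4) kf kh by auto
    ultimately show ?thesis using y by blast
  qed
  have o2: "other ?h {v, e} = ?k" using other_eq[OF h(1) ha(4) k(1) angleD(4)[OF ak] kh] .
  have all: "q = f \<or> q = ?h \<or> q = ?g \<or> q = ?k" if q: "q \<in> F" "v \<in> vs q" for q
  proof -
    obtain y z where yz: "angle q y v z" using vs_angle[OF q] by blast
    note qa = angleD[OF yz]
    have "y \<in> {a, b, c, e}" unfolding N[symmetric] using qa(9) by simp
    then consider "y = a" | "y = b" | "y = c" | "y = e" by auto
    then show ?thesis
    proof cases
      case 1 then show ?thesis using h(4)[OF q(1)] qa by auto
    next
      case 2 then show ?thesis using g(4)[OF q(1)] qa by auto
    next
      case 3 then show ?thesis using k(4)[OF q(1)] qa by auto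
    next
      case 4 then show ?thesis using other(4)[OF h(1) ha(4) q(1)] qa o2 by auto
    qed
  qed
  show ?thesis
    by (rule that[OF N ca _ _ eb ce ag ah ak gh kf kh k(2) refl o2 all]) (use ga ha in auto)
qed

text \<open>
  Two small faces can share an edge only at a vertex \<open>x\<close> of degree 2, hence the exceptional
  vertices. \<open>T_edge\<close> marks the edges over which \<open>f\<close> has to pay 2 to a triangle. A deficient face
  does not pay for its triangles at all, a demanding one asks its 4-vertices for help, and a short one cannot
  help a triangle with a deficient neighbour.
\<close>

definition small :: "'f \<Rightarrow> bool" where "small f \<longleftrightarrow> len f \<le> 4"
definition exceptional :: "'a \<Rightarrow> bool" where "exceptional v \<longleftrightarrow> v \<noteq> x \<and> A v x \<and> deg x = 2"
definition three :: "'a \<Rightarrow> bool" where "three v \<longleftrightarrow> v \<in> U \<and> v \<noteq> x \<and> \<not> exceptional v \<and> deg v = 3"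
definition four :: "'a \<Rightarrow> bool" where "four v \<longleftrightarrow> v \<in> U \<and> v \<noteq> x \<and> \<not> exceptional v \<and> deg v = 4"
definition big :: "'a \<Rightarrow> bool" where "big v \<longleftrightarrow> v \<in> U \<and> \<not> three v"
definition free :: "'a \<Rightarrow> bool" where "free v \<longleftrightarrow> v \<in> U \<and> v \<noteq> x \<and> \<not> three v \<and> \<not> four v"
definition rich :: "'a \<Rightarrow> bool" where "rich v \<longleftrightarrow> three v \<and> (\<forall>f\<in>F. v \<in> vs f \<longrightarrow> \<not> small f)"
definition num_big :: "'f \<Rightarrow> nat" where "num_big f = card {v \<in> vs f. big v}"
definition num_rich :: "'f \<Rightarrow> nat" where "num_rich f = card {v \<in> vs f. rich v}"
definition T_edge :: "'f \<Rightarrow> 'a set \<Rightarrow> bool" where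
  "T_edge f e \<longleftrightarrow> f \<in> F \<and> e \<in> bd f \<and> len (other f e) = 3 \<and> x \<notin> vs (other f e)"
definition num_T :: "'f \<Rightarrow> nat" where "num_T f = card {e. T_edge f e}"
definition num_small_at :: "'a \<Rightarrow> 'f \<Rightarrow> nat" where "num_small_at v f = card {e \<in> bd f. v \<in> e \<and> small (other f e)}"
text \<open>After serving its eight 3-vertices such a face has one unit left per rich vertex, while
  each triangle asks for 2.\<close>

definition deficient :: "'f \<Rightarrow> bool" where "deficient f \<longleftrightarrow> len f = 8 \<and> num_big f = 0 \<and> num_rich f < 2 * num_T f"
text \<open>The two triangles ask for 4, but a single big vertex of degree 4 contributes only 3, so
  one unit is missing.\<close>

definition demanding :: "'f \<Rightarrow> bool" where "demanding f \<longleftrightarrow> len f = 8 \<and> num_big f = 1 \<and> num_T f = 2 \<and> num_rich f = 0"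
text \<open>Even with one rich vertex such a face has nothing to spare: 3 from a 4-vertex and 1 from
  the rich vertex are just the 4 for its triangles.\<close>

definition short :: "'f \<Rightarrow> bool" where "short f \<longleftrightarrow> len f = 8 \<and> num_big f = 1 \<and> num_T f = 2 \<and> num_rich f \<le> 1"
definition in_triangle :: "'a \<Rightarrow> bool" where "in_triangle v \<longleftrightarrow> (\<exists>T\<in>F. len T = 3 \<and> v \<in> vs T)"

lemma not_small: "f \<in> F \<Longrightarrow> \<not> small f \<longleftrightarrow> 8 \<le> len f"
  using len_small_or_large[of f] by (auto simp: small_def)

lemma threeD: "three v \<Longrightarrow> v \<in> U \<and> v \<noteq> x \<and> \<not> exceptional v \<and> deg v = 3"
  by (simp add: three_def)

lemma fourD: "four v \<Longrightarrow> v \<in> U \<and> v \<noteq> x \<and> \<not> exceptional v \<and> deg v = 4"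
  by (simp add: four_def)

lemma rich_three: "rich v \<Longrightarrow> three v" by (simp add: rich_def)

lemma three_not_four: "three v \<Longrightarrow> \<not> four v" by (simp add: three_def four_def)

lemma no_5_cycle: "A a b \<Longrightarrow> A b c \<Longrightarrow> A c p \<Longrightarrow> A p q \<Longrightarrow> A q a \<Longrightarrow> distinct [a,b,c,p,q] \<Longrightarrow> False"
  using no567[of "[a,b,c,p,q]"] by (simp add: cedges_def EA_iff)

lemma no_6_cycle: "A a b \<Longrightarrow> A b c \<Longrightarrow> A c p \<Longrightarrow> A p q \<Longrightarrow> A q r \<Longrightarrow> A r a \<Longrightarrow> distinct [a,b,c,p,q,r] \<Longrightarrow> False"
  using no567[of "[a,b,c,p,q,r]"] by (simp add: cedges_def EA_iff)

lemma no_7_cycle: "A a b \<Longrightarrow> A b c \<Longrightarrow> A c p \<Longrightarrow> A p q \<Longrightarrow> A q r \<Longrightarrow> A r s \<Longrightarrow> A s a \<Longrightarrow> distinct [a,b,c,p,q,r,s] \<Longrightarrow> False"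
  using no567[of "[a,b,c,p,q,r,s]"] by (simp add: cedges_def EA_iff)

lemma tri_share: "A a b \<Longrightarrow> A b c \<Longrightarrow> A a c \<Longrightarrow> A a b' \<Longrightarrow> A b' c' \<Longrightarrow> A a c' \<Longrightarrow> {a, b, c} = {a, b', c'}"
  using tri_far[of a b c a b' c' a a] by auto

lemma edge_facial:
  assumes "f \<in> F" "{a, b} \<in> bd f" obtains zs where "facial f (a # b # zs)"
proof -
  obtain z where z: "angle f b a z" using edge_angle[OF assms] by blast
  obtain zs where "facial f (z # a # b # zs)" using angle_facial[OF angle_sym[OF z]] by blast
  then show ?thesis using facial_rot[of f z "a # b # zs"] that by simp
qed

lemma facial3:
  assumes "facial f [a,b,c]"
  shows "angle f c a b \<and> angle f a b c \<and> angle f b c a \<and> distinct [a,b,c] \<and> vs f = {a,b,c} \<and> len f = 3"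
proof -
  have s: "f \<in> F" "distinct [a,b,c]" using assms by (simp_all add: facial_def)
  have b: "bd f = {{a,b},{b,c},{c,a}}"
    using facial_bd[OF assms] by (simp add: cedges_def)
  have "vs f = {a,b,c}" "len f = 3" using facial_vs[OF assms] facial_len[OF assms] by simp_all
  moreover have "angle f c a b" "angle f a b c" "angle f b c a" unfolding angle_def b using s by auto
  ultimately show ?thesis using s by simp
qed

lemma facial4:
  assumes "facial f [a,b,c,p]"
  shows "angle f p a b \<and> angle f a b c \<and> angle f b c p \<and> angle f c p a \<and> distinct [a,b,c,p]
    \<and> vs f = {a,b,c,p} \<and> len f = 4"
proof -
  have s: "f \<in> F" "distinct [a,b,c,p]" using assms by (simp_all add: facial_def)
  have b: "bd f = {{a,b},{b,c},{c,p},{p,a}}"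
    using facial_bd[OF assms] by (simp add: cedges_def)
  have "vs f = {a,b,c,p}" "len f = 4" using facial_vs[OF assms] facial_len[OF assms] by simp_all
  moreover have "angle f p a b" "angle f a b c" "angle f b c p" "angle f c p a" unfolding angle_def b using s by auto
  ultimately show ?thesis using s by simp
qed

lemma facial3_adj:
  assumes "facial f [a,b,c]" shows "A a b" "A b c" "A a c" "A b a" "A c b" "A c a" "f \<in> F"
proof -
  have 1: "angle f a b c" and 2: "angle f b c a" using facial3[OF assms] by simp_all
  show "A a b" "A b c" "A a c" "A b a" "A c b" "A c a" "f \<in> F"
    using angleD[OF 1] angleD[OF 2] by simp_all
qed

lemma facial4_adj:
  assumes "facial f [a,b,c,p]"
  shows "A a b" "A b c" "A c p" "A p a" "A b a" "A c b" "A p c" "A a p" "f \<in> F"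
proof -
  have 1: "angle f a b c" and 2: "angle f c p a" using facial4[OF assms] by simp_all
  show "A a b" "A b c" "A c p" "A p a" "A b a" "A c b" "A p c" "A a p" "f \<in> F"
    using angleD[OF 1] angleD[OF 2] by simp_all
qed

lemma facial8:
  assumes "facial f [a0,a1,a2,a3,a4,a5,a6,a7]"
  shows "angle f a7 a0 a1" "angle f a0 a1 a2" "angle f a1 a2 a3" "angle f a2 a3 a4" "angle f a3 a4 a5" "angle f a4 a5 a6"
    "angle f a5 a6 a7" "angle f a6 a7 a0" "distinct [a0,a1,a2,a3,a4,a5,a6,a7]"
    "vs f = {a0,a1,a2,a3,a4,a5,a6,a7}" "len f = 8"
    "bd f = {{a0,a1},{a1,a2},{a2,a3},{a3,a4},{a4,a5},{a5,a6},{a6,a7},{a7,a0}}"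
proof -
  have s: "f \<in> F" "distinct [a0,a1,a2,a3,a4,a5,a6,a7]" using assms by (auto simp: facial_def)
  show b: "bd f = {{a0,a1},{a1,a2},{a2,a3},{a3,a4},{a4,a5},{a5,a6},{a6,a7},{a7,a0}}"
    using facial_bd[OF assms] by (simp add: cedges_def)
  show "distinct [a0,a1,a2,a3,a4,a5,a6,a7]" by fact
  show "vs f = {a0,a1,a2,a3,a4,a5,a6,a7}" "len f = 8" using facial_vs[OF assms] facial_len[OF assms] by simp_all
  show "angle f a7 a0 a1" "angle f a0 a1 a2" "angle f a1 a2 a3" "angle f a2 a3 a4" "angle f a3 a4 a5" "angle f a4 a5 a6"
    "angle f a5 a6 a7" "angle f a6 a7 a0"
    unfolding angle_def b using s by auto
qed

lemma len3: "length zs = 1 \<Longrightarrow> \<exists>c. zs = [c]" by (cases zs) auto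
lemma len4: "length zs = 2 \<Longrightarrow> \<exists>c p. zs = [c, p]" by (cases zs; cases "tl zs") auto

text \<open>Two triangles with a common vertex coincide by the distance condition. A triangle and a
  4-face on a common edge give a 5-cycle or two such triangles, two 4-faces give a 6-cycle or have a
  further vertex in common. Where the faces share two edges at a vertex, this vertex has degree 2
  and hence is \<open>x\<close>.\<close>

lemma small_adj:
  assumes f: "f \<in> F" "{a, b} \<in> bd f" "small f" and g: "g \<in> F" "{a, b} \<in> bd g" "small g" and ne: "f \<noteq> g"
  shows "(a = x \<or> b = x) \<and> deg x = 2"
proof -
  have deg2: "v = x \<and> deg x = 2" if "angle f p v q" "angle g p v q" for p v q
  proof -
    have d: "deg v = 2" using two_edges[OF that ne] .
    have "v \<in> U" using angleD(14)[OF that(1)] .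
    then have "v = x" using deg_ge_3[of v] d by force
    then show ?thesis using d by simp
  qed
  obtain zs where zs: "facial f (a # b # zs)" using edge_facial[OF f(1,2)] by blast
  obtain ws where ws: "facial g (a # b # ws)" using edge_facial[OF g(1,2)] by blast
  have lz: "length zs = 1 \<or> length zs = 2" using facial_len[OF zs] facial_ge3[OF zs] f(3) by (auto simp: small_def)
  have lw: "length ws = 1 \<or> length ws = 2" using facial_len[OF ws] facial_ge3[OF ws] g(3) by (auto simp: small_def)
  have t4: False if t: "facial h [a, b, c]" and q: "facial k [a, b, c', p]" for h k c c' p
  proof -
    have ta: "A a b" "A b c" "A a c" "A b a" using facial3_adj[OF t] by simp_all
    have qa: "A b c'" "A c' p" "A a p" "A p a" "A c a" "A c b" using facial3_adj[OF t] facial4_adj[OF q] by simp_all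
    have d: "distinct [a, b, c]" "distinct [a, b, c', p]" using facial3[OF t] facial4[OF q] by auto
    show False
    proof (cases "c = c' \<or> c = p")
      case True
      then show False
      proof
        assume c: "c = c'"
        have "{a, b, c} = {a, c, p}" using tri_share[of a b c c p] ta qa c by auto
        then show False using d c by auto
      next
        assume c: "c = p"
        have "{b, a, c} = {b, c', c}" using tri_share[of b a c c' c] ta qa c by auto
        then show False using d c by auto
      qed
    next
      case False
      then show False using no_5_cycle[of a c b c' p] ta qa d by auto
    qed
  qed
  show ?thesis
  proof (cases "length zs = 1")
    case z1: True
    then obtain c where c: "facial f [a, b, c]" using zs len3 by blast
    note fc = facial3[OF c]
    show ?thesis
    proof (cases "length ws = 1")
      case True
      then obtain c' where c': "facial g [a, b, c']" using ws len3 by blast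
      note gc = facial3[OF c']
      have "{a, b, c} = {a, b, c'}"
        by (rule tri_share) (use facial3_adj[OF c] facial3_adj[OF c'] in simp_all)
      then have kept: "c' = c" using fc gc by auto
      have "b = x" using deg2[of a b c] fc gc kept by auto
      moreover have "a = x" using deg2[of c a b] fc gc kept by auto
      ultimately show ?thesis using fc by auto
    next
      case False
      then obtain c' p where "facial g [a, b, c', p]" using ws lw len4 by metis
      then show ?thesis using t4 c by blast
    qed
  next
    case False
    then obtain c p where c: "facial f [a, b, c, p]" using zs lz len4 by metis
    note fc = facial4[OF c]
    show ?thesis
    proof (cases "length ws = 1")
      case True
      then obtain c' where "facial g [a, b, c']" using ws len3 by blast
      then show ?thesis using t4 c by blast
    next
      case False
      then obtain c' p' where c': "facial g [a, b, c', p']" using ws lw len4 by metis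
      note gc = facial4[OF c']
      have fa: "A a b" "A b c" "A c p" "A p a" and ga: "A b c'" "A c' p'" "A p' a"
        and fs: "A b a" "A c b" "A p c" "A a p" "A c' b" "A p' c'" "A a p'"
        using facial4_adj[OF c] facial4_adj[OF c'] by simp_all
      consider "c = c'" | "p = p'" | "c = p'" | "p = c'" | "distinct [a, p, c, b, c', p']" using fc gc by auto
      then show ?thesis
      proof cases
        case 1 then show ?thesis using deg2[of a b c] fc gc by auto
      next
        case 2 then show ?thesis using deg2[of p a b] fc gc by auto
      next
        case 3
        have "{a, b, c} = {a, c, p}" using tri_share[of a b c c p] fa ga fs 3 by auto
        then show ?thesis using fc by auto
      next
        case 4
        have "{b, a, p} = {b, p, c}" using tri_share[of b a p p c] fa ga fs 4 by auto
        then show ?thesis using fc by auto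
      next
        case 5
        then show ?thesis using no_6_cycle[of a p c b c' p'] fa ga fs by auto
      qed
    qed
  qed
qed

lemma no_two_small:
  assumes "v \<noteq> x" "\<not> exceptional v" "f \<in> F" "{v, y} \<in> bd f" "g \<in> F" "{v, y} \<in> bd g" "f \<noteq> g" "small f"
  shows "\<not> small g"
proof
  assume "small g"
  then have "(v = x \<or> y = x) \<and> deg x = 2" using small_adj[of f v y g] assms by blast
  moreover have "A v y" using edge_A assms by blast
  ultimately show False using assms by (auto simp: exceptional_def)
qed

lemma num_small_at_angle:
  assumes "angle f a v b"
  shows "num_small_at v f = of_bool (small (other f {v, a})) + of_bool (small (other f {v, b}))"
proof -
  note fa = angleD[OF assms]
  have "{e \<in> bd f. v \<in> e} = {{v, a}, {v, b}}"
  proof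
    show "{e \<in> bd f. v \<in> e} \<subseteq> {{v, a}, {v, b}}"
    proof
      fix e assume e: "e \<in> {e \<in> bd f. v \<in> e}"
      then have "e \<in> {e\<in>EA. v \<in> e}" using bdE[OF fa(1)] by auto
      then obtain y where y: "e = {v, y}" unfolding edges_at by auto
      then have "y = a \<or> y = b" using angle_unique[OF assms] e by auto
      then show "e \<in> {{v, a}, {v, b}}" using y by auto
    qed
  qed (use fa in auto)
  then have "{e \<in> bd f. v \<in> e \<and> small (other f e)} = {e \<in> {{v, a}, {v, b}}. small (other f e)}" by blast
  also have "\<dots> = (if small (other f {v, a}) then {{v, a}} else {}) \<union> (if small (other f {v, b}) then {{v, b}} else {})"
    by auto
  finally have *: "num_small_at v f = card \<dots>" unfolding num_small_at_def by simp
  have "{v, a} \<noteq> {v, b}" using fa(2) by (auto simp: doubleton_eq_iff)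
  then show ?thesis unfolding * by simp
qed

text \<open>The two faces beyond share the third edge at \<open>v\<close>, so they cannot both be
  small.\<close>

lemma three_edges:
  assumes "three v" "angle f a v b"
  shows "\<not> (small (other f {v, a}) \<and> small (other f {v, b}))"
proof -
  note v = threeD[OF assms(1)]
  obtain c where c: "angle (other f {v, b}) b v c" "angle (other f {v, a}) a v c" "other f {v, a} \<noteq> other f {v, b}"
    using three_struct[OF _ assms(2)] v by metis
  show ?thesis
    using no_two_small[of v "other f {v, a}" c "other f {v, b}"] v c angleD(1,4) by metis
qed

lemma rich_iff:
  assumes "three v" "angle f a v b" "\<not> small f"
  shows "rich v \<longleftrightarrow> \<not> small (other f {v, a}) \<and> \<not> small (other f {v, b})"
proof -
  note v = threeD[OF assms(1)]
  note fa = angleD[OF assms(2)]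
  have all: "\<And>g. g \<in> F \<Longrightarrow> v \<in> vs g \<Longrightarrow> g = f \<or> g = other f {v, a} \<or> g = other f {v, b}"
    using three_struct[OF _ assms(2)] v by metis
  have "v \<in> vs (other f {v, a})" "v \<in> vs (other f {v, b})"
    using other(3)[OF fa(1) fa(5)] other(3)[OF fa(1) fa(4)] by (auto simp: vs_def)
  then show ?thesis
    unfolding rich_def using all assms(1,3) other(1)[OF fa(1) fa(5)] other(1)[OF fa(1) fa(4)] by blast
qed

lemma three_num_small_at:
  assumes "three v" "v \<in> vs f" "f \<in> F" "\<not> small f"
  shows "num_small_at v f = of_bool (\<not> rich v)"
proof -
  obtain a b where ab: "angle f a v b" using vs_angle assms by blast
  show ?thesis using num_small_at_angle[OF ab] rich_iff[OF assms(1) ab assms(4)] three_edges[OF assms(1) ab] by auto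
qed

lemma sum_num_small_at: "f \<in> F \<Longrightarrow> (\<Sum>v\<in>vs f. num_small_at v f) = 2 * card {e \<in> bd f. small (other f e)}"
proof -
  assume f: "f \<in> F"
  let ?S = "{e \<in> bd f. small (other f e)}"
  have fin: "finite ?S" "finite (vs f)" using fin_bd[OF f] fin_vs[OF f] by auto
  have "(\<Sum>v\<in>vs f. num_small_at v f) = (\<Sum>v\<in>vs f. \<Sum>e\<in>?S. of_bool (v \<in> e))"
  proof (rule sum.cong[OF refl])
    fix v
    have "{e \<in> bd f. v \<in> e \<and> small (other f e)} = ?S \<inter> {e. v \<in> e}" by auto
    then show "num_small_at v f = (\<Sum>e\<in>?S. of_bool (v \<in> e))" unfolding num_small_at_def using fin by (simp add: sum_of_bool_eq)
  qed
  also have "\<dots> = (\<Sum>e\<in>?S. \<Sum>v\<in>vs f. of_bool (v \<in> e))" by (rule sum.swap)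
  also have "\<dots> = (\<Sum>e\<in>?S. 2)"
  proof (rule sum.cong[OF refl])
    fix e assume e: "e \<in> ?S"
    then have "e \<in> EA" using bdE[OF f] by auto
    then obtain a b where ab: "e = {a, b}" "A a b" by (auto simp: EA_def)
    have "vs f \<inter> {v. v \<in> e} = {a, b}" using e ab by (auto simp: vs_def)
    moreover have "a \<noteq> b" using ab irr by auto
    ultimately show "(\<Sum>v\<in>vs f. of_bool (v \<in> e)) = (2::nat)" using fin by (simp add: sum_of_bool_eq)
  qed
  finally show ?thesis by simp
qed

lemma vs_split: "f \<in> F \<Longrightarrow> vs f = {v \<in> vs f. big v} \<union> {v \<in> vs f. three v}"
  using vs_U by (auto simp: big_def)

text \<open>Each edge of \<open>f\<close> next to a small face is counted at both its ends, so the
  counts \<open>num_small_at\<close> have an even sum; a 3-vertex contributes 1 exactly if it is not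
  rich. This often provides one more rich vertex than the direct argument.\<close>

lemma parity:
  assumes f: "f \<in> F" "\<not> small f"
  shows "even (len f + num_big f + num_rich f + (\<Sum>v\<in>{v \<in> vs f. big v}. num_small_at v f))"
proof -
  let ?B = "{v \<in> vs f. big v}" and ?T = "{v \<in> vs f. three v}"
  have fin: "finite ?B" "finite ?T" using fin_vs[OF f(1)] by auto
  have dj: "?B \<inter> ?T = {}" by (auto simp: big_def)
  have "(\<Sum>v\<in>?B. num_small_at v f) + (\<Sum>v\<in>?T. num_small_at v f) = (\<Sum>v\<in>vs f. num_small_at v f)"
    using sum.union_disjoint[OF fin dj, of "\<lambda>v. num_small_at v f"] vs_split[OF f(1)] by simp
  then have 1: "even ((\<Sum>v\<in>?B. num_small_at v f) + (\<Sum>v\<in>?T. num_small_at v f))" unfolding sum_num_small_at[OF f(1)] by simp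
  have 2: "(\<Sum>v\<in>?T. num_small_at v f) = (\<Sum>v\<in>?T. of_bool (\<not> rich v))"
    by (rule sum.cong) (use three_num_small_at f in auto)
  have "?T \<inter> {v. rich v} = {v \<in> vs f. rich v}" using rich_three by auto
  then have 3: "(\<Sum>v\<in>?T. of_bool (rich v)) = num_rich f" using fin by (simp add: sum_of_bool_eq num_rich_def)
  have "(\<Sum>v\<in>?T. of_bool (\<not> rich v)) + (\<Sum>v\<in>?T. of_bool (rich v)) = (\<Sum>v\<in>?T. (1::nat))"
    unfolding sum.distrib[symmetric] by (rule sum.cong) auto
  then have 4: "(\<Sum>v\<in>?T. num_small_at v f) + num_rich f = card ?T" using 2 3 by simp
  have "card ?B + card ?T = len f"
    using card_Un_disjoint[OF fin dj] vs_split[OF f(1)] card_vs[OF f(1)] by simp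
  then have "len f = num_big f + (\<Sum>v\<in>?T. num_small_at v f) + num_rich f" using 4 by (simp add: num_big_def)
  then show ?thesis using 1 by presburger
qed

section \<open>Triangular faces along a larger face\<close>

lemma tri_vertices:
  assumes "T \<in> F" "len T = 3" "{a, b} \<in> bd T"
  obtains c where "facial T [a, b, c]"
proof -
  obtain zs where zs: "facial T (a # b # zs)" using edge_facial[OF assms(1,3)] by blast
  then have "length zs = 1" using facial_len[OF zs] assms by simp
  then show ?thesis using that zs len3 by blast
qed

lemma tri_adj:
  assumes "T \<in> F" "len T = 3" "a \<in> vs T" "b \<in> vs T" "a \<noteq> b"
  shows "A a b" "{a, b} \<in> bd T"
proof -
  obtain y z where yz: "angle T y a z" using vs_angle[OF assms(1,3)] by blast
  then obtain c where c: "facial T [y, a, c]" using tri_vertices[OF assms(1,2) angleD(3)[OF yz]] by blast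
  note t = facial3[OF c]
  have "b = y \<or> b = c" using t assms by auto
  then show "{a, b} \<in> bd T" using t angleD[of T y a c] by auto
  then show "A a b" using edge_A assms by blast
qed

text \<open>Distinct triangular faces have distinct vertex sets, so the distance condition applies.\<close>

lemma tri_faces_far:
  assumes "T \<in> F" "len T = 3" "T' \<in> F" "len T' = 3" "T \<noteq> T'" "u \<in> vs T" "u' \<in> vs T'"
  shows "u \<noteq> u'" "\<not> A u u'"
proof -
  obtain y z where yz: "angle T y u z" using vs_angle[OF assms(1,6)] by blast
  then obtain c where c: "facial T [y, u, c]" using tri_vertices[OF assms(1,2) angleD(3)[OF yz]] by blast
  obtain y' z' where yz': "angle T' y' u' z'" using vs_angle[OF assms(3,7)] by blast
  then obtain c' where c': "facial T' [y', u', c']" using tri_vertices[OF assms(3,4) angleD(3)[OF yz']] by blast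
  note t = facial3[OF c] and t' = facial3[OF c']
  have tA: "A y u" "A u c" "A y c" and tA': "A y' u'" "A u' c'" "A y' c'"
    using facial3_adj[OF c] facial3_adj[OF c'] by simp_all
  have "vs T \<noteq> vs T'"
  proof
    assume eq: "vs T = vs T'"
    have e: "{p, q} \<in> bd T" "{p, q} \<in> bd T'" if "p \<in> vs T" "q \<in> vs T" "p \<noteq> q" for p q
      using tri_adj(2) assms that eq by blast+
    have "deg p = 2" if "p \<in> vs T" "q \<in> vs T" "s \<in> vs T" "distinct [p, q, s]" for p q s
    proof (rule two_edges)
      show "angle T q p s" "angle T' q p s" using e that assms by (auto simp: angle_def)
    qed (use assms in auto)
    then have "deg y = 2" "deg u = 2" using t by auto
    then show False using deg_ge_3[of y] deg_ge_3[of u] t vs_U[OF assms(1)] by fastforce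
  qed
  then have "{y, u, c} \<noteq> {y', u', c'}" using t t' by auto
  then have "u \<noteq> u' \<and> \<not> A u u'"
    by (rule tri_far[OF tA tA']) auto
  then show "u \<noteq> u'" "\<not> A u u'" by auto
qed

lemma T_edgeD:
  assumes "T_edge f e" shows "f \<in> F" "e \<in> bd f" "other f e \<in> F" "len (other f e) = 3" "x \<notin> vs (other f e)" "e \<in> bd (other f e)"
    "other f e \<noteq> f" "small (other f e)" "e \<subseteq> vs (other f e)"
  using assms other[of f e] by (auto simp: T_edge_def small_def vs_def)

text \<open>If the same triangle were behind both edges, they would form an angle of two faces, at a
  vertex of degree 2. That vertex would be \<open>x\<close>, which \<open>T_edge\<close> excludes.
  So the triangles differ and are far apart.\<close>

lemma T_edge_far:
  assumes "T_edge f e" "T_edge f e'" "e \<noteq> e'" "p \<in> e" "q \<in> e'"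
  shows "p \<noteq> q" "\<not> A p q"
proof -
  note t = T_edgeD[OF assms(1)] and t' = T_edgeD[OF assms(2)]
  have "other f e \<noteq> other f e'"
  proof
    assume eq: "other f e = other f e'"
    have "e \<in> EA" "e' \<in> EA" using t t' bdE by auto
    then obtain a b a' b' where eq': "e = {a, b}" "A a b" "e' = {a', b'}" "A a' b'" unfolding EA_def by blast
    then have ab: "e = {a, b}" "a \<noteq> b" "e' = {a', b'}" "a' \<noteq> b'" using irr by blast+
    have sub: "e \<subseteq> vs (other f e)" "e' \<subseteq> vs (other f e)" using t t' eq by auto
    have "card (vs (other f e)) = 3" using card_vs t by simp
    moreover have "finite (vs (other f e))" using fin_vs t by auto
    ultimately have "e \<inter> e' \<noteq> {}"
      using sub ab card_mono[of "vs (other f e)" "e \<union> e'"] card_Un_disjoint[of e e'] by auto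
    then obtain v y y' where v: "e = {y, v}" "e' = {v, y'}" "y \<noteq> y'"
      using ab assms(3) by (auto simp: insert_commute)
    have a1: "angle f y v y'" "angle (other f e) y v y'" using v t t' eq by (auto simp: angle_def)
    have "deg v = 2" by (rule two_edges[OF a1 t(7)[symmetric]])
    then have "v = x" using deg_ge_3[of v] angleD(14)[OF a1(1)] by force
    then show False using t(5) v sub by auto
  qed
  then show "p \<noteq> q" "\<not> A p q" using tri_faces_far[of "other f e" "other f e'" p q] t t' assms(4,5) by auto
qed

lemma finite_T_edge: "finite {e. T_edge f e}"
proof (cases "f \<in> F")
  case True
  then show ?thesis using finite_subset[of "{e. T_edge f e}" "bd f"] fin_bd by (auto simp: T_edge_def)
qed (simp add: T_edge_def)

text \<open>To each edge with a triangle belong three edges of \<open>f\<close>: itself and its two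
  neighbours. By \<open>T_edge_far\<close> these triples are disjoint.\<close>

lemma num_T_bound:
  assumes "f \<in> F" "\<not> small f"
  shows "3 * num_T f \<le> len f"
proof -
  define N where "N e = {e' \<in> bd f. e' \<inter> e \<noteq> {}}" for e
  have l8: "8 \<le> len f" using not_small assms by auto
  have cN: "card (N e) = 3" if e: "T_edge f e" for e
  proof -
    note t = T_edgeD[OF e]
    have "e \<in> EA" using bdE t by auto
    then obtain a b where ab: "e = {a, b}" by (auto simp: EA_def)
    obtain zs where zs: "facial f (a # b # zs)" using edge_facial[of f a b] t ab by auto
    have "6 \<le> length zs" using facial_len[OF zs] l8 by simp
    then obtain c ws l where ws: "zs = c # ws @ [l]" using two_ends[of zs] by fastforce
    have d: "distinct (a # b # c # ws @ [l])" using facial_distinct[OF zs] ws by simp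
    have bf: "bd f = insert {l, a} (insert {a, b} (insert {b, c} (pedges (c # ws @ [l]))))"
      using facial_bd[OF zs] ws by (simp add: cedges_eq)
    have "{a, b} \<inter> e' = {}" if "e' \<in> pedges (c # ws @ [l])" for e' using pedges_subset[OF that] d by auto
    then have "N e = {{l, a}, {a, b}, {b, c}}" unfolding N_def bf ab by blast
    moreover have "{l, a} \<noteq> {a, b}" "{l, a} \<noteq> {b, c}" "{a, b} \<noteq> {b, c}" using d by (auto simp: doubleton_eq_iff)
    ultimately show ?thesis by simp
  qed
  have dj: "N e \<inter> N e' = {}" if e: "T_edge f e" "T_edge f e'" "e \<noteq> e'" for e e'
  proof (rule ccontr)
    assume "N e \<inter> N e' \<noteq> {}"
    then obtain e0 where e0: "e0 \<in> bd f" "e0 \<inter> e \<noteq> {}" "e0 \<inter> e' \<noteq> {}" by (auto simp: N_def)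
    then obtain p q where pq: "p \<in> e0" "p \<in> e" "q \<in> e0" "q \<in> e'" by auto
    have "p \<noteq> q" "\<not> A p q" using T_edge_far[OF e pq(2,4)] by auto
    moreover have "e0 \<in> EA" using e0 bdE assms by auto
    ultimately show False using pq sym by (auto simp: EA_def)
  qed
  have "card (\<Union>e\<in>{e. T_edge f e}. N e) = (\<Sum>e\<in>{e. T_edge f e}. card (N e))"
    by (rule card_UN_disjoint) (use finite_T_edge fin_bd[OF assms(1)] dj in \<open>auto simp: N_def\<close>)
  also have "\<dots> = 3 * num_T f" using cN by (simp add: num_T_def)
  finally have "3 * num_T f = card (\<Union>e\<in>{e. T_edge f e}. N e)" by simp
  also have "\<dots> \<le> card (bd f)" by (rule card_mono) (use fin_bd[OF assms(1)] in \<open>auto simp: N_def\<close>)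
  finally show ?thesis by (simp add: len_def)
qed

text \<open>
  Charge moved across a 4-vertex \<open>v\<close>, seen from the face \<open>f\<close>. If \<open>v\<close> is on a triangle, the face
  opposite to it gives 1 to each of the two faces between. Otherwise a demanding face at \<open>v\<close> takes 1 from
  the face on the other side of the small face at \<open>v\<close>; if this one is demanding as well, the
  face opposite to the small face gives 1 to each of them.
\<close>

definition num_demanding :: "'a \<Rightarrow> nat" where "num_demanding v = card {f \<in> F. v \<in> vs f \<and> num_small_at v f = 1 \<and> demanding f}"

definition exchange :: "'a \<Rightarrow> 'f \<Rightarrow> int" where
  "exchange v f = (if in_triangle v then (if num_small_at v f = 1 then 1 else if num_small_at v f = 0 then -2 else 0)
     else if num_small_at v f = 1 then (if demanding f then 1 else - of_bool (num_demanding v = 1))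
     else if num_small_at v f = 0 then - 2 * of_bool (num_demanding v = 2) else 0)"

text \<open>
  A large face has the charge \<open>3 (len f - 8)\<close> plus 3 for each of its vertices, and \<open>kept v f\<close> is what
  remains of the latter: \<open>f\<close> gives 2 to a rich vertex and 3 to any other 3-vertex, and receives 6
  from \<open>x\<close> and 1 from a free vertex.
\<close>

definition kept :: "'a \<Rightarrow> 'f \<Rightarrow> int" where
  "kept v f = (if v = x then 9 else if three v then of_bool (rich v) else if four v then 3 + exchange v f else 4)"

section \<open>Double counting and the total charge\<close>

lemma faces_at:
  assumes "v \<in> U" shows "card {f \<in> F. v \<in> vs f} = deg v"
proof -
  let ?E = "{e \<in> EA. v \<in> e}" and ?F = "{f \<in> F. v \<in> vs f}"
  have inj: "inj (\<lambda>y. {v, y})" by (rule injI) (auto simp: doubleton_eq_iff)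
  have E: "finite ?E" "card ?E = deg v"
    unfolding edges_at deg_eq using fin_nbrs card_image[OF inj_on_subset[OF inj]] by auto
  have 1: "(\<Sum>e\<in>?E. of_bool (e \<in> bd f)) = (2::nat)" if f: "f \<in> ?F" for f
  proof -
    obtain a b where ab: "angle f a v b" using vs_angle f by blast
    note fa = angleD[OF ab]
    have "?E \<inter> {e. e \<in> bd f} = {{v, a}, {v, b}}"
    proof
      show "?E \<inter> {e. e \<in> bd f} \<subseteq> {{v, a}, {v, b}}"
      proof
        fix e assume e: "e \<in> ?E \<inter> {e. e \<in> bd f}"
        then have "e \<in> {e\<in>EA. v \<in> e}" by blast
        then obtain y where y: "e = {v, y}" unfolding edges_at by auto
        then have "y = a \<or> y = b" using angle_unique[OF ab] e by auto
        then show "e \<in> {{v, a}, {v, b}}" using y by auto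
      qed
      show "{{v, a}, {v, b}} \<subseteq> ?E \<inter> {e. e \<in> bd f}" using fa by (auto simp: EA_iff)
    qed
    moreover have "{v, a} \<noteq> {v, b}" using fa(2) by (auto simp: doubleton_eq_iff)
    ultimately show ?thesis using E by (simp add: sum_of_bool_eq)
  qed
  have 2: "(\<Sum>f\<in>?F. of_bool (e \<in> bd f)) = (2::nat)" if e: "e \<in> ?E" for e
  proof -
    have "?F \<inter> {f. e \<in> bd f} = {f \<in> F. e \<in> bd f}" using e by (auto simp: vs_def)
    then show ?thesis using two[of e] e finF by (simp add: sum_of_bool_eq)
  qed
  have "2 * card ?F = (\<Sum>f\<in>?F. \<Sum>e\<in>?E. of_bool (e \<in> bd f))" using 1 by simp
  also have "\<dots> = (\<Sum>e\<in>?E. \<Sum>f\<in>?F. of_bool (e \<in> bd f))" by (rule sum.swap)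
  also have "\<dots> = 2 * deg v" using 2 E by simp
  finally show ?thesis by simp
qed

lemma sum_deg: "(\<Sum>v\<in>U. deg v) = 2 * card EA"
proof -
  have fE: "finite EA"
    by (rule finite_subset[of _ "Pow U"]) (use AU AU2 finU in \<open>auto simp: EA_def\<close>)
  have "(\<Sum>v\<in>U. deg v) = (\<Sum>v\<in>U. \<Sum>e\<in>EA. of_bool (v \<in> e))"
  proof (rule sum.cong[OF refl])
    fix v :: 'a
    have inj: "inj (\<lambda>y. {v, y})" by (rule injI) (auto simp: doubleton_eq_iff)
    have "card {e\<in>EA. v \<in> e} = deg v"
      unfolding edges_at deg_eq using card_image[OF inj_on_subset[OF inj]] by auto
    moreover have "EA \<inter> {e. v \<in> e} = {e\<in>EA. v \<in> e}" by auto
    ultimately show "deg v = (\<Sum>e\<in>EA. of_bool (v \<in> e))" using fE by (simp add: sum_of_bool_eq)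
  qed
  also have "\<dots> = (\<Sum>e\<in>EA. \<Sum>v\<in>U. of_bool (v \<in> e))" by (rule sum.swap)
  also have "\<dots> = (\<Sum>e\<in>EA. 2)"
  proof (rule sum.cong[OF refl])
    fix e assume "e \<in> EA"
    then obtain a b where ab: "e = {a, b}" "A a b" by (auto simp: EA_def)
    have "U \<inter> {v. v \<in> e} = {a, b}" using ab AU AU2 by auto
    moreover have "a \<noteq> b" using ab irr by auto
    ultimately show "(\<Sum>v\<in>U. of_bool (v \<in> e)) = (2::nat)" using finU by (simp add: sum_of_bool_eq)
  qed
  finally show ?thesis by simp
qed

lemma sum_len: "(\<Sum>f\<in>F. len f) = 2 * card EA"
proof -
  have fE: "finite EA"
    by (rule finite_subset[of _ "Pow U"]) (use AU AU2 finU in \<open>auto simp: EA_def\<close>)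
  have "(\<Sum>f\<in>F. len f) = (\<Sum>f\<in>F. \<Sum>e\<in>EA. of_bool (e \<in> bd f))"
  proof (rule sum.cong[OF refl])
    fix f assume "f \<in> F"
    then have "EA \<inter> {e. e \<in> bd f} = bd f" using bdE by auto
    then show "len f = (\<Sum>e\<in>EA. of_bool (e \<in> bd f))" using fE by (simp add: sum_of_bool_eq len_def)
  qed
  also have "\<dots> = (\<Sum>e\<in>EA. \<Sum>f\<in>F. of_bool (e \<in> bd f))" by (rule sum.swap)
  also have "\<dots> = (\<Sum>e\<in>EA. 2)"
  proof (rule sum.cong[OF refl])
    fix e assume e: "e \<in> EA"
    have "F \<inter> {f. e \<in> bd f} = {f \<in> F. e \<in> bd f}" by auto
    then show "(\<Sum>f\<in>F. of_bool (e \<in> bd f)) = (2::nat)" using two[OF e] finF by (simp add: sum_of_bool_eq)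
  qed
  finally show ?thesis by simp
qed

lemma total_charge: "(\<Sum>v\<in>U. 6 * (int (deg v) - 4)) + (\<Sum>f\<in>F. 6 * (int (len f) - 4)) = -48"
proof -
  have "(\<Sum>v\<in>U. 6 * (int (deg v) - 4)) = 6 * int (\<Sum>v\<in>U. deg v) - 24 * int (card U)"
    by (simp add: sum_subtractf sum_distrib_left right_diff_distrib)
  moreover have "(\<Sum>f\<in>F. 6 * (int (len f) - 4)) = 6 * int (\<Sum>f\<in>F. len f) - 24 * int (card F)"
    by (simp add: sum_subtractf sum_distrib_left right_diff_distrib)
  ultimately show ?thesis using euler unfolding sum_deg sum_len by linarith
qed

text \<open>A 4-vertex has initial charge 0 and only passes charge on: what the faces at it receive
  is what others at it give.\<close>

lemma four_exchange:
  assumes "four v"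
  shows "(\<Sum>f\<in>{f \<in> F. v \<in> vs f \<and> \<not> small f}. exchange v f) \<le> 0"
proof -
  note v = fourD[OF assms]
  have "{f \<in> F. v \<in> vs f} \<noteq> {}" using faces_at[of v] v by (metis card.empty zero_neq_numeral)
  then obtain f0 where f0: "f0 \<in> F" "v \<in> vs f0" by blast
  \<comment> \<open>Start at a small face if there is one. Its neighbours are then large, and only
    the face \<open>k\<close> opposite to it is in doubt: if \<open>k\<close> is small as well,
    nothing moves.\<close>
  obtain f where f: "f \<in> F" "v \<in> vs f" "small f \<or> (\<forall>g\<in>F. v \<in> vs g \<longrightarrow> \<not> small g)"
    using f0 by blast
  obtain a b where ab: "angle f a v b" using vs_angle f by blast
  note fa = angleD[OF ab]
  have d4: "deg v = 4" using v by simp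
  obtain p q k where N: "angle (other f {v, b}) b v p" "angle (other f {v, a}) a v q" "angle k p v q"
    "other f {v, a} \<noteq> other f {v, b}" "k \<noteq> f" "k \<noteq> other f {v, a}" "k \<noteq> other f {v, b}"
    "other (other f {v, b}) {v, p} = k" "other (other f {v, a}) {v, q} = k"
    "\<And>g. g \<in> F \<Longrightarrow> v \<in> vs g \<Longrightarrow> g = f \<or> g = other f {v, a} \<or> g = other f {v, b} \<or> g = k"
    by (rule four_struct[OF d4 ab]) (rule that)
  define g h where "g = other f {v, b}" and "h = other f {v, a}"
  note N = N[folded g_def h_def]
  note ga = angleD[OF N(1)] and ha = angleD[OF N(2)] and ka = angleD[OF N(3)]
  have gf: "g \<noteq> f" "h \<noteq> f" using other(2)[OF fa(1) fa(4)] other(2)[OF fa(1) fa(5)] by (simp_all add: g_def h_def)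
  have og: "other g {v, b} = f" "other h {v, a} = f"
    using other_other[OF fa(1) fa(4)] other_other[OF fa(1) fa(5)] by (simp_all add: g_def h_def)
  have ok: "other k {v, p} = g" "other k {v, q} = h"
    using other_other[OF ga(1) ga(4)] other_other[OF ha(1) ha(4)] N(8,9) by simp_all
  have set: "{f' \<in> F. v \<in> vs f'} = {f, g, h, k}" using N(10) fa ga ha ka by auto
  have n: "num_small_at v f = of_bool (small h) + of_bool (small g)" "num_small_at v g = of_bool (small f) + of_bool (small k)"
    "num_small_at v h = of_bool (small f) + of_bool (small k)" "num_small_at v k = of_bool (small g) + of_bool (small h)"
    using num_small_at_angle[OF ab] num_small_at_angle[OF N(1)] num_small_at_angle[OF N(2)] num_small_at_angle[OF N(3)] og ok N(8,9)
    unfolding g_def[symmetric] h_def[symmetric] by simp_all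
  have d: "distinct [f, g, h, k]" using gf N(4-7) by auto
  show ?thesis
  proof (cases "small f")
    case False
    then have ns: "\<not> small g'" if "g' \<in> F" "v \<in> vs g'" for g' using f(3) that by blast
    have n0: "num_small_at v f = 0" "num_small_at v g = 0" "num_small_at v h = 0" "num_small_at v k = 0"
      using n False ns[OF ga(1) ga(17)] ns[OF ha(1) ha(17)] ns[OF ka(1) ka(17)] by simp_all
    have "num_small_at v g' = 0" if "g' \<in> F" "v \<in> vs g'" for g'
    proof -
      have "g' \<in> {f, g, h, k}" unfolding set[symmetric] using that by simp
      then show ?thesis using n0 by blast
    qed
    moreover have nt: "\<not> in_triangle v" using ns by (fastforce simp: in_triangle_def small_def)
    moreover have "num_demanding v = 0"
    proof -
      have "{f \<in> F. v \<in> vs f \<and> num_small_at v f = 1 \<and> demanding f} = {}" using calculation(1) by auto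
      then show ?thesis unfolding num_demanding_def by (simp only: card.empty)
    qed
    ultimately have "exchange v g' = 0" if "g' \<in> F" "v \<in> vs g'" for g' using that by (simp add: exchange_def)
    then show ?thesis by simp
  next
    case True
    have s: "\<not> small g" "\<not> small h"
      using no_two_small[of v f b g] no_two_small[of v f a h] v fa ga ha gf True by auto
    show ?thesis
    proof (cases "small k")
      case k: True
      have "{f \<in> F. v \<in> vs f \<and> \<not> small f} = {g, h}" using set s True k by auto
      then show ?thesis using d n True s k by (simp add: exchange_def)
    next
      case False
      have l: "{f \<in> F. v \<in> vs f \<and> \<not> small f} = {g, h, k}" using set s True False by auto
      have nn: "num_small_at v g = 1" "num_small_at v h = 1" "num_small_at v k = 0" "num_small_at v f = 0" using n True s False by simp_all
      have "{f \<in> F. v \<in> vs f \<and> num_small_at v f = 1 \<and> demanding f} = {f' \<in> {f, g, h, k}. num_small_at v f' = 1 \<and> demanding f'}" using set by blast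
      also have "\<dots> = (if demanding g then {g} else {}) \<union> (if demanding h then {h} else {})" using nn by auto
      finally have "num_demanding v = of_bool (demanding g) + of_bool (demanding h)" unfolding num_demanding_def using d by (auto simp: card_insert_if)
      then show ?thesis unfolding l using d nn by (simp add: exchange_def)
    qed
  qed
qed

text \<open>A 3-vertex starts with -6. It gets 2 from each of three large faces if it is rich, and
  otherwise 3 from at least two.\<close>

lemma three_large:
  assumes "three v"
  shows "int (card {f \<in> F. v \<in> vs f \<and> \<not> small f}) * (3 - of_bool (rich v)) \<ge> 6"
proof -
  note v = threeD[OF assms]
  let ?S = "{f \<in> F. v \<in> vs f \<and> small f}" and ?L = "{f \<in> F. v \<in> vs f \<and> \<not> small f}"
  have "card (?L \<union> ?S) = card ?L + card ?S" by (rule card_Un_disjoint) (use finF in auto)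
  moreover have "?L \<union> ?S = {f \<in> F. v \<in> vs f}" by auto
  ultimately have c: "card ?L + card ?S = 3" using faces_at v by simp
  show ?thesis
  proof (cases "rich v")
    case True
    then have "?S = {}" by (auto simp: rich_def)
    then have "card ?L = 3" using c by (simp only: card.empty)
    then show ?thesis using True by simp
  next
    case False
    have "f = g" if "f \<in> ?S" "g \<in> ?S" for f g
    proof (rule ccontr)
      assume ne: "f \<noteq> g"
      have "f \<in> F" "v \<in> vs f" using that(1) by simp_all
      then obtain a b where ab: "angle f a v b" using vs_angle by blast
      have "g = other f {v, a} \<or> g = other f {v, b}" using three_struct[OF _ ab] v that ne by (metis (no_types, lifting) mem_Collect_eq)
      then show False using no_two_small[of v f a g] no_two_small[of v f b g] v that ne angleD[OF ab] other(3) by auto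
    qed
    then have "card ?S \<le> 1" using finF by (auto simp: card_le_Suc0_iff_eq)
    then show ?thesis using c False by simp
  qed
qed

text \<open>The bookkeeping is separated from the choice of donors, which enters only through
  \<open>attributed\<close> and \<open>root\<close>. The first assumption says that large faces can
  pay, the second that triangles without \<open>x\<close> are served, the third that the 2 units of
  each root triangle are covered by the units taken from donors.\<close>

lemma accounting:
  fixes attributed :: "'f \<Rightarrow> 'a \<Rightarrow> bool" and root :: "'f \<Rightarrow> bool"
  assumes LG: "\<And>f. f \<in> F \<Longrightarrow> \<not> small f \<Longrightarrow>
      2 * (if deficient f then 0 else int (num_T f)) \<le> 3 * (int (len f) - 8) + (\<Sum>v\<in>vs f. kept v f - of_bool (attributed f v))"
    and TF: "\<And>T. T \<in> F \<Longrightarrow> len T = 3 \<Longrightarrow> x \<notin> vs T \<Longrightarrow>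
      6 \<le> (\<Sum>e\<in>bd T. 2 * of_bool (\<not> deficient (other T e))) + 2 * int (card {v \<in> vs T. free v}) + 2 * of_bool (root T)"
    and RT: "2 * card {T \<in> F. len T = 3 \<and> x \<notin> vs T \<and> root T} \<le> card {(f, v). f \<in> F \<and> \<not> small f \<and> v \<in> vs f \<and> attributed f v}"
  shows False
proof -
  let ?L = "{f \<in> F. \<not> small f}" and ?T = "{T \<in> F. len T = 3 \<and> x \<notin> vs T}" and ?X = "{T \<in> F. len T = 3 \<and> x \<in> vs T}"
    and ?Q = "{T \<in> F. len T = 4}"
  have fin: "finite ?L" "finite ?T" "finite ?X" "finite ?Q" using finF by auto
  have F: "F = ?L \<union> (?T \<union> (?X \<union> ?Q))" using len_ge_3 by (force simp: small_def)
  have sF: "(\<Sum>f\<in>F. 6 * (int (len f) - 4)) = (\<Sum>f\<in>?L. 6 * (int (len f) - 4)) - 6 * int (card ?T) - 6 * int (card ?X)"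
  proof -
    have "(\<Sum>f\<in>F. 6 * (int (len f) - 4)) = (\<Sum>f\<in>?L. 6 * (int (len f) - 4)) + (\<Sum>f\<in>?T \<union> (?X \<union> ?Q). 6 * (int (len f) - 4))"
      by (subst F, rule sum.union_disjoint) (use fin in \<open>auto simp: small_def\<close>)
    also have "(\<Sum>f\<in>?T \<union> (?X \<union> ?Q). 6 * (int (len f) - 4)) = (\<Sum>f\<in>?T. 6 * (int (len f) - 4)) + (\<Sum>f\<in>?X \<union> ?Q. 6 * (int (len f) - 4))"
      by (rule sum.union_disjoint) (use fin in auto)
    also have "(\<Sum>f\<in>?X \<union> ?Q. 6 * (int (len f) - 4)) = (\<Sum>f\<in>?X. 6 * (int (len f) - 4)) + (\<Sum>f\<in>?Q. 6 * (int (len f) - 4))"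
      by (rule sum.union_disjoint) (use fin in auto)
    finally show ?thesis by simp
  qed
  define k' where "k' f = (if deficient f then 0 else int (num_T f))" for f
  have "(\<Sum>f\<in>?L. 6 * (int (len f) - 4)) \<ge> (\<Sum>f\<in>?L. 2 * k' f + (\<Sum>v\<in>vs f. 3 - kept v f) + (\<Sum>v\<in>vs f. of_bool (attributed f v)))"
  proof (rule sum_mono)
    fix f assume f: "f \<in> ?L"
    have "(\<Sum>v\<in>vs f. 3 - kept v f) + (\<Sum>v\<in>vs f. of_bool (attributed f v)) = 3 * int (len f) - (\<Sum>v\<in>vs f. kept v f - of_bool (attributed f v))"
      using card_vs f by (simp add: sum_subtractf)
    then show "2 * k' f + (\<Sum>v\<in>vs f. 3 - kept v f) + (\<Sum>v\<in>vs f. of_bool (attributed f v)) \<le> 6 * (int (len f) - 4)"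
      using LG[of f] f by (simp add: k'_def)
  qed
  also have "(\<Sum>f\<in>?L. 2 * k' f + (\<Sum>v\<in>vs f. 3 - kept v f) + (\<Sum>v\<in>vs f. of_bool (attributed f v)))
      = 2 * (\<Sum>f\<in>?L. k' f) + (\<Sum>f\<in>?L. \<Sum>v\<in>vs f. 3 - kept v f) + (\<Sum>f\<in>?L. \<Sum>v\<in>vs f. of_bool (attributed f v))"
    by (simp add: sum.distrib sum_distrib_left)
  finally have s1: "(\<Sum>f\<in>?L. 6 * (int (len f) - 4)) \<ge>
      2 * (\<Sum>f\<in>?L. k' f) + (\<Sum>f\<in>?L. \<Sum>v\<in>vs f. 3 - kept v f) + (\<Sum>f\<in>?L. \<Sum>v\<in>vs f. of_bool (attributed f v))" .
  have "(\<Sum>f\<in>?L. \<Sum>v\<in>vs f. of_bool (attributed f v)) = (\<Sum>f\<in>?L. int (card {v \<in> vs f. attributed f v}))"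
  proof (rule sum.cong[OF refl])
    fix f assume "f \<in> ?L"
    then have "finite (vs f)" using fin_vs by blast
    moreover have "vs f \<inter> {v. attributed f v} = {v \<in> vs f. attributed f v}" by auto
    ultimately show "(\<Sum>v\<in>vs f. of_bool (attributed f v)) = int (card {v \<in> vs f. attributed f v})" by (simp add: sum_of_bool_eq)
  qed
  also have "\<dots> = int (card (SIGMA f:?L. {v \<in> vs f. attributed f v}))"
    by (subst card_SigmaI) (use finF fin_vs in auto)
  also have "(SIGMA f:?L. {v \<in> vs f. attributed f v}) = {(f, v). f \<in> F \<and> \<not> small f \<and> v \<in> vs f \<and> attributed f v}" by auto
  finally have s2: "(\<Sum>f\<in>?L. \<Sum>v\<in>vs f. of_bool (attributed f v)) \<ge> 2 * int (card {T \<in> F. len T = 3 \<and> x \<notin> vs T \<and> root T})"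
    using RT by linarith
  have s3: "(\<Sum>f\<in>?L. k' f) = (\<Sum>T\<in>?T. \<Sum>e\<in>bd T. of_bool (\<not> deficient (other T e)))"
  proof -
    let ?P = "SIGMA f:{f \<in> ?L. \<not> deficient f}. {e. T_edge f e}" and ?R = "SIGMA T:?T. {e \<in> bd T. \<not> deficient (other T e)}"
    have "(\<Sum>f\<in>?L. k' f) = (\<Sum>f\<in>{f \<in> ?L. \<not> deficient f}. k' f)"
      by (rule sum.mono_neutral_right) (use fin in \<open>auto simp: k'_def\<close>)
    also have "\<dots> = (\<Sum>f\<in>{f \<in> ?L. \<not> deficient f}. int (card {e. T_edge f e}))"
      by (rule sum.cong) (auto simp: k'_def num_T_def)
    also have "\<dots> = int (card ?P)"
      by (subst card_SigmaI) (use finF finite_T_edge in auto)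
    also have "card ?P = card ?R"
    \<comment> \<open>Crossing an edge turns a pair of paying face and edge into a pair of triangle
      and edge, and crossing it again inverts this.\<close>
    proof (rule bij_betw_same_card)
      show "bij_betw (\<lambda>(f, e). (other f e, e)) ?P ?R"
      proof (rule bij_betw_byWitness[where f' = "\<lambda>(f, e). (other f e, e)"])
        show "(\<lambda>(f, e). (other f e, e)) ` ?P \<subseteq> ?R"
        proof (rule image_subsetI)
          fix z assume "z \<in> ?P"
          then obtain f e where z: "z = (f, e)" "f \<in> F" "\<not> deficient f" "T_edge f e" by auto
          note t = T_edgeD[OF z(4)]
          have "other (other f e) e = f" using other_other t by blast
          then show "(\<lambda>(f, e). (other f e, e)) z \<in> ?R" using z t by auto
        qed
        show "(\<lambda>(f, e). (other f e, e)) ` ?R \<subseteq> ?P"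
        proof (rule image_subsetI)
          fix z assume "z \<in> ?R"
          then obtain T e where z: "z = (T, e)" "T \<in> F" "len T = 3" "x \<notin> vs T" "e \<in> bd T" "\<not> deficient (other T e)" by auto
          have o: "other (other T e) e = T" "other T e \<in> F" "e \<in> bd (other T e)" "other T e \<noteq> T"
            using other_other other z by blast+
          have "e \<in> EA" using bdE z by blast
          then obtain a b where ab: "e = {a, b}" by (auto simp: EA_def)
          have "a \<noteq> x" "b \<noteq> x" using z ab by (auto simp: vs_def)
          then have "\<not> small (other T e)"
            using small_adj[of T a b "other T e"] o z ab by (auto simp: small_def)
          then show "(\<lambda>(f, e). (other f e, e)) z \<in> ?P" using z o by (auto simp: T_edge_def)
        qed
        show "\<forall>z\<in>?P. (\<lambda>(f, e). (other f e, e)) ((\<lambda>(f, e). (other f e, e)) z) = z"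
          using other_other T_edgeD by auto
        show "\<forall>z\<in>?R. (\<lambda>(f, e). (other f e, e)) ((\<lambda>(f, e). (other f e, e)) z) = z"
          using other_other by auto
      qed
    qed
    also have "int (card ?R) = (\<Sum>T\<in>?T. int (card {e \<in> bd T. \<not> deficient (other T e)}))"
      by (subst card_SigmaI) (use finF fin_bd in auto)
    also have "\<dots> = (\<Sum>T\<in>?T. \<Sum>e\<in>bd T. of_bool (\<not> deficient (other T e)))"
    proof (rule sum.cong[OF refl])
      fix T assume "T \<in> ?T"
      then have "finite (bd T)" using fin_bd by blast
      moreover have "bd T \<inter> {e. \<not> deficient (other T e)} = {e \<in> bd T. \<not> deficient (other T e)}" by auto
      ultimately show "int (card {e \<in> bd T. \<not> deficient (other T e)}) = (\<Sum>e\<in>bd T. of_bool (\<not> deficient (other T e)))"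
        by (simp add: sum_of_bool_eq)
    qed
    finally show ?thesis .
  qed
  have "(\<Sum>T\<in>?T. 6) \<le> (\<Sum>T\<in>?T. (\<Sum>e\<in>bd T. 2 * of_bool (\<not> deficient (other T e))) + 2 * int (card {v \<in> vs T. free v}) + 2 * of_bool (root T))"
    by (rule sum_mono) (use TF in auto)
  also have "\<dots> = 2 * (\<Sum>T\<in>?T. \<Sum>e\<in>bd T. of_bool (\<not> deficient (other T e))) + 2 * (\<Sum>T\<in>?T. int (card {v \<in> vs T. free v})) + 2 * (\<Sum>T\<in>?T. of_bool (root T))"
    by (simp add: sum.distrib sum_distrib_left)
  also have "(\<Sum>T\<in>?T. of_bool (root T)) = int (card {T \<in> F. len T = 3 \<and> x \<notin> vs T \<and> root T})"
  proof -
    have "?T \<inter> {T. root T} = {T \<in> F. len T = 3 \<and> x \<notin> vs T \<and> root T}" by auto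
    then show ?thesis using fin by (simp add: sum_of_bool_eq)
  qed
  finally have s4: "6 * int (card ?T) \<le> 2 * (\<Sum>T\<in>?T. \<Sum>e\<in>bd T. of_bool (\<not> deficient (other T e)))
     + 2 * (\<Sum>T\<in>?T. int (card {v \<in> vs T. free v})) + 2 * int (card {T \<in> F. len T = 3 \<and> x \<notin> vs T \<and> root T})" by simp
  have vsU: "vs f = {v \<in> U. v \<in> vs f}" if "f \<in> F" for f using vs_U[OF that] by auto
  have s5: "(\<Sum>f\<in>?L. \<Sum>v\<in>vs f. 3 - kept v f) = (\<Sum>v\<in>U. \<Sum>f\<in>{f \<in> F. v \<in> vs f \<and> \<not> small f}. 3 - kept v f)"
  proof -
    have "(\<Sum>f\<in>?L. \<Sum>v\<in>vs f. 3 - kept v f) = (\<Sum>f\<in>?L. \<Sum>v\<in>{v \<in> U. v \<in> vs f}. 3 - kept v f)"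
      using vsU by auto
    also have "\<dots> = (\<Sum>v\<in>U. \<Sum>f\<in>{f \<in> ?L. v \<in> vs f}. 3 - kept v f)"
      by (rule sum.swap_restrict) (use fin finU in auto)
    also have "\<dots> = (\<Sum>v\<in>U. \<Sum>f\<in>{f \<in> F. v \<in> vs f \<and> \<not> small f}. 3 - kept v f)"
      by (intro sum.cong) auto
    finally show ?thesis .
  qed
  define m where "m v = int (card {T \<in> ?T. v \<in> vs T})" for v
  have s6: "(\<Sum>T\<in>?T. int (card {v \<in> vs T. free v})) = (\<Sum>v\<in>U. of_bool (free v) * m v)"
  proof -
    have "(\<Sum>T\<in>?T. int (card {v \<in> vs T. free v})) = (\<Sum>T\<in>?T. \<Sum>v\<in>{v \<in> U. v \<in> vs T}. of_bool (free v))"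
    proof (rule sum.cong[OF refl])
      fix T assume "T \<in> ?T"
      then have "T \<in> F" by simp
      have "{v \<in> U. v \<in> vs T} \<inter> {v. free v} = {v \<in> vs T. free v}" using vs_U[OF \<open>T \<in> F\<close>] by auto
      then show "int (card {v \<in> vs T. free v}) = (\<Sum>v\<in>{v \<in> U. v \<in> vs T}. of_bool (free v))"
        using finU by (simp add: sum_of_bool_eq)
    qed
    also have "\<dots> = (\<Sum>v\<in>U. \<Sum>T\<in>{T \<in> ?T. v \<in> vs T}. of_bool (free v))"
      by (rule sum.swap_restrict) (use fin finU in auto)
    finally show ?thesis by (simp add: m_def mult.commute)
  qed
  \<comment> \<open>The final charge of \<open>v\<close>: initial charge, plus what its large faces
    give it, minus 2 to its triangle if it is free.\<close>
  define w where "w v = 6 * (int (deg v) - 4) + (\<Sum>f\<in>{f \<in> F. v \<in> vs f \<and> \<not> small f}. 3 - kept v f) - 2 * of_bool (free v) * m v" for v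
  have sw: "(\<Sum>v\<in>U. w v) = (\<Sum>v\<in>U. 6 * (int (deg v) - 4)) + (\<Sum>f\<in>?L. \<Sum>v\<in>vs f. 3 - kept v f)
      - 2 * (\<Sum>T\<in>?T. int (card {v \<in> vs T. free v}))"
    unfolding s5 s6 by (simp add: w_def sum.distrib sum_subtractf sum_distrib_left mult.assoc)
  have tot: "(\<Sum>v\<in>U. w v) - 6 * int (card ?X) \<le> -48"
    using total_charge sF s1 s2 s3 s4 sw by linarith
  define l where "l v = int (card {f \<in> F. v \<in> vs f \<and> \<not> small f})" for v
  have lm: "l v + m v \<le> int (deg v)" if "v \<in> U" for v
  proof -
    have "card {f \<in> F. v \<in> vs f \<and> \<not> small f} + card {T \<in> ?T. v \<in> vs T} = card ({f \<in> F. v \<in> vs f \<and> \<not> small f} \<union> {T \<in> ?T. v \<in> vs T})"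
      by (rule card_Un_disjoint[symmetric]) (use finF in \<open>auto simp: small_def\<close>)
    also have "\<dots> \<le> card {f \<in> F. v \<in> vs f}" by (rule card_mono) (use finF in auto)
    finally show ?thesis using faces_at[OF that] by (simp add: l_def m_def)
  qed
  have m1: "m v \<le> 1" for v
  proof -
    have "T = T'" if "T \<in> {T \<in> ?T. v \<in> vs T}" "T' \<in> {T \<in> ?T. v \<in> vs T}" for T T'
      using tri_faces_far(1)[of T T' v v] that by blast
    then have "card {T \<in> ?T. v \<in> vs T} \<le> 1" using finF by (auto simp: card_le_Suc0_iff_eq)
    then show ?thesis by (simp add: m_def)
  qed
  \<comment> \<open>The initial charge of \<open>x\<close> is 6 times its degree minus 24. It spends
    6 per large face and reserves 6 per triangle at it, and these faces are at most as many as its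
    degree.\<close>
  have wx: "w x \<ge> -24 + 6 * int (card ?X)"
  proof -
    have "card {f \<in> F. x \<in> vs f \<and> \<not> small f} + card ?X = card ({f \<in> F. x \<in> vs f \<and> \<not> small f} \<union> ?X)"
      by (rule card_Un_disjoint[symmetric]) (use finF in \<open>auto simp: small_def\<close>)
    also have "\<dots> \<le> card {f \<in> F. x \<in> vs f}" by (rule card_mono) (use finF in auto)
    finally have "l x + int (card ?X) \<le> int (deg x)" using faces_at[OF xU] by (simp add: l_def)
    moreover have "(\<Sum>f\<in>{f \<in> F. x \<in> vs f \<and> \<not> small f}. 3 - kept x f) = - 6 * l x" by (simp add: kept_def l_def)
    ultimately show ?thesis unfolding w_def by (simp add: free_def)
  qed
  have wv: "w v \<ge> - 10 * of_bool (exceptional v)" if v: "v \<in> U" "v \<noteq> x" for v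
  proof -
    consider "three v" | "four v" | "free v" using v by (auto simp: free_def)
    then show ?thesis
    proof cases
      case 1
      then have "(\<Sum>f\<in>{f \<in> F. v \<in> vs f \<and> \<not> small f}. 3 - kept v f) = l v * (3 - of_bool (rich v))"
        using v by (simp add: kept_def l_def)
      then have "0 \<le> w v" using three_large[OF 1] threeD[OF 1] 1 unfolding w_def by (simp add: l_def free_def)
      then show ?thesis by (cases "exceptional v") simp_all
    next
      case 2
      have "(\<Sum>f\<in>{f \<in> F. v \<in> vs f \<and> \<not> small f}. 3 - kept v f) = - (\<Sum>f\<in>{f \<in> F. v \<in> vs f \<and> \<not> small f}. exchange v f)"
        using v 2 three_not_four by (auto simp: kept_def sum_negf[symmetric] intro!: sum.cong)
      then have "0 \<le> w v" using four_exchange[OF 2] fourD[OF 2] 2 unfolding w_def by (simp add: free_def)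
      then show ?thesis by (cases "exceptional v") simp_all
    next
      case 3
      have "(\<Sum>f\<in>{f \<in> F. v \<in> vs f \<and> \<not> small f}. 3 - kept v f) = - l v"
        using v 3 by (simp add: kept_def l_def free_def)
      then have w: "w v = 6 * (int (deg v) - 4) - l v - 2 * m v" using 3 by (simp add: w_def)
      \<comment> \<open>Since \<open>l v + m v\<close> is at most the degree and \<open>m v\<close>
        at most 1, the final charge is at least 5 times the degree minus 25. This is nonnegative
        from degree 5 on and -10 for degree 3.\<close>
      have "3 \<le> deg v" using deg_ge_3 v by blast
      moreover have "deg v \<ge> 5" if "\<not> exceptional v"
        using 3 that calculation unfolding free_def three_def four_def by force
      ultimately show ?thesis using w lm[OF v(1)] m1[of v] by (cases "exceptional v") auto
    qed
  qed
  \<comment> \<open>In total the vertices keep at least -24 - 20 = -44 after the triangles at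
    \<open>x\<close> are paid, more than -48.\<close>
  have "card {v \<in> U. exceptional v} \<le> 2"
  proof (cases "deg x = 2")
    case True
    have "card {v \<in> U. exceptional v} \<le> card {y. A x y}"
      by (rule card_mono) (use fin_nbrs sym in \<open>auto simp: exceptional_def\<close>)
    then show ?thesis using deg_eq[of x] True by simp
  qed (simp add: exceptional_def)
  moreover have "(\<Sum>v\<in>U - {x}. w v) \<ge> (\<Sum>v\<in>U - {x}. - 10 * of_bool (exceptional v))" by (rule sum_mono) (use wv in auto)
  moreover have "(\<Sum>v\<in>U - {x}. - 10 * of_bool (exceptional v)) = - 10 * int (card {v \<in> U. exceptional v})"
  proof -
    have "(U - {x}) \<inter> {v. exceptional v} = {v \<in> U. exceptional v}" by (auto simp: exceptional_def)
    then have "(\<Sum>v\<in>U - {x}. of_bool (exceptional v)) = int (card {v \<in> U. exceptional v})" using finU by (simp add: sum_of_bool_eq)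
    then show ?thesis by (simp only: sum_distrib_left[symmetric])
  qed
  moreover have "(\<Sum>v\<in>U. w v) = w x + (\<Sum>v\<in>U - {x}. w v)" using finU xU by (simp add: sum.remove)
  ultimately show False using tot wx by linarith
qed

text \<open>
  The triangle \<open>T\<close> gets nothing from the deficient face \<open>h\<close>, and lacks 2 because its third vertex
  \<open>v\<close> has degree 4. It obtains 1 on behalf of each of the two faces \<open>g\<close> at \<open>v\<close>.
\<close>

definition root_side :: "'f \<Rightarrow> 'f \<Rightarrow> 'f \<Rightarrow> 'a \<Rightarrow> 'a \<Rightarrow> 'a \<Rightarrow> bool" where
  "root_side T g h u u' v \<longleftrightarrow> facial T [u, v, u'] \<and> x \<notin> vs T \<and> h = other T {u, u'} \<and> deficient h \<and> four v \<and> g = other T {u, v}"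

section \<open>Triangles beside a deficient face\<close>

lemma num_big_pos: "f \<in> F \<Longrightarrow> v \<in> vs f \<Longrightarrow> big v \<Longrightarrow> 0 < num_big f"
  unfolding num_big_def using fin_vs by (auto simp: card_gt_0_iff)

lemma num_big_0: "f \<in> F \<Longrightarrow> num_big f = 0 \<Longrightarrow> v \<in> vs f \<Longrightarrow> three v"
  using num_big_pos vs_U by (force simp: big_def)

lemma x_big: "big x" using xU by (simp add: big_def three_def)

lemma facial_biconn: "facial f c \<Longrightarrow> biconn (vs f)"
  using biconn_cycle[of c] facial_vs[of f c] facial_bd[of f c] facial_distinct[of f c] bdE[OF facial_F[of f c]] by simp

lemma face_biconn: "f \<in> F \<Longrightarrow> biconn (vs f)"
  using facial_ex facial_biconn by blast

text \<open>The two faces share an edge, so their union is 2-connected, and an end of that edge has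
  all its three neighbours in the union. \<open>reducible_biconn\<close> forbids this.\<close>

lemma reducible_theta:
  assumes h: "h \<in> F" "\<And>y. y \<in> vs h \<Longrightarrow> three y" and D: "D \<in> F" "\<And>y. y \<in> vs D \<Longrightarrow> three y"
    and e: "e \<in> bd h" "e \<in> bd D" "h \<noteq> D"
  shows False
proof -
  obtain a b where ab: "e = {a, b}" "A a b" using e bdE[OF h(1)] by (auto simp: EA_def)
  have ne: "a \<noteq> b" using ab irr by auto
  obtain c where c: "angle h a b c" using edge_angle[of h b a] e ab h by (metis insert_commute)
  obtain c' where c': "angle D a b c'" using edge_angle[of D b a] e ab D by (metis insert_commute)
  note ca = angleD[OF c] and ca' = angleD[OF c']
  have t: "three b" using h(2) ca by blast
  have kept: "c \<noteq> c'" using two_edges[OF c, of D] c' e(3) threeD[OF t] by auto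
  let ?B = "vs h \<union> vs D"
  have N: "{a, c, c'} \<subseteq> {y \<in> ?B. A b y}" using ca ca' by auto
  have "finite {y \<in> ?B. A b y}" using fin_vs h D by auto
  then have "card {a, c, c'} \<le> d b ?B" unfolding d_def using N by (rule card_mono)
  then have "3 \<le> d b ?B" using kept ca(2) ca'(2) by simp
  moreover have "biconn ?B"
    by (rule biconn_Un[of _ _ a b]) (use face_biconn h D ca ca' ne in auto)
  moreover have "?B \<subseteq> U - {x}" using h(2) D(2) threeD by auto
  moreover have "b \<in> ?B" using ca by auto
  ultimately show False using reducible_biconn[of ?B b] h(2) D(2) threeD by auto
qed

lemma root_sideD:
  assumes "root_side T g h u u' v"
  shows "T \<in> F" "len T = 3" "x \<notin> vs T" "h \<in> F" "g \<in> F" "deficient h" "four v" "angle T u v u'" "angle T v u' u" "angle T u' u v"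
    "vs T = {u, v, u'}" "distinct [u, v, u']" "other T {u, u'} = h" "other T {u, v} = g" "{u, u'} \<in> bd h" "{u, v} \<in> bd g"
    "three u" "three u'" "h \<noteq> T" "g \<noteq> T" "g \<noteq> h" "other h {u, u'} = T" "other g {u, v} = T" "len h = 8"
    "\<And>y. y \<in> vs h \<Longrightarrow> three y" "v \<notin> vs h" "\<not> small g" "\<not> small h" "big v"
proof -
  have r: "facial T [u, v, u']" "x \<notin> vs T" "h = other T {u, u'}" "deficient h" "four v" "g = other T {u, v}"
    using assms unfolding root_side_def by blast+
  note t = facial3[OF r(1)] and ta = facial3_adj[OF r(1)]
  show a: "angle T u v u'" "angle T v u' u" "angle T u' u v" "vs T = {u, v, u'}" "distinct [u, v, u']" "len T = 3" "T \<in> F"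
    using t ta by auto
  show "x \<notin> vs T" "deficient h" "four v" by (fact r)+
  show "other T {u, u'} = h" "other T {u, v} = g" using r(3,6) by simp_all
  have e1: "{u, u'} \<in> bd T" using angleD(6)[OF a(2)] by (simp add: insert_commute)
  have e2: "{u, v} \<in> bd T" using angleD(3)[OF a(1)] .
  show b: "h \<in> F" "g \<in> F" "{u, u'} \<in> bd h" "{u, v} \<in> bd g" "h \<noteq> T" "g \<noteq> T"
    using other[OF a(7) e1] other[OF a(7) e2] r by simp_all
  show "other h {u, u'} = T" "other g {u, v} = T" using other_other[OF a(7) e1] other_other[OF a(7) e2] r by simp_all
  have n: "num_big h = 0" and len: "len h = 8" using r(4) by (auto simp: deficient_def)
  show all: "\<And>y. y \<in> vs h \<Longrightarrow> three y" using num_big_0[OF b(1) n] .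
  show "len h = 8" by fact
  show "three u" "three u'" by (rule all[OF edge_vs(1)[OF b(3)]], rule all[OF edge_vs(2)[OF b(3)]])
  show "big v" using r(5) three_not_four fourD by (auto simp: big_def)
  then show vh: "v \<notin> vs h" using all by (auto simp: big_def)
  show "g \<noteq> h" using vh b(4) by (auto simp: vs_def)
  have nx: "u \<noteq> x" "v \<noteq> x" "u' \<noteq> x" using r(2) a(4) by auto
  show "\<not> small g" using small_adj[of T u v g] a(6,7) e2 b nx by (auto simp: small_def)
  show "\<not> small h" using len by (simp add: small_def)
qed

definition root :: "'f \<Rightarrow> bool" where "root T \<longleftrightarrow> (\<exists>g h u u' v. root_side T g h u u' v)"

lemma root_side_swap:
  assumes "root_side T g h u u' v" shows "root_side T (other T {u', v}) h u' u v"
proof -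
  have "facial T [u', v, u]" using facial_rev[of T "[u, v, u']"] assms by (simp add: root_side_def)
  then show ?thesis unfolding root_side_def using root_sideD[OF assms] by (simp add: insert_commute[of u' u])
qed

text \<open>If one neighbouring face is deficient, the third vertex of \<open>T\<close> is big by
  \<open>reducible_theta\<close>. The other two faces contain it, so they are not deficient and pay
  4; the remaining 2 come from this vertex if it is free, and otherwise \<open>T\<close> is a
  root.\<close>

lemma triangle_charge:
  assumes T: "T \<in> F" "len T = 3" "x \<notin> vs T"
  shows "6 \<le> (\<Sum>e\<in>bd T. 2 * of_bool (\<not> deficient (other T e))) + 2 * int (card {v \<in> vs T. free v}) + 2 * of_bool (root T)"
proof (cases "\<exists>e\<in>bd T. deficient (other T e)")
  case False
  then have "(\<Sum>e\<in>bd T. 2 * of_bool (\<not> deficient (other T e))) = (\<Sum>e\<in>bd T. (2::int))" by (intro sum.cong) auto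
  also have "\<dots> = 6" using T by (simp add: len_def)
  finally show ?thesis by simp
next
  case True
  then obtain e where e: "e \<in> bd T" "deficient (other T e)" by auto
  then obtain u u' where uu: "e = {u, u'}" using bdE[OF T(1)] by (auto simp: EA_def)
  then obtain v where "facial T [u, u', v]" using tri_vertices T e by metis
  then have fv: "facial T [u, v, u']" using facial_rev[of T "[u, u', v]"] facial_rot[of T v "[u', u]"] facial_rot[of T u' "[u, v]"] by simp
  note t = facial3[OF fv]
  let ?h = "other T e"
  have o: "?h \<in> F" "?h \<noteq> T" "e \<in> bd ?h" using other[OF T(1) e(1)] by auto
  have n0: "num_big ?h = 0" using e by (simp add: deficient_def)
  have th: "\<And>y. y \<in> vs ?h \<Longrightarrow> three y" using num_big_0[OF o(1) n0] .
  have "u \<in> vs ?h" "u' \<in> vs ?h" using o(3) uu by (auto simp: vs_def)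
  then have "three u" "three u'" using th by blast+
  then have nv: "\<not> three v" using reducible_theta[OF o(1) th T(1) _ o(3) e(1) o(2)] t by auto
  have vU: "v \<in> U" "v \<noteq> x" using vs_U[OF T(1)] t T(3) by auto
  have b: "big v" using vU nv by (simp add: big_def)
  have e12: "{u, v} \<in> bd T" "{u', v} \<in> bd T" using t by (auto simp: angle_def insert_commute)
  have nD: "\<not> deficient (other T e')" if "e' \<in> bd T" "v \<in> e'" for e'
  proof -
    note o' = other[OF T(1) that(1)]
    have "0 < num_big (other T e')" using num_big_pos[OF o'(1) _ b] o'(3) that by (auto simp: vs_def)
    then show ?thesis by (simp add: deficient_def)
  qed
  have ne: "{u, v} \<noteq> {u', v}" using t by (auto simp: doubleton_eq_iff)
  have "(\<Sum>e\<in>{{u, v}, {u', v}}. 2 * of_bool (\<not> deficient (other T e))) \<le> (\<Sum>e\<in>bd T. 2 * of_bool (\<not> deficient (other T e)) :: int)"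
    by (rule sum_mono2) (use e12 fin_bd[OF T(1)] in auto)
  moreover have "(\<Sum>e\<in>{{u, v}, {u', v}}. 2 * of_bool (\<not> deficient (other T e))) = (4::int)"
    using ne nD[of "{u, v}"] nD[of "{u', v}"] e12 by simp
  moreover have "1 \<le> int (card {v \<in> vs T. free v}) \<or> root T"
  proof (cases "four v")
    case True
    then have "root_side T (other T {u, v}) ?h u u' v" using fv T(3) e(2) uu by (simp add: root_side_def)
    then show ?thesis by (auto simp: root_def)
  next
    case False
    then have "{v} \<subseteq> {v \<in> vs T. free v}" using vU nv t by (auto simp: free_def)
    then have "card {v} \<le> card {v \<in> vs T. free v}" by (intro card_mono) (use fin_vs[OF T(1)] in auto)
    then show ?thesis by simp
  qed
  ultimately show ?thesis by (auto simp del: of_nat_0_less_iff)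
qed

text \<open>Each root triangle has two different sides \<open>g\<close>, and choosing a donor for
  each pair of triangle and side gives an injection. The donor relation is a parameter here;
  existence and injectivity are what remains to be shown for the concrete one.\<close>

lemma root_count:
  assumes "\<And>T g h u u' v. root_side T g h u u' v \<Longrightarrow> \<exists>z y. z \<in> F \<and> \<not> small z \<and> y \<in> vs z \<and> donor T g z y"
    and "\<And>T g z y T' g'. donor T g z y \<Longrightarrow> donor T' g' z y \<Longrightarrow> (\<exists>h u u' v. root_side T g h u u' v) \<Longrightarrow> (\<exists>h u u' v. root_side T' g' h u u' v) \<Longrightarrow> T = T' \<and> g = g'"
  shows "2 * card {T \<in> F. len T = 3 \<and> x \<notin> vs T \<and> root T} \<le>
    card {(f, v). f \<in> F \<and> \<not> small f \<and> v \<in> vs f \<and> (\<exists>T g. (\<exists>h u u' w. root_side T g h u u' w) \<and> donor T g f v)}"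
    (is "2 * card ?R \<le> card ?P")
proof -
  define G where "G T = {g. \<exists>h u u' v. root_side T g h u u' v}" for T
  have GF: "finite (G T)" for T
    by (rule finite_subset[OF _ finF]) (use root_sideD(5) in \<open>auto simp: G_def\<close>)
  have G2: "2 \<le> card (G T)" if "T \<in> ?R" for T
  proof -
    have "root T" using that by simp
    then obtain g h u u' v where r: "root_side T g h u u' v" unfolding root_def by blast
    note rD = root_sideD[OF r] and rD' = root_sideD[OF root_side_swap[OF r]]
    have "other T {u', v} \<noteq> g"
    proof
      assume eq: "other T {u', v} = g"
      have "angle g u v u'" using rD(5,12,16) rD'(16) eq by (auto simp: angle_def insert_commute)
      then have "deg v = 2" using two_edges[OF rD(8)] rD(20) by metis
      then show False using fourD[OF rD(7)] by simp
    qed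
    then have "card {other T {u', v}, g} = 2" by simp
    moreover have "{other T {u', v}, g} \<subseteq> G T" using r root_side_swap[OF r] by (auto simp: G_def)
    ultimately show ?thesis using card_mono[OF GF] by metis
  qed
  let ?S = "SIGMA T:?R. G T"
  have fR: "finite ?R" using finF by auto
  have "2 * card ?R = (\<Sum>T\<in>?R. 2)" by simp
  also have "\<dots> \<le> (\<Sum>T\<in>?R. card (G T))" by (rule sum_mono) (use G2 in auto)
  also have "\<dots> = card ?S" by (subst card_SigmaI) (use fR GF in auto)
  also have "\<dots> \<le> card ?P"
  proof -
    define D where "D p = (SOME q. fst q \<in> F \<and> \<not> small (fst q) \<and> snd q \<in> vs (fst q) \<and> donor (fst p) (snd p) (fst q) (snd q))" for p
    have D: "fst (D p) \<in> F \<and> \<not> small (fst (D p)) \<and> snd (D p) \<in> vs (fst (D p)) \<and> donor (fst p) (snd p) (fst (D p)) (snd (D p))"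
      if p: "p \<in> ?S" for p
    proof -
      have "\<exists>q. fst q \<in> F \<and> \<not> small (fst q) \<and> snd q \<in> vs (fst q) \<and> donor (fst p) (snd p) (fst q) (snd q)"
        using p assms(1) by (fastforce simp: G_def)
      then show ?thesis unfolding D_def by (rule someI_ex)
    qed
    have rsS: "\<exists>h u u' v. root_side (fst p) (snd p) h u u' v" if "p \<in> ?S" for p
      using that unfolding G_def by (elim SigmaE2 SigmaE) simp
    have "inj_on D ?S"
    proof (rule inj_onI)
      fix p q assume pq: "p \<in> ?S" "q \<in> ?S" "D p = D q"
      have "donor (fst p) (snd p) (fst (D q)) (snd (D q))" using D[OF pq(1)] pq(3) by simp
      then show "p = q" using assms(2) D[OF pq(2)] rsS[OF pq(1)] rsS[OF pq(2)] by (metis prod.expand)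
    qed
    moreover have "D ` ?S \<subseteq> ?P"
    proof (rule image_subsetI)
      fix p assume p: "p \<in> ?S"
      have "(fst (D p), snd (D p)) \<in> ?P" using D[OF p] rsS[OF p] by blast
      then show "D p \<in> ?P" by simp
    qed
    moreover have "finite ?P"
      by (rule finite_subset[of _ "F \<times> U"]) (use finF finU vs_U in auto)
    ultimately show ?thesis by (rule card_inj_on_le)
  qed
  finally show ?thesis .
qed

lemma facial8_adj:
  assumes "facial f [a0,a1,a2,a3,a4,a5,a6,a7]"
  shows "A a0 a1" "A a1 a2" "A a2 a3" "A a3 a4" "A a4 a5" "A a5 a6" "A a6 a7" "A a7 a0"
    "A a1 a0" "A a2 a1" "A a3 a2" "A a4 a3" "A a5 a4" "A a6 a5" "A a7 a6" "A a0 a7" "f \<in> F"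
  using angleD(7,8,9,10)[OF facial8(2)[OF assms]] angleD(7,8,9,10)[OF facial8(4)[OF assms]] angleD(7,8,9,10)[OF facial8(6)[OF assms]]
    angleD(7,8,9,10)[OF facial8(8)[OF assms]] angleD(1)[OF facial8(2)[OF assms]] by simp_all

lemma vs_facial8:
  assumes "f \<in> F" "len f = 8" "a \<in> vs f"
  obtains a1 a2 a3 a4 a5 a6 a7 where "facial f [a,a1,a2,a3,a4,a5,a6,a7]"
proof -
  obtain ys where ys: "facial f (a # ys)" using vs_facial_hd[OF assms(1,3)] by blast
  then have "length ys = 7" using facial_len[OF ys] assms(2) by simp
  then obtain a1 a2 a3 a4 a5 a6 a7 where "ys = [a1,a2,a3,a4,a5,a6,a7]"
    by (auto simp: numeral_eq_Suc length_Suc_conv)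
  then show ?thesis using that ys by blast
qed

lemma angle_facial8:
  assumes "angle f a v b" "len f = 8"
  obtains a3 a4 a5 a6 a7 where "facial f [a,v,b,a3,a4,a5,a6,a7]"
proof -
  obtain zs where zs: "facial f (a # v # b # zs)" using angle_facial[OF assms(1)] by blast
  then have "length zs = 5" using facial_len[OF zs] assms(2) by simp
  then obtain a3 a4 a5 a6 a7 where "zs = [a3,a4,a5,a6,a7]"
    by (auto simp: numeral_eq_Suc length_Suc_conv)
  then show ?thesis using that zs by blast
qed

section \<open>Reducible configurations\<close>

text \<open>A chord between vertices at distance 2, 3 or 4 along an 8-cycle closes a cycle of length
  7, 6 or 5.\<close>

lemma chord8:
  assumes "f \<in> F" "len f = 8" "a \<in> vs f" "b \<in> vs f" "A a b"
  shows "{a, b} \<in> bd f"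
proof -
  obtain a1 a2 a3 a4 a5 a6 a7 where l: "facial f [a,a1,a2,a3,a4,a5,a6,a7]" using vs_facial8[OF assms(1-3)] by blast
  note e = facial8_adj[OF l] and m = facial8[OF l]
  have ba: "A b a" using assms(5) sym by blast
  have "b \<noteq> a" using assms(5) irr by auto
  then have "b \<in> {a1,a2,a3,a4,a5,a6,a7}" using assms(4) m(10) by auto
  then consider "b = a1" | "b = a2" | "b = a3" | "b = a4" | "b = a5" | "b = a6" | "b = a7" by auto
  then show ?thesis
  proof cases
    case 1 then show ?thesis using m(12) by simp
  next
    case 2 then show ?thesis using no_7_cycle[of a a2 a3 a4 a5 a6 a7] e assms(5) m(9) by simp
  next
    case 3 then show ?thesis using no_6_cycle[of a a3 a4 a5 a6 a7] e assms(5) m(9) by simp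
  next
    case 4 then show ?thesis using no_5_cycle[of a a4 a5 a6 a7] e assms(5) m(9) by simp
  next
    case 5 then show ?thesis using no_6_cycle[of a a1 a2 a3 a4 a5] e ba m(9) by simp
  next
    case 6 then show ?thesis using no_7_cycle[of a a1 a2 a3 a4 a5 a6] e ba m(9) by simp
  next
    case 7 then show ?thesis using m(12) by (simp add: insert_commute)
  qed
qed

lemma chord_angle8:
  assumes "angle f a v b" "len f = 8" "y \<in> vs f" "A v y" shows "y = a \<or> y = b"
  using angle_unique[OF assms(1)] chord8[OF angleD(1)[OF assms(1)] assms(2) angleD(17)[OF assms(1)] assms(3,4)] by blast

text \<open>A path of length 2 outside the face closes a cycle of length 5 or 6 with a part of it if
  the ends are at distance 3 or 4.\<close>

lemma outer8:
  assumes l: "facial h [a0,a1,a2,a3,a4,a5,a6,a7]" and "w \<notin> vs h" "A w a0" "A w y" "y \<in> vs h"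
  shows "y \<in> {a0,a1,a2,a6,a7}"
proof -
  note e = facial8_adj[OF l] and m = facial8[OF l]
  have s: "A a0 w" "A y w" using assms sym by blast+
  have nw: "w \<noteq> a0" "w \<noteq> a1" "w \<noteq> a2" "w \<noteq> a3" "w \<noteq> a4" "w \<noteq> a5" "w \<noteq> a6" "w \<noteq> a7" using assms(2) m(10) by auto
  have "y \<noteq> a3" using no_5_cycle[of w a0 a1 a2 a3] e assms s nw m(9) by auto
  moreover have "y \<noteq> a4" using no_6_cycle[of w a0 a1 a2 a3 a4] e assms s nw m(9) by auto
  moreover have "y \<noteq> a5" using no_5_cycle[of w a0 a7 a6 a5] e assms s nw m(9) by auto
  ultimately show ?thesis using assms(5) m(10) by auto
qed

lemma nbrs3: "deg v = 3 \<Longrightarrow> A v a \<Longrightarrow> A v b \<Longrightarrow> A v c \<Longrightarrow> distinct [a,b,c] \<Longrightarrow> A v y \<Longrightarrow> y \<in> {a,b,c}"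
proof -
  assume a: "deg v = 3" "A v a" "A v b" "A v c" "distinct [a,b,c]" "A v y"
  have "{a,b,c} = {y. A v y}"
    by (rule card_subset_eq) (use a deg_eq fin_nbrs in auto)
  then show ?thesis using a by auto
qed

lemma num_big_1:
  assumes "f \<in> F" "num_big f = 1" "v \<in> vs f" "big v" "y \<in> vs f" "y \<noteq> v" shows "three y"
proof (rule ccontr)
  assume "\<not> three y"
  then have "big y" using vs_U assms by (auto simp: big_def)
  then have "{v, y} \<subseteq> {v \<in> vs f. big v}" using assms by auto
  then have "card {v, y} \<le> num_big f" unfolding num_big_def using fin_vs[OF assms(1)] by (intro card_mono) auto
  then show False using assms by simp
qed

lemma num_big_2:
  assumes "f \<in> F" "v \<in> vs f" "big v" "y \<in> vs f" "big y" "y \<noteq> v" shows "2 \<le> num_big f"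
  using num_big_pos[OF assms(1-3)] num_big_1[OF assms(1) _ assms(2-4,6)] assms(5) by (cases "num_big f = 1") (auto simp: big_def)

lemma face3:
  assumes "three v" "f \<in> F" "v \<in> vs f" "g \<in> F" "v \<in> vs g" "f \<noteq> g" "k \<in> F" "v \<in> vs k" "k \<noteq> f" "k \<noteq> g"
    "k' \<in> F" "v \<in> vs k'"
  shows "k' = f \<or> k' = g \<or> k' = k"
proof -
  have "card {f, g, k} = 3" using assms by auto
  moreover have "card {f \<in> F. v \<in> vs f} = 3" using faces_at threeD[OF assms(1)] by auto
  moreover have "{f, g, k} \<subseteq> {f \<in> F. v \<in> vs f}" using assms by auto
  ultimately have "{f, g, k} = {f \<in> F. v \<in> vs f}" using finF by (intro card_subset_eq) auto
  then show ?thesis using assms by blast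
qed

lemma small_three:
  assumes "three v" "f \<in> F" "v \<in> vs f" "small f" "g \<in> F" "v \<in> vs g" "small g" shows "f = g"
proof (rule ccontr)
  assume ne: "f \<noteq> g"
  note v = threeD[OF assms(1)]
  obtain a b where ab: "angle f a v b" using vs_angle assms by blast
  note fa = angleD[OF ab]
  obtain c where "\<And>k. k \<in> F \<Longrightarrow> v \<in> vs k \<Longrightarrow> k = f \<or> k = other f {v, a} \<or> k = other f {v, b}"
    using three_struct[OF _ ab] v by metis
  then have "g = other f {v, a} \<or> g = other f {v, b}" using assms ne by blast
  then show False using no_two_small[of v f a g] no_two_small[of v f b g] v assms fa ne other(3)[OF fa(1) fa(5)] other(3)[OF fa(1) fa(4)] by auto
qed

lemma tri_at:
  assumes "T \<in> F" "len T = 3" "v \<in> vs T" "A v a" "A v b" "A a b" shows "a \<in> vs T" "b \<in> vs T"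
proof -
  obtain y z where yz: "angle T y v z" using vs_angle[OF assms(1,3)] by blast
  then obtain c where c: "facial T [y, v, c]" using tri_vertices[OF assms(1,2) angleD(3)[OF yz]] by blast
  have "{v, a, b} = {v, y, c}"
    by (rule tri_share) (use facial3_adj[OF c] assms in simp_all)
  then show "a \<in> vs T" "b \<in> vs T" using facial3[OF c] by auto
qed

lemma edge_share_big:
  assumes "three b" "angle f a b c" "D \<in> F" "{a, b} \<in> bd D" "D \<noteq> f"
  shows "biconn (vs f \<union> vs D)" "3 \<le> d b (vs f \<union> vs D)" "b \<in> vs f"
proof -
  note fa = angleD[OF assms(2)]
  obtain c' where c': "angle D a b c'" using edge_angle[of D b a] assms(3,4) angle_sym by (metis insert_commute)
  note Da = angleD[OF c']
  have kept: "c \<noteq> c'" using two_edges[OF assms(2), of D] c' assms(5) threeD[OF assms(1)] by auto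
  let ?B = "vs f \<union> vs D"
  have N: "{a, c, c'} \<subseteq> {y \<in> ?B. A b y}" using fa Da by auto
  have "finite {y \<in> ?B. A b y}" using fin_vs[OF fa(1)] fin_vs[OF Da(1)] by auto
  then have "card {a, c, c'} \<le> d b ?B" unfolding d_def using N by (rule card_mono)
  then show "3 \<le> d b ?B" using kept fa(2) Da(2) by simp
  show "biconn ?B"
    by (rule biconn_Un[of _ _ a b]) (use face_biconn fa Da in auto)
  show "b \<in> vs f" by (rule fa)
qed

lemma conn_del: "f \<in> F \<Longrightarrow> conn (vs f - {v})"
  using face_biconn[of f] unfolding biconn_def by (cases "v \<in> vs f") auto

text \<open>Apply \<open>reducible_save\<close> to the union of \<open>h\<close>, \<open>g\<close>
  and \<open>D\<close>: delete the vertex \<open>u'\<close> of the triangle, all of whose neighbours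
  are on \<open>h\<close> or \<open>g\<close>, and save the 4-vertex \<open>v\<close>. After that
  \<open>g\<close> with the small face \<open>D\<close> is a 2-connected part with a vertex of
  degree 3.\<close>

lemma reducible_root:
  assumes r: "root_side T g h u u' v" and g: "len g = 8" "num_big g = 1" and D: "D \<in> F" "small D" "D \<noteq> T"
    "\<And>y. y \<in> vs D \<Longrightarrow> three y" "\<And>y. y \<in> vs D \<Longrightarrow> \<not> A v y" and e: "e \<in> bd D" "e \<in> bd g"
  shows False
proof -
  note R = root_sideD[OF r]
  note t = angleD[OF R(8)]
  let ?S = "vs h \<union> vs g \<union> vs D"
  have vg: "v \<in> vs g" "u \<in> vs g" using edge_vs[OF R(16)] by auto
  have uh: "u \<in> vs h" "u' \<in> vs h" using edge_vs[OF R(15)] by auto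
  have g3: "three y" if "y \<in> vs g" "y \<noteq> v" for y using num_big_1[OF R(5) g(2) vg(1) R(29) that] .
  obtain q where q: "angle g u v q" using edge_angle[OF R(5), of v u] R(16) angle_sym by (metis insert_commute)
  note ga = angleD[OF q]
  have u'g: "u' \<notin> vs g"
  proof
    assume u': "u' \<in> vs g"
    have "u' = u \<or> u' = q" using chord_angle8[OF q g(1) u'] t by blast
    then have "angle g u v u'" using R(12) q by auto
    then show False using two_edges[OF R(8)] R(20) fourD[OF R(7)] by fastforce
  qed
  have u'D: "u' \<notin> vs D"
    using small_three[OF R(18), of D T] D R(1,2,11) by (auto simp: small_def)
  obtain b where b: "angle h u u' b" using edge_angle[OF R(4), of u' u] R(15) angle_sym by (metis insert_commute)
  note ha = angleD[OF b]
  have nb: "y \<in> {u, b, v}" if "A u' y" for y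
    using nbrs3[of u' u b v y] threeD[OF R(18)] ha t R(12,26) that by auto
  \<comment> \<open>\<open>outer8\<close> from both \<open>u\<close> and \<open>u'\<close> leaves
    only the next vertices of \<open>h\<close> on either side, and these would give a second
    triangle at \<open>v\<close>.\<close>
  have vh: "y = u \<or> y = u'" if y: "A v y" "y \<in> vs h" for y
  proof (rule ccontr)
    assume n: "\<not> ?thesis"
    obtain b2 b3 b4 b5 b6 where l: "facial h [u,u',b,b2,b3,b4,b5,b6]" using angle_facial8[OF b R(24)] by blast
    have l2: "facial h [u',b,b2,b3,b4,b5,b6,u]" using facial_rot[OF l] by simp
    note m = facial8[OF l] and e = facial8_adj[OF l]
    have "y \<in> {u,u',b,b5,b6}" by (rule outer8[OF l R(26)]) (use t y in auto)
    moreover have "y \<in> {u',b,b2,b6,u}" by (rule outer8[OF l2 R(26)]) (use t y in auto)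
    ultimately have "y = b \<or> y = b6" using n m(9) by auto
    moreover have "\<not> A v b" using tri_at[OF R(1,2), of v u' b] R(11,26) t ha m(9) e by auto
    moreover have "\<not> A v b6" using tri_at[OF R(1,2), of v u b6] R(11,26) t m(9,10) e by auto
    ultimately show False using y by auto
  qed
  have Nv: "{y \<in> ?S. A v y} = {u, u', q}"
  proof
    show "{y \<in> ?S. A v y} \<subseteq> {u, u', q}"
      using vh chord_angle8[OF q g(1)] D(5) by blast
    show "{u, u', q} \<subseteq> {y \<in> ?S. A v y}" using uh ga t by auto
  qed
  have "e \<in> EA" using e bdE R by blast
  then obtain e1 e2 where ee: "e = {e1, e2}" by (auto simp: EA_def)
  obtain e3 where e3: "angle g e1 e2 e3" using edge_angle[OF R(5), of e2 e1] e ee angle_sym by (metis insert_commute)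
  have e2D: "e2 \<in> vs D" using e(1) edge_vs(2) unfolding ee by blast
  have e2: "three e2" "e2 \<in> vs D" "e2 \<in> vs g" using D(4)[OF e2D] e2D angleD(17)[OF e3] by blast+
  have Dg: "D \<noteq> g" using D(2) g(1) by (auto simp: small_def)
  note sh = edge_share_big[OF e2(1) e3 D(1) _ Dg]
  show False
  proof (rule reducible_save[of ?S u' v "vs g \<union> vs D" e2])
    show "?S \<subseteq> U - {x}"
    proof
      fix y assume "y \<in> ?S"
      then have "three y \<or> four y" using R(7,25) g3 D(4) by blast
      then show "y \<in> U - {x}" using threeD fourD by auto
    qed
    show "u' \<in> ?S" "deg u' = 3" "v \<in> ?S" "A u' v" "deg v = 4"
      using uh threeD[OF R(18)] vg t fourD[OF R(7)] by auto
    show "y \<in> ?S" if "A u' y" for y using nb[OF that] uh ha vg by auto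
    show "d v ?S = 3" unfolding d_def Nv using R(12) ga(2,18) u'g by (auto simp: card_insert_if)
    show "deg y = 3" if "y \<in> ?S" "y \<noteq> v" for y
      using that R(25) g3 D(4) threeD by blast
    show "conn (?S - {u'})"
    proof -
      have "conn ((vs h - {u'}) \<union> (vs g - {u'}))"
        by (rule conn_Un[OF conn_del[OF R(4)] conn_del[OF R(5)]]) (use uh vg R(12) in auto)
      then have "conn ((vs h - {u'}) \<union> (vs g - {u'}) \<union> (vs D - {u'}))"
        by (rule conn_Un[OF _ conn_del[OF D(1)]]) (use e2 u'D in auto)
      then show ?thesis by (simp add: Un_Diff)
    qed
    show "vs g \<union> vs D \<subseteq> ?S - {u'}" using u'g u'D by auto
    show "biconn (vs g \<union> vs D)" "3 \<le> d e2 (vs g \<union> vs D)" "e2 \<in> vs g \<union> vs D" using sh e ee e2 by auto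
  qed
qed

lemma three_alt:
  assumes "three v" "\<not> rich v" "angle f a v b" "\<not> small f"
  shows "small (other f {v, a}) \<longleftrightarrow> \<not> small (other f {v, b})"
  using rich_iff[OF assms(1,3,4)] three_edges[OF assms(1,3)] assms(2) by blast

lemma T_edge_adj: "T_edge f {a, b} \<Longrightarrow> T_edge f {c, p} \<Longrightarrow> A b c \<Longrightarrow> {a, b} \<noteq> {c, p} \<Longrightarrow> False"
  using T_edge_far(2)[of f "{a, b}" "{c, p}" b c] by blast

lemma not_T_edge: "\<not> small (other f e) \<Longrightarrow> \<not> T_edge f e"
  using T_edgeD(8) by blast

text \<open>
  A 3-vertex that is not rich has exactly one edge of \<open>f\<close> next to a small face, so these edges
  alternate along \<open>f\<close>.
\<close>

lemma alternate8:
  assumes l: "facial f [l0,l1,l2,l3,l4,l5,l6,l7]" and th: "\<And>y. y \<in> {l1,l2,l3,l4,l5,l6,l7} \<Longrightarrow> three y \<and> \<not> rich y"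
    and n: "\<not> small (other f {l0, l1})" "\<not> T_edge f {l7, l0}" and k: "num_T f = 2"
  shows "{e. T_edge f e} = {{l1, l2}, {l5, l6}}"
proof -
  note m = facial8[OF l] and e = facial8_adj[OF l]
  have ns: "\<not> small f" using m(11) by (simp add: small_def)
  note alt = three_alt[OF _ _ _ ns]
  have c: "{b, a} = {a, b}" for a b :: 'a by (rule insert_commute)
  have 1: "small (other f {l1, l2})" using alt[OF _ _ m(2)] th[of l1] n c[of l1 l0] by simp
  have 2: "\<not> small (other f {l2, l3})" using alt[OF _ _ m(3)] th[of l2] 1 c[of l2 l1] by simp
  have 3: "small (other f {l3, l4})" using alt[OF _ _ m(4)] th[of l3] 2 c[of l3 l2] by simp
  have 4: "\<not> small (other f {l4, l5})" using alt[OF _ _ m(5)] th[of l4] 3 c[of l4 l3] by simp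
  have 5: "small (other f {l5, l6})" using alt[OF _ _ m(6)] th[of l5] 4 c[of l5 l4] by simp
  have 6: "\<not> small (other f {l6, l7})" using alt[OF _ _ m(7)] th[of l6] 5 c[of l6 l5] by simp
  have sub: "{e. T_edge f e} \<subseteq> {{l1, l2}, {l3, l4}, {l5, l6}}"
  proof
    fix e assume "e \<in> {e. T_edge f e}"
    then have t: "T_edge f e" by simp
    have "e \<in> {{l0,l1},{l1,l2},{l2,l3},{l3,l4},{l4,l5},{l5,l6},{l6,l7},{l7,l0}}"
      unfolding m(12)[symmetric] by (rule T_edgeD(2)[OF t])
    then show "e \<in> {{l1, l2}, {l3, l4}, {l5, l6}}"
      using t not_T_edge[OF n(1)] not_T_edge[OF 2] not_T_edge[OF 4] not_T_edge[OF 6] n(2) by blast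
  qed
  have d: "{l1, l2} \<noteq> {l3, l4}" "{l3, l4} \<noteq> {l5, l6}" "{l1, l2} \<noteq> {l5, l6}" using m(9) by (auto simp: doubleton_eq_iff)
  \<comment> \<open>A triangle at the middle edge is too close to triangles at the other two, so
    there would be only one.\<close>
  have n34: "\<not> T_edge f {l3, l4}"
  proof
    assume t: "T_edge f {l3, l4}"
    have "\<not> T_edge f {l1, l2}" using T_edge_adj[OF _ t e(3)] d by blast
    moreover have "\<not> T_edge f {l5, l6}" using T_edge_adj[OF t _ e(5)] d by blast
    ultimately have "{e. T_edge f e} \<subseteq> {{l3, l4}}" using sub by blast
    then have "num_T f \<le> card {{l3, l4}}" unfolding num_T_def by (intro card_mono) auto
    then show False using k by simp
  qed
  then have sub: "{e. T_edge f e} \<subseteq> {{l1, l2}, {l5, l6}}" using sub by blast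
  show ?thesis by (rule card_subset_eq[OF _ sub]) (use k d in \<open>auto simp: num_T_def\<close>)
qed

section \<open>Demanding faces at a 4-vertex and the face that pays for them\<close>

lemma demanding_alternate:
  assumes D: "demanding f" and l: "facial f [l0,l1,l2,l3,l4,l5,l6,l7]" and b: "big l0"
    and n: "\<not> small (other f {l0, l1})" "\<not> T_edge f {l7, l0}"
  shows "{e. T_edge f e} = {{l1, l2}, {l5, l6}}" "\<And>y. y \<in> {l1,l2,l3,l4,l5,l6,l7} \<Longrightarrow> three y \<and> \<not> rich y"
proof -
  note m = facial8[OF l] and e = facial8_adj[OF l]
  have dd: "num_big f = 1" "num_T f = 2" "num_rich f = 0" using D by (auto simp: demanding_def)
  show th: "three y \<and> \<not> rich y" if "y \<in> {l1,l2,l3,l4,l5,l6,l7}" for y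
  proof -
    have y: "y \<in> vs f" "y \<noteq> l0" using that m(9,10) by auto
    have "{v \<in> vs f. rich v} = {}" using dd(3) fin_vs[OF e(17)] by (simp add: num_rich_def)
    then show ?thesis using num_big_1[OF e(17) dd(1) _ b y] y m(10) by auto
  qed
  show "{e. T_edge f e} = {{l1, l2}, {l5, l6}}" using alternate8[OF l th n dd(2)] .
qed

lemma in_triangle_T_edge: "T_edge f e \<Longrightarrow> v \<in> e \<Longrightarrow> in_triangle v"
  using T_edgeD(3,4,9) unfolding in_triangle_def by blast

text \<open>The face opposite to \<open>f\<close> at \<open>w\<close> is also flanked by large faces
  only, so two demanding faces, each flanked by one small face, must be the two neighbours of
  \<open>f\<close>.\<close>

lemma payer_struct:
  assumes w: "four w" and a: "angle f t w z" and n: "num_small_at w f = 0" "num_demanding w = 2"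
  shows "demanding (other f {w, t})" "num_small_at w (other f {w, t}) = 1" "demanding (other f {w, z})" "num_small_at w (other f {w, z}) = 1"
proof -
  have d4: "deg w = 4" using fourD[OF w] by blast
  note fa = angleD[OF a]
  obtain p q k where N: "angle (other f {w, z}) z w p" "angle (other f {w, t}) t w q" "angle k p w q"
    "other f {w, t} \<noteq> other f {w, z}" "k \<noteq> f" "k \<noteq> other f {w, t}" "k \<noteq> other f {w, z}"
    "other (other f {w, z}) {w, p} = k" "other (other f {w, t}) {w, q} = k"
    "\<And>g. g \<in> F \<Longrightarrow> w \<in> vs g \<Longrightarrow> g = f \<or> g = other f {w, t} \<or> g = other f {w, z} \<or> g = k"
    by (rule four_struct[OF d4 a]) (rule that)
  define g h where "g = other f {w, z}" and "h = other f {w, t}"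
  note N = N[folded g_def h_def]
  note ga = angleD[OF N(1)] and ha = angleD[OF N(2)] and ka = angleD[OF N(3)]
  have ok: "other k {w, p} = g" "other k {w, q} = h"
    using other_other[OF ga(1) ga(4)] other_other[OF ha(1) ha(4)] N(8,9) by simp_all
  have "num_small_at w f = of_bool (small h) + of_bool (small g)" using num_small_at_angle[OF a] by (simp add: g_def h_def)
  then have "num_small_at w k = 0" using num_small_at_angle[OF N(3)] ok n(1) by simp
  have sub: "{f \<in> F. w \<in> vs f \<and> num_small_at w f = 1 \<and> demanding f} \<subseteq> {g, h}"
  proof
    fix y assume y: "y \<in> {f \<in> F. w \<in> vs f \<and> num_small_at w f = 1 \<and> demanding f}"
    then have "y \<noteq> k" "y \<noteq> f" using \<open>num_small_at w k = 0\<close> n(1) by auto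
    then show "y \<in> {g, h}" using N(10)[of y] y by blast
  qed
  have "{f \<in> F. w \<in> vs f \<and> num_small_at w f = 1 \<and> demanding f} = {g, h}"
    by (rule card_subset_eq[OF _ sub]) (use n(2) N(4) in \<open>auto simp: num_demanding_def\<close>)
  then show "demanding (other f {w, t})" "num_small_at w (other f {w, t}) = 1" "demanding (other f {w, z})" "num_small_at w (other f {w, z}) = 1"
    unfolding g_def[symmetric] h_def[symmetric] by blast+
qed

lemma four_big: "four v \<Longrightarrow> big v"
  using fourD[of v] three_not_four[of v] by (auto simp: big_def)

text \<open>At the 3-vertex \<open>t\<close> the triangle beyond \<open>{t, t1}\<close> has the
  third edge of \<open>t\<close> on its boundary, so it also borders the face \<open>f\<close>
  beyond \<open>{t, w}\<close>. This carries triangles from one face to the next.\<close>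

lemma third_T_edge:
  assumes "three t" "angle p w t t1" "T_edge p {t, t1}" "other p {t, w} = f"
  obtains t' where "facial (other p {t, t1}) [t1, t, t']" "angle f w t t'" "T_edge f {t, t'}" "other f {t, t'} = other p {t, t1}"
    "{y. A t y} = {w, t1, t'}" "t' \<noteq> w" "t' \<noteq> t1" "other (other p {t, t1}) {t, t'} = f" "f \<noteq> other p {t, t1}"
proof -
  have d3: "deg t = 3" using threeD[OF assms(1)] by blast
  note T = T_edgeD[OF assms(3)]
  obtain c where c: "{y. A t y} = {w, t1, c}" "c \<noteq> w" "c \<noteq> t1" "angle (other p {t, t1}) t1 t c" "angle f w t c"
    "f \<noteq> other p {t, t1}" "other (other p {t, t1}) {t, c} = f" "other f {t, c} = other p {t, t1}"
    by (rule three_struct[OF d3 assms(2), unfolded assms(4)]) (rule that)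
  note ca = angleD[OF c(4)] and cf = angleD[OF c(5)]
  obtain c' where c': "facial (other p {t, t1}) [t1, t, c']" using tri_vertices[OF T(3,4) ca(3)] by blast
  have "angle (other p {t, t1}) t1 t c'" using facial3[OF c'] by blast
  then have "c = t1 \<or> c = c'" by (rule angle_unique[OF _ ca(4)])
  then have "c = c'" using c(3) by blast
  moreover have "T_edge f {t, c}" using T cf c(8) by (simp add: T_edge_def)
  ultimately show ?thesis using that c c' by blast
qed

lemma payer_nbr:
  assumes w: "four w" "\<not> in_triangle w" and a: "angle f t w z" "\<not> small f" and n: "num_small_at w f = 0" "num_demanding w = 2"
  obtains t1 l3 l4 l5 l6 l7 t' where "demanding (other f {w, t})" "facial (other f {w, t}) [w,t,t1,l3,l4,l5,l6,l7]"
    "{e. T_edge (other f {w, t}) e} = {{t, t1}, {l5, l6}}"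
    "\<And>y. y \<in> {t,t1,l3,l4,l5,l6,l7} \<Longrightarrow> three y \<and> \<not> rich y"
    "facial (other (other f {w, t}) {t, t1}) [t1, t, t']" "angle f w t t'" "T_edge f {t, t'}" "other f {t, t'} = other (other f {w, t}) {t, t1}"
    "{y. A t y} = {w, t1, t'}" "t' \<noteq> w" "t' \<noteq> t1"
proof -
  define p where "p = other f {w, t}"
  note fa = angleD[OF a(1)]
  have Dp: "demanding p" using payer_struct(1)[OF w(1) a(1) n] by (simp add: p_def)
  note op = other[OF fa(1) fa(5), folded p_def]
  have opf: "other p {w, t} = f" using other_other[OF fa(1) fa(5)] by (simp add: p_def)
  then have opf': "other p {t, w} = f" by (simp add: insert_commute)
  have lp: "len p = 8" using Dp by (simp add: demanding_def)
  obtain l7 where "angle p t w l7" using edge_angle[OF op(1) op(3)] by blast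
  then have l7: "angle p l7 w t" by (rule angle_sym)
  obtain t1 l3 l4 l5 l6 where "facial p [l7,w,t,t1,l3,l4,l5,l6]" by (rule angle_facial8[OF l7 lp])
  then have l: "facial p [w,t,t1,l3,l4,l5,l6,l7]" using facial_rot[of p l7 "[w,t,t1,l3,l4,l5,l6]"] by simp
  note m = facial8[OF l]
  have nt: "\<not> T_edge p {l7, w}" using in_triangle_T_edge[of p "{l7, w}" w] w(2) by blast
  have ns: "\<not> small (other p {w, t})" using opf a(2) by simp
  note al = demanding_alternate[OF Dp l four_big[OF w(1)] ns nt]
  have T: "T_edge p {t, t1}" using al(1) by blast
  have t3: "three t" using al(2) by blast
  obtain t' where t': "facial (other p {t, t1}) [t1, t, t']" "angle f w t t'" "T_edge f {t, t'}" "other f {t, t'} = other p {t, t1}"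
    "{y. A t y} = {w, t1, t'}" "t' \<noteq> w" "t' \<noteq> t1"
    by (rule third_T_edge[OF t3 m(2) T opf']) (rule that)
  show ?thesis by (rule that[folded p_def, OF Dp l al t'])
qed

text \<open>Take \<open>f\<close>, the demanding face \<open>p\<close> beyond \<open>{w, t}\<close>
  and the triangle \<open>S\<close> at the other neighbour \<open>z\<close> of \<open>w\<close>;
  delete \<open>t\<close> and save \<open>w\<close>. Deleting \<open>t\<close> opens both
  \<open>f\<close> and \<open>p\<close>, but the triangle with an ear from \<open>z\<close> through
  \<open>w\<close>, the rest of \<open>p\<close> and the rest of \<open>f\<close> to
  \<open>z'\<close> is still 2-connected, and \<open>z\<close> has degree 3 in it.\<close>

lemma reducible_two_demanding:
  assumes w: "four w" "\<not> in_triangle w" and f: "f \<in> F" "w \<in> vs f" "len f = 8" "num_big f = 1" and n: "num_small_at w f = 0" "num_demanding w = 2"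
  shows False
proof -
  have sf: "\<not> small f" using f(3) by (simp add: small_def)
  obtain t z where a: "angle f t w z" using vs_angle f by blast
  have a': "angle f z w t" using angle_sym[OF a] .
  obtain t1 l3 l4 l5 l6 l7 t' where P: "demanding (other f {w, t})" "facial (other f {w, t}) [w,t,t1,l3,l4,l5,l6,l7]"
    "{e. T_edge (other f {w, t}) e} = {{t, t1}, {l5, l6}}"
    "\<And>y. y \<in> {t,t1,l3,l4,l5,l6,l7} \<Longrightarrow> three y \<and> \<not> rich y"
    "facial (other (other f {w, t}) {t, t1}) [t1, t, t']" "angle f w t t'" "T_edge f {t, t'}" "other f {t, t'} = other (other f {w, t}) {t, t1}"
    "{y. A t y} = {w, t1, t'}" "t' \<noteq> w" "t' \<noteq> t1"
    by (rule payer_nbr[OF w a sf n]) (rule that)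
  obtain z1 k3 k4 k5 k6 k7 z' where Q: "demanding (other f {w, z})" "facial (other f {w, z}) [w,z,z1,k3,k4,k5,k6,k7]"
    "{e. T_edge (other f {w, z}) e} = {{z, z1}, {k5, k6}}"
    "\<And>y. y \<in> {z,z1,k3,k4,k5,k6,k7} \<Longrightarrow> three y \<and> \<not> rich y"
    "facial (other (other f {w, z}) {z, z1}) [z1, z, z']" "angle f w z z'" "T_edge f {z, z'}" "other f {z, z'} = other (other f {w, z}) {z, z1}"
    "{y. A z y} = {w, z1, z'}" "z' \<noteq> w" "z' \<noteq> z1"
    by (rule payer_nbr[OF w a' sf n]) (rule that)
  define p where "p = other f {w, t}"
  define S where "S = other f {z, z'}"
  define T where "T = other f {t, t'}"
  note P = P[folded p_def, folded P(8)[folded p_def], folded T_def]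
  note Q = Q[folded Q(8), folded S_def]
  note fa = angleD[OF a]
  note pm = facial8[OF P(2)] and pe = facial8_adj[OF P(2)]
  note S3 = facial3[OF Q(5)] and SA = facial3_adj[OF Q(5)] and T3 = facial3[OF P(5)]
  have sS: "small S" and sp: "\<not> small p" using S3 pm(11) by (simp_all add: small_def)
  have pf: "p \<noteq> f" using other(2)[OF fa(1) fa(5)] by (simp add: p_def)
  have wS: "w \<notin> vs S" "w \<notin> vs T" using w(2) SA(7) S3 T3 facial_F[OF P(5)] unfolding in_triangle_def by blast+
  obtain f4 f5 f6 f7 f3 where l: "facial f [t,w,z,f3,f4,f5,f6,f7]" by (rule angle_facial8[OF a f(3)])
  note fm0 = facial8[OF l]
  have "f3 = z'" using angle_unique[OF Q(6), of f3] angleD[OF fm0(3)] fm0(9) by auto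
  moreover have "f7 = t'" using angle_unique[OF P(6), of f7] angleD[OF fm0(1)] fm0(9) by auto
  ultimately have l: "facial f [t,w,z,z',f4,f5,f6,t']" using l by simp
  note fm = facial8[OF l] and fe = facial8_adj[OF l]
  have f3: "three y" if "y \<in> vs f" "y \<noteq> w" for y using num_big_1[OF f(1,4,2) four_big[OF w(1)] that] .
  have p3: "three y" if "y \<in> vs p" "y \<noteq> w" for y using P(4) that pm(10) by auto
  have zp: "z \<notin> vs p"
  proof
    assume zp: "z \<in> vs p"
    have "z = l7 \<or> z = t" using chord_angle8[OF pm(1) pm(11) zp] fe by blast
    then have "angle p t w z" using angle_sym[OF pm(1)] fm(9) by auto
    then show False using two_edges[OF a, of p] pf fourD[OF w(1)] by simp
  qed
  have TS: "T \<noteq> S"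
  proof
    assume "T = S"
    then have "{t1, t, t'} = {z1, z, z'}" using T3 S3 by simp
    then have "z \<in> {t1, t, t'}" "z' \<in> {t1, t, t'}" by blast+
    then show False using fm(9) by auto
  qed
  have z1f: "z1 \<notin> vs f"
  proof
    assume "z1 \<in> vs f"
    then have "z1 = w \<or> z1 = z'" using chord_angle8[OF Q(6) f(3)] SA by blast
    then show False using Q(11) wS S3 by auto
  qed
  define X where "X = other S {z', z1}"
  have eX: "{z', z1} \<in> bd S" "{z1, z'} \<in> bd S" "{z, z1} \<in> bd S"
    using angleD(3,5)[of S z' z1 z] angleD(5)[of S z1 z z'] S3 by blast+
  note oX = other[OF SA(7) eX(1), folded X_def]
  have Xv: "z' \<in> vs X" "z1 \<in> vs X" using oX(3) by (auto simp: vs_def)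
  have three: "three z'" "three z1" using f3[of z'] fm Q(4) by auto
  have Sf: "S \<noteq> f" "S \<noteq> p" using sS sf sp by auto
  define p2 where "p2 = other f {w, z}"
  have z1p2: "z1 \<in> vs p2" "p2 \<in> F" "z \<in> vs p2" "p2 \<noteq> S" using facial8[OF Q(2)] facial_F[OF Q(2)] sS by (auto simp: p2_def small_def)
  have p2X: "p2 \<noteq> X"
  proof
    assume eq: "p2 = X"
    have "{z, z1} \<in> bd p2" using facial8(12)[OF Q(2)] by (simp add: p2_def)
    moreover have "{z1, z'} \<in> bd p2" using oX(3) eq by (simp add: insert_commute)
    moreover have "z \<noteq> z'" using fm(9) by simp
    ultimately have "angle p2 z z1 z'" "angle S z z1 z'" unfolding angle_def using eX z1p2(2) SA(7) by blast+
    then have "deg z1 = 2" using two_edges z1p2(4) by blast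
    then show False using threeD[OF three(2)] by simp
  qed
  \<comment> \<open>If \<open>p\<close> touched the triangle at \<open>z'\<close> or
    \<open>z1\<close>, it would be the third face at that 3-vertex, the one beyond
    \<open>{z', z1}\<close>.\<close>
  have pX: "p = X" if "z' \<in> vs p \<or> z1 \<in> vs p"
    using that
  proof
    assume z: "z' \<in> vs p"
    have Xf: "X \<noteq> f" using Xv z1f by auto
    show "p = X"
      using face3[OF three(1) SA(7) _ f(1) _ _ oX(1) Xv(1) _ _ pe(17) z] S3 fm Sf pf Xf oX(2) by auto
  next
    assume z: "z1 \<in> vs p"
    have "p \<noteq> p2" using zp z1p2 by auto
    then show "p = X"
      using face3[OF three(2) SA(7) _ z1p2(2,1) _ oX(1) Xv(2) _ _ pe(17) z] S3 Sf p2X z1p2 oX(2) by auto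
  qed
  have pS: "vs p \<inter> vs S = {}"
  proof (rule ccontr)
    assume "vs p \<inter> vs S \<noteq> {}"
    then have eq: "p = X" using pX zp S3 by auto
    have oS: "other p {z', z1} = S" using other_other[OF SA(7) eX(1)] eq by (simp add: X_def)
    have "x \<notin> vs S" using T_edgeD(5)[OF Q(7)] by (simp add: S_def)
    then have "T_edge p {z', z1}" using oX(1,3) oS S3 eq by (simp add: T_edge_def)
    then have "{z', z1} \<in> {e. T_edge p e}" by simp
    then have zz: "{z', z1} \<in> {{t, t1}, {l5, l6}}" unfolding P(3) .
    have "{z', z1} \<noteq> {t, t1}"
    proof
      assume "{z', z1} = {t, t1}"
      then have "t \<in> vs S" using S3 by auto
      then have "t \<in> {z1, z, z'}" using S3 by auto
      then have "t = z1" using fm(9) by auto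
      then show False using z1f fm(10) by auto
    qed
    then have "{z', z1} = {l5, l6}" using zz by simp
    \<comment> \<open>Then \<open>z\<close> is adjacent to \<open>l5\<close>, and
      \<open>w, z, l5, l4, l3, t1, t\<close> is a 7-cycle.\<close>
    then have "l5 = z1 \<or> l5 = z'" by (auto simp: doubleton_eq_iff)
    then have zl: "A z l5" using SA by auto
    have "distinct [w, z, l5, l4, l3, t1, t]" using pm(9,10) zp fm(9) by auto
    then show False using no_7_cycle[OF fe(2) zl pe(13) pe(12) pe(11) pe(10) pe(9)] by simp
  qed
  let ?S = "vs p \<union> vs f \<union> vs S"
  have Nw: "{y \<in> ?S. A w y} = {t, z, l7}"
  proof
    show "{t, z, l7} \<subseteq> {y \<in> ?S. A w y}" using pm pe fe fm by auto
    show "{y \<in> ?S. A w y} \<subseteq> {t, z, l7}"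
    proof
      fix y assume y: "y \<in> {y \<in> ?S. A w y}"
      moreover have "z \<in> vs f" by (rule fa)
      ultimately consider "y \<in> vs p" | "y \<in> vs f" | "y \<in> vs S" "y \<noteq> z" by blast
      then show "y \<in> {t, z, l7}"
      proof cases
        case 1 then show ?thesis using chord_angle8[OF pm(1) pm(11)] y by blast
      next
        case 2 then show ?thesis using chord_angle8[OF a f(3)] y by blast
      next
        case 3
        have "A z y" using tri_adj(1)[OF SA(7) _ _ 3(1), of z] S3 3 by auto
        then have "w \<in> vs S" using tri_at(1)[OF SA(7) _ _ _ _, of z w y] S3 fe(10) y by auto
        then show ?thesis using wS by blast
      qed
    qed
  qed
  have tS: "t \<notin> vs S" using pS pm(10) by auto
  have fS: "vs f \<inter> vs S = {z, z'}" using S3 fm(10) z1f by auto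
  let ?Y = "(vs p - {t}) \<union> set [f4, f5, f6, t']"
  \<comment> \<open>The edge from \<open>t1\<close> to \<open>t'\<close> in the triangle at
    \<open>t\<close> bypasses the deleted vertex \<open>t\<close> and joins the rests of
    \<open>p\<close> and \<open>f\<close>.\<close>
  have wY: "w \<in> vs p - {t}" using pm(9,10) by auto
  have "conn ?Y"
  proof (rule conn_Un[OF conn_del[OF pe(17)]])
    show "conn (set [f4, f5, f6, t'])" by (rule conn_path) (use fe EA_iff in auto)
    have "t1 \<in> vs p - {t}" using pm(9,10) by auto
    moreover have "A t1 t'" using facial3_adj[OF P(5)] by simp
    ultimately show "(vs p - {t}) \<inter> set [f4, f5, f6, t'] \<noteq> {} \<or> (\<exists>s\<in>vs p - {t}. \<exists>u\<in>set [f4, f5, f6, t']. A s u)" by auto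
  qed
  moreover have "w \<in> ?Y" "f4 \<in> ?Y" using wY by auto
  ultimately obtain ys where ys: "distinct ys" "ys \<noteq> []" "pedges ys \<subseteq> EA" "set ys \<subseteq> ?Y" "hd ys = w" "last ys = f4"
    using conn_path_exists[of ?Y w f4] by metis
  have YS: "?Y \<inter> vs S = {}"
  proof -
    have "set [f4, f5, f6, t'] \<inter> vs S = {}"
    proof -
      have "set [f4, f5, f6, t'] \<subseteq> vs f - {z, z'}" using fm(9,10) by auto
      then show ?thesis using fS by blast
    qed
    then show ?thesis using pS by blast
  qed
  have tY: "t \<notin> ?Y" using fm(9) by auto
  let ?B = "vs S \<union> set ys"
  have bB: "biconn ?B"
  proof (rule biconn_ear[OF face_biconn[OF SA(7)] ys(1-3), of z z'])
    show "set ys \<inter> vs S = {}" using ys(4) YS by blast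
    show "z \<in> vs S" "z' \<in> vs S" using S3 by auto
    show "z \<noteq> z'" using fm(9) by simp
    show "A z (hd ys)" "A z' (last ys)" using ys(5,6) fe by auto
  qed
  have wB: "w \<in> set ys" using ys(2,5) by (metis hd_in_set)
  show False
  proof (rule reducible_save[of ?S t w ?B z])
    show "?S \<subseteq> U - {x}"
    proof
      fix y assume y: "y \<in> ?S"
      have "y \<in> vs S \<Longrightarrow> three y" using S3 three f3[of z] fm by auto
      then have "three y \<or> four y" using f3 p3 w y by blast
      then show "y \<in> U - {x}" using threeD fourD by auto
    qed
    show "t \<in> ?S" "w \<in> ?S" using pm by auto
    show "deg t = 3" using f3[of t] fm(9,10) threeD by auto
    show "y \<in> ?S" if "A t y" for y
    proof -
      have "y \<in> {w, t1, t'}" unfolding P(9)[symmetric] using that by simp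
      then show ?thesis using pm(10) fm(10) by auto
    qed
    show "A t w" by (rule fe)
    show "deg w = 4" using fourD[OF w(1)] by simp
    have "l7 \<noteq> z" using zp pm(10) by auto
    then show "d w ?S = 3" unfolding d_def Nw using fm(9) pm(9) by (auto simp: card_insert_if)
    show "deg y = 3" if "y \<in> ?S" "y \<noteq> w" for y
    proof -
      have "y \<in> vs S \<Longrightarrow> three y" using S3 three f3[of z] fm by auto
      then show ?thesis using f3 p3 that threeD by blast
    qed
    show "conn (?S - {t})"
    proof -
      have "conn ((vs p - {t}) \<union> (vs f - {t}))"
        by (rule conn_Un[OF conn_del[OF pe(17)] conn_del[OF f(1)]]) (use wY fm in auto)
      then have "conn ((vs p - {t}) \<union> (vs f - {t}) \<union> (vs S - {t}))"
        by (rule conn_Un[OF _ conn_del[OF SA(7)]]) (use fS fm(9) tS in auto)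
      then show ?thesis by (simp add: Un_Diff)
    qed
    have "?Y \<subseteq> ?S - {t}" using tY fm(10) by auto
    then show "?B \<subseteq> ?S - {t}" using ys(4) tS by blast
    show "biconn ?B" by (rule bB)
    show "z \<in> ?B" using S3 by auto
    have "finite ?B" using fin_vs[OF SA(7)] by simp
    then have "card {w, z1, z'} \<le> d z ?B" unfolding d_def using S3 SA wB fe by (intro card_mono) auto
    moreover have "card {w, z1, z'} = 3" using Q(10,11) wS S3 by (auto simp: card_insert_if)
    ultimately show "3 \<le> d z ?B" by simp
  qed
qed

section \<open>Short faces beside a root triangle\<close>

lemma root_h:
  assumes r: "root_side T g h u u' v" and a: "angle g v u m"
  shows "other g {u, m} = h" "angle h m u u'" "three m" "{y. A u y} = {v, m, u'}" "m \<notin> vs T" "m \<noteq> u'"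
proof -
  note R = root_sideD[OF r]
  have d3: "deg u = 3" using threeD[OF R(17)] by blast
  have ou: "other g {u, v} = T" by (rule R)
  obtain c where c: "{y. A u y} = {v, m, c}" "c \<noteq> v" "c \<noteq> m" "angle (other g {u, m}) m u c" "angle T v u c"
    "T \<noteq> other g {u, m}" "other (other g {u, m}) {u, c} = T" "other T {u, c} = other g {u, m}"
    by (rule three_struct[OF d3 a, unfolded ou]) (rule that)
  have "c = u' \<or> c = v" by (rule angle_unique[OF R(10) angleD(4)[OF c(5)]])
  then have cu: "c = u'" using c(2) by blast
  show h: "other g {u, m} = h" using c(8) R(13) unfolding cu by simp
  show "{y. A u y} = {v, m, u'}" "m \<noteq> u'" using c(1,3) unfolding cu by blast+
  show a': "angle h m u u'" using c(4) unfolding cu h .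
  show "three m" by (rule R(25)[OF angleD(16)[OF a']])
  show "m \<notin> vs T" unfolding R(11) using angleD(2,12)[OF a] \<open>m \<noteq> u'\<close> by blast
qed

lemma root_T_edge: "root_side T g h u u' v \<Longrightarrow> T_edge g {u, v}"
  using root_sideD[of T g h u u' v] by (simp add: T_edge_def)

text \<open>If the third vertex of the second triangle of \<open>g\<close> were a 3-vertex, this
  triangle could serve as \<open>D\<close> in \<open>reducible_root\<close>.\<close>

lemma root_T2:
  assumes r: "root_side T g h u u' v" and sg: "short g" and t: "T_edge g {p, q}" "v \<notin> {p, q}"
    and v2: "v2 \<in> vs (other g {p, q})" "v2 \<notin> {p, q}"
  shows "big v2" "other g {p, q} \<noteq> T" "three p" "three q"
proof -
  note R = root_sideD[OF r] and T2 = T_edgeD[OF t(1)]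
  have g: "len g = 8" "num_big g = 1" using sg by (auto simp: short_def)
  have vg: "v \<in> vs g" using edge_vs[OF R(16)] by auto
  have pq: "p \<in> vs g" "q \<in> vs g" using edge_vs[OF T2(2)] by auto
  have g3: "three y" if "y \<in> vs g" "y \<noteq> v" for y using num_big_1[OF R(5) g(2) vg R(29) that] .
  show p3: "three p" "three q" using g3 pq t(2) by auto
  have ne: "{u, v} \<noteq> {p, q}" using t(2) by auto
  have far: "\<not> A v p" using T_edge_far(2)[OF root_T_edge[OF r] t(1) ne, of v p] by blast
  show nT: "other g {p, q} \<noteq> T"
  proof
    assume eq: "other g {p, q} = T"
    have "p \<in> vs T" using edge_vs(1)[OF T2(6)] eq by simp
    moreover have "v \<in> vs T" using R(11) by simp
    ultimately have "A v p" using tri_adj(1)[OF R(1,2)] t(2) by blast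
    then show False using far by blast
  qed
  obtain c where c: "facial (other g {p, q}) [p, q, c]" by (rule tri_vertices[OF T2(3,4,6)])
  note c3 = facial3[OF c]
  have cv: "c = v2" using v2 c3 by auto
  show "big v2"
  proof (rule ccontr)
    assume "\<not> big v2"
    moreover have "v2 \<in> U" by (rule vs_U[OF T2(3) v2(1)])
    ultimately have v3: "three v2" by (simp add: big_def)
    show False
    proof (rule reducible_root[OF r g T2(3,8) nT _ _ T2(6,2)])
      fix y assume y: "y \<in> vs (other g {p, q})"
      then have "y \<in> {p, q, v2}" using c3 cv by simp
      then show "three y" using p3 v3 by blast
      have "v \<in> vs T" using R(11) by simp
      then show "\<not> A v y" by (rule tri_faces_far(2)[OF R(1,2) T2(3,4) nT[symmetric] _ y])
    qed
  qed
qed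

text \<open>The configuration of a red donor: a 4-face touches \<open>g\<close> and \<open>h\<close>
  in consecutive edges at \<open>m\<close>. Its vertex \<open>c2\<close> is big, since otherwise the
  4-face and \<open>h\<close> would be two adjacent faces with 3-vertices only.\<close>

lemma red_configD:
  assumes r: "root_side T g h u u' v" and sg: "short g" and l: "facial g [v,u,m,c,y,p,q,s]"
    and Q: "facial (other g {m, c}) [m,c,c2,m2]"
  shows "three m" "three c" "three y" "angle h u m m2" "three m2" "big c2" "angle (other g {c, y}) c2 c y"
    "other (other g {c, y}) {c, c2} = other g {m, c}" "c \<notin> vs h" "other (other g {c, y}) {c, y} = g"
    "other g {c, y} \<noteq> other g {m, c}" "other (other g {m, c}) {m2, m} = h" "len (other g {m, c}) = 4"
    "other g {c, y} \<in> F" "other (other g {m, c}) {c2, c} = other g {c, y}"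
    "\<And>z. z \<in> {u, m, c, y, p, q, s} \<Longrightarrow> three z"
proof -
  note R = root_sideD[OF r]
  have g: "len g = 8" "num_big g = 1" using sg by (auto simp: short_def)
  note m = facial8[OF l] and e = facial8_adj[OF l]
  note num_quad_at = facial4[OF Q] and qA = facial4_adj[OF Q]
  let ?Q = "other g {m, c}" and ?Z = "other g {c, y}"
  have vg: "v \<in> vs g" using edge_vs[OF R(16)] by auto
  show g3: "three z" if "z \<in> {u, m, c, y, p, q, s}" for z
    using num_big_1[OF R(5) g(2) vg R(29), of z] that m(9,10) by auto
  then show th: "three m" "three c" "three y" by blast+
  note rh = root_h[OF r m(2)]
  have cm: "{c, m} = {m, c}" "{m, u} = {u, m}" by auto
  have oh: "other g {m, u} = h" using rh(1) cm by simp
  have d3: "deg m = 3" "deg c = 3" using threeD th by blast+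
  obtain c' where c': "{y. A m y} = {u, c, c'}" "c' \<noteq> u" "c' \<noteq> c" "angle ?Q c m c'" "angle h u m c'"
    "h \<noteq> ?Q" "other ?Q {m, c'} = h" "other h {m, c'} = ?Q"
    by (rule three_struct[OF d3(1) m(3), unfolded oh]) (rule that)
  have "angle ?Q m2 m c" using num_quad_at by blast
  then have "c' = m2 \<or> c' = c" by (rule angle_unique[OF _ angleD(4)[OF c'(4)]])
  then have kept: "c' = m2" using c'(3) by blast
  show hm: "angle h u m m2" using c'(5) kept by simp
  show m23: "three m2" by (rule R(25)[OF angleD(18)[OF hm]])
  show o1: "other ?Q {m2, m} = h" using c'(7) kept by (simp add: insert_commute)
  obtain c'' where c'': "{z. A c z} = {m, y, c''}" "c'' \<noteq> m" "c'' \<noteq> y" "angle ?Z y c c''" "angle ?Q m c c''"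
    "?Q \<noteq> ?Z" "other ?Z {c, c''} = ?Q" "other ?Q {c, c''} = ?Z"
    by (rule three_struct[OF d3(2) m(4), unfolded cm]) (rule that)
  have "angle ?Q m c c2" using num_quad_at by blast
  then have "c'' = m \<or> c'' = c2" by (rule angle_unique[OF _ angleD(4)[OF c''(5)]])
  then have cc': "c'' = c2" using c''(2) by blast
  show Za: "angle ?Z c2 c y" using c''(4) cc' angle_sym by simp
  show "other ?Z {c, c2} = ?Q" "?Z \<noteq> ?Q" "other ?Q {c2, c} = ?Z" using c''(6,7,8) cc' by (auto simp: insert_commute)
  have cy: "{c, y} \<in> bd g" by (rule angleD(4)[OF m(4)])
  show "other ?Z {c, y} = g" "?Z \<in> F" using other_other[OF R(5) cy] other(1)[OF R(5) cy] by auto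
  show "len ?Q = 4" using num_quad_at by blast
  have "\<not> three c2"
  proof
    assume c3: "three c2"
    have e1: "{m, m2} \<in> bd h" by (rule angleD(4)[OF hm])
    have e2: "{m, m2} \<in> bd ?Q" using angleD(4)[OF c'(4)] kept by simp
    have all: "three z" if "z \<in> vs ?Q" for z
    proof -
      have "z \<in> {m,c,c2,m2}" using that num_quad_at by simp
      then show ?thesis using th m23 c3 by blast
    qed
    show False by (rule reducible_theta[OF R(4) R(25) qA(9) all e1 e2 c'(6)])
  qed
  moreover have "c2 \<in> U" by (rule angleD(13)[OF Za])
  ultimately show cb: "big c2" by (simp add: big_def)
  show "c \<notin> vs h"
  proof
    assume ch: "c \<in> vs h"
    have nZ: "h \<noteq> ?Z" using R(25)[of c2] angleD(16)[OF Za] cb by (auto simp: big_def)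
    have "h = g \<or> h = ?Q \<or> h = ?Z"
      by (rule face3[OF th(2) R(5) angleD(18)[OF m(3)] qA(9) angleD(16)[OF c'(4)] _ _ angleD(17)[OF Za] _ _ R(4) ch])
        (use other(2)[OF R(5) angleD(4)[OF m(3)]] other(2)[OF R(5) cy] other(1)[OF R(5) cy] c''(6) in auto)
    then show False using R(21) c'(6) nZ by blast
  qed
qed

text \<open>The face beyond \<open>{c, y}\<close> is to be charged at \<open>y\<close>, so it must
  not have lost a unit at \<open>c2\<close> as well. Such a loss would go to a demanding face beyond
  \<open>{c2, m2}\<close>. By alternation that face has a triangle at the neighbour
  \<open>l6\<close> of \<open>m2\<close>, which is on \<open>h\<close>; the third vertex of the
  triangle is on \<open>h\<close> too, contrary to \<open>reducible_theta\<close>.\<close>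

lemma red_no_pull:
  assumes r: "root_side T g h u u' v" and sg: "short g" and l: "facial g [v,u,m,c,y,p,q,s]"
    and Q: "facial (other g {m, c}) [m,c,c2,m2]" and f: "four c2" "\<not> in_triangle c2"
    and n: "num_small_at c2 (other g {c, y}) = 1" and nD: "\<not> demanding (other g {c, y})"
  shows "num_demanding c2 \<noteq> 1"
proof
  assume D: "num_demanding c2 = 1"
  note R = root_sideD[OF r] and X = red_configD[OF r sg l Q]
  note num_quad_at = facial4[OF Q] and qA = facial4_adj[OF Q]
  define K where "K = other g {m, c}"
  define Z where "Z = other g {c, y}"
  note X = X[folded K_def Z_def] and num_quad_at = num_quad_at[folded K_def] and qA = qA[folded K_def]
  have a: "angle K c c2 m2" using num_quad_at by blast
  note Ka = angleD[OF a]
  have sK: "small K" using X(13) by (simp add: small_def)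
  have d4: "deg c2 = 4" using fourD[OF f(1)] by blast
  define P where "P = other K {c2, m2}"
  note oP = other[OF Ka(1) Ka(4), folded P_def]
  obtain p' q' k where N: "angle P m2 c2 p'" "angle Z c c2 q'" "angle k p' c2 q'"
    "Z \<noteq> P" "k \<noteq> K" "k \<noteq> Z" "k \<noteq> P" "other P {c2, p'} = k" "other Z {c2, q'} = k"
    "\<And>g. g \<in> F \<Longrightarrow> c2 \<in> vs g \<Longrightarrow> g = K \<or> g = Z \<or> g = P \<or> g = k"
    by (rule four_struct[OF d4 a, unfolded X(15) P_def[symmetric]]) (rule that)
  note Pa = angleD[OF N(1)] and Za = angleD[OF N(2)] and ka = angleD[OF N(3)]
  have oZ: "other Z {c2, c} = K" using X(8) by (simp add: insert_commute)
  have oPK: "other P {c2, m2} = K" using other_other[OF Ka(1) Ka(4)] by (simp add: P_def)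
  have nk: "\<not> small k" using num_small_at_angle[OF N(2)] oZ N(9) sK n unfolding Z_def by simp
  have nP: "\<not> small P"
    using no_two_small[of c2 K m2 P] fourD[OF f(1)] Ka(1,4) oP sK by auto
  have nZ: "\<not> small Z"
    using no_two_small[of c2 K c Z] fourD[OF f(1)] Ka(1,5) Za(1,5) X(11) sK by auto
  have ok: "other k {c2, p'} = P" "other k {c2, q'} = Z"
    using other_other[OF Pa(1) Pa(4)] other_other[OF Za(1) Za(4)] N(8,9) by simp_all
  have "num_small_at c2 k = 0" using num_small_at_angle[OF N(3)] ok nP nZ by simp
  moreover have "{f \<in> F. c2 \<in> vs f \<and> num_small_at c2 f = 1 \<and> demanding f} \<noteq> {}" using D unfolding num_demanding_def by (metis card.empty zero_neq_one)
  then obtain P' where P': "P' \<in> F" "c2 \<in> vs P'" "num_small_at c2 P' = 1" "demanding P'" by blast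
  have "\<not> demanding K" using X(13) by (simp add: demanding_def)
  then have "P' = P" using N(10)[OF P'(1,2)] P'(3,4) nD calculation unfolding Z_def by auto
  then have DP: "demanding P" using P' by simp
  have lP: "len P = 8" using DP by (simp add: demanding_def)
  obtain l2 l3 l4 l5 l6 where "facial P [m2,c2,p',l2,l3,l4,l5,l6]" by (rule angle_facial8[OF N(1) lP])
  then have l: "facial P [c2,p',l2,l3,l4,l5,l6,m2]" using facial_rot[of P m2 "[c2,p',l2,l3,l4,l5,l6]"] by simp
  have n1: "\<not> small (other P {c2, p'})" using N(8) nk by simp
  have n2: "\<not> T_edge P {m2, c2}" using in_triangle_T_edge[of P "{m2, c2}" c2] f(2) by blast
  note al = demanding_alternate[OF DP l four_big[OF f(1)] n1 n2]
  note lm = facial8[OF l]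
  have a6: "angle P m2 l6 l5" using angle_sym[OF lm(7)] .
  have T: "T_edge P {l6, l5}" using al(1) by (metis (mono_tags) insert_commute insertI1 insertI2 mem_Collect_eq)
  have t6: "three l6" "three l5" using al(2) by blast+
  have d2: "deg m2 = 3" using threeD[OF X(5)] by blast
  have ea: "angle K c2 m2 m" using num_quad_at by blast
  have mm: "{m2, c2} = {c2, m2}" by auto
  have P2: "other K {m2, c2} = P" by (simp add: P_def mm)
  obtain m3 where m3: "angle h m m2 m3" "angle P c2 m2 m3" "other P {m2, m3} = h"
    by (rule three_struct[OF d2 ea, unfolded X(12) P2]) (rule that)
  have "m3 = l6"
    using angle_unique[OF lm(8), of m3] angleD(2,4)[OF m3(2)] by auto
  then have oh: "other P {l6, m2} = h" using m3(3) by (simp add: insert_commute)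
  obtain t' where t': "facial (other P {l6, l5}) [l5, l6, t']" "angle h m2 l6 t'" "other h {l6, t'} = other P {l6, l5}"
    by (rule third_T_edge[OF t6(1) a6 T oh]) (rule that)
  note TD = T_edgeD[OF T]
  have all: "three z" if "z \<in> vs (other P {l6, l5})" for z
  proof -
    have "z \<in> {l5, l6, t'}" using facial3[OF t'(1)] that by simp
    then show ?thesis using t6 R(25)[OF angleD(18)[OF t'(2)]] by blast
  qed
  have e1: "{l6, t'} \<in> bd h" by (rule angleD(4)[OF t'(2)])
  show False
    using reducible_theta[OF R(4) R(25) TD(3) all e1] other(2,3)[OF R(4) e1] t'(3) by metis
qed

text \<open>The one case in which the red donor \<open>Z\<close> could not afford its unit.
  Alternation from the rich vertex \<open>y\<close> fixes its two triangles, and the one at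
  \<open>z3\<close> has 3-vertices only. Delete \<open>m2\<close>, saving the 4-vertex
  \<open>c2\<close>, in the union of \<open>h\<close>, \<open>Z\<close> and this triangle.\<close>

lemma reducible_red:
  assumes r: "root_side T g h u u' v" and sg: "short g" and l: "facial g [v,u,m,c,y,p,q,s]"
    and Q: "facial (other g {m, c}) [m,c,c2,m2]" and ry: "rich y" and tpq: "T_edge g {p, q}" and sig: "num_big (other g {y, p}) = 1"
    and f: "four c2"
    and Zc: "len (other g {c, y}) = 8" "num_big (other g {c, y}) = 1" "num_T (other g {c, y}) = 2" "num_rich (other g {c, y}) = 1"
  shows False
proof -
  note R = root_sideD[OF r] and X = red_configD[OF r sg l Q]
  define K where "K = other g {m, c}"
  define Z where "Z = other g {c, y}"
  define \<sigma> where "\<sigma> = other g {y, p}"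
  note num_quad_at = facial4[OF Q, folded K_def] and qA = facial4_adj[OF Q, folded K_def]
  note X = X[folded K_def Z_def] and Zc = Zc[folded Z_def] and sig = sig[folded \<sigma>_def]
  note gm = facial8[OF l] and ge = facial8_adj[OF l]
  have g8: "len g = 8" by (rule gm)
  obtain z3 z4 z5 z6 z7 where lz: "facial Z [c2,c,y,z3,z4,z5,z6,z7]" by (rule angle_facial8[OF X(7) Zc(1)])
  note zm = facial8[OF lz] and ze = facial8_adj[OF lz]
  have sK: "small K" using X(13) by (simp add: small_def)
  have nsZ: "\<not> small Z" using Zc(1) by (simp add: small_def)
  have c2Z: "c2 \<in> vs Z" using zm(10) by simp
  have Z3: "three w" if "w \<in> vs Z" "w \<noteq> c2" for w using num_big_1[OF ze(17) Zc(2) c2Z X(6) that] .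
  obtain w0 where w0: "{v \<in> vs Z. rich v} = {w0}" using Zc(4) unfolding num_rich_def by (rule card_1_singletonE)
  have yZ: "y \<in> vs Z" using zm(10) by simp
  then have "w0 = y" using w0 ry by auto
  then have nr: "\<not> rich w" if "w \<in> vs Z" "w \<noteq> y" for w using w0 that by blast
  have zz: "three w \<and> \<not> rich w" if "w \<in> {z3,z4,z5,z6,z7}" for w
    using Z3[of w] nr[of w] that zm(9,10) by auto
  note alt = three_alt[OF _ _ _ nsZ]
  have cm: "{b, a} = {a, b}" for a b :: 'a by (rule insert_commute)
  have 2: "\<not> small (other Z {y, z3})" using rich_iff[OF X(3) zm(3) nsZ] ry by blast
  have 3: "small (other Z {z3, z4})" using alt[OF _ _ zm(4)] zz[of z3] 2 cm[of z3 y] by simp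
  have 4: "\<not> small (other Z {z4, z5})" using alt[OF _ _ zm(5)] zz[of z4] 3 cm[of z4 z3] by simp
  have 5: "small (other Z {z5, z6})" using alt[OF _ _ zm(6)] zz[of z5] 4 cm[of z5 z4] by simp
  have 6: "\<not> small (other Z {z6, z7})" using alt[OF _ _ zm(7)] zz[of z6] 5 cm[of z6 z5] by simp
  have 1: "\<not> T_edge Z {c, y}" using not_T_edge[of Z "{c, y}"] X(10) g8 by (simp add: small_def)
  have 0: "\<not> T_edge Z {c2, c}" using X(8,13) cm[of c2 c] by (simp add: T_edge_def)
  have sub: "{e. T_edge Z e} \<subseteq> {{z3, z4}, {z5, z6}, {z7, c2}}"
  proof
    fix e assume "e \<in> {e. T_edge Z e}"
    then have t: "T_edge Z e" by simp
    have "e \<in> {{c2,c},{c,y},{y,z3},{z3,z4},{z4,z5},{z5,z6},{z6,z7},{z7,c2}}"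
      unfolding zm(12)[symmetric] by (rule T_edgeD(2)[OF t])
    then show "e \<in> {{z3, z4}, {z5, z6}, {z7, c2}}"
      using t not_T_edge[OF 2] not_T_edge[OF 4] not_T_edge[OF 6] 0 1 by blast
  qed
  have d: "{z3, z4} \<noteq> {z5, z6}" "{z5, z6} \<noteq> {z7, c2}" "{z3, z4} \<noteq> {z7, c2}" using zm(9) by (auto simp: doubleton_eq_iff)
  \<comment> \<open>This edge is at distance 1 from both other candidates, so a triangle there would
    be the only one.\<close>
  have n56: "\<not> T_edge Z {z5, z6}"
  proof
    assume t: "T_edge Z {z5, z6}"
    have "\<not> T_edge Z {z3, z4}" using T_edge_adj[OF _ t ze(5)] d by blast
    moreover have "\<not> T_edge Z {z7, c2}" using T_edge_adj[OF t _ ze(7)] d by blast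
    ultimately have "{e. T_edge Z e} \<subseteq> {{z5, z6}}" using sub by blast
    then have "num_T Z \<le> card {{z5, z6}}" unfolding num_T_def by (intro card_mono) auto
    then show False using Zc(3) by simp
  qed
  then have sub: "{e. T_edge Z e} \<subseteq> {{z3, z4}, {z7, c2}}" using sub by blast
  have "{e. T_edge Z e} = {{z3, z4}, {z7, c2}}"
    by (rule card_subset_eq[OF _ sub]) (use Zc(3) d in \<open>auto simp: num_T_def\<close>)
  then have T34: "T_edge Z {z3, z4}" and T70: "T_edge Z {z7, c2}" by blast+
  define T3 where "T3 = other Z {z3, z4}"
  define T7 where "T7 = other Z {z7, c2}"
  note T3D = T_edgeD[OF T34, folded T3_def] and T7D = T_edgeD[OF T70, folded T7_def]
  have t3: "three z3" "three z4" "three z7" using zz by blast+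
  have d3: "deg y = 3" using threeD[OF X(3)] by blast
  have yc: "{y, c} = {c, y}" by auto
  obtain y' where y': "{z. A y z} = {c, p, y'}" "y' \<noteq> c" "y' \<noteq> p" "angle \<sigma> p y y'" "angle Z c y y'" "other Z {y, y'} = \<sigma>"
    by (rule three_struct[OF d3 gm(5), unfolded yc, folded Z_def \<sigma>_def]) (rule that)
  have "y' = z3" using angle_unique[OF zm(3) angleD(4)[OF y'(5)]] y'(2) by auto
  note y' = y'[unfolded this]
  have os: "other Z {z3, y} = \<sigma>" using y'(6) cm[of z3 y] by simp
  obtain t where t: "facial T3 [z4, z3, t]" "angle \<sigma> y z3 t"
    by (rule third_T_edge[OF t3(1) angle_sym[OF angle_sym[OF zm(4)]] T34 os, folded T3_def]) (rule that)
  have p3: "three p" using X(16) by blast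
  have op: "other g {p, y} = \<sigma>" by (simp add: \<sigma>_def cm[of p y])
  obtain v2 where v2: "facial (other g {p, q}) [q, p, v2]" "angle \<sigma> y p v2"
    by (rule third_T_edge[OF p3 gm(6) tpq op]) (rule that)
  note v23 = facial3[OF v2(1)]
  have vpq: "v \<notin> {p, q}" using gm(9) by auto
  have v2b: "big v2" using root_T2(1)[OF r sg tpq vpq, of v2] v23 by auto
  \<comment> \<open>The face beyond \<open>{y, p}\<close> has \<open>v2\<close> as its only big
    vertex. So once the third vertex \<open>t\<close> of the triangle at \<open>z3\<close> differs
    from \<open>v2\<close>, it is a 3-vertex.\<close>
  have tv: "t \<noteq> v2"
  proof
    assume tv: "t = v2"
    have "T3 = other g {p, q}"
      using tri_faces_far(1)[OF T3D(3,4) T_edgeD(3,4)[OF tpq], of t v2] tv facial3[OF t(1)] v23 by auto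
    then have "z3 \<in> {q, p, v2}" using facial3[OF t(1)] v23 by auto
    moreover have "z3 \<noteq> q"
    proof
      assume "z3 = q"
      then have "A y q" using ze by simp
      then have "q = c \<or> q = p" using chord_angle8[OF gm(5) g8] gm(10) by auto
      then show False using gm(9) by auto
    qed
    ultimately show False using y'(3) v2b t3 by (auto simp: big_def)
  qed
  have F\<sigma>: "\<sigma> \<in> F" "t \<in> vs \<sigma>" "v2 \<in> vs \<sigma>" using angleD[OF t(2)] angleD[OF v2(2)] by blast+
  have tt: "three t" using num_big_1[OF F\<sigma>(1) sig F\<sigma>(3) v2b F\<sigma>(2) tv] .
  have T3all: "three w" if "w \<in> vs T3" for w
  proof -
    have "w \<in> {z4, z3, t}" using facial3[OF t(1)] that by simp
    then show ?thesis using t3 tt by blast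
  qed
  have d4: "deg c2 = 4" using fourD[OF f] by blast
  have dm2: "deg m2 = 3" using threeD[OF X(5)] by blast
  have ea: "angle K c2 m2 m" using num_quad_at by blast
  obtain m3 where m3: "{y. A m2 y} = {c2, m, m3}" "m3 \<noteq> c2" "m3 \<noteq> m" "angle h m m2 m3"
    by (rule three_struct[OF dm2 ea, unfolded X(12)]) (rule that)
  obtain b3 b4 b5 b6 b7 where "facial h [m,m2,m3,b3,b4,b5,b6,b7]" by (rule angle_facial8[OF m3(4) R(24)])
  then have lh: "facial h [m2,m3,b3,b4,b5,b6,b7,m]" using facial_rot[of h m "[m2,m3,b3,b4,b5,b6,b7]"] by simp
  note hm = facial8[OF lh] and he = facial8_adj[OF lh]
  have b7: "b7 = u" using angle_unique[OF hm(8), of u] angleD(3,2,11)[OF X(4)] angleD(5)[OF X(4)] by auto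
  have cb: "c2 \<notin> vs h" using R(25) X(6) by (auto simp: big_def)
  have m2K: "m2 \<in> vs K" "c2 \<in> vs K" using num_quad_at by auto
  have m2T: "m2 \<notin> vs S" if "S \<in> F" "len S = 3" for S
    using small_three[OF X(5) that(1) _ _ qA(9) m2K(1) sK] that(2) X(13) by (auto simp: small_def)
  have c2T7: "c2 \<in> vs T7" using T7D(9) by blast
  have nT37: "T3 \<noteq> T7" using T3all[of c2] c2T7 X(6) by (auto simp: big_def)
  have m2Z: "m2 \<notin> vs Z"
  proof
    assume mz: "m2 \<in> vs Z"
    have "m2 = z7 \<or> m2 = c" using chord_angle8[OF zm(1) zm(11) mz] qA by blast
    moreover have "m2 \<noteq> c" using num_quad_at by auto
    ultimately have "angle Z m2 c2 c" using zm(1) by simp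
    then have "deg c2 = 2" using two_edges[of K m2 c2 c Z] num_quad_at angle_sym[of K c c2 m2] X(11) by blast
    then show False using d4 by simp
  qed
  let ?S = "vs h \<union> vs Z \<union> vs T3"
  have tri_no: "\<not> A c2 w" if "A m2 w" for w
  proof
    assume cw: "A c2 w"
    have "m2 \<in> vs T7" using tri_at(1)[OF T7D(3,4) c2T7 _ cw that] qA by blast
    then show False using m2T[OF T7D(3,4)] by blast
  qed
  \<comment> \<open>\<open>outer8\<close> leaves five candidates: \<open>m\<close> and
    \<open>m3\<close> would make a triangle at \<open>m2\<close>, \<open>b3\<close> a 6-cycle, and
    \<open>b7\<close> is \<open>u\<close>, whose neighbours are known.\<close>
  have vh: "w = m2" if w: "A c2 w" "w \<in> vs h" for w
  proof -
    have "w \<in> {m2,m3,b3,b7,m}" by (rule outer8[OF lh cb _ w]) (rule qA(3))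
    moreover have "w \<noteq> m3" "w \<noteq> m" using tri_no w(1) he by blast+
    moreover have "w \<noteq> b3"
    proof
      assume wb: "w = b3"
      have "distinct [c2, c, m, m2, m3, b3]" using cb X(9) hm(9,10) num_quad_at by auto
      then show False using no_6_cycle[of c2 c m m2 m3 b3] qA he w(1) wb sym by auto
    qed
    moreover have "w \<noteq> b7"
    proof
      assume "w = b7"
      then have "A u c2" using w(1) b7 sym by blast
      then have "c2 \<in> {v, m, u'}" unfolding root_h(4)[OF r gm(2), symmetric] by simp
      then have "c2 = v" using X(1,6) R(18) by (auto simp: big_def)
      then have "A v c" using qA by blast
      then have "c = s \<or> c = u" using chord_angle8[OF gm(1) g8] gm(10) by auto
      then show False using gm(9) by auto
    qed
    ultimately show ?thesis by blast
  qed
  have m2h: "m2 \<in> vs h" "m \<in> vs h" "m3 \<in> vs h" using hm(10) by auto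
  have Nw: "{w \<in> ?S. A c2 w} = {m2, c, z7}"
  proof
    show "{m2, c, z7} \<subseteq> {w \<in> ?S. A c2 w}" using m2h zm(10) qA ze by auto
    show "{w \<in> ?S. A c2 w} \<subseteq> {m2, c, z7}"
    proof
      fix w assume w: "w \<in> {w \<in> ?S. A c2 w}"
      then consider "w \<in> vs h" | "w \<in> vs Z" | "w \<in> vs T3" by blast
      then show "w \<in> {m2, c, z7}"
      proof cases
        case 1 then show ?thesis using vh w by blast
      next
        case 2 then show ?thesis using chord_angle8[OF zm(1) zm(11)] w by blast
      next
        case 3 then show ?thesis using tri_faces_far(2)[OF T7D(3,4) T3D(3,4) nT37[symmetric] c2T7, of w] w by blast
      qed
    qed
  qed
  have TZ: "T3 \<noteq> Z" by (rule T3D)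
  have a43: "angle Z z4 z3 y" using angle_sym[OF zm(4)] .
  have e43: "{z4, z3} \<in> bd T3" using T3D(6) cm[of z4 z3] by simp
  note sh = edge_share_big[OF t3(1) a43 T3D(3) e43 TZ]
  show False
  proof (rule reducible_save[of ?S m2 c2 "vs Z \<union> vs T3" z3])
    have ok: "three w" if "w \<in> ?S" "w \<noteq> c2" for w using that R(25) Z3 T3all by blast
    show "?S \<subseteq> U - {x}"
    proof
      fix w assume "w \<in> ?S"
      then have "three w \<or> w = c2" using ok by blast
      then show "w \<in> U - {x}" using threeD fourD[OF f] by blast
    qed
    show "m2 \<in> ?S" "c2 \<in> ?S" using m2h c2Z by auto
    show "deg m2 = 3" "deg c2 = 4" by fact+
    show "w \<in> ?S" if "A m2 w" for w
    proof -
      have "w \<in> {c2, m, m3}" unfolding m3(1)[symmetric] using that by simp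
      then show ?thesis using m2h c2Z by auto
    qed
    show "A m2 c2" using qA by blast
    have "m2 \<noteq> z7" "m2 \<noteq> c" using m2Z zm(10) by auto
    then show "d c2 ?S = 3" unfolding d_def Nw using zm(9) by (auto simp: card_insert_if)
    show "deg w = 3" if "w \<in> ?S" "w \<noteq> c2" for w using ok[OF that] threeD by blast
    show "conn (?S - {m2})"
    proof -
      have mm: "m \<in> vs h - {m2}" using m2h hm(9) by auto
      have kept: "c \<in> vs Z - {m2}" using m2Z zm(10) by auto
      have 1: "conn ((vs h - {m2}) \<union> (vs Z - {m2}))"
        by (rule conn_Un[OF conn_del[OF R(4)] conn_del[OF ze(17)]]) (use mm kept qA(1) in blast)
      have z3S: "z3 \<in> vs Z - {m2}" "z3 \<in> vs T3 - {m2}" using m2Z zm(10) facial3[OF t(1)] by auto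
      have "conn ((vs h - {m2}) \<union> (vs Z - {m2}) \<union> (vs T3 - {m2}))"
        by (rule conn_Un[OF 1 conn_del[OF T3D(3)]]) (use z3S in blast)
      then show ?thesis by (simp add: Un_Diff)
    qed
    show "vs Z \<union> vs T3 \<subseteq> ?S - {m2}" using m2Z m2T[OF T3D(3,4)] by auto
    show "biconn (vs Z \<union> vs T3)" "3 \<le> d z3 (vs Z \<union> vs T3)" "z3 \<in> vs Z \<union> vs T3" using sh by auto
  qed
qed

section \<open>Donors\<close>

text \<open>
  \<open>donor T g z y\<close>: the face \<open>z\<close> gives 1 to \<open>T\<close> on behalf of \<open>g\<close>, taken from the charge that \<open>z\<close> keeps
  at its vertex \<open>y\<close>. This is \<open>g\<close> itself unless \<open>g\<close> is short. A short \<open>g\<close> has a second triangle;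
  if a face next to that triangle has two big vertices, it is the donor. If not, then the next
  vertex after \<open>v, u\<close> on \<open>g\<close> is rich and \<open>h\<close> pays, or it is on a 4-face and a face with a
  rich vertex \<open>y\<close> pays.
\<close>

definition good_donor :: "'f \<Rightarrow> 'a \<Rightarrow> 'f \<Rightarrow> 'a \<Rightarrow> bool" where
  "good_donor g v z y \<longleftrightarrow> (\<exists>p q. T_edge g {p, q} \<and> v \<notin> {p, q} \<and> facial (other g {p, q}) [p, q, y] \<and>
     z = other (other g {p, q}) {p, y} \<and> 2 \<le> num_big z)"

definition red_donor :: "'f \<Rightarrow> 'a \<Rightarrow> 'a \<Rightarrow> 'f \<Rightarrow> 'a \<Rightarrow> bool" where
  "red_donor g v u z y \<longleftrightarrow> (\<exists>m c p q s c2 m2. facial g [v,u,m,c,y,p,q,s] \<and> facial (other g {m, c}) [m,c,c2,m2] \<and> rich y \<and>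
     T_edge g {p, q} \<and> num_big (other g {y, p}) = 1 \<and> z = other g {c, y})"

definition donor :: "'f \<Rightarrow> 'f \<Rightarrow> 'f \<Rightarrow> 'a \<Rightarrow> bool" where
  "donor T g z y \<longleftrightarrow> (\<exists>h u u' v. root_side T g h u u' v \<and>
     (\<not> short g \<and> z = g \<and> y = v \<or>
      short g \<and> good_donor g v z y \<or>
      short g \<and> red_donor g v u z y \<or>
      short g \<and> (\<nexists>z y. good_donor g v z y) \<and> angle g v u y \<and> rich y \<and> z = h))"

lemma shortD: "short g \<Longrightarrow> len g = 8 \<and> num_big g = 1 \<and> num_T g = 2 \<and> num_rich g \<le> 1"
  by (simp add: short_def)

lemma good_donorD:
  assumes r: "root_side T g h u u' v" and sg: "short g" and "good_donor g v z y"
  shows "\<exists>p q. T_edge g {p, q} \<and> v \<notin> {p, q} \<and> facial (other g {p, q}) [p, q, y] \<and> z = other (other g {p, q}) {p, y}"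
    "2 \<le> num_big z" "big y" "z \<in> F" "y \<in> vs z" "\<not> small z" "\<exists>e. T_edge z e \<and> y \<in> e" "in_triangle y"
proof -
  obtain p q where pq: "T_edge g {p, q}" "v \<notin> {p, q}" "facial (other g {p, q}) [p, q, y]" "z = other (other g {p, q}) {p, y}" "2 \<le> num_big z"
    using assms(3) unfolding good_donor_def by blast
  note t = T_edgeD[OF pq(1)] and f = facial3[OF pq(3)]
  show "\<exists>p q. T_edge g {p, q} \<and> v \<notin> {p, q} \<and> facial (other g {p, q}) [p, q, y] \<and> z = other (other g {p, q}) {p, y}" using pq by blast
  show "2 \<le> num_big z" by fact
  show "big y" using root_T2(1)[OF r sg pq(1,2), of y] f by auto
  have e: "{p, y} \<in> bd (other g {p, q})" using f angleD(5)[of "other g {p, q}" y p q] angleD(3)[of "other g {p, q}" y p q] by blast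
  note o = other[OF t(3) e]
  show zF: "z \<in> F" "y \<in> vs z" using o(1,3) edge_vs unfolding pq(4) by blast+
  have nx: "p \<noteq> x" "y \<noteq> x" using t(5) f by auto
  show "\<not> small z"
  proof
    assume "small z"
    then have s: "small (other (other g {p, q}) {p, y})" unfolding pq(4) .
    have "(p = x \<or> y = x) \<and> deg x = 2" by (rule small_adj[OF t(3) e t(8) o(1,3) s o(2)[symmetric]])
    then show False using nx by blast
  qed
  have "other z {p, y} = other g {p, q}" using other_other[OF t(3) e] unfolding pq(4) .
  then have "T_edge z {p, y}" using o(1,3) t(4,5) unfolding pq(4) by (simp add: T_edge_def)
  then show "\<exists>e. T_edge z e \<and> y \<in> e" by blast
  then show "in_triangle y" using in_triangle_T_edge by blast
qed

text \<open>At \<open>c\<close> the neighbour off \<open>g\<close> is \<open>c2\<close>, and at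
  \<open>p\<close> it is the third vertex \<open>v2\<close> of the second triangle. Both are big and
  on the face beyond \<open>{c, p}\<close>, which thus has two big vertices.\<close>

lemma good_donorI:
  assumes r: "root_side T g h u u' v" and sg: "short g" and t: "T_edge g {p, q}" "v \<notin> {p, q}"
    and a: "angle g c' c p" "angle g c p q" and c: "three c" and K: "angle (other g {c', c}) c' c c2" "big c2"
  shows "\<exists>z y. good_donor g v z y"
proof -
  note T2 = T_edgeD[OF t(1)]
  have pq3: "three p" "three q"
  proof -
    obtain w where w: "facial (other g {p, q}) [p, q, w]" by (rule tri_vertices[OF T2(3,4,6)])
    have "w \<in> vs (other g {p, q})" "w \<notin> {p, q}" using facial3[OF w] by auto
    then show "three p" "three q" using root_T2(3,4)[OF r sg t] by blast+
  qed
  define Z where "Z = other g {c, p}"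
  have "other g {p, c} = Z" by (simp add: Z_def insert_commute)
  then obtain v2 where v2: "facial (other g {p, q}) [q, p, v2]" "angle Z c p v2" "other (other g {p, q}) {p, v2} = Z"
    using third_T_edge[OF pq3(1) a(2) t(1)] by metis
  note v23 = facial3[OF v2(1)] and v2A = facial3_adj[OF v2(1)]
  have v2b: "big v2" using root_T2(1)[OF r sg t, of v2] v23 by auto
  have d3: "deg c = 3" using threeD[OF c] by blast
  have kept: "{c, c'} = {c', c}" by auto
  obtain d where d: "d \<noteq> c'" "angle Z p c d" "angle (other g {c', c}) c' c d"
    by (rule three_struct[OF d3 a(1), unfolded kept, folded Z_def]) (rule that)
  have "d = c2" using angle_unique[OF K(1) angleD(4)[OF d(3)]] d(1) by blast
  then have cZ: "c2 \<in> vs Z" using angleD(18)[OF d(2)] by simp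
  have ne: "c2 \<noteq> v2"
  proof
    assume e: "c2 = v2"
    have "c \<in> vs (other g {p, q})"
      by (rule tri_at(1)[OF T2(3,4), of p c v2])
        (use v23 v2A angleD(8)[OF K(1)] angleD(9,10)[OF a(1)] angleD(7,9)[OF a(2)] e in auto)
    then have "c = q \<or> c = p \<or> c = v2" using v23 by auto
    then show False using angleD(2,11)[OF a(2)] c v2b by (auto simp: big_def)
  qed
  have "2 \<le> num_big Z" by (rule num_big_2[OF angleD(1)[OF d(2)] angleD(18)[OF v2(2)] v2b cZ K(2) ne])
  moreover have "facial (other g {p, q}) [p, q, v2]"
    using facial_rev[OF v2(1)] facial_rot[of "other g {p, q}" v2 "[p, q]"] by simp
  ultimately have "good_donor g v Z v2" unfolding good_donor_def using t v2(3) by blast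
  then show ?thesis by blast
qed

text \<open>For a short \<open>g\<close> look at the face \<open>K\<close> beyond
  \<open>{m, c}\<close>. If it is large, \<open>m\<close> is rich and \<open>h\<close> pays. If not,
  it is a 4-face, and the position of the second triangle decides between a good and a red
  donor.\<close>

lemma donor_exists:
  assumes r: "root_side T g h u u' v"
  shows "\<exists>z y. z \<in> F \<and> \<not> small z \<and> y \<in> vs z \<and> donor T g z y"
proof -
  note R = root_sideD[OF r]
  have vg: "v \<in> vs g" using edge_vs[OF R(16)] by auto
  consider "\<not> short g" | "short g" "\<exists>z y. good_donor g v z y" | "short g" "\<nexists>z y. good_donor g v z y" by blast
  then show ?thesis
  proof cases
    case 1
    then have "donor T g g v" unfolding donor_def using r by blast
    then show ?thesis using R(5,27) vg by blast
  next
    case 2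
    then obtain z y where z: "good_donor g v z y" by blast
    then have "donor T g z y" unfolding donor_def using r 2(1) by blast
    then show ?thesis using good_donorD[OF r 2(1) z] by blast
  next
    case 3
    note sg = 3(1)
    have g: "len g = 8" "num_big g = 1" "num_T g = 2" using shortD[OF sg] by auto
    obtain m where m0: "angle g v u m" using edge_angle[OF R(5,16)] by blast
    note rh = root_h[OF r m0]
    obtain c y p q s where l: "facial g [v,u,m,c,y,p,q,s]" by (rule angle_facial8[OF m0 g(1)])
    note gm = facial8[OF l] and ge = facial8_adj[OF l]
    note tuv = root_T_edge[OF r]
    have "\<exists>e2. T_edge g e2 \<and> e2 \<noteq> {u, v}"
    proof (rule ccontr)
      assume "\<nexists>e2. T_edge g e2 \<and> e2 \<noteq> {u, v}"
      then have "{e. T_edge g e} \<subseteq> {{u, v}}" by blast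
      then have "num_T g \<le> card {{u, v}}" unfolding num_T_def by (intro card_mono) auto
      then show False using g(3) by simp
    qed
    then obtain e2 where e2: "T_edge g e2" "e2 \<noteq> {u, v}" by blast
    note far = T_edge_far[OF tuv e2(1) e2(2)[symmetric]]
    have "e2 \<in> {{v,u},{u,m},{m,c},{c,y},{y,p},{p,q},{q,s},{s,v}}"
      unfolding gm(12)[symmetric] by (rule T_edgeD(2)[OF e2(1)])
    moreover have "e2 \<noteq> {v, u}" using e2(2) by (simp add: insert_commute)
    moreover have "u \<notin> e2" "v \<notin> e2" using far(1) by blast+
    moreover have "m \<notin> e2" using far(2)[of u m] ge by blast
    moreover have "s \<notin> e2" using far(2)[of v s] ge by blast
    ultimately have e2': "e2 = {c, y} \<or> e2 = {y, p} \<or> e2 = {p, q}" by blast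
    have g3: "three z" if "z \<in> {u, m, c, y, p, q, s}" for z
      using num_big_1[OF R(5) g(2) vg R(29), of z] that gm(9,10) by auto
    have th: "three m" "three c" "three y" "three p" "three q" using g3 by blast+
    define K where "K = other g {m, c}"
    have emc: "{m, c} \<in> bd g" by (rule angleD(4)[OF gm(3)])
    note oK = other[OF R(5) emc, folded K_def]
    show ?thesis
    proof (cases "small K")
      case True
      have mK: "m \<in> vs K" using oK(3) edge_vs by blast
      have uT: "u \<in> vs T" using R(11) by simp
      \<comment> \<open>A triangle at \<open>m\<close> would be within distance 1 of
        \<open>T\<close>.\<close>
      have "len K \<noteq> 3"
      proof
        assume l3: "len K = 3"
        have "K \<noteq> T" using rh(5) mK by blast
        then have "\<not> A m u" using tri_faces_far(2)[OF oK(1) l3 R(1,2) _ mK uT] by blast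
        then show False using ge by blast
      qed
      then have l4: "len K = 4" using True len_ge_3[OF oK(1)] by (simp add: small_def)
      obtain zs where zs: "facial K (m # c # zs)" by (rule edge_facial[OF oK(1,3)])
      then have "length zs = 2" using facial_len[OF zs] l4 by simp
      then obtain c2 m2 where Q: "facial K [m,c,c2,m2]" using zs len4 by blast
      note X = red_configD[OF r sg l Q[unfolded K_def]]
      have cm: "{c, m} = {m, c}" by auto
      have ncy: "\<not> small (other g {c, y})"
        using three_edges[OF th(2) gm(4)] True unfolding cm K_def by blast
      have aK: "angle (other g {m, c}) m c c2" using facial4[OF Q] unfolding K_def by blast
      consider "e2 = {y, p}" | "e2 = {p, q}" using e2' not_T_edge[OF ncy] e2(1) by blast
      then show ?thesis
      proof cases
        case 1
        have t: "T_edge g {y, p}" using e2(1) 1 by simp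
        have "v \<notin> {y, p}" using gm(9) by auto
        then have "\<exists>z y. good_donor g v z y" using good_donorI[OF r sg t _ gm(4,5) th(2) aK X(6)] by blast
        then show ?thesis using 3(2) by blast
      next
        case 2
        have t: "T_edge g {p, q}" using e2(1) 2 by simp
        have vpq: "v \<notin> {p, q}" using gm(9) by auto
        have nyp: "\<not> small (other g {y, p})"
          using three_edges[OF th(4) gm(6)] T_edgeD(8)[OF t] by (metis insert_commute)
        have yc: "{y, c} = {c, y}" by auto
        have sg': "\<not> small g" by (rule R(27))
        have ry: "rich y" using rich_iff[OF th(3) gm(5) sg'] ncy nyp unfolding yc by blast
        have op: "other g {p, y} = other g {y, p}" by (simp add: insert_commute)
        obtain v2 where v2: "facial (other g {p, q}) [q, p, v2]" "angle (other g {y, p}) y p v2" "other (other g {p, q}) {p, v2} = other g {y, p}"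
          using third_T_edge[OF th(4) gm(6) t op] by metis
        note v23 = facial3[OF v2(1)]
        have v2b: "big v2" using root_T2(1)[OF r sg t vpq, of v2] v23 by auto
        have fl2: "facial (other g {p, q}) [p, q, v2]"
          using facial_rev[OF v2(1)] facial_rot[of "other g {p, q}" v2 "[p, q]"] by simp
        have "\<not> 2 \<le> num_big (other g {y, p})"
        proof
          assume "2 \<le> num_big (other g {y, p})"
          then have "good_donor g v (other g {y, p}) v2" unfolding good_donor_def using t vpq fl2 v2(3) by metis
          then show False using 3(2) by blast
        qed
        moreover have "0 < num_big (other g {y, p})" by (rule num_big_pos[OF angleD(1,18)[OF v2(2)] v2b])
        ultimately have n1: "num_big (other g {y, p}) = 1" by simp
        have "red_donor g v u (other g {c, y}) y" unfolding red_donor_def using l Q[unfolded K_def] ry t n1 by blast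
        then have "donor T g (other g {c, y}) y" unfolding donor_def using r sg by blast
        moreover have "y \<in> vs (other g {c, y})" using angleD(18)[OF X(7)] .
        ultimately show ?thesis using X(14) ncy by blast
      qed
    next
      case False
      have mu: "{m, u} = {u, m}" by auto
      have "rich m" using rich_iff[OF th(1) gm(3) R(27)] False R(28) rh(1) unfolding mu K_def by simp
      then have "donor T g h m" unfolding donor_def using r 3 m0 by blast
      moreover have "m \<in> vs h" by (rule angleD(16)[OF rh(2)])
      ultimately show ?thesis using R(4,28) by blast
    qed
  qed
qed

section \<open>No donor is charged twice\<close>

text \<open>In a root triangle the only big vertex is \<open>v\<close>, so the edge opposite to it
  is the one shared with the deficient face, which has no big vertices. Hence a second triangle of a
  short face, whose third vertex is big, is never a root.\<close>

lemma rootless: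
  assumes r: "root_side T g h u u' v" and g0: "T_edge g0 {p, q}" "other g0 {p, q} = T" "num_big g0 \<noteq> 0" and y: "y \<in> vs T" "y \<notin> {p, q}" "big y"
  shows False
proof -
  note R = root_sideD[OF r] and t = T_edgeD[OF g0(1), unfolded g0(2)]
  have yv: "y = v" using y R(11,17,18) by (auto simp: big_def)
  have "{p, q} \<in> EA" using bdE[OF R(1)] t(6) by blast
  then have "A p q" using EA_iff by blast
  then have "p \<noteq> q" using irr by auto
  moreover have "p \<in> vs T" "q \<in> vs T" using t(9) by auto
  ultimately have "{p, q} = {u, u'}" using y(2) yv R(11) by auto
  then have "h = g0" using R(13) other_other[OF t(1,2)] g0(2) by simp
  then show False using R(6) g0(3) by (simp add: deficient_def)
qed

lemma root_of_side:
  assumes "root_side T g h u u' v" "root_side T' g h' u1 u1' v1" "num_big g = 1"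
  shows "T = T'" "v = v1"
proof -
  note R = root_sideD[OF assms(1)] and R' = root_sideD[OF assms(2)]
  have vg: "v \<in> vs g" "v1 \<in> vs g" using edge_vs[OF R(16)] edge_vs[OF R'(16)] by auto
  show vv: "v = v1" using num_big_1[OF R(5) assms(3) vg(1) R(29) vg(2)] R'(29) by (auto simp: big_def)
  have "v \<in> vs T" "v \<in> vs T'" using R(11) R'(11) vv by auto
  then show "T = T'" using tri_faces_far(1)[OF R(1,2) R'(1,2)] by blast
qed

lemma big_not_rich: "big y \<Longrightarrow> \<not> rich y"
  using rich_three by (auto simp: big_def)

lemma red_donorE:
  assumes r: "root_side T g h u u' v" and sg: "short g" and "red_donor g v u z y"
  obtains m c p q s c2 m2 where "facial g [v,u,m,c,y,p,q,s]" "facial (other g {m, c}) [m,c,c2,m2]" "rich y" "T_edge g {p, q}"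
     "num_big (other g {y, p}) = 1" "z = other g {c, y}" "z \<in> F" "big c2" "angle z c2 c y" "len (other z {c2, c}) = 4" "z \<noteq> g" "three c"
     "num_big z \<noteq> 0"
proof -
  obtain m c p q s c2 m2 where a: "facial g [v,u,m,c,y,p,q,s]" "facial (other g {m, c}) [m,c,c2,m2]" "rich y" "T_edge g {p, q}"
     "num_big (other g {y, p}) = 1" "z = other g {c, y}"
    using assms(3) unfolding red_donor_def by blast
  note X = red_configD[OF r sg a(1,2)]
  have za: "angle z c2 c y" "z \<in> F" using X(7,14) a(6) by auto
  have "c2 \<in> vs z" by (rule angleD(16)[OF za(1)])
  then have n: "num_big z \<noteq> 0" using num_big_pos[OF za(2) _ X(6)] by simp
  have "other z {c2, c} = other g {m, c}" using X(8) a(6) by (simp add: insert_commute)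
  then have l4: "len (other z {c2, c}) = 4" using X(13) by simp
  have cy: "{c, y} \<in> bd g" by (rule angleD(4)[OF facial8(4)[OF a(1)]])
  have ne: "z \<noteq> g" using other(2)[OF root_sideD(5)[OF r] cy] a(6) by simp
  show ?thesis by (rule that[OF a za(2) X(6) za(1) l4 ne X(2) n])
qed

text \<open>A second short face charging \<open>z\<close> at \<open>y\<close> would be the third
  face at \<open>y\<close>, the one beyond \<open>{y, p}\<close>. Its only big vertex is then the
  third vertex of the second triangle of \<open>g\<close>, which would have to be a root, against
  \<open>rootless\<close>.\<close>

lemma red_donor_inj:
  assumes r: "root_side T g h u u' v" and sg: "short g" and d: "red_donor g v u z y"
    and r': "root_side T' g' h' u1 u1' v1" and sg': "short g'" and d': "red_donor g' v1 u1 z y"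
  shows "g = g'"
proof (rule ccontr)
  assume ne: "g \<noteq> g'"
  note R = root_sideD[OF r] and R' = root_sideD[OF r']
  obtain m c p q s where a: "facial g [v,u,m,c,y,p,q,s]" "rich y" "T_edge g {p, q}" "z = other g {c, y}"
    by (rule red_donorE[OF r sg d]) (rule that)
  obtain m' c' p' q' s' where a': "facial g' [v1,u1,m',c',y,p',q',s']" "z \<noteq> g'"
    by (rule red_donorE[OF r' sg' d']) (rule that)
  note gm = facial8[OF a(1)]
  have y3: "three y" using a(2) rich_three by blast
  have d3: "deg y = 3" using threeD[OF y3] by blast
  have yg': "y \<in> vs g'" using facial8(10)[OF a'(1)] by simp
  have yc: "{y, c} = {c, y}" by auto
  have "g' = g \<or> g' = other g {y, c} \<or> g' = other g {y, p}"
    by (rule three_struct[OF d3 gm(5)]) (use R'(5) yg' in blast)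
  then have gs: "g' = other g {y, p}" using ne a(4) a'(2) unfolding yc by blast
  have vpq: "v \<notin> {p, q}" using gm(9) by auto
  note T2 = T_edgeD[OF a(3)]
  have p3: "three p"
  proof -
    obtain w where w: "facial (other g {p, q}) [p, q, w]" by (rule tri_vertices[OF T2(3,4,6)])
    have "w \<in> vs (other g {p, q})" "w \<notin> {p, q}" using facial3[OF w] by auto
    then show ?thesis using root_T2(3)[OF r sg a(3) vpq] by blast
  qed
  have op: "other g {p, y} = g'" using gs by (simp add: insert_commute)
  obtain v2 where v2: "facial (other g {p, q}) [q, p, v2]" "angle g' y p v2"
    by (rule third_T_edge[OF p3 gm(6) a(3) op]) (rule that)
  note v23 = facial3[OF v2(1)]
  have v2T: "v2 \<in> vs (other g {p, q})" "v2 \<notin> {p, q}" using v23 by auto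
  have v2b: "big v2" using root_T2(1)[OF r sg a(3) vpq v2T] .
  have v1g: "v1 \<in> vs g'" using edge_vs[OF R'(16)] by auto
  have "v2 = v1" using num_big_1[OF R'(5) _ v1g R'(29) angleD(18)[OF v2(2)]] shortD[OF sg'] v2b by (auto simp: big_def)
  then have "v2 \<in> vs T'" using R'(11) by simp
  then have "other g {p, q} = T'" using tri_faces_far(1)[OF T2(3,4) R'(1,2) _ v2T(1)] by blast
  then show False using rootless[OF r' a(3) _ _ _ v2T(2) v2b] v2T(1) shortD[OF sg] by simp
qed

text \<open>Two triangles using the same \<open>m\<close> on \<open>h\<close> would lie at both
  neighbours of \<open>m\<close> on \<open>h\<close>, with \<open>g\<close> and \<open>g'\<close>
  sharing the edge \<open>{m, c}\<close>. As \<open>g\<close> has no second rich vertex, the third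
  face \<open>D\<close> at \<open>c\<close> is small. With 3-vertices only, it contradicts
  \<open>reducible_root\<close>; a big vertex on it creates a good donor for
  \<open>g\<close>.\<close>

lemma pay_unique:
  assumes r: "root_side T g h u u' v" and sg: "short g" and ng: "\<nexists>z y. good_donor g v z y" and a: "angle g v u m" and rm: "rich m"
    and r': "root_side T' g' h u1 u1' v1" and sg': "short g'" and a': "angle g' v1 u1 m"
  shows "u = u1"
proof (rule ccontr)
  assume ne: "u \<noteq> u1"
  note R = root_sideD[OF r] and R' = root_sideD[OF r']
  note rh = root_h[OF r a] and rh' = root_h[OF r' a']
  have g8: "len g = 8" "num_big g = 1" "num_rich g \<le> 1" "num_T g = 2" and g8': "len g' = 8" "num_big g' = 1" using shortD[OF sg] shortD[OF sg'] by auto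
  obtain c y1 p q s where l: "facial g [v,u,m,c,y1,p,q,s]" by (rule angle_facial8[OF a g8(1)])
  obtain c' y1' p' q' s' where l': "facial g' [v1,u1,m,c',y1',p',q',s']" by (rule angle_facial8[OF a' g8'(1)])
  note gm = facial8[OF l] and ge = facial8_adj[OF l] and gm' = facial8[OF l'] and ge' = facial8_adj[OF l']
  have vg: "v \<in> vs g" "v1 \<in> vs g'" using gm(10) gm'(10) by auto
  have g3: "three z" if "z \<in> {u, m, c, y1, p, q, s}" for z
    using num_big_1[OF R(5) g8(2) vg(1) R(29), of z] that gm(9,10) by auto
  have g3': "three z" if "z \<in> {u1, m, c', y1', p', q', s'}" for z
    using num_big_1[OF R'(5) g8'(2) vg(2) R'(29), of z] that gm'(9,10) by auto
  have m3: "three m" "three c" "three y1" "three p" "three q" using g3 by blast+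
  have d3: "deg m = 3" using threeD m3 by blast
  have emu: "{u, m} \<in> bd h" "{u1, m} \<in> bd h" using angleD(5)[OF rh(2)] angleD(5)[OF rh'(2)] .
  have hm: "angle h u m u1" unfolding angle_def using R(4) ne emu by (simp add: insert_commute)
  have o: "other h {u, m} = g" "other h {u1, m} = g'"
    using other_other[OF R(5) angleD(4)[OF a]] rh(1) other_other[OF R'(5) angleD(4)[OF a']] rh'(1) by simp_all
  have mc: "{m, u} = {u, m}" "{m, u1} = {u1, m}" by auto
  obtain n where n: "{z. A m z} = {u, u1, n}" "n \<noteq> u" "n \<noteq> u1" "angle g' u1 m n" "angle g u m n" "g \<noteq> g'"
      "other g' {m, n} = g" "other g {m, n} = g'"
    by (rule three_struct[OF d3 hm, unfolded mc o]) (rule that)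
  have "n = c" using angle_unique[OF gm(3) angleD(4)[OF n(5)]] n(2) by blast
  moreover have "n = c'" using angle_unique[OF gm'(3) angleD(4)[OF n(4)]] n(3) by blast
  ultimately have nc: "n = c" "c' = c" by auto
  note gm' = gm'[unfolded nc] and ge' = ge'[unfolded nc]
  have dc: "deg c = 3" using threeD m3 by blast
  have oc: "other g {c, m} = g'" using n(8) nc by (simp add: insert_commute)
  obtain e where e: "{z. A c z} = {m, y1, e}" "e \<noteq> m" "e \<noteq> y1" "angle (other g {c, y1}) y1 c e" "angle g' m c e"
    "other (other g {c, y1}) {c, e} = g'" "other g' {c, e} = other g {c, y1}"
    "\<And>k. k \<in> F \<Longrightarrow> c \<in> vs k \<Longrightarrow> k = g \<or> k = g' \<or> k = other g {c, y1}"
    by (rule three_struct[OF dc gm(4), unfolded oc]) (rule that)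
  have "e = y1'" using angle_unique[OF gm'(4) angleD(4)[OF e(5)]] e(2) by blast
  note e = e[unfolded this]
  have y1'3: "three y1'" using g3' by blast
  define D where "D = other g {c, y1}"
  have ecy: "{c, y1} \<in> bd g" by (rule angleD(4)[OF gm(4)])
  note oD = other[OF R(5) ecy, folded D_def]
  have "\<not> rich c"
  proof
    assume "rich c"
    then have "{m, c} \<subseteq> {w \<in> vs g. rich w}" using rm gm(10) by auto
    then have "card {m, c} \<le> num_rich g" unfolding num_rich_def using fin_vs[OF R(5)] by (intro card_mono) auto
    then show False using g8(3) gm(9) by simp
  qed
  then have sD: "small D" using rich_iff[OF m3(2) gm(4) R(27)] oc R'(27) unfolding D_def by blast
  have AA: "A v u" "A u m" "A m c" "A c y1" "A c y1'" using ge ge' by blast+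
  have AS: "A u v" "A m u" "A c m" "A y1 c" "A y1' c" using AA sym by blast+
  have cT: "c \<notin> vs T"
  proof
    assume "c \<in> vs T"
    then have "c = u'" using R(11) gm(9) by auto
    then have Auc: "A u c" using tri_adj(1)[OF R(1,2), of u c] R(11,12) by auto
    have "m \<in> vs T" using tri_at(1)[OF R(1,2), of u m c] R(11) AA Auc by auto
    then show False using rh(5) by blast
  qed
  have cD: "c \<in> vs D" using oD(3) edge_vs by blast
  have DT: "D \<noteq> T" using cT cD by blast
  have nvc: "\<not> A v c" using chord_angle8[OF gm(1) g8(1), of c] gm(9,10) by auto
  have nvy: "\<not> A v y1" using chord_angle8[OF gm(1) g8(1), of y1] gm(9,10) by auto
  have contra: False if all: "\<And>z. z \<in> vs D \<Longrightarrow> three z" and nadj: "\<And>z. z \<in> vs D \<Longrightarrow> \<not> A v z"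
    by (rule reducible_root[OF r g8(1,2) oD(1) sD DT all nadj oD(3) ecy])
  have ang_D: "angle D y1 c y1'" using e(4) by (simp add: D_def)
  show False
  proof (cases "len D = 3")
    case True
    have "y1 \<in> vs D" "y1' \<in> vs D" using angleD[OF ang_D] by blast+
    moreover obtain w where w: "facial D [y1, c, w]" by (rule tri_vertices[OF oD(1) True angleD(3)[OF ang_D]])
    ultimately have vD: "vs D = {y1, c, y1'}" using facial3[OF w] angleD(2,12)[OF ang_D] by auto
    have vT: "v \<in> vs T" using R(11) by simp
    show False
    proof (rule contra)
      show "three z" if "z \<in> vs D" for z using that m3 y1'3 unfolding vD by blast
      show "\<not> A v z" if "z \<in> vs D" for z
        by (rule tri_faces_far(2)[OF R(1,2) oD(1) True DT[symmetric] vT that])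
    qed
  next
    case False
    then have l4: "len D = 4" using sD len_ge_3[OF oD(1)] by (simp add: small_def)
    obtain zs where zs: "facial D (y1 # c # y1' # zs)" by (rule angle_facial[OF ang_D])
    then have "length zs = 1" using facial_len[OF zs] l4 by simp
    then obtain d where d: "facial D [y1, c, y1', d]" using zs len3 by blast
    note D4 = facial4[OF d] and DA = facial4_adj[OF d]
    show False
    proof (cases "three d")
      case True
      show False
      proof (rule contra)
        fix z assume "z \<in> vs D"
        then consider "z = y1" | "z = c" | "z = y1'" | "z = d" using D4 by auto
        note zc = this
        show "three z" using zc m3 y1'3 True by cases auto
        have vt: "\<not> three v" using R(29) by (simp add: big_def)
        show "\<not> A v z"
          using zc
        proof cases
          case 3
          show ?thesis
          proof
            assume z: "A v z"
            have "y1' \<notin> vs g \<or> y1' = u \<or> y1' = s"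
              using chord_angle8[OF gm(1) g8(1), of y1'] z 3 by blast
            moreover have "y1' \<noteq> u" using chord_angle8[OF gm(4) g8(1), of u] AA(5) gm(9,10) by auto
            moreover have "y1' \<noteq> s" using chord_angle8[OF gm(4) g8(1), of s] AA(5) gm(9,10) by auto
            ultimately have "y1' \<notin> vs g" by blast
            then have "distinct [v, y1', c, m, u]" using gm(9,10) by auto
            then show False using no_5_cycle[of v y1' c m u] z 3 AA AS by simp
          qed
        next
          case 4
          show ?thesis
          proof
            assume z: "A v z"
            have "d \<notin> vs g \<or> d = u \<or> d = s"
              using chord_angle8[OF gm(1) g8(1), of d] z 4 by blast
            moreover have "d \<noteq> u" using chord_angle8[OF gm(5) g8(1), of u] DA gm(9,10) by auto
            moreover have "d \<noteq> s" using chord_angle8[OF gm(5) g8(1), of s] DA gm(9,10) by auto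
            ultimately have "d \<notin> vs g" by blast
            then have "distinct [v, d, y1, c, m, u]" using gm(9,10) by auto
            then show False using no_6_cycle[of v d y1 c m u] z 4 AA AS DA by simp
          qed
        qed (use nvc nvy in auto)
      qed
    next
      case False
      have "d \<in> U" using vs_U[OF oD(1)] D4 by auto
      then have db: "big d" using False by (simp add: big_def)
      note tuv = root_T_edge[OF r]
      have "\<exists>e2. T_edge g e2 \<and> e2 \<noteq> {u, v}"
      proof (rule ccontr)
        assume "\<nexists>e2. T_edge g e2 \<and> e2 \<noteq> {u, v}"
        then have "{e. T_edge g e} \<subseteq> {{u, v}}" by blast
        then have "num_T g \<le> card {{u, v}}" unfolding num_T_def by (intro card_mono) auto
        then show False using g8(4) by simp
      qed
      then obtain e2 where e2: "T_edge g e2" "e2 \<noteq> {u, v}" by blast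
      note far = T_edge_far[OF tuv e2(1) e2(2)[symmetric]]
      have "e2 \<in> {{v,u},{u,m},{m,c},{c,y1},{y1,p},{p,q},{q,s},{s,v}}"
        unfolding gm(12)[symmetric] by (rule T_edgeD(2)[OF e2(1)])
      moreover have "e2 \<noteq> {v, u}" using e2(2) by (simp add: insert_commute)
      moreover have "u \<notin> e2" "v \<notin> e2" using far(1) by blast+
      moreover have "m \<notin> e2" using far(2)[of u m] ge by blast
      moreover have "s \<notin> e2" using far(2)[of v s] ge by blast
      ultimately have "e2 = {c, y1} \<or> e2 = {y1, p} \<or> e2 = {p, q}" by blast
      moreover have "e2 \<noteq> {c, y1}" using T_edgeD(4)[OF e2(1)] l4 unfolding D_def by auto
      moreover have "e2 \<noteq> {y1, p}"
        using three_edges[OF m3(3) gm(5)] sD T_edgeD(8)[OF e2(1)] unfolding D_def by (metis insert_commute)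
      ultimately have t: "T_edge g {p, q}" using e2(1) by blast
      have vpq: "v \<notin> {p, q}" using gm(9) by auto
      have aD: "angle (other g {c, y1}) c y1 d" using D4 angle_sym unfolding D_def by blast
      show False using good_donorI[OF r sg t vpq gm(5,6) m3(3) aD db] ng by blast
    qed
  qed
qed

lemma donor_inj:
  assumes "donor T g z y" "donor T' g' z y"
  shows "T = T' \<and> g = g'"
proof -
  have main: "T = T' \<and> g = g'"
    if r: "root_side T g h u u' v" and r': "root_side T' g' h' u1 u1' v1"
      and c: "\<not> short g \<and> z = g \<and> y = v \<or> short g \<and> good_donor g v z y"
      and c': "\<not> short g' \<and> z = g' \<and> y = v1 \<or> short g' \<and> good_donor g' v1 z y"
    for T g h u u' v T' g' h' u1 u1' v1
  proof -
    have mix: False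
      if r: "root_side T g h u u' v" and r': "root_side T' g' h' u1 u1' v1" and c: "\<not> short g \<and> z = g \<and> y = v"
        and c': "short g'" "good_donor g' v1 z y" for T g h u u' v T' g' h' u1 u1' v1
    proof -
      note R = root_sideD[OF r]
      obtain p q where pq: "T_edge g' {p, q}" "facial (other g' {p, q}) [p, q, y]" using good_donorD(1)[OF r' c'] by blast
      note f = facial3[OF pq(2)] and t = T_edgeD[OF pq(1)]
      have "y \<in> vs T" using R(11) c by simp
      moreover have y: "y \<in> vs (other g' {p, q})" "y \<notin> {p, q}" using f by auto
      ultimately have "other g' {p, q} = T" using tri_faces_far(1)[OF t(3,4) R(1,2)] by blast
      then show False using rootless[OF r pq(1) _ _ _ y(2)] y(1) good_donorD(3)[OF r' c'] shortD[OF c'(1)] by simp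
    qed
    consider "\<not> short g \<and> z = g \<and> y = v" "\<not> short g' \<and> z = g' \<and> y = v1" | "short g" "good_donor g v z y" "short g'" "good_donor g' v1 z y"
      using c c' mix[OF r r'] mix[OF r' r] by blast
    then show ?thesis
    proof cases
      case 1
      note R = root_sideD[OF r] and R' = root_sideD[OF r']
      have "y \<in> vs T" "y \<in> vs T'" using R(11) R'(11) 1 by auto
      then show ?thesis using tri_faces_far(1)[OF R(1,2) R'(1,2)] 1 by blast
    next
      case 2
      obtain p q where pq: "T_edge g {p, q}" "facial (other g {p, q}) [p, q, y]" using good_donorD(1)[OF r 2(1,2)] by blast
      obtain p' q' where pq': "T_edge g' {p', q'}" "facial (other g' {p', q'}) [p', q', y]" using good_donorD(1)[OF r' 2(3,4)] by blast
      note f = facial3[OF pq(2)] and t = T_edgeD[OF pq(1)] and f' = facial3[OF pq'(2)] and t' = T_edgeD[OF pq'(1)]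
      have yy: "y \<in> vs (other g {p, q})" "y \<in> vs (other g' {p', q'})" using f f' by auto
      then have eq: "other g {p, q} = other g' {p', q'}" using tri_faces_far(1)[OF t(3,4) t'(3,4)] by blast
      then have "{p, q, y} = {p', q', y}" using f f' by simp
      then have ee: "{p, q} = {p', q'}" using f f' by auto
      have "g = other (other g {p, q}) {p, q}" using other_other[OF t(1,2)] by (rule HOL.sym)
      also have "\<dots> = other (other g' {p', q'}) {p', q'}" by (rule arg_cong2[where f = other, OF eq ee])
      also have "\<dots> = g'" by (rule other_other[OF t'(1,2)])
      finally have gg: "g = g'" .
      then show ?thesis using root_of_side(1)[OF r r'[folded gg]] shortD[OF 2(1)] by blast
    qed
  qed
  obtain h u u' v where r: "root_side T g h u u' v" and c:
     "\<not> short g \<and> z = g \<and> y = v \<or> short g \<and> good_donor g v z y \<or> short g \<and> red_donor g v u z y \<or>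
      short g \<and> (\<nexists>z y. good_donor g v z y) \<and> angle g v u y \<and> rich y \<and> z = h"
    using assms(1) unfolding donor_def by blast
  obtain h' u1 u1' v1 where r': "root_side T' g' h' u1 u1' v1" and c':
     "\<not> short g' \<and> z = g' \<and> y = v1 \<or> short g' \<and> good_donor g' v1 z y \<or> short g' \<and> red_donor g' v1 u1 z y \<or>
      short g' \<and> (\<nexists>z y. good_donor g' v1 z y) \<and> angle g' v1 u1 y \<and> rich y \<and> z = h'"
    using assms(2) unfolding donor_def by blast
  note R = root_sideD[OF r] and R' = root_sideD[OF r']
  \<comment> \<open>Whether \<open>y\<close> is rich separates the kinds: the first two charge big
    vertices, the last two rich ones.\<close>
  have b: "rich y \<longleftrightarrow> \<not> (\<not> short g \<and> z = g \<and> y = v \<or> short g \<and> good_donor g v z y)"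
    using c big_not_rich[of y] R(29) good_donorD(3)[OF r] red_donorE[OF r] by metis
  have b': "rich y \<longleftrightarrow> \<not> (\<not> short g' \<and> z = g' \<and> y = v1 \<or> short g' \<and> good_donor g' v1 z y)"
    using c' big_not_rich[of y] R'(29) good_donorD(3)[OF r'] red_donorE[OF r'] by metis
  show ?thesis
  proof (cases "rich y")
    case False
    then show ?thesis using main[OF r r'] b b' by blast
  next
    case True
    \<comment> \<open>A red donor has a big vertex, a paying \<open>h\<close> is deficient and has
      none.\<close>
    have mix: False if "root_side T g h u u' v" "short g" "red_donor g v u h' y" "root_side T' g' h' u1 u1' v1" for T g h u u' v T' g' h' u1 u1' v1
    proof -
      have "num_big h' \<noteq> 0" by (rule red_donorE[OF that(1,2,3)])
      then show False using root_sideD(6)[OF that(4)] by (simp add: deficient_def)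
    qed
    have kept: "short g \<and> red_donor g v u z y \<or> short g \<and> (\<nexists>z y. good_donor g v z y) \<and> angle g v u y \<and> rich y \<and> z = h"
      "short g' \<and> red_donor g' v1 u1 z y \<or> short g' \<and> (\<nexists>z y. good_donor g' v1 z y) \<and> angle g' v1 u1 y \<and> rich y \<and> z = h'"
      using True b b' c c' by blast+
    then consider "short g" "short g'" "red_donor g v u z y" "red_donor g' v1 u1 z y"
      | "short g" "short g'" "\<nexists>z y. good_donor g v z y" "angle g v u y" "angle g' v1 u1 y" "z = h" "z = h'"
      using mix[OF r _ _ r'] mix[OF r' _ _ r] by blast
    then show ?thesis
    proof cases
      case 1
      then have gg: "g = g'" using red_donor_inj[OF r _ _ r'] by blast
      then show ?thesis using root_of_side(1)[OF r r'[folded gg]] shortD 1 by blast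
    next
      case 2
      have exchange: "h' = h" using 2 by simp
      have uu: "u = u1" using pay_unique[OF r 2(1,3,4) True r'[unfolded exchange] 2(2,5)] .
      have "u \<in> vs T" "u \<in> vs T'" using R(11) R'(11) uu by auto
      then have TT: "T = T'" using tri_faces_far(1)[OF R(1,2) R'(1,2)] by blast
      have "v1 \<in> vs T'" using R'(11) by blast
      then have "v1 \<in> {u, v, u'}" using R(11) TT by blast
      then have "v1 = v" using R(17,18) R'(29) by (auto simp: big_def)
      then show ?thesis using TT R(14) R'(14) uu by simp
    qed
  qed
qed

section \<open>Final charge of the large faces\<close>

definition attributed :: "'f \<Rightarrow> 'a \<Rightarrow> bool" where "attributed f y \<longleftrightarrow> (\<exists>T g. donor T g f y)"
definition net :: "'a \<Rightarrow> 'f \<Rightarrow> int" where "net v f = kept v f - of_bool (attributed f v)"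
definition num_att :: "'f \<Rightarrow> nat" where "num_att f = card {y \<in> vs f. rich y \<and> attributed f y}"
definition num_quad_at :: "'a \<Rightarrow> 'f \<Rightarrow> nat" where "num_quad_at b f = card {e \<in> bd f. b \<in> e \<and> len (other f e) = 4}"

section \<open>What a large face retains at its vertices\<close>

text \<open>A big vertex is charged only as the vertex \<open>v\<close> of a side that is not short,
  or as the third vertex of the second triangle of a short side. In both cases it is on an edge of
  \<open>f\<close> with a triangle behind.\<close>

lemma attributed_big:
  assumes "attributed f y" "big y"
  shows "in_triangle y" "\<exists>e. T_edge f e \<and> y \<in> e" "num_big f = 1 \<Longrightarrow> \<not> short f" "four y \<or> 2 \<le> num_big f"
    "(\<exists>T h u u'. root_side T f h u u' y) \<or> (\<exists>T g h u u' v. root_side T g h u u' v \<and> short g \<and> good_donor g v f y)"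
proof -
  have nr: "\<not> rich y" using big_not_rich assms(2) by blast
  obtain T g h u u' v where r: "root_side T g h u u' v" and c:
     "\<not> short g \<and> f = g \<and> y = v \<or> short g \<and> good_donor g v f y \<or> short g \<and> red_donor g v u f y \<or>
      short g \<and> (\<nexists>z y. good_donor g v z y) \<and> angle g v u y \<and> rich y \<and> f = h"
    using assms(1) unfolding attributed_def donor_def by blast
  have nred: "\<not> (short g \<and> red_donor g v u f y)" using nr red_donorE[OF r] by metis
  then have c: "\<not> short g \<and> f = g \<and> y = v \<or> short g \<and> good_donor g v f y" using c nr by blast
  then show "(\<exists>T h u u'. root_side T f h u u' y) \<or> (\<exists>T g h u u' v. root_side T g h u u' v \<and> short g \<and> good_donor g v f y)"
    using r by blast
  show e: "\<exists>e. T_edge f e \<and> y \<in> e" using c root_T_edge[OF r] good_donorD(7)[OF r] by blast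
  then show "in_triangle y" using in_triangle_T_edge by blast
  show "\<not> short f" if "num_big f = 1" using c good_donorD(2)[OF r, of f y] that by auto
  show "four y \<or> 2 \<le> num_big f" using c good_donorD(2)[OF r, of f y] root_sideD(7)[OF r] by blast
qed

lemma not_attributed_nonrich: "three y \<Longrightarrow> \<not> rich y \<Longrightarrow> \<not> attributed f y"
proof
  assume y: "three y" "\<not> rich y" and a: "attributed f y"
  obtain T g h u u' v where r: "root_side T g h u u' v" and c:
     "\<not> short g \<and> f = g \<and> y = v \<or> short g \<and> good_donor g v f y \<or> short g \<and> red_donor g v u f y \<or>
      short g \<and> (\<nexists>z y. good_donor g v z y) \<and> angle g v u y \<and> rich y \<and> f = h"
    using a unfolding attributed_def donor_def by blast
  have nred: "\<not> (short g \<and> red_donor g v u f y)" using y red_donorE[OF r] by metis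
  have "big y" using c nred y(2) good_donorD(3)[OF r] root_sideD(29)[OF r] by blast
  then show False using y by (simp add: big_def)
qed

lemma num_small_at_le_2: "f \<in> F \<Longrightarrow> v \<in> vs f \<Longrightarrow> num_small_at v f \<le> 2"
proof -
  assume "f \<in> F" "v \<in> vs f"
  then obtain a b where ab: "angle f a v b" using vs_angle by blast
  show ?thesis unfolding num_small_at_angle[OF ab] by simp
qed

lemma num_quad_at_le:
  assumes "f \<in> F"
  shows "num_quad_at b f \<le> num_small_at b f" "T_edge f e \<Longrightarrow> b \<in> e \<Longrightarrow> Suc (num_quad_at b f) \<le> num_small_at b f"
proof -
  let ?N = "{e \<in> bd f. b \<in> e \<and> small (other f e)}" and ?Q = "{e \<in> bd f. b \<in> e \<and> len (other f e) = 4}"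
  have fin: "finite ?N" using fin_bd[OF assms] by simp
  have sub: "?Q \<subseteq> ?N" by (auto simp: small_def)
  show "num_quad_at b f \<le> num_small_at b f" unfolding num_quad_at_def num_small_at_def by (rule card_mono[OF fin sub])
  assume e: "T_edge f e" "b \<in> e"
  note t = T_edgeD[OF e(1)]
  have "e \<in> ?N" "e \<notin> ?Q" using t e(2) by auto
  then have "?Q \<subset> ?N" using sub by blast
  then show "Suc (num_quad_at b f) \<le> num_small_at b f" unfolding num_quad_at_def num_small_at_def using psubset_card_mono[OF fin] by (simp add: Suc_le_eq)
qed

text \<open>Anything below 3 occurs only at 4-vertices, in four ways: 2 units given as the face
  opposite to a triangle, 2 given to two demanding faces, 1 given to a donor demand at a vertex with
  small faces on both sides, or 1 given to one demanding face.\<close>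

lemma net_big:
  assumes f: "f \<in> F" "v \<in> vs f" and b: "big v"
  shows "3 \<le> net v f \<or> net v f = 1 \<and> four v \<and> in_triangle v \<and> num_small_at v f = 0
    \<or> net v f = 1 \<and> four v \<and> \<not> in_triangle v \<and> num_small_at v f = 0 \<and> num_demanding v = 2
    \<or> net v f = 2 \<and> four v \<and> in_triangle v \<and> num_small_at v f = 2 \<and> attributed f v
    \<or> net v f = 2 \<and> four v \<and> \<not> in_triangle v \<and> num_small_at v f = 1 \<and> \<not> demanding f \<and> num_demanding v = 1"
proof -
  have n3: "\<not> three v" using b by (simp add: big_def)
  show ?thesis
  proof (cases "v = x \<or> \<not> four v")
    case True
    then show ?thesis using n3 by (auto simp: net_def kept_def)
  next
    case False
    then have 4: "four v" "v \<noteq> x" by auto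
    have kept: "kept v f = 3 + exchange v f" using 4 n3 by (simp add: kept_def)
    have "num_small_at v f \<le> 2" by (rule num_small_at_le_2[OF f])
    then consider (0) "num_small_at v f = 0" | (1) "num_small_at v f = 1" | (2) "num_small_at v f = 2" by linarith
    note nc = this
    show ?thesis
    proof (cases "in_triangle v")
      case True
      show ?thesis
        using nc
      proof cases
        case 0
        have "\<not> attributed f v"
        proof
          assume "attributed f v"
          then obtain e where "T_edge f e" "v \<in> e" using attributed_big(2)[OF _ b] by blast
          then show False using num_quad_at_le(2)[OF f(1)] 0 by fastforce
        qed
        then show ?thesis using 0 True 4 kept by (simp add: net_def exchange_def)
      next
        case 1
        then show ?thesis using True 4 kept by (simp add: net_def exchange_def)
      next
        case 2
        then show ?thesis using True 4 kept by (simp add: net_def exchange_def)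
      qed
    next
      case False
      then have "\<not> attributed f v" using attributed_big(1)[OF _ b] by blast
      then have N: "net v f = 3 + exchange v f" using kept by (simp add: net_def)
      show ?thesis
        using nc
      proof cases
        case 0
        then show ?thesis using False 4 N by (simp add: exchange_def)
      next
        case 1
        then show ?thesis using False 4 N by (simp add: exchange_def)
      next
        case 2
        then show ?thesis using False 4 N by (simp add: exchange_def)
      qed
    qed
  qed
qed

lemma net_ge_1: "f \<in> F \<Longrightarrow> v \<in> vs f \<Longrightarrow> big v \<Longrightarrow> 1 \<le> net v f"
  using net_big[of f v] by auto

lemma net_three: "three v \<Longrightarrow> net v f = of_bool (rich v) - of_bool (rich v \<and> attributed f v)"
  using not_attributed_nonrich[of v f] threeD[of v] by (auto simp: net_def kept_def)

lemma num_att_le: "f \<in> F \<Longrightarrow> num_att f \<le> num_rich f"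
  unfolding num_att_def num_rich_def using fin_vs[of f] by (intro card_mono) auto

lemma sum_net:
  assumes f: "f \<in> F"
  shows "(\<Sum>v\<in>vs f. net v f) = (\<Sum>v\<in>{v \<in> vs f. big v}. net v f) + int (num_rich f) - int (num_att f)"
proof -
  let ?B = "{v \<in> vs f. big v}" and ?T = "{v \<in> vs f. three v}"
  have fin: "finite ?B" "finite ?T" using fin_vs[OF f] by auto
  have dj: "?B \<inter> ?T = {}" by (auto simp: big_def)
  have "(\<Sum>v\<in>vs f. net v f) = (\<Sum>v\<in>?B. net v f) + (\<Sum>v\<in>?T. net v f)"
    using sum.union_disjoint[OF fin dj, of "\<lambda>v. net v f"] vs_split[OF f] by simp
  also have "(\<Sum>v\<in>?T. net v f) = (\<Sum>v\<in>?T. of_bool (rich v) - of_bool (rich v \<and> attributed f v))"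
    by (rule sum.cong) (auto simp: net_three)
  also have "\<dots> = (\<Sum>v\<in>?T. of_bool (rich v)) - (\<Sum>v\<in>?T. of_bool (rich v \<and> attributed f v))" by (rule sum_subtractf)
  also have "(\<Sum>v\<in>?T. of_bool (rich v)) = int (num_rich f)"
  proof -
    have "?T \<inter> {v. rich v} = {v \<in> vs f. rich v}" using rich_three by auto
    then show ?thesis using fin by (simp add: sum_of_bool_eq num_rich_def)
  qed
  also have "(\<Sum>v\<in>?T. of_bool (rich v \<and> attributed f v)) = int (num_att f)"
  proof -
    have "?T \<inter> {v. rich v \<and> attributed f v} = {v \<in> vs f. rich v \<and> attributed f v}" using rich_three by auto
    then show ?thesis using fin by (simp add: sum_of_bool_eq num_att_def)
  qed
  finally show ?thesis by simp
qed

text \<open>At a rich vertex a face is charged as a red donor or as a deficient \<open>h\<close>;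
  the latter is excluded. The last two conclusions bring in \<open>red_no_pull\<close> and
  \<open>reducible_red\<close>.\<close>

lemma attributed_red:
  assumes y: "rich y" "attributed f y" and nD: "\<not> deficient f"
  obtains c2 c where "big c2" "angle f c2 c y" "three c" "len (other f {c2, c}) = 4"
    "four c2 \<Longrightarrow> \<not> in_triangle c2 \<Longrightarrow> num_small_at c2 f = 1 \<Longrightarrow> \<not> demanding f \<Longrightarrow> num_demanding c2 \<noteq> 1"
    "four c2 \<Longrightarrow> len f = 8 \<Longrightarrow> num_big f = 1 \<Longrightarrow> num_T f = 2 \<Longrightarrow> num_rich f = 1 \<Longrightarrow> False"
proof -
  have nb: "\<not> big y" using y big_not_rich by blast
  obtain T g h u u' v where r: "root_side T g h u u' v" and c:
     "\<not> short g \<and> f = g \<and> y = v \<or> short g \<and> good_donor g v f y \<or> short g \<and> red_donor g v u f y \<or>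
      short g \<and> (\<nexists>z y. good_donor g v z y) \<and> angle g v u y \<and> rich y \<and> f = h"
    using y(2) unfolding attributed_def donor_def by blast
  have c': "short g" "red_donor g v u f y" using c nb good_donorD(3)[OF r] root_sideD(29,6)[OF r] nD by blast+
  obtain m c p q s c2 m2 where R: "facial g [v,u,m,c,y,p,q,s]" "facial (other g {m, c}) [m,c,c2,m2]" "rich y" "T_edge g {p, q}"
     "num_big (other g {y, p}) = 1" "f = other g {c, y}" "f \<in> F" "big c2" "angle f c2 c y" "len (other f {c2, c}) = 4" "three c"
    by (rule red_donorE[OF r c']) (rule that)
  show ?thesis
  proof (rule that[OF R(8,9,11,10)])
    show "num_demanding c2 \<noteq> 1" if "four c2" "\<not> in_triangle c2" "num_small_at c2 f = 1" "\<not> demanding f"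
      using red_no_pull[OF r c'(1) R(1,2)] that unfolding R(6) by blast
    show False if "four c2" "len f = 8" "num_big f = 1" "num_T f = 2" "num_rich f = 1"
      using reducible_red[OF r c'(1) R(1-5)] that unfolding R(6) by blast
  qed
qed

text \<open>Next but one to a rich vertex charged in this way is a big vertex whose edge of
  \<open>f\<close> in between borders a 4-face. The edge, whose other end is a 3-vertex, determines
  the rich vertex.\<close>

lemma num_att_bound:
  assumes f: "f \<in> F" and nD: "\<not> deficient f"
  shows "num_att f \<le> (\<Sum>b\<in>{v \<in> vs f. big v}. num_quad_at b f)"
proof -
  let ?B = "{v \<in> vs f. big v}" and ?Y = "{y \<in> vs f. rich y \<and> attributed f y}"
  let ?E = "\<lambda>b. {e \<in> bd f. b \<in> e \<and> len (other f e) = 4}"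
  define P where "P y e \<longleftrightarrow> (\<exists>c2 c. big c2 \<and> angle f c2 c y \<and> three c \<and> e = {c2, c} \<and> len (other f e) = 4)" for y e
  have ex: "\<exists>e. P y e" if "y \<in> ?Y" for y
  proof -
    have y: "rich y" "attributed f y" using that by auto
    obtain c2 c where "big c2" "angle f c2 c y" "three c" "len (other f {c2, c}) = 4"
      by (rule attributed_red[OF y nD])
    then show ?thesis unfolding P_def by blast
  qed
  then obtain \<phi> where \<phi>: "\<And>y. y \<in> ?Y \<Longrightarrow> P y (\<phi> y)" by metis
  have "inj_on \<phi> ?Y"
  proof (rule inj_onI)
    fix y y' assume yy: "y \<in> ?Y" "y' \<in> ?Y" "\<phi> y = \<phi> y'"
    obtain c2 c where c: "big c2" "angle f c2 c y" "three c" "\<phi> y = {c2, c}" using \<phi>[OF yy(1)] unfolding P_def by blast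
    obtain b2 b where b: "big b2" "angle f b2 b y'" "three b" "\<phi> y' = {b2, b}" using \<phi>[OF yy(2)] unfolding P_def by blast
    have "{c2, c} = {b2, b}" using c b yy by simp
    then have "c2 = b2 \<and> c = b" using c(1,3) b(1,3) by (auto simp: doubleton_eq_iff big_def)
    then show "y = y'" using angle_unique[OF c(2), of y'] angleD(2,4)[OF b(2)] by blast
  qed
  moreover have "\<phi> ` ?Y \<subseteq> (\<Union>b\<in>?B. ?E b)"
  proof (rule image_subsetI)
    fix y assume "y \<in> ?Y"
    then obtain c2 c where c: "big c2" "angle f c2 c y" "\<phi> y = {c2, c}" "len (other f (\<phi> y)) = 4" using \<phi> unfolding P_def by blast
    have "c2 \<in> ?B" using c angleD(16)[OF c(2)] by simp
    moreover have "\<phi> y \<in> ?E c2" using c angleD(3)[OF c(2)] by simp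
    ultimately show "\<phi> y \<in> (\<Union>b\<in>?B. ?E b)" by blast
  qed
  moreover have fin: "finite ?B" using fin_vs[OF f] by simp
  moreover have "finite (\<Union>b\<in>?B. ?E b)" using fin fin_bd[OF f] by simp
  ultimately have "card ?Y \<le> card (\<Union>b\<in>?B. ?E b)" by (rule_tac card_inj_on_le)
  also have "\<dots> \<le> (\<Sum>b\<in>?B. card (?E b))" by (rule card_UN_le[OF fin])
  finally show ?thesis by (simp add: num_att_def num_quad_at_def)
qed

section \<open>Rich vertices forced by the positions of triangles\<close>

lemma T_edge_next: "three z \<Longrightarrow> angle f a z b \<Longrightarrow> T_edge f {a, z} \<Longrightarrow> \<not> small (other f {z, b})"
  using three_edges[of z f a b] T_edgeD(8)[of f "{a, z}"] by (simp add: insert_commute)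

lemma richI:
  assumes "three y" "angle f a y b" "\<not> small f" "\<not> small (other f {a, y})" "\<not> small (other f {y, b})" shows "rich y"
  using rich_iff[OF assms(1-3)] assms(4,5) by (simp add: insert_commute)

lemma rich_between:
  assumes "three z" "angle f a z y" "T_edge f {a, z}" "three y" "angle f z y k" "\<not> small f" "\<not> small (other f {y, k})"
  shows "rich y"
  by (rule richI[OF assms(4,5,6) _ assms(7)]) (rule T_edge_next[OF assms(1-3)])

lemma num_small_at_0: "angle f a v b \<Longrightarrow> num_small_at v f = 0 \<Longrightarrow> \<not> small (other f {v, a}) \<and> \<not> small (other f {v, b})"
  using num_small_at_angle[of f a v b] by auto

text \<open>The triangle at \<open>w\<close> is not behind an edge of \<open>f\<close> at
  \<open>w\<close>, and by the distance condition no other triangle touches \<open>w\<close> or its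
  neighbours. Two triangles fit into the remaining edges in one way only.\<close>

lemma unpaid_pattern:
  assumes f: "f \<in> F" "len f = 8" "num_T f = 2" and w: "w \<in> vs f" "in_triangle w" "num_small_at w f = 0"
  obtains y z c3 c4 c5 z' y' where "facial f [w,y,z,c3,c4,c5,z',y']" "T_edge f {z, c3}" "T_edge f {c5, z'}"
proof -
  obtain y z c3 c4 c5 z' y' where l: "facial f [w,y,z,c3,c4,c5,z',y']" using vs_facial8[OF f(1,2) w(1)] by blast
  note m = facial8[OF l] and ee = facial8_adj[OF l]
  obtain T where T: "T \<in> F" "len T = 3" "w \<in> vs T" using w(2) unfolding in_triangle_def by blast
  have no: "\<not> T_edge f e" if e: "a \<in> e" "a = w \<or> A w a" "a \<in> vs f" for a e
  proof
    assume t: "T_edge f e"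
    note tD = T_edgeD[OF t]
    have "other f e = T"
      using tri_faces_far[OF T(1,2) tD(3,4) _ T(3), of a] tD(9) e by blast
    then have aT: "a \<in> vs T" using tD(9) e by blast
    have aw: "a \<noteq> w"
    proof
      assume "a = w"
      then have "Suc (num_quad_at w f) \<le> num_small_at w f" using num_quad_at_le(2)[OF f(1) t] e by blast
      then show False using w(3) by simp
    qed
    then have "{w, a} \<in> bd f" using chord8[OF f(1,2) w(1) e(3)] e(2) by blast
    moreover have "{w, a} \<in> bd T" using tri_adj(2)[OF T(1,2,3) aT] aw by blast
    moreover have "T \<noteq> f" using f T by auto
    ultimately have "other f {w, a} = T" using other_eq f(1) T(1) by blast
    then have "{w, a} \<in> {e \<in> bd f. w \<in> e \<and> small (other f e)}" using \<open>{w, a} \<in> bd f\<close> T(2) by (simp add: small_def)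
    then show False using w(3) fin_bd[OF f(1)] unfolding num_small_at_def by auto
  qed
  have n: "\<not> T_edge f {w, y}" "\<not> T_edge f {y, z}" "\<not> T_edge f {z', y'}" "\<not> T_edge f {y', w}"
    using no[of w "{w, y}"] no[of y "{y, z}"] no[of y' "{z', y'}"] no[of w "{y', w}"] ee m(10) by auto
  have sub: "{e. T_edge f e} \<subseteq> {{z, c3}, {c3, c4}, {c4, c5}, {c5, z'}}"
  proof
    fix e assume "e \<in> {e. T_edge f e}"
    then have t: "T_edge f e" by simp
    have "e \<in> {{w,y},{y,z},{z,c3},{c3,c4},{c4,c5},{c5,z'},{z',y'},{y',w}}"
      unfolding m(12)[symmetric] by (rule T_edgeD(2)[OF t])
    then show "e \<in> {{z, c3}, {c3, c4}, {c4, c5}, {c5, z'}}" using t n by blast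
  qed
  obtain e1 e2 where E: "{e. T_edge f e} = {e1, e2}" "e1 \<noteq> e2" using f(3) unfolding num_T_def card_2_iff by blast
  have E1: "T_edge f e1" "T_edge f e2" using E by blast+
  have ne: "{c3, z} \<noteq> {c3, c4}" "{z, c3} \<noteq> {c4, c5}" "{c3, c4} \<noteq> {c4, c5}" "{c3, c4} \<noteq> {c5, z'}" "{c4, c5} \<noteq> {c5, z'}"
    using m(9) by (auto simp: doubleton_eq_iff)
  have x1: "\<not> (T_edge f {z, c3} \<and> T_edge f {c3, c4})" using T_edge_far(1)[of f "{z, c3}" "{c3, c4}" c3 c3] ne by (auto simp: insert_commute)
  have x2: "\<not> (T_edge f {z, c3} \<and> T_edge f {c4, c5})" using T_edge_adj[of f z c3 c4 c5] ne ee by blast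
  have x3: "\<not> (T_edge f {c3, c4} \<and> T_edge f {c4, c5})" using T_edge_far(1)[of f "{c3, c4}" "{c4, c5}" c4 c4] ne by auto
  have x4: "\<not> (T_edge f {c3, c4} \<and> T_edge f {c5, z'})" using T_edge_adj[of f c3 c4 c5 z'] ne ee by blast
  have x5: "\<not> (T_edge f {c4, c5} \<and> T_edge f {c5, z'})" using T_edge_far(1)[of f "{c4, c5}" "{c5, z'}" c5 c5] ne by auto
  have "e1 \<in> {{z, c3}, {c3, c4}, {c4, c5}, {c5, z'}}" "e2 \<in> {{z, c3}, {c3, c4}, {c4, c5}, {c5, z'}}" using E1 sub by blast+
  then have "T_edge f {z, c3} \<and> T_edge f {c5, z'}" using E1 E(2) x1 x2 x3 x4 x5 by blast
  then show ?thesis using that l by blast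
qed

text \<open>Each of the two neighbours of \<open>w\<close> on \<open>f\<close> is rich unless it or the next vertex is big.\<close>

lemma unpaid_rich:
  assumes f: "f \<in> F" "len f = 8" "num_T f = 2" and w: "w \<in> vs f" "in_triangle w" "num_small_at w f = 0" "big w"
  shows "num_big f \<le> 2 \<Longrightarrow> 1 \<le> num_rich f" "num_big f = 1 \<Longrightarrow> 2 \<le> num_rich f"
proof -
  obtain y z c3 c4 c5 z' y' where l: "facial f [w,y,z,c3,c4,c5,z',y']" "T_edge f {z, c3}" "T_edge f {c5, z'}"
    using unpaid_pattern[OF f w(1-3)] by blast
  note m = facial8[OF l(1)]
  have ns: "\<not> small f" using f by (simp add: small_def)
  have nw: "\<not> small (other f {w, y'})" "\<not> small (other f {w, y})" using num_small_at_0[OF m(1) w(3)] by auto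
  have r1: "rich y" if "three y" "three z"
  proof (rule rich_between[OF that(2) angle_sym[OF m(3)] _ that(1) angle_sym[OF m(2)] ns])
    show "T_edge f {c3, z}" using l(2) by (simp add: insert_commute)
    show "\<not> small (other f {y, w})" using nw by (simp add: insert_commute)
  qed
  have r2: "rich y'" if "three y'" "three z'"
  proof (rule rich_between[OF that(2) m(7) l(3) that(1) m(8) ns])
    show "\<not> small (other f {y', w})" using nw by (simp add: insert_commute)
  qed
  have fin: "finite {v \<in> vs f. big v}" "finite {v \<in> vs f. rich v}" using fin_vs[OF f(1)] by auto
  have three: "three v" if "v \<in> vs f" "\<not> big v" for v using that vs_U[OF f(1)] by (simp add: big_def)
  show "1 \<le> num_rich f" if "num_big f \<le> 2"
  proof (rule ccontr)
    assume "\<not> 1 \<le> num_rich f"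
    then have "num_rich f = 0" by simp
    then have "{v \<in> vs f. rich v} = {}" using fin(2) unfolding num_rich_def by simp
    then have "\<not> rich y" "\<not> rich y'" using m(10) by auto
    then obtain p q where p: "p \<in> {y, z}" "big p" "q \<in> {y', z'}" "big q" using r1 r2 three m(10) by blast
    have "{w, p, q} \<subseteq> {v \<in> vs f. big v}" using p w m(10) by auto
    then have "card {w, p, q} \<le> num_big f" unfolding num_big_def by (rule card_mono[OF fin(1)])
    moreover have "card {w, p, q} = 3" using p(1,3) m(9) by auto
    ultimately show False using that by simp
  qed
  show "2 \<le> num_rich f" if "num_big f = 1"
  proof -
    have th: "three v" if "v \<in> vs f" "v \<noteq> w" for v using num_big_1[OF f(1) \<open>num_big f = 1\<close> w(1,4) that] .
    have "rich y" "rich y'" using r1 r2 th m(9,10) by auto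
    then have "{y, y'} \<subseteq> {v \<in> vs f. rich v}" using m(10) by auto
    then have "card {y, y'} \<le> num_rich f" unfolding num_rich_def by (rule card_mono[OF fin(2)])
    then show ?thesis using m(9) by simp
  qed
qed

text \<open>If \<open>z'\<close> were charged as the vertex of a root side \<open>f\<close>, then
  \<open>w\<close>, the next vertex after \<open>z\<close>, would be a 3-vertex by
  \<open>root_h\<close>. If it were charged for a short \<open>g\<close>, then \<open>g\<close>
  would be the face beyond \<open>{z, w}\<close>, so its only big vertex \<open>w\<close> would be
  on a triangle.\<close>

lemma payer_no_attributed:
  assumes f: "f \<in> F" "\<not> small f" and w: "four w" "\<not> in_triangle w" and a: "angle f w z z'" and t: "T_edge f {z, z'}" and z: "three z"
    and b: "big z'" "attributed f z'"
  shows False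
proof -
  have zz: "z \<noteq> z'" using angleD[OF a] by blast
  have wb: "big w" using four_big w by blast
  note tD = T_edgeD[OF t]
  from attributed_big(5)[OF b(2,1)] show False
  proof (elim disjE exE conjE)
    fix T h u u' assume r: "root_side T f h u u' z'"
    note R = root_sideD[OF r]
    have "{u, z'} = {z, z'}" using T_edge_far(1)[OF root_T_edge[OF r] t, of z' z'] by blast
    then have uz: "u = z" using zz by (auto simp: doubleton_eq_iff)
    have "angle f z' u w" using angle_sym[OF a] uz by simp
    then have "three w" by (rule root_h(3)[OF r])
    then show False using wb by (simp add: big_def)
  next
    fix T g h u u' v assume r: "root_side T g h u u' v" and sg: "short g" and gg: "good_donor g v f z'"
    obtain p q where pq: "T_edge g {p, q}" "facial (other g {p, q}) [p, q, z']" "f = other (other g {p, q}) {p, z'}"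
      using good_donorD(1)[OF r sg gg] by blast
    note T2 = T_edgeD[OF pq(1)] and f3 = facial3[OF pq(2)]
    have ang2: "angle (other g {p, q}) z' p q" using f3 by blast
    have e: "{p, z'} \<in> bd (other g {p, q})" by (rule angleD(5)[OF ang2])
    have ofp: "other f {p, z'} = other g {p, q}" using other_other[OF T2(3) e] pq(3) by simp
    have "T_edge f {p, z'}" using other(3)[OF T2(3) e] f(1) ofp T2(4,5) pq(3) by (simp add: T_edge_def)
    then have "{p, z'} = {z, z'}" using T_edge_far(1)[of f "{p, z'}" "{z, z'}" z' z'] t by blast
    then have pz: "p = z" using zz by (auto simp: doubleton_eq_iff)
    have d3: "deg z = 3" using threeD[OF z] by blast
    obtain c where c: "c \<noteq> z'" "angle (other f {z, z'}) z' z c" "other (other f {z, z'}) {z, c} = other f {z, w}"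
      by (rule three_struct[OF d3 a]) (rule that)
    have oz: "other f {z, z'} = other g {p, q}" using ofp pz by simp
    have "c = q" using angle_unique[OF ang2, of c] angleD(4)[OF c(2)] c(1) unfolding oz pz by blast
    then have "other (other g {p, q}) {p, q} = other f {z, w}" using c(3) oz pz by simp
    then have "g = other f {z, w}" using other_other[OF T2(1,2)] by simp
    then have "{z, w} \<in> bd g" using other(3)[OF f(1) angleD(5)[OF a]] by simp
    then have wg: "w \<in> vs g" using edge_vs by blast
    note R = root_sideD[OF r]
    have vg: "v \<in> vs g" using edge_vs[OF R(16)] by auto
    have "w = v" using num_big_1[OF R(5) _ vg R(29) wg] shortD[OF sg] wb by (auto simp: big_def)
    then have "in_triangle w" using R(1,2,11) unfolding in_triangle_def by blast
    then show False using w by blast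
  qed
qed

text \<open>The triangles along \<open>f\<close> are at the two neighbours of \<open>w\<close>. A
  second big 4-vertex of the first kind would be on one of them, and a second payer would need
  triangles at both its own neighbours.\<close>

lemma payer_other:
  assumes f: "f \<in> F" "len f = 8" "num_T f = 2" and w: "w \<in> vs f" "four w" "\<not> in_triangle w" "num_small_at w f = 0" "num_demanding w = 2"
    and b: "b \<in> vs f" "b \<noteq> w" "four b"
  shows "\<not> (in_triangle b \<and> attributed f b)" "\<not> (\<not> in_triangle b \<and> num_small_at b f = 0 \<and> num_demanding b = 2)"
proof -
  have ns: "\<not> small f" using f by (simp add: small_def)
  obtain t z where a: "angle f t w z" using vs_angle[OF f(1) w(1)] by blast
  have a': "angle f z w t" using angle_sym[OF a] .
  obtain t1 l3 l4 l5 l6 l7 t' where P: "\<And>y. y \<in> {t,t1,l3,l4,l5,l6,l7} \<Longrightarrow> three y \<and> \<not> rich y" "angle f w t t'" "T_edge f {t, t'}"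
    by (rule payer_nbr[OF w(2,3) a ns w(4,5)]) (rule that)
  obtain z1 k3 k4 k5 k6 k7 z' where Q: "\<And>y. y \<in> {z,z1,k3,k4,k5,k6,k7} \<Longrightarrow> three y \<and> \<not> rich y" "angle f w z z'" "T_edge f {z, z'}"
    by (rule payer_nbr[OF w(2,3) a' ns w(4,5)]) (rule that)
  have t3: "three t" "three z" using P(1) Q(1) by blast+
  obtain f3 f4 f5 f6 f7 where l: "facial f [t,w,z,f3,f4,f5,f6,f7]" by (rule angle_facial8[OF a f(2)])
  note m0 = facial8[OF l]
  have "f3 = z'" using angle_unique[OF Q(2) angleD(4)[OF m0(3)]] m0(9) by auto
  moreover have "f7 = t'" using angle_unique[OF P(2), of f7] angleD(5)[OF m0(1)] m0(9) by auto
  ultimately have l: "facial f [t,w,z,z',f4,f5,f6,t']" using l by simp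
  note m = facial8[OF l]
  have "{t, t'} \<noteq> {z, z'}" using m(9) by (auto simp: doubleton_eq_iff)
  then have c2: "card {{t, t'}, {z, z'}} = 2" by simp
  have sub: "{{t, t'}, {z, z'}} \<subseteq> {e. T_edge f e}" using P(3) Q(3) by blast
  have Te: "{{t, t'}, {z, z'}} = {e. T_edge f e}"
    by (rule card_subset_eq[OF finite_T_edge sub]) (use c2 f(3) in \<open>simp add: num_T_def\<close>)
  have bb: "big b" using four_big b(3) by blast
  have btz: "b \<noteq> t" "b \<noteq> z" using t3 bb by (auto simp: big_def)
  show "\<not> (in_triangle b \<and> attributed f b)"
  proof
    assume h: "in_triangle b \<and> attributed f b"
    then obtain e where "T_edge f e" "b \<in> e" using attributed_big(2)[OF _ bb] by blast
    then have "b = t' \<or> b = z'" using Te btz by blast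
    then show False
    proof
      assume "b = t'"
      then show False using payer_no_attributed[OF f(1) ns w(2,3) P(2,3) t3(1)] bb h by blast
    next
      assume "b = z'"
      then show False using payer_no_attributed[OF f(1) ns w(2,3) Q(2,3) t3(2)] bb h by blast
    qed
  qed
  show "\<not> (\<not> in_triangle b \<and> num_small_at b f = 0 \<and> num_demanding b = 2)"
  proof
    assume h: "\<not> in_triangle b \<and> num_small_at b f = 0 \<and> num_demanding b = 2"
    then have h': "\<not> in_triangle b" "num_small_at b f = 0" "num_demanding b = 2" by auto
    have nb: "\<exists>e. T_edge f e \<and> p \<in> e" if p: "angle f p b q" for p q
    proof -
      obtain r where "T_edge f {p, r}"
        by (rule payer_nbr[OF b(3) h'(1) p ns h'(2,3)]) (rule that)
      then show ?thesis by blast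
    qed
    have T4: "p = t \<or> p = t' \<or> p = z \<or> p = z'" if "\<exists>e. T_edge f e \<and> p \<in> e" for p using that Te by blast
    have nT: "b \<noteq> t'" "b \<noteq> z'" using in_triangle_T_edge[OF P(3), of b] in_triangle_T_edge[OF Q(3), of b] h'(1) by auto
    have d: "distinct [t,w,z,z',f4,f5,f6,t']" by (rule m)
    consider "b = f4" | "b = f5" | "b = f6" using b(1,2) btz nT m(10) by auto
    then show False
    proof cases
      case 1 then show ?thesis using T4[OF nb[OF angle_sym[OF m(5)[folded 1]]]] d by auto
    next
      case 2 then show ?thesis using T4[OF nb[OF m(6)[folded 2]]] d by auto
    next
      case 3 then show ?thesis using T4[OF nb[OF m(7)[folded 3]]] d by auto
    qed
  qed
qed

lemma pattern9:
  assumes f: "f \<in> F" "len f = 9" "num_T f = 3"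
  obtains a0 a1 a2 a3 a4 a5 a6 a7 a8 where "facial f [a0,a1,a2,a3,a4,a5,a6,a7,a8]" "T_edge f {a0, a1}" "T_edge f {a3, a4}" "T_edge f {a6, a7}"
proof -
  have "{e. T_edge f e} \<noteq> {}" using f(3) unfolding num_T_def by (metis card.empty zero_neq_numeral)
  then obtain e where e: "T_edge f e" by blast
  note t = T_edgeD[OF e]
  then have "e \<in> EA" using bdE by blast
  then obtain a0 a1 where a: "e = {a0, a1}" by (auto simp: EA_def)
  have e01: "T_edge f {a0, a1}" using e a by simp
  have e01': "{a0, a1} \<in> bd f" using T_edgeD(2)[OF e01] .
  obtain zs where zs: "facial f (a0 # a1 # zs)" by (rule edge_facial[OF f(1) e01'])
  then have "length zs = 7" using facial_len[OF zs] f(2) by simp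
  then obtain a2 a3 a4 a5 a6 a7 a8 where "zs = [a2,a3,a4,a5,a6,a7,a8]"
    by (auto simp: numeral_eq_Suc length_Suc_conv)
  then have l: "facial f [a0,a1,a2,a3,a4,a5,a6,a7,a8]" using zs by simp
  have b: "bd f = {{a0,a1},{a1,a2},{a2,a3},{a3,a4},{a4,a5},{a5,a6},{a6,a7},{a7,a8},{a8,a0}}"
    using facial_bd[OF l] by (simp add: cedges_def)
  have d: "distinct [a0,a1,a2,a3,a4,a5,a6,a7,a8]" by (rule facial_distinct[OF l])
  have A: "A a1 a2" "A a8 a0" "A a4 a5" "A a5 a6" using edge_A[OF f(1)] b by auto
  have c: "{a, b} = {b, a}" for a b :: 'a by auto
  have no: "\<not> T_edge f e'" if "e' \<noteq> {a0, a1}" "p \<in> e'" "p \<in> {a0, a1, a2, a8}" for e' p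
  proof
    assume t: "T_edge f e'"
    note far = T_edge_far[OF e01 t that(1)[symmetric]]
    show False using that(2,3) far(1)[of a0 p] far(1)[of a1 p] far(2)[of a1 p] far(2)[of a0 p] A sym by blast
  qed
  have ne: "{a1,a2} \<noteq> {a0,a1}" "{a2,a3} \<noteq> {a0,a1}" "{a7,a8} \<noteq> {a0,a1}" "{a8,a0} \<noteq> {a0,a1}"
    "{a3,a4} \<noteq> {a4,a5}" "{a3,a4} \<noteq> {a5,a6}" "{a4,a5} \<noteq> {a5,a6}" "{a4,a5} \<noteq> {a6,a7}" "{a5,a6} \<noteq> {a6,a7}"
    using d by (auto simp: doubleton_eq_iff)
  have n: "\<not> T_edge f {a1,a2}" "\<not> T_edge f {a2,a3}" "\<not> T_edge f {a7,a8}" "\<not> T_edge f {a8,a0}"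
    using no[of "{a1,a2}" a1] no[of "{a2,a3}" a2] no[of "{a7,a8}" a8] no[of "{a8,a0}" a8] ne by auto
  have sub: "{e. T_edge f e} \<subseteq> {{a0,a1}, {a3,a4}, {a4,a5}, {a5,a6}, {a6,a7}}"
  proof
    fix e assume "e \<in> {e. T_edge f e}"
    then have t: "T_edge f e" by simp
    have "e \<in> {{a0,a1},{a1,a2},{a2,a3},{a3,a4},{a4,a5},{a5,a6},{a6,a7},{a7,a8},{a8,a0}}"
      unfolding b[symmetric] by (rule T_edgeD(2)[OF t])
    then show "e \<in> {{a0,a1}, {a3,a4}, {a4,a5}, {a5,a6}, {a6,a7}}" using t n by blast
  qed
  have x1: "\<not> (T_edge f {a3,a4} \<and> T_edge f {a4,a5})" using T_edge_far(1)[of f "{a3,a4}" "{a4,a5}" a4 a4] ne(5) by blast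
  have x2: "\<not> (T_edge f {a3,a4} \<and> T_edge f {a5,a6})" using T_edge_adj[of f a3 a4 a5 a6] ne(6) A(3) by blast
  have x3: "\<not> (T_edge f {a4,a5} \<and> T_edge f {a5,a6})" using T_edge_far(1)[of f "{a4,a5}" "{a5,a6}" a5 a5] ne(7) by blast
  have x4: "\<not> (T_edge f {a4,a5} \<and> T_edge f {a6,a7})" using T_edge_adj[of f a4 a5 a6 a7] ne(8) A(4) by blast
  have x5: "\<not> (T_edge f {a5,a6} \<and> T_edge f {a6,a7})" using T_edge_far(1)[of f "{a5,a6}" "{a6,a7}" a6 a6] ne(9) by blast
  have "T_edge f {a3,a4} \<and> T_edge f {a6,a7}"
  proof (rule ccontr)
    assume "\<not> ?thesis"
    then obtain e' where "{e. T_edge f e} \<subseteq> {{a0,a1}, e'}" using sub x1 x2 x3 x4 x5 by blast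
    then have "num_T f \<le> card {{a0,a1}, e'}" unfolding num_T_def by (intro card_mono) auto
    also have "\<dots> \<le> 2" by (simp add: card_insert_if)
    finally show False using f(3) by simp
  qed
  then show ?thesis using that l e01 by blast
qed

text \<open>Three triangles are evenly spaced along a 9-face. The vertex midway between two of them
  is rich unless it or one of its neighbours is big, and a single big vertex can spoil only one of
  the three gaps.\<close>

lemma rich9:
  assumes f: "f \<in> F" "len f = 9" "num_T f = 3" and n: "num_big f \<le> 1"
  shows "2 \<le> num_rich f"
proof -
  obtain a0 a1 a2 a3 a4 a5 a6 a7 a8 where l: "facial f [a0,a1,a2,a3,a4,a5,a6,a7,a8]" and T: "T_edge f {a0, a1}" "T_edge f {a3, a4}" "T_edge f {a6, a7}"
    by (rule pattern9[OF f])
  have b: "bd f = {{a0,a1},{a1,a2},{a2,a3},{a3,a4},{a4,a5},{a5,a6},{a6,a7},{a7,a8},{a8,a0}}"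
    using facial_bd[OF l] by (simp add: cedges_def)
  have d: "distinct [a0,a1,a2,a3,a4,a5,a6,a7,a8]" by (rule facial_distinct[OF l])
  have v: "vs f = {a0,a1,a2,a3,a4,a5,a6,a7,a8}" using facial_vs[OF l] by simp
  have ns: "\<not> small f" using f by (simp add: small_def)
  have an: "angle f p q s" if "{p, q} \<in> bd f" "{q, s} \<in> bd f" "p \<noteq> s" for p q s using that f(1) by (simp add: angle_def)
  have R: "rich y" if e: "T_edge f {a, z}" "T_edge f {o1, o2}" "three z" "three y" "three o1" "{z, y} \<in> bd f" "{y, o1} \<in> bd f"
    "distinct [a, z, y, o1, o2]" for a z y o1 o2
  proof (rule rich_between[OF e(3) _ e(1) e(4) _ ns])
    show "angle f a z y" "angle f z y o1" using an[OF T_edgeD(2)[OF e(1)] e(6)] an[OF e(6,7)] e(8) by auto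
    have "angle f o2 o1 y" using an[of o2 o1 y] T_edgeD(2)[OF e(2)] e(7,8) by (auto simp: insert_commute)
    then have "\<not> small (other f {o1, y})" using T_edge_next[OF e(5), of f o2 y] e(2) by (simp add: insert_commute)
    then show "\<not> small (other f {y, o1})" by (simp add: insert_commute)
  qed
  have r2: "rich a2" if "three a1" "three a2" "three a3"
    by (rule R[OF T(1,2) that]) (use b d in auto)
  have r5: "rich a5" if "three a4" "three a5" "three a6"
    by (rule R[OF T(2,3) that]) (use b d in auto)
  have r8: "rich a8" if "three a7" "three a8" "three a0"
    by (rule R[OF T(3,1) that]) (use b d in auto)
  have fin: "finite {v \<in> vs f. big v}" "finite {v \<in> vs f. rich v}" using fin_vs[OF f(1)] by auto
  have three: "three v" if "v \<in> vs f" "\<not> big v" for v using that vs_U[OF f(1)] by (simp add: big_def)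
  have one: "p = q" if "big p" "big q" "p \<in> vs f" "q \<in> vs f" for p q
  proof (rule ccontr)
    assume "p \<noteq> q"
    then have "2 \<le> num_big f" using num_big_2[OF f(1) that(3,1,4,2)] by blast
    then show False using n by simp
  qed
  have two: "2 \<le> num_rich f" if "rich p" "rich q" "p \<in> vs f" "q \<in> vs f" "p \<noteq> q" for p q
  proof -
    have "{p, q} \<subseteq> {v \<in> vs f. rich v}" using that by auto
    then have "card {p, q} \<le> num_rich f" unfolding num_rich_def by (rule card_mono[OF fin(2)])
    then show ?thesis using that by simp
  qed
  have vv: "a0 \<in> vs f" "a1 \<in> vs f" "a2 \<in> vs f" "a3 \<in> vs f" "a4 \<in> vs f" "a5 \<in> vs f" "a6 \<in> vs f" "a7 \<in> vs f" "a8 \<in> vs f"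
    using v by auto
  show ?thesis
  proof (cases "big a1 \<or> big a2 \<or> big a3")
    case True
    then obtain p where p: "big p" "p \<in> {a1,a2,a3}" by blast
    have pv: "p \<in> vs f" using p(2) v by auto
    have "three w" if "w \<in> {a4,a5,a6,a7,a8,a0}" for w
    proof -
      have "w \<in> vs f" "w \<noteq> p" using that p(2) d v by auto
      then show ?thesis using three one[OF p(1) _ pv] by metis
    qed
    then have "rich a5" "rich a8" using r5 r8 by blast+
    then show ?thesis using two[of a5 a8] vv d by simp
  next
    case False
    then have "three a1" "three a2" "three a3" using three vv by blast+
    then have 2: "rich a2" by (rule r2)
    show ?thesis
    proof (cases "big a4 \<or> big a5 \<or> big a6")
      case True
      then obtain p where p: "big p" "p \<in> {a4,a5,a6}" by blast
      have pv: "p \<in> vs f" using p(2) v by auto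
      have "three w" if "w \<in> {a7,a8,a0}" for w
      proof -
        have "w \<in> vs f" "w \<noteq> p" using that p(2) d v by auto
        then show ?thesis using three one[OF p(1) _ pv] by metis
      qed
      then have "rich a8" using r8 by blast
      then show ?thesis using 2 two[of a2 a8] vv d by simp
    next
      case False
      then have "three a4" "three a5" "three a6" using three vv by blast+
      then have "rich a5" by (rule r5)
      then show ?thesis using 2 two[of a2 a5] vv d by simp
    qed
  qed
qed

section \<open>The inequality for every large face\<close>

text \<open>The needed 2 per triangle must come from the surplus length, the big vertices
  (\<open>S\<close>) and the rich vertices that are not charged. Few big vertices leave little in
  \<open>S\<close>; then parity, the forced rich vertices and the reducible configurations close the
  gap.\<close>

lemma face_charge:
  assumes f: "f \<in> F" "\<not> small f"
  shows "2 * (if deficient f then 0 else int (num_T f)) \<le> 3 * (int (len f) - 8) + (\<Sum>v\<in>vs f. kept v f - of_bool (attributed f v))"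
proof -
  let ?B = "{v \<in> vs f. big v}"
  define S where "S = (\<Sum>v\<in>?B. net v f)"
  define Q where "Q = (\<Sum>v\<in>?B. num_small_at v f)"
  have fin: "finite ?B" using fin_vs[OF f(1)] by simp
  have ln8: "8 \<le> len f" using not_small f by blast
  have k3: "3 * num_T f \<le> len f" by (rule num_T_bound[OF f])
  have num_att: "num_att f \<le> num_rich f" by (rule num_att_le[OF f(1)])
  have tot: "(\<Sum>v\<in>vs f. kept v f - of_bool (attributed f v)) = S + int (num_rich f) - int (num_att f)"
    using sum_net[OF f(1)] by (simp add: net_def S_def)
  have "(\<Sum>v\<in>?B. 1) \<le> S" unfolding S_def by (rule sum_mono) (use net_ge_1[OF f(1)] in auto)
  then have Sn: "int (num_big f) \<le> S" by (simp add: num_big_def)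
  then have S0: "0 \<le> S" by linarith
  have par: "even (len f + num_big f + num_rich f + Q)" using parity[OF f] by (simp add: Q_def)
  show ?thesis
  proof (cases "deficient f \<or> 10 \<le> len f")
    case True
    then show ?thesis
    proof
      \<comment> \<open>A deficient face pays no triangle, and every unit it may be charged is left
        over at a rich vertex.\<close>
      assume "deficient f"
      then show ?thesis unfolding tot using ln8 num_att Sn by simp
    next
      assume "10 \<le> len f"
      \<comment> \<open>Tight at length 10, where at most three triangles need 6 and the surplus is
        6.\<close>
      then have "2 * int (num_T f) \<le> 3 * (int (len f) - 8)" using k3 by presburger
      then show ?thesis unfolding tot using num_att Sn by auto
    qed
  next
    case False
    then have nD: "\<not> deficient f" and l: "len f = 8 \<or> len f = 9" using ln8 by auto
    \<comment> \<open>The shortfall is at most 4, so \<open>S\<close> at least 4 always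
      suffices.\<close>
    have kb: "2 * int (num_T f) \<le> 3 * (int (len f) - 8) + 4" using l
    proof
      assume "len f = 8"
      then have "num_T f \<le> 2" using k3 by linarith
      then show ?thesis using \<open>len f = 8\<close> by simp
    next
      assume "len f = 9"
      then have "num_T f \<le> 3" using k3 by linarith
      then show ?thesis using \<open>len f = 9\<close> by simp
    qed
    have goal: ?thesis if "2 * int (num_T f) \<le> 3 * (int (len f) - 8) + S + int (num_rich f) - int (num_att f)"
      unfolding tot using that nD by simp
    have ARq: "num_att f \<le> (\<Sum>b\<in>?B. num_quad_at b f)" by (rule num_att_bound[OF f(1) nD])
    have "(\<Sum>b\<in>?B. num_quad_at b f) \<le> Q" unfolding Q_def by (rule sum_mono) (rule num_quad_at_le(1)[OF f(1)])
    then have ARQ: "num_att f \<le> Q" using ARq by simp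
    \<comment> \<open>A charged rich vertex needs a big vertex with a 4-face behind an edge of
      \<open>f\<close>, and \<open>attributed_red\<close> excludes that this vertex has at the same
      time paid a demanding face.\<close>
    have pull: "num_att f = 0" if P: "\<And>b. b \<in> ?B \<Longrightarrow> num_small_at b f = 0 \<or> four b \<and> \<not> in_triangle b \<and> num_small_at b f = 1 \<and> \<not> demanding f \<and> num_demanding b = 1"
    proof (rule ccontr)
      assume "num_att f \<noteq> 0"
      then have "{y \<in> vs f. rich y \<and> attributed f y} \<noteq> {}" unfolding num_att_def by (metis card.empty)
      then obtain y where y: "rich y" "attributed f y" by blast
      obtain c2 c where c: "big c2" "angle f c2 c y" "len (other f {c2, c}) = 4"
        "four c2 \<Longrightarrow> \<not> in_triangle c2 \<Longrightarrow> num_small_at c2 f = 1 \<Longrightarrow> \<not> demanding f \<Longrightarrow> num_demanding c2 \<noteq> 1"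
        by (rule attributed_red[OF y nD]) (rule that)
      have "c2 \<in> ?B" using c angleD(16)[OF c(2)] by simp
      moreover have "{c2, c} \<in> {e \<in> bd f. c2 \<in> e \<and> small (other f e)}" using c(3) angleD(3)[OF c(2)] by (simp add: small_def)
      then have "num_small_at c2 f \<noteq> 0" using fin_bd[OF f(1)] unfolding num_small_at_def by auto
      ultimately show False using P[of c2] c(4) by auto
    qed
    show ?thesis
    proof (cases "x \<in> vs f")
      case True
      then have xB: "x \<in> ?B" using x_big by simp
      have "S = net x f + (\<Sum>v\<in>?B - {x}. net v f)" unfolding S_def by (rule sum.remove[OF fin xB])
      moreover have "0 \<le> (\<Sum>v\<in>?B - {x}. net v f)" by (rule sum_nonneg) (use net_ge_1[OF f(1)] in fastforce)
      moreover have "8 \<le> net x f" by (simp add: net_def kept_def)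
      ultimately have "8 \<le> S" by linarith
      then show ?thesis using kb num_att by (intro goal) arith
    next
      case nx: False
      have big_b: "net b f \<ge> 3 \<or> four b" if "b \<in> ?B" for b using net_big[OF f(1), of b] that by auto
      consider (0) "num_big f = 0" | (1) "num_big f = 1" | (2) "num_big f = 2" | (3) "num_big f = 3" | (4) "4 \<le> num_big f" by linarith
      then show ?thesis
      proof cases
        case 0
        then have "?B = {}" using fin unfolding num_big_def by simp
        then have Q0: "Q = 0" by (simp only: Q_def sum.empty)
        then have A0: "num_att f = 0" using ARQ by simp
        show ?thesis
        proof (rule goal)
          from l show "2 * int (num_T f) \<le> 3 * (int (len f) - 8) + S + int (num_rich f) - int (num_att f)"
          proof
            assume l8: "len f = 8"
            then have "2 * num_T f \<le> num_rich f" using nD 0 by (simp add: deficient_def)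
            then show ?thesis using l8 A0 S0 by arith
          next
            assume l9: "len f = 9"
            then have "odd (num_rich f)" using par 0 Q0 by simp
            then have "1 \<le> num_rich f" by (cases "num_rich f") auto
            \<comment> \<open>Three triangles need 6 and the surplus is 3: two rich vertices come
              from \<open>rich9\<close>, the third from parity.\<close>
            moreover have "3 \<le> num_rich f" if "num_T f = 3"
            proof -
              have "2 \<le> num_rich f" using rich9[OF f(1) l9 that] 0 by simp
              moreover have "num_rich f \<noteq> 2" using \<open>odd (num_rich f)\<close> by auto
              ultimately show ?thesis by linarith
            qed
            ultimately show ?thesis using l9 A0 S0 k3 by (cases "num_T f = 3") arith+
          qed
        qed
      next
        case 1
        then obtain b where B: "?B = {b}" unfolding num_big_def by (rule card_1_singletonE)
        have b: "b \<in> vs f" "big b" using B by auto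
        have S: "S = net b f" "Q = num_small_at b f" "num_att f \<le> num_quad_at b f" using B ARq by (simp_all add: S_def Q_def)
        have bx: "b \<noteq> x" using b nx by auto
        note N = net_big[OF f(1) b]
        have nA2: "num_small_at b f \<le> 2" by (rule num_small_at_le_2[OF f(1) b(1)])
        have par1: "even (len f + 1 + num_rich f + num_small_at b f)" using par 1 S(2) by simp
        have attT: "Suc (num_quad_at b f) \<le> num_small_at b f" if "attributed f b" using attributed_big(2)[OF that b(2)] num_quad_at_le(2)[OF f(1)] by blast
        have P0: "num_att f = 0" if "num_small_at b f = 0 \<or> four b \<and> \<not> in_triangle b \<and> num_small_at b f = 1 \<and> \<not> demanding f \<and> num_demanding b = 1"
          by (rule pull) (use that B in auto)
        show ?thesis
        proof (rule goal)
          from l show "2 * int (num_T f) \<le> 3 * (int (len f) - 8) + S + int (num_rich f) - int (num_att f)"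
          proof
            assume l9: "len f = 9"
            show ?thesis
            proof (cases "num_T f = 3")
              case False
              then show ?thesis using l9 k3 num_att Sn 1 by arith
            next
              case True
              have r2: "2 \<le> num_rich f" using rich9[OF f(1) l9 True] 1 by simp
              from N consider "3 \<le> net b f" | "net b f = 1" "num_small_at b f = 0" | "net b f = 2" "attributed f b" "num_small_at b f = 2"
                | "net b f = 2" "four b \<and> \<not> in_triangle b \<and> num_small_at b f = 1 \<and> \<not> demanding f \<and> num_demanding b = 1" by auto
              then show ?thesis
              proof cases
                case 1 then show ?thesis using l9 True num_att S by arith
              next
                case 2 then show ?thesis using l9 True P0[OF disjI1[OF 2(2)]] S r2 by arith
              next
                case 3 then show ?thesis using l9 True attT[OF 3(2)] S r2 by arith
              next
                case 4 then show ?thesis using l9 True P0[OF disjI2[OF 4(2)]] S r2 by arith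
              qed
            qed
          next
            assume l8: "len f = 8"
            have par8: "odd (num_rich f + num_small_at b f)" using par1 unfolding l8 by presburger
            consider (k0) "num_T f = 0" | (k1) "num_T f = 1" | (k2) "num_T f = 2" using k3 l8 by linarith
            then show ?thesis
            proof cases
              case k0
              then show ?thesis using l8 num_att S0 by arith
            next
              case k1
              from N have "2 \<le> net b f \<or> net b f = 1 \<and> num_small_at b f = 0" by auto
              then show ?thesis
              proof
                assume "2 \<le> net b f"
                then show ?thesis using k1 l8 num_att S by arith
              next
                assume h: "net b f = 1 \<and> num_small_at b f = 0"
                then have "odd (num_rich f)" using par8 by simp
                then have "1 \<le> num_rich f" by (cases "num_rich f") auto
                then show ?thesis using k1 l8 S P0[OF disjI1[OF conjunct2[OF h]]] h by arith
              qed
            next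
              case k2
              \<comment> \<open>Two triangles need 4 from \<open>b\<close> and the rich vertices.
                With at most one rich vertex \<open>f\<close> is short, hence not charged at
                \<open>b\<close>, and without any it is demanding and receives a unit at a 4-vertex
                \<open>b\<close>.\<close>
              have short_r: "short f \<longleftrightarrow> num_rich f \<le> 1" using l8 1 k2 by (simp add: short_def)
              have D1_r: "demanding f \<longleftrightarrow> num_rich f = 0" using l8 1 k2 by (simp add: demanding_def)
              have natt: "\<not> attributed f b" if "num_rich f \<le> 1" using attributed_big(3)[OF _ b(2) 1] that short_r by blast
              have free4: "4 \<le> net b f" if "\<not> four b" "num_rich f \<le> 1"
                using natt[OF that(2)] that(1) bx b(2) by (simp add: net_def kept_def big_def)
              from N consider (a) "3 \<le> net b f" | (o) "net b f = 1" "in_triangle b" "num_small_at b f = 0"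
                | (g) "net b f = 1" "four b" "\<not> in_triangle b" "num_small_at b f = 0" "num_demanding b = 2"
                | (w) "net b f = 2" "attributed f b" "num_small_at b f = 2"
                | (p) "net b f = 2" "four b \<and> \<not> in_triangle b \<and> num_small_at b f = 1 \<and> \<not> demanding f \<and> num_demanding b = 1" by auto
              then show ?thesis
              proof cases
                case o
                then have "odd (num_rich f)" using par8 by simp
                moreover have "2 \<le> num_rich f" using unpaid_rich(2)[OF f(1) l8 k2 b(1) o(2,3) b(2) 1] .
                ultimately have "3 \<le> num_rich f" by (cases "num_rich f = 2") auto
                then show ?thesis using k2 l8 S P0[OF disjI1[OF o(3)]] o by arith
              next
                case g
                then show ?thesis using reducible_two_demanding[OF g(2,3) f(1) b(1) l8 1 g(4,5)] by blast
              next
                case w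
                have "odd (num_rich f)" using par8 w by simp
                moreover have "2 \<le> num_rich f" using natt w(2) by force
                ultimately have "3 \<le> num_rich f" by (cases "num_rich f = 2") auto
                then show ?thesis using k2 l8 S attT[OF w(2)] w by arith
              next
                case p
                then have "even (num_rich f)" using par8 by auto
                moreover have "num_rich f \<noteq> 0" using p D1_r by blast
                ultimately have "2 \<le> num_rich f" by (cases "num_rich f = 1") auto
                then show ?thesis using k2 l8 S P0[OF disjI2[OF p(2)]] p by arith
              next
                case a
                consider "num_small_at b f = 0" | "num_small_at b f = 1" | "num_small_at b f = 2" using nA2 by linarith
                then show ?thesis
                proof cases
                  case nA0: 1
                  then have "odd (num_rich f)" using par8 by simp
                  then have "1 \<le> num_rich f" by (cases "num_rich f") auto
                  then show ?thesis using k2 l8 S P0[OF disjI1[OF nA0]] a by arith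
                next
                  case nA1: 2
                  then have ev: "even (num_rich f)" using par8 by auto
                  have q1: "num_att f \<le> 1" using S(3) num_quad_at_le(1)[OF f(1), of b] nA1 by linarith
                  show ?thesis
                  proof (cases "num_rich f = 0")
                    case True
                    then have D: "demanding f" "\<not> attributed f b" using D1_r natt by auto
                    have "4 \<le> net b f"
                    proof (cases "four b")
                      case 4: True
                      have "kept b f = 3 + exchange b f" using 4 bx three_not_four[of b] by (auto simp: kept_def)
                      then show ?thesis using D nA1 by (simp add: net_def exchange_def)
                    qed (use free4 True in simp)
                    then show ?thesis using k2 l8 S num_att by arith
                  next
                    case False
                    then have "2 \<le> num_rich f" using ev by (cases "num_rich f = 1") auto
                    then show ?thesis using k2 l8 S q1 a by arith
                  qed
                next
                  case nA2: 3
                  then have od: "odd (num_rich f)" using par8 by auto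
                  have q2: "num_att f \<le> 2" using S(3) num_quad_at_le(1)[OF f(1), of b] nA2 by linarith
                  show ?thesis
                  proof (cases "num_rich f = 1")
                    case True
                    show ?thesis
                    proof (cases "num_att f = 0")
                      case False
                      then have "{y \<in> vs f. rich y \<and> attributed f y} \<noteq> {}" unfolding num_att_def by (metis card.empty)
                      \<comment> \<open>A charge at the only rich vertex would make \<open>b\<close>
                        the vertex \<open>c2\<close> of a red donor; by \<open>reducible_red\<close>
                        it is not a 4-vertex, so it keeps 4.\<close>
                      then obtain y where y: "rich y" "attributed f y" by blast
                      obtain c2 c where c: "big c2" "angle f c2 c y"
                        "four c2 \<Longrightarrow> len f = 8 \<Longrightarrow> num_big f = 1 \<Longrightarrow> num_T f = 2 \<Longrightarrow> num_rich f = 1 \<Longrightarrow> False"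
                        by (rule attributed_red[OF y nD]) (rule that)
                      have "c2 \<in> ?B" using c angleD(16)[OF c(2)] by simp
                      then have "c2 = b" using B by blast
                      then have "\<not> four b" using c(3) l8 \<open>num_big f = 1\<close> k2 True by blast
                      then have "4 \<le> net b f" using free4 True by simp
                      then show ?thesis using k2 l8 S num_att by arith
                    qed (use k2 l8 S a True in arith)
                  next
                    case False
                    then have "3 \<le> num_rich f" using od by (cases "num_rich f = 2"; cases "num_rich f = 0") auto
                    then show ?thesis using k2 l8 S q2 a by arith
                  qed
                qed
              qed
            qed
          qed
        qed
      next
        case 2
        then obtain b1 b2 where B: "?B = {b1, b2}" "b1 \<noteq> b2" unfolding num_big_def card_2_iff by blast
        have b: "b1 \<in> vs f" "big b1" "b2 \<in> vs f" "big b2" using B by auto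
        have S: "S = net b1 f + net b2 f" "Q = num_small_at b1 f + num_small_at b2 f" "num_att f \<le> num_quad_at b1 f + num_quad_at b2 f"
          using B ARq by (simp_all add: S_def Q_def)
        \<comment> \<open>With the smaller value first, a sum below 4 forces \<open>b1\<close> to
          keep only 1, so \<open>b1\<close> is a 4-vertex without small faces beside it along
          \<open>f\<close>.\<close>
        have main: "2 * int (num_T f) \<le> 3 * (int (len f) - 8) + S + int (num_rich f) - int (num_att f)"
          if b: "?B = {b1, b2}" "b1 \<noteq> b2" and le: "net b1 f \<le> net b2 f" for b1 b2
        proof -
          have b': "b1 \<in> vs f" "big b1" "b2 \<in> vs f" "big b2" using b by auto
          have S: "S = net b1 f + net b2 f" "Q = num_small_at b1 f + num_small_at b2 f" "num_att f \<le> num_quad_at b1 f + num_quad_at b2 f"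
            using b ARq by (simp_all add: S_def Q_def)
          note N1 = net_big[OF f(1) b'(1,2)] and N2 = net_big[OF f(1) b'(3,4)]
          have par2: "even (len f + num_rich f + num_small_at b1 f + num_small_at b2 f)" using par 2 S(2) by (simp add: ac_simps)
          show ?thesis
          proof (cases "4 \<le> S")
            case True
            then show ?thesis using kb num_att by arith
          next
            case False
            then have 1: "net b1 f = 1" "four b1" "num_small_at b1 f = 0" and n2: "net b2 f \<le> 2"
              using N1 N2 le S by auto
            have four2: "four b2" using N2 n2 by auto
            from N2 n2 consider (z) "net b2 f = 1" "num_small_at b2 f = 0"
              | (w) "net b2 f = 2" "in_triangle b2" "attributed f b2" "num_small_at b2 f = 2"
              | (p) "net b2 f = 2" "four b2 \<and> \<not> in_triangle b2 \<and> num_small_at b2 f = 1 \<and> \<not> demanding f \<and> num_demanding b2 = 1" by auto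
            then show ?thesis
            proof cases
              case p
              have A0: "num_att f = 0" by (rule pull) (use b 1 p in auto)
              from l show ?thesis
              proof
                assume "len f = 8"
                then have "odd (num_rich f)" using par2 1 p by auto
                then have "1 \<le> num_rich f" by (cases "num_rich f") auto
                then show ?thesis using \<open>len f = 8\<close> k3 S 1 p A0 by arith
              qed (use k3 S 1 p A0 in arith)
            next
              case z
              have A0: "num_att f = 0" using ARQ S(2) 1 z by simp
              from l show ?thesis
              proof
                assume l9: "len f = 9"
                then have "odd (num_rich f)" using par2 1 z by auto
                then have "1 \<le> num_rich f" by (cases "num_rich f") auto
                then show ?thesis using l9 k3 S 1 z A0 by arith
              next
                assume l8: "len f = 8"
                then have ev: "even (num_rich f)" using par2 1 z by auto
                show ?thesis
                proof (cases "num_T f = 2")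
                  case False
                  then show ?thesis using l8 k3 S 1 z A0 by arith
                next
                  case k2: True
                  \<comment> \<open>If neither vertex is on a triangle, both would pay two demanding
                    faces, which \<open>payer_other\<close> excludes. Parity then doubles the single
                    rich vertex.\<close>
                  have "1 \<le> num_rich f"
                  proof (cases "in_triangle b1 \<or> in_triangle b2")
                    case True
                    then show ?thesis
                      using unpaid_rich(1)[OF f(1) l8 k2 b'(1) _ 1(3) b'(2)] unpaid_rich(1)[OF f(1) l8 k2 b'(3) _ z(2) b'(4)] 2 by auto
                  next
                    case False
                    then have "num_demanding b1 = 2" "num_demanding b2 = 2" using N1 N2 1 z by auto
                    then show ?thesis
                      using payer_other(2)[OF f(1) l8 k2 b'(1) 1(2) _ 1(3) _ b'(3) b(2)[symmetric] four2] False z by blast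
                  qed
                  then have "2 \<le> num_rich f" using ev by (cases "num_rich f = 1") auto
                  then show ?thesis using l8 k2 S 1 z A0 by arith
                qed
              qed
            next
              case w
              obtain e where "T_edge f e" "b2 \<in> e" using attributed_big(2)[OF w(3) b'(4)] by blast
              then have "Suc (num_quad_at b2 f) \<le> 2" using num_quad_at_le(2)[OF f(1)] w(4) by metis
              moreover have "num_quad_at b1 f = 0" using num_quad_at_le(1)[OF f(1), of b1] 1 by simp
              ultimately have A1: "num_att f \<le> 1" using S(3) by linarith
              from l show ?thesis
              proof
                assume "len f = 9"
                then show ?thesis using k3 S 1 w A1 num_att by arith
              next
                assume l8: "len f = 8"
                then have ev: "even (num_rich f)" using par2 1 w by auto
                show ?thesis
                proof (cases "num_T f = 2")
                  case False
                  then show ?thesis using l8 k3 S 1 w num_att by arith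
                next
                  case k2: True
                  have "1 \<le> num_rich f"
                  proof (cases "in_triangle b1")
                    case True
                    then show ?thesis
                      using unpaid_rich(1)[OF f(1) l8 k2 b'(1) _ 1(3) b'(2)] 2 by auto
                  next
                    case False
                    then have "num_demanding b1 = 2" using N1 1 by auto
                    then show ?thesis
                      using payer_other(1)[OF f(1) l8 k2 b'(1) 1(2) False 1(3) _ b'(3) b(2)[symmetric] four2] w by blast
                  qed
                  then have "2 \<le> num_rich f" using ev by (cases "num_rich f = 1") auto
                  then show ?thesis using l8 k2 S 1 w A1 by arith
                qed
              qed
            qed
          qed
        qed
        show ?thesis
        proof (rule goal, cases "net b1 f \<le> net b2 f")
          case True
          then show "2 * int (num_T f) \<le> 3 * (int (len f) - 8) + S + int (num_rich f) - int (num_att f)" by (rule main[OF B])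
        next
          case False
          have B': "?B = {b2, b1}" "b2 \<noteq> b1" using B by auto
          show "2 * int (num_T f) \<le> 3 * (int (len f) - 8) + S + int (num_rich f) - int (num_att f)"
            by (rule main[OF B']) (use False in simp)
        qed
      next
        case 3
        show ?thesis
        proof (rule goal, cases "4 \<le> S")
          case True
          then show "2 * int (num_T f) \<le> 3 * (int (len f) - 8) + S + int (num_rich f) - int (num_att f)" using kb num_att by arith
        next
          case False
          then have S3: "S = 3" using Sn 3 by linarith
          \<comment> \<open>All three big vertices keep exactly 1, which by \<open>net_big\<close>
            happens only without small faces beside them. So no rich vertex is charged, and parity
            supplies one at length 8.\<close>
          have "num_small_at b f = 0" if bB: "b \<in> ?B" for b
          proof (rule ccontr)
            assume "num_small_at b f \<noteq> 0"
            then have "2 \<le> net b f" using net_big[OF f(1), of b] bB by auto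
            moreover have "S = net b f + (\<Sum>v\<in>?B - {b}. net v f)" unfolding S_def by (rule sum.remove[OF fin bB])
            moreover have "(\<Sum>v\<in>?B - {b}. 1) \<le> (\<Sum>v\<in>?B - {b}. net v f)"
              by (rule sum_mono) (use net_ge_1[OF f(1)] in auto)
            moreover have "(\<Sum>v\<in>?B - {b}. 1) = (2::int)" using 3 bB fin by (simp add: num_big_def)
            ultimately show False using S3 by linarith
          qed
          then have Q0: "Q = 0" unfolding Q_def by simp
          then have A0: "num_att f = 0" using ARQ by simp
          from l show "2 * int (num_T f) \<le> 3 * (int (len f) - 8) + S + int (num_rich f) - int (num_att f)"
          proof
            assume "len f = 8"
            then have "odd (num_rich f)" using par 3 Q0 by auto
            then have "1 \<le> num_rich f" by (cases "num_rich f") auto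
            then show ?thesis using \<open>len f = 8\<close> k3 S3 A0 by arith
          qed (use k3 S3 A0 in arith)
        qed
      next
        case 4
        then show ?thesis using kb num_att Sn by (intro goal) arith
      qed
    qed
  qed
qed

theorem no_counterexample: False
proof (rule accounting[of attributed root])
  show "2 * (if deficient f then 0 else int (num_T f)) \<le> 3 * (int (len f) - 8) + (\<Sum>v\<in>vs f. kept v f - of_bool (attributed f v))"
    if "f \<in> F" "\<not> small f" for f using face_charge[OF that] .
  show "6 \<le> (\<Sum>e\<in>bd T. 2 * of_bool (\<not> deficient (other T e))) + 2 * int (card {v \<in> vs T. free v}) + 2 * of_bool (root T)"
    if "T \<in> F" "len T = 3" "x \<notin> vs T" for T using triangle_charge[OF that] .
  have "(\<exists>T g. (\<exists>h u u' w. root_side T g h u u' w) \<and> donor T g f v) = attributed f v" for f v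
    unfolding attributed_def donor_def by blast
  then show "2 * card {T \<in> F. len T = 3 \<and> x \<notin> vs T \<and> root T} \<le> card {(f, v). f \<in> F \<and> \<not> small f \<and> v \<in> vs f \<and> attributed f v}"
    using root_count[of donor] donor_exists donor_inj by simp
qed

end


section \<open>Weak degeneracy of planar graphs\<close>

text \<open>Strong induction on \<open>card U\<close> makes any failure a minimal one. The relation
  \<open>B\<close> drops the edges outside \<open>U\<close>, so that the degrees and faces of the
  locales refer to the subgraph induced on \<open>U\<close>.\<close>

lemma (in sgraph) planar_wd:
  fixes p :: "'a \<Rightarrow> complex"
  assumes V: "finite V" "\<And>a b. A a b \<Longrightarrow> a \<in> V" and pg: "plane_graph p \<gamma> V EA"
    and no567: "\<And>xs. distinct xs \<Longrightarrow> cedges xs \<subseteq> EA \<Longrightarrow> length xs \<notin> {5, 6, 7}"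
    and far: "\<And>a b c a' b' c' u u'. A a b \<Longrightarrow> A b c \<Longrightarrow> A a c \<Longrightarrow> A a' b' \<Longrightarrow> A b' c' \<Longrightarrow> A a' c' \<Longrightarrow>
        {a, b, c} \<noteq> {a', b', c'} \<Longrightarrow> u \<in> {a, b, c} \<Longrightarrow> u' \<in> {a', b', c'} \<Longrightarrow> u \<noteq> u' \<and> \<not> A u u'"
    and "U \<subseteq> V" "x \<in> U"
  shows "wd (U - {x}) (\<lambda>v. 2 - of_bool (A v x))"
  using assms(6,7)
proof (induction "card U" arbitrary: U x rule: less_induct)
  case less
  have finU: "finite U" using V(1) less(2) finite_subset by blast
  show ?case
  proof (rule ccontr)
    assume bad: "\<not> wd (U - {x}) (\<lambda>v. 2 - of_bool (A v x))"
    define B where "B a b \<longleftrightarrow> A a b \<and> a \<in> U \<and> b \<in> U" for a b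
    interpret B: sgraph B by unfold_locales (use sym irr in \<open>auto simp: B_def\<close>)
    have sB: "sgraph B" "sgraph A" by unfold_locales
    have EB: "B.EA = {e \<in> EA. e \<subseteq> U}"
    proof
      show "B.EA \<subseteq> {e \<in> EA. e \<subseteq> U}" by (auto simp: B.EA_def EA_def B_def)
      show "{e \<in> EA. e \<subseteq> U} \<subseteq> B.EA"
      proof
        fix e assume "e \<in> {e \<in> EA. e \<subseteq> U}"
        then obtain a b where "e = {a, b}" "A a b" "a \<in> U" "b \<in> U" by (auto simp: EA_def)
        then show "e \<in> B.EA" unfolding B.EA_def B_def by blast
      qed
    qed
    have "mincex B U x"
    proof (unfold_locales)
      show "finite U" "x \<in> U" by fact+
      show "a \<in> U" if "B a b" for a b using that by (simp add: B_def)
      show "\<not> B.wd (U - {x}) (\<lambda>v. 2 - of_bool (B v x))"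
      proof
        assume "B.wd (U - {x}) (\<lambda>v. 2 - of_bool (B v x))"
        then have "wd (U - {x}) (\<lambda>v. 2 - of_bool (B v x))"
          by (rule wd_agree[OF _ _ sB(1)]) (auto simp: B_def)
        then have "wd (U - {x}) (\<lambda>v. 2 - of_bool (A v x))"
          by (rule wd_cong) (use less(3) in \<open>auto simp: B_def\<close>)
        then show False using bad by simp
      qed
      show "B.wd (W - {y}) (\<lambda>v. 2 - of_bool (B v y))" if W: "W \<subset> U" "y \<in> W" for W y
      proof -
        have "card W < card U" using W(1) finU psubset_card_mono by blast
        then have "wd (W - {y}) (\<lambda>v. 2 - of_bool (A v y))" by (rule less(1)) (use W less(2) in auto)
        then have "B.wd (W - {y}) (\<lambda>v. 2 - of_bool (A v y))"
          by (rule B.wd_agree[OF _ _ sB(2)]) (use W in \<open>auto simp: B_def\<close>)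
        then show ?thesis by (rule B.wd_cong) (use W in \<open>auto simp: B_def\<close>)
      qed
    qed
    then interpret M: mincex B U x .
    have EB': "{e \<in> B.EA. e \<subseteq> U} = B.EA" using EB by blast
    interpret P: plane_graph p \<gamma> V EA by (rule pg)
    have sub: "B.EA \<subseteq> EA" using EB by blast
    have pgU: "plane_graph p \<gamma> U {e \<in> B.EA. e \<subseteq> U}"
    proof (unfold EB', unfold_locales)
      show "inj_on p U" using P.inj less(2) inj_on_subset by blast
      show "e \<subseteq> U" if "e \<in> B.EA" for e using that EB by blast
      show "card e = 2" "arc (\<gamma> e)" "{pathstart (\<gamma> e), pathfinish (\<gamma> e)} = p ` e" if "e \<in> B.EA" for e
        using that sub P.E_card P.arc_\<gamma> P.ends_\<gamma> by blast+
      show "(path_image (\<gamma> e) - p ` e) \<inter> p ` U = {}" if "e \<in> B.EA" for e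
        using P.verts_\<gamma>[of e] that sub less(2) by blast
      show "(path_image (\<gamma> e) - p ` e) \<inter> path_image (\<gamma> e') = {}" if "e \<in> B.EA" "e' \<in> B.EA" "e \<noteq> e'" for e e'
        using P.edges_\<gamma>[of e e'] that sub by blast
    qed
    have c3: "3 \<le> card U" using M.card_U by simp
    obtain F :: "complex set set" and bd where "finite F"
      and F1: "\<And>R. R \<in> F \<Longrightarrow> \<exists>c. distinct c \<and> 3 \<le> length c \<and> cedges c = bd R"
      and F2: "\<And>R. R \<in> F \<Longrightarrow> bd R \<subseteq> B.EA"
      and F3: "\<And>e. e \<in> B.EA \<Longrightarrow> card {R\<in>F. e \<in> bd R} = 2"
      and F4: "\<And>v X. X \<subseteq> {e\<in>B.EA. v \<in> e} \<Longrightarrow> X \<noteq> {} \<Longrightarrow> X \<noteq> {e\<in>B.EA. v \<in> e} \<Longrightarrow>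
          \<exists>R\<in>F. \<exists>e\<in>X. \<exists>e'\<in>B.EA - X. v \<in> e' \<and> e \<in> bd R \<and> e' \<in> bd R"
      and F5: "card U + card F = card B.EA + 2"
      by (rule B.plane_faces[OF pgU finU c3 M.conn_U M.conn_minus, unfolded EB']) (assumption, rule that)
    have "cex B U x F bd"
    proof (unfold_locales)
      show "finite F" by fact
      show "length xs \<notin> {5, 6, 7}" if "distinct xs" "cedges xs \<subseteq> B.EA" for xs
        using no567[of xs] that sub by blast
      show "u \<noteq> u' \<and> \<not> B u u'"
        if "B a b" "B b c" "B a c" "B a' b'" "B b' c'" "B a' c'" "{a, b, c} \<noteq> {a', b', c'}" "u \<in> {a, b, c}" "u' \<in> {a', b', c'}"
        for a b c a' b' c' u u'
        using far[of a b c a' b' c' u u'] that unfolding B_def by blast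
      show "\<exists>c. distinct c \<and> 3 \<le> length c \<and> cedges c = bd f" if "f \<in> F" for f by (rule F1[OF that])
      show "bd f \<subseteq> B.EA" if "f \<in> F" for f by (rule F2[OF that])
      show "card {f\<in>F. e \<in> bd f} = 2" if "e \<in> B.EA" for e by (rule F3[OF that])
      show "\<exists>f\<in>F. \<exists>e\<in>X. \<exists>e'\<in>B.EA - X. v \<in> e' \<and> e \<in> bd f \<and> e' \<in> bd f"
        if "X \<subseteq> {e\<in>B.EA. v \<in> e}" "X \<noteq> {}" "X \<noteq> {e\<in>B.EA. v \<in> e}" for X v
        by (rule F4[OF that])
      show "card U + card F = card B.EA + 2" by (rule F5)
    qed
    then show False by (rule cex.no_counterexample)
  qed
qed

section \<open>Transfer to digraphs, walks and legal steps\<close>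

lemma arcs_ends_del_vert: "arcs_ends (pre_digraph.del_vert G u) = {(a, b) \<in> arcs_ends G. a \<noteq> u \<and> b \<noteq> u}"
  by (auto simp: arcs_ends_def arc_to_ends_def pre_digraph.del_vert_def)

lemma verts_del_vert: "verts (pre_digraph.del_vert G u) = verts G - {u}"
  by (simp add: pre_digraph.del_vert_def)

text \<open>The functions need to agree on the current vertices only, since \<open>Delete\<close>
  and \<open>DeleteSave\<close> yield total functions with irrelevant values elsewhere.\<close>

lemma (in sgraph) wd_legal:
  fixes H :: "('a, 'b) pre_digraph"
  assumes "wd S f" "verts H = S" "\<And>a b. a \<in> S \<Longrightarrow> b \<in> S \<Longrightarrow> (a \<rightarrow>\<^bsub>H\<^esub> b) = A a b" "\<And>y. y \<in> S \<Longrightarrow> g y = f y"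
  shows "\<exists>K h. legal_step\<^sup>*\<^sup>* (H, g) (K, h) \<and> verts K = {}"
  using assms
proof (induction arbitrary: H g rule: wd.induct)
  case (wd_empty f)
  then show ?case by blast
next
  case (wd_del u S f)
  let ?H = "pre_digraph.del_vert H u" and ?g = "\<lambda>x. if x \<rightarrow>\<^bsub>H\<^esub> u then g x - 1 else g x"
  have g: "?g y = f y - of_bool (A y u)" if "y \<in> S - {u}" for y
    using wd_del(1,7,8) that by simp
  have D: "Delete u (H, g) = (?H, ?g)" by (simp add: Delete_def)
  have "legal_step (H, g) (Delete u (H, g))"
  proof (rule legal_step.delete)
    show "u \<in> verts H" "0 \<le> g u" using wd_del(1,2,6,8) by auto
    show "nonneg (Delete u (H, g))"
      unfolding D nonneg_def using g wd_del(3,6) by (auto simp: verts_del_vert)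
  qed
  then have step: "legal_step (H, g) (?H, ?g)" unfolding D .
  have "\<exists>K h. legal_step\<^sup>*\<^sup>* (?H, ?g) (K, h) \<and> verts K = {}"
  proof (rule wd_del.IH)
    show "verts ?H = S - {u}" using wd_del(6) by (simp add: verts_del_vert)
    show "(a \<rightarrow>\<^bsub>?H\<^esub> b) = A a b" if "a \<in> S - {u}" "b \<in> S - {u}" for a b
      using wd_del(7)[of a b] that by (auto simp: arcs_ends_del_vert)
    show "?g y = f y - of_bool (A y u)" if "y \<in> S - {u}" for y by (rule g[OF that])
  qed
  then show ?case using converse_rtranclp_into_rtranclp[of legal_step, OF step] by blast
next
  case (wd_save a S b f)
  let ?H = "pre_digraph.del_vert H a" and ?g = "\<lambda>x. if x \<rightarrow>\<^bsub>H\<^esub> a \<and> x \<noteq> b then g x - 1 else g x"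
  have g: "?g y = f y - of_bool (A y a \<and> y \<noteq> b)" if "y \<in> S - {a}" for y
    using wd_save(1,9,10) that by simp
  have D: "DeleteSave a b (H, g) = (?H, ?g)" by (simp add: DeleteSave_def)
  have "legal_step (H, g) (DeleteSave a b (H, g))"
  proof (rule legal_step.delete_save)
    show "a \<rightarrow>\<^bsub>H\<^esub> b" "g b < g a" using wd_save(1,2,3,4,9,10) by auto
    show "nonneg (DeleteSave a b (H, g))"
      unfolding D nonneg_def using g wd_save(5,8) by (auto simp: verts_del_vert)
  qed
  then have step: "legal_step (H, g) (?H, ?g)" unfolding D .
  have "\<exists>K h. legal_step\<^sup>*\<^sup>* (?H, ?g) (K, h) \<and> verts K = {}"
  proof (rule wd_save.IH)
    show "verts ?H = S - {a}" using wd_save(8) by (simp add: verts_del_vert)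
    show "(y \<rightarrow>\<^bsub>?H\<^esub> z) = A y z" if "y \<in> S - {a}" "z \<in> S - {a}" for y z
      using wd_save(9)[of y z] that by (auto simp: arcs_ends_del_vert)
    show "?g y = f y - of_bool (A y a \<and> y \<noteq> b)" if "y \<in> S - {a}" for y by (rule g[OF that])
  qed
  then show ?case using converse_rtranclp_into_rtranclp[of legal_step, OF step] by blast
qed

lemma walk_arcs:
  fixes G :: "('a, 'b) pre_digraph"
  assumes "ys \<noteq> []" "\<And>a b. {a, b} \<in> pedges ys \<Longrightarrow> a \<rightarrow>\<^bsub>G\<^esub> b"
  shows "\<exists>w. set w \<subseteq> arcs G \<and> pre_digraph.cas G (hd ys) w (last ys) \<and>
    pre_digraph.awalk_verts G (hd ys) w = ys \<and> Suc (length w) = length ys \<and> tail G ` set w = set (butlast ys)"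
  using assms
proof (induction ys rule: pedges.induct)
  case (2 a)
  show ?case by (intro exI[of _ "[]"]) (simp add: pre_digraph.cas.simps pre_digraph.awalk_verts.simps)
next
  case (3 a b zs)
  have "a \<rightarrow>\<^bsub>G\<^esub> b" using 3(3)[of a b] by simp
  then obtain e where e: "e \<in> arcs G" "tail G e = a" "head G e = b" by (auto simp: arcs_ends_def arc_to_ends_def)
  obtain w where w: "set w \<subseteq> arcs G" "pre_digraph.cas G b w (last (b # zs))"
    "pre_digraph.awalk_verts G b w = b # zs" "Suc (length w) = length (b # zs)" "tail G ` set w = set (butlast (b # zs))"
    using 3(1) 3(3) by (metis list.distinct(1) list.sel(1) insertI2 pedges.simps(3))
  show ?case
    by (intro exI[of _ "e # w"]) (use e w in \<open>auto simp: pre_digraph.cas.simps pre_digraph.awalk_verts.simps\<close>)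
qed simp

lemma cycle_arcs_exist:
  fixes G :: "('a, 'b) pre_digraph"
  assumes "wf_digraph G" "distinct xs" "xs \<noteq> []" "\<And>a b. {a, b} \<in> cedges xs \<Longrightarrow> a \<rightarrow>\<^bsub>G\<^esub> b"
  shows "\<exists>w. pre_digraph.cycle G w \<and> length w = length xs \<and> tail G ` set w = set xs"
proof -
  interpret G: wf_digraph G by fact
  let ?ys = "xs @ [hd xs]"
  have h: "hd ?ys = hd xs" using assms(3) by simp
  obtain w where w: "set w \<subseteq> arcs G" "G.cas (hd xs) w (last ?ys)"
    "G.awalk_verts (hd xs) w = ?ys" "Suc (length w) = length ?ys" "tail G ` set w = set (butlast ?ys)"
    using walk_arcs[of ?ys G] assms(4) unfolding cedges_def h by blast
  have ne: "w \<noteq> []" using w(4) assms(3) by auto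
  have "hd xs \<in> verts G"
  proof -
    obtain e w' where "w = e # w'" using ne by (cases w) auto
    then have "e \<in> arcs G" "tail G e = hd xs" using w(1,2) by auto
    then show ?thesis using G.tail_in_verts by metis
  qed
  then have "G.awalk (hd xs) w (hd xs)" using w(1,2) by (simp add: G.awalk_def)
  moreover have "distinct (tl (G.awalk_verts (hd xs) w))"
    unfolding w(3) using assms(2,3) by (cases xs) auto
  ultimately have "G.cycle w" unfolding G.cycle_def using ne by blast
  then show ?thesis using w(4,5) by auto
qed

theorem theorem1p2:
  fixes G :: "('a, 'b) pre_digraph"
  assumes "graph G"
    and "planar G"
    and "triangle_dist G \<ge> 2"
    and "\<not> has_cycle_of_length G 5"
    and "\<not> has_cycle_of_length G 6"
    and "\<not> has_cycle_of_length G 7"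
  shows "weakly_degenerate 2 G"
proof -
  interpret G: graph G by fact
  have wf: "wf_digraph G" by unfold_locales
  define A where "A a b \<longleftrightarrow> a \<rightarrow>\<^bsub>G\<^esub> b" for a b
  have AV: "a \<in> verts G" if "A a b" for a b
    using that unfolding A_def arcs_ends_def arc_to_ends_def by auto
  interpret sgraph A
  proof
    show "A b a" if "A a b" for a b
      using that arcs_ends_symmetric[OF G.sym_arcs] unfolding A_def by blast
    show "\<not> A a a" for a
      unfolding A_def arcs_ends_def arc_to_ends_def using G.no_loops by fastforce
  qed
  have E: "EA = edges G" unfolding EA_def edges_def A_def ..
  have cyc: "\<exists>w. G.cycle w \<and> length w = length xs \<and> tail G ` set w = set xs"
    if "distinct xs" "xs \<noteq> []" "cedges xs \<subseteq> EA" for xs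
  proof (rule cycle_arcs_exist[OF wf that(1,2)])
    show "a \<rightarrow>\<^bsub>G\<^esub> b" if "{a, b} \<in> cedges xs" for a b
      using that \<open>cedges xs \<subseteq> EA\<close> EA_iff A_def by blast
  qed
  have no567: "length xs \<notin> {5, 6, 7}" if d: "distinct xs" "cedges xs \<subseteq> EA" for xs
  proof
    assume l: "length xs \<in> {5, 6, 7}"
    then have "xs \<noteq> []" by auto
    then obtain w where "G.cycle w" "length w = length xs" using cyc[OF d(1) _ d(2)] by blast
    then have "has_cycle_of_length G (length xs)" unfolding has_cycle_of_length_def by blast
    then show False using l assms(4-6) by auto
  qed
  have in_triangle: "{a, b, c} \<in> triangles G" if "A a b" "A b c" "A a c" for a b c
  proof -
    have "distinct [a, b, c]" using that irr by auto
    moreover have "cedges [a, b, c] \<subseteq> EA" using that sym by (auto simp: cedges_def EA_iff)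
    ultimately obtain w where "G.cycle w" "length w = 3" "tail G ` set w = {a, b, c}" using cyc[of "[a, b, c]"] by auto
    then show ?thesis unfolding triangles_def by blast
  qed
  have far: "u \<noteq> u' \<and> \<not> A u u'"
    if t: "A a b" "A b c" "A a c" "A a' b'" "A b' c'" "A a' c'"
      "{a, b, c} \<noteq> {a', b', c'}" "u \<in> {a, b, c}" "u' \<in> {a', b', c'}" for a b c a' b' c' u u'
  proof -
    have "triangle_dist G \<le> graph_dist G u u'"
      unfolding triangle_dist_def by (rule Inf_lower) (use in_triangle[OF t(1-3)] in_triangle[OF t(4-6)] t(7-9) in blast)
    then have d2: "2 \<le> G.\<mu> (\<lambda>_. 1) u u'" using assms(3) unfolding graph_dist_def by (rule order_trans[rotated])
    \<comment> \<open>With unit costs the cost of a walk is its length, so the empty walk and the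
      single arc are both too short.\<close>
    have le: "2 \<le> length w" if "G.awalk u w u'" for w
    proof -
      have "G.awalk_cost (\<lambda>_. 1) w = real (length w)" by (simp add: G.awalk_cost_def sum_list_triv)
      then have "G.\<mu> (\<lambda>_. 1) u u' \<le> ereal (real (length w))" using G.min_cost_le_walk_cost[OF that, of "\<lambda>_. 1"] by simp
      with d2 have "2 \<le> ereal (real (length w))" by (rule order_trans)
      then have "ereal 2 \<le> ereal (real (length w))" by simp
      then show ?thesis by simp
    qed
    have "A u b \<or> A u c \<or> A u a" using t(1-3,8) sym by blast
    then have uV: "u \<in> verts G" using AV by blast
    show ?thesis
    proof
      show "u \<noteq> u'"
      proof
        assume "u = u'"
        then have "G.awalk u [] u'" using uV by (simp add: G.awalk_def)
        from le[OF this] show False by simp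
      qed
      show "\<not> A u u'"
      proof
        assume "A u u'"
        then obtain e where "e \<in> arcs G" "tail G e = u" "head G e = u'"
          unfolding A_def arcs_ends_def arc_to_ends_def by auto
        then have "G.awalk u [e] u'" using uV by (simp add: G.awalk_def)
        from le[OF this] show False by simp
      qed
    qed
  qed
  obtain p \<gamma> where pd: "plane_drawing G p \<gamma>" using assms(2) unfolding planar_def by blast
  note D = pd[unfolded plane_drawing_def]
  note drawing1 = D[THEN conjunct1] and D = D[THEN conjunct2]
  note drawing2 = D[THEN conjunct1, THEN bspec] and D = D[THEN conjunct2]
  note drawing3 = D[THEN conjunct1, THEN bspec] and drawing4 = D[THEN conjunct2, THEN bspec, THEN bspec, THEN mp]
  have pg: "plane_graph p \<gamma> (verts G) EA"
    unfolding plane_graph_def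
  proof (intro conjI allI impI)
    show "inj_on p (verts G)" by (rule drawing1)
    fix e assume e: "e \<in> EA"
    then obtain a b where ab: "e = {a, b}" "A a b" by (auto simp: EA_def)
    then show "e \<subseteq> verts G" using AV sym by blast
    show "card e = 2" using ab irr by (metis card_2_iff)
    have eG: "e \<in> edges G" using e E by simp
    show "Path_Connected.arc (\<gamma> e)" "{pathstart (\<gamma> e), pathfinish (\<gamma> e)} = p ` e"
      using drawing2[OF eG] by simp_all
    show "(path_image (\<gamma> e) - p ` e) \<inter> p ` verts G = {}" by (rule drawing3[OF eG])
    show "(path_image (\<gamma> e) - p ` e) \<inter> path_image (\<gamma> e') = {}" if "e' \<in> EA" "e \<noteq> e'" for e'
      using drawing4[OF eG _ that(2)] that(1) E by simp
  qed
  have "wd (verts G) (\<lambda>_. 2)"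
  proof (cases "verts G = {}")
    case True
    then show ?thesis by (simp add: wd_empty)
  next
    case False
    then obtain x where x: "x \<in> verts G" by blast
    \<comment> \<open>Deleting any vertex first turns the constant 2 into the function of the rooted
      claim.\<close>
    have "wd (verts G - {x}) (\<lambda>v. 2 - of_bool (A v x))"
      by (rule planar_wd[OF G.finite_verts AV pg no567 far subset_refl x])
    then show ?thesis by (intro wd.wd_del[OF x]) simp_all
  qed
  then have "\<exists>K h. legal_step\<^sup>*\<^sup>* (G, \<lambda>_. int 2) (K, h) \<and> verts K = {}"
    by (rule wd_legal) (auto simp: A_def)
  then show ?thesis unfolding weakly_degenerate_def weakly_f_degenerate_def .
qed

end
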